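(* (1) Every sententially categorical cardinal is less than every lightface $\Sigma_2$-correct cardinal. (2) Every theory categorical cardinal and indeed any fresh cardinal is less than every $\Sigma_2({\mathbb R})$-correct cardinal. (3) The least lightface $\Sigma_2$-correct cardinal is strictly less than the least $\Sigma_2({\mathbb R})$-correct cardinal, which is strictly less than the least fully (boldface) $\Sigma_2$-correct cardinal.
   Context: Work in ZFC. A cardinal $\kappa$ is sententially (resp. theory) categorical, in first or second order (or $\alpha$-order for an absolutely definable ordinal $\alpha$), if there is a sentence $\sigma$ (resp. theory $T$) of that order in the language of set theory such that $V_\kappa$ is, up to isomorphism, the unique model of ${\rm ZFC}_2+\sigma$ (resp. ${\rm ZFC}_2+T$); equivalently, $\kappa$ is the only inaccessible cardinal with $V_\kappa\models\sigma$ (resp. $V_\kappa\models T$). An inaccessible cardinal $\kappa$ is fresh (for its theory of the given order) if the theory of $V_\kappa$ is not the theory of $V_\delta$ for any inaccessible $\delta<\kappa$. An ordinal $\delta$ is lightface $\Sigma_2$-correct if $V_\delta$ has the same $\Sigma_2$ theory as $V$; it is $\Sigma_2({\mathbb R})$-correct if $V_\delta$ satisfies the same $\Sigma_2$ assertions as $V$ with real parameters; and it is fully (boldface) $\Sigma_2$-correct if $V_\delta\prec_{\Sigma_2}V$, i.e. $V_\delta$ agrees with $V$ on all $\Sigma_2$ assertions with arbitrary parameters from $V_\delta$. *)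

theory Defs
  imports Main
begin

text \<open>
  ``Work in ZFC'' is rendered as: let \<open>(V, \<epsilon>)\<close> be an arbitrary model of first-order ZFC, with
  separation and replacement as axiom schemes over the formulas \<open>fm\<close> below.  Everything after the
  class \<open>zfc\<close> quantifies only over elements of that model (HOL sets occur merely as comprehension
  notation), so it is a first-order statement about \<open>(V, \<epsilon>)\<close>.  In particular formulas, theories,
  assignments and satisfaction are the coded, internal ones, as they are within ZFC; the model may
  be ill-founded or have nonstandard natural numbers.
\<close>

section \<open>Models of ZFC\<close>

datatype fm = FMem nat nat | FEq nat nat | FNeg fm | FAnd fm fm | FEx nat fm

primrec holds :: "('a \<Rightarrow> 'a \<Rightarrow> bool) \<Rightarrow> fm \<Rightarrow> (nat \<Rightarrow> 'a) \<Rightarrow> bool" where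
  "holds r (FMem i j) s \<longleftrightarrow> r (s i) (s j)"
| "holds r (FEq i j) s \<longleftrightarrow> s i = s j"
| "holds r (FNeg p) s \<longleftrightarrow> \<not> holds r p s"
| "holds r (FAnd p q) s \<longleftrightarrow> holds r p s \<and> holds r q s"
| "holds r (FEx i p) s \<longleftrightarrow> (\<exists>x. holds r p (s(i := x)))"

text \<open>
  The axioms for a structure with domain \<open>D\<close> and relation \<open>r\<close>; they are used for the ambient
  universe and for the models of second-order ZFC inside it.
\<close>

definition ax_extensionality :: "'a set \<Rightarrow> ('a \<Rightarrow> 'a \<Rightarrow> bool) \<Rightarrow> bool" where
  "ax_extensionality D r \<longleftrightarrow> (\<forall>x\<in>D. \<forall>y\<in>D. (\<forall>z\<in>D. r z x \<longleftrightarrow> r z y) \<longrightarrow> x = y)"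

definition ax_foundation :: "'a set \<Rightarrow> ('a \<Rightarrow> 'a \<Rightarrow> bool) \<Rightarrow> bool" where
  "ax_foundation D r \<longleftrightarrow>
    (\<forall>x\<in>D. (\<exists>y\<in>D. r y x) \<longrightarrow> (\<exists>y\<in>D. r y x \<and> \<not> (\<exists>z\<in>D. r z x \<and> r z y)))"

definition ax_pairing :: "'a set \<Rightarrow> ('a \<Rightarrow> 'a \<Rightarrow> bool) \<Rightarrow> bool" where
  "ax_pairing D r \<longleftrightarrow> (\<forall>x\<in>D. \<forall>y\<in>D. \<exists>p\<in>D. \<forall>z\<in>D. r z p \<longleftrightarrow> z = x \<or> z = y)"

definition ax_union :: "'a set \<Rightarrow> ('a \<Rightarrow> 'a \<Rightarrow> bool) \<Rightarrow> bool" where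
  "ax_union D r \<longleftrightarrow> (\<forall>x\<in>D. \<exists>u\<in>D. \<forall>z\<in>D. r z u \<longleftrightarrow> (\<exists>y\<in>D. r z y \<and> r y x))"

definition ax_power :: "'a set \<Rightarrow> ('a \<Rightarrow> 'a \<Rightarrow> bool) \<Rightarrow> bool" where
  "ax_power D r \<longleftrightarrow> (\<forall>x\<in>D. \<exists>p\<in>D. \<forall>y\<in>D. r y p \<longleftrightarrow> (\<forall>z\<in>D. r z y \<longrightarrow> r z x))"

definition ax_infinity :: "'a set \<Rightarrow> ('a \<Rightarrow> 'a \<Rightarrow> bool) \<Rightarrow> bool" where
  "ax_infinity D r \<longleftrightarrow>
    (\<exists>w\<in>D. (\<exists>e\<in>D. r e w \<and> (\<forall>z\<in>D. \<not> r z e)) \<and>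
      (\<forall>x\<in>D. r x w \<longrightarrow> (\<exists>y\<in>D. r y w \<and> (\<forall>z\<in>D. r z y \<longleftrightarrow> r z x \<or> z = x))))"

definition ax_choice :: "'a set \<Rightarrow> ('a \<Rightarrow> 'a \<Rightarrow> bool) \<Rightarrow> bool" where
  "ax_choice D r \<longleftrightarrow>
    (\<forall>x\<in>D. (\<forall>y\<in>D. r y x \<longrightarrow> (\<exists>z\<in>D. r z y)) \<and>
      (\<forall>y\<in>D. \<forall>y'\<in>D. r y x \<and> r y' x \<and> y \<noteq> y' \<longrightarrow> \<not> (\<exists>z\<in>D. r z y \<and> r z y')) \<longrightarrow>
      (\<exists>c\<in>D. \<forall>y\<in>D. r y x \<longrightarrow> (\<exists>!z. z \<in> D \<and> r z y \<and> r z c)))"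

definition separation_for :: "'a set \<Rightarrow> ('a \<Rightarrow> 'a \<Rightarrow> bool) \<Rightarrow> ('a \<Rightarrow> bool) \<Rightarrow> bool" where
  "separation_for D r P \<longleftrightarrow> (\<forall>x\<in>D. \<exists>y\<in>D. \<forall>z\<in>D. r z y \<longleftrightarrow> r z x \<and> P z)"

definition replacement_for :: "'a set \<Rightarrow> ('a \<Rightarrow> 'a \<Rightarrow> bool) \<Rightarrow> ('a \<Rightarrow> 'a \<Rightarrow> bool) \<Rightarrow> bool" where
  "replacement_for D r F \<longleftrightarrow>
    (\<forall>a\<in>D. (\<forall>x\<in>D. r x a \<longrightarrow> (\<exists>!y. y \<in> D \<and> F x y)) \<longrightarrow>
      (\<exists>b\<in>D. \<forall>y\<in>D. r y b \<longleftrightarrow> (\<exists>x\<in>D. r x a \<and> F x y)))"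

definition base_axioms :: "'a set \<Rightarrow> ('a \<Rightarrow> 'a \<Rightarrow> bool) \<Rightarrow> bool" where
  "base_axioms D r \<longleftrightarrow>
    ax_extensionality D r \<and> ax_foundation D r \<and> ax_pairing D r \<and> ax_union D r \<and>
    ax_power D r \<and> ax_infinity D r \<and> ax_choice D r"

class zfc =
  fixes mem :: "'a \<Rightarrow> 'a \<Rightarrow> bool" (infix "\<epsilon>" 50)
  assumes base_axioms: "base_axioms UNIV (\<epsilon>)"
    and separation_schema: "separation_for UNIV (\<epsilon>) (\<lambda>z. holds (\<epsilon>) p (s(0 := z)))"
    and replacement_schema:
      "replacement_for UNIV (\<epsilon>) (\<lambda>x y. holds (\<epsilon>) p (s(0 := x, 1 := y)))"

section \<open>Basic set theory in the universe\<close>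

definition elts :: "'v::zfc \<Rightarrow> 'v set" where
  "elts x = {z. z \<epsilon> x}"

text \<open>Meaningful only if the class \<open>A\<close> is a set of the universe, as in all uses below.\<close>

definition set_of :: "'v::zfc set \<Rightarrow> 'v" where
  "set_of A = (THE x. elts x = A)"

definition empty :: "'v::zfc" where
  "empty = set_of {}"

definition succ :: "'v::zfc \<Rightarrow> 'v" where
  "succ x = set_of (insert x (elts x))"

primrec numeral_set :: "nat \<Rightarrow> 'v::zfc" where
  "numeral_set 0 = empty"
| "numeral_set (Suc n) = succ (numeral_set n)"

definition omega :: "'v::zfc" where
  "omega = set_of {n. \<forall>x. empty \<epsilon> x \<and> (\<forall>y\<in>elts x. succ y \<epsilon> x) \<longrightarrow> n \<epsilon> x}"

definition pow :: "'v::zfc \<Rightarrow> 'v" where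
  "pow x = set_of {y. elts y \<subseteq> elts x}"

definition opair :: "'v::zfc \<Rightarrow> 'v \<Rightarrow> 'v" where
  "opair x y = set_of {set_of {x}, set_of {x, y}}"

definition cprod :: "'v::zfc \<Rightarrow> 'v \<Rightarrow> 'v" where
  "cprod a b = set_of {opair x y | x y. x \<epsilon> a \<and> y \<epsilon> b}"

definition fun_on :: "'v::zfc \<Rightarrow> 'v \<Rightarrow> bool" where
  "fun_on f d \<longleftrightarrow>
    (\<forall>p\<in>elts f. \<exists>x\<in>elts d. \<exists>y. p = opair x y) \<and> (\<forall>x\<in>elts d. \<exists>!y. opair x y \<epsilon> f)"

definition app :: "'v::zfc \<Rightarrow> 'v \<Rightarrow> 'v" where
  "app f x = (THE y. opair x y \<epsilon> f)"

definition maps :: "'v::zfc \<Rightarrow> 'v \<Rightarrow> 'v \<Rightarrow> bool" where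
  "maps f a b \<longleftrightarrow> fun_on f a \<and> (\<forall>x\<in>elts a. app f x \<epsilon> b)"

definition injects :: "'v::zfc \<Rightarrow> 'v \<Rightarrow> 'v \<Rightarrow> bool" where
  "injects f a b \<longleftrightarrow> maps f a b \<and> (\<forall>x\<in>elts a. \<forall>y\<in>elts a. app f x = app f y \<longrightarrow> x = y)"

definition bijects :: "'v::zfc \<Rightarrow> 'v \<Rightarrow> 'v \<Rightarrow> bool" where
  "bijects f a b \<longleftrightarrow> injects f a b \<and> (\<forall>y\<in>elts b. \<exists>x\<in>elts a. app f x = y)"

definition upd :: "'v::zfc \<Rightarrow> 'v \<Rightarrow> 'v \<Rightarrow> 'v" where
  "upd f i x = set_of (insert (opair i x) {p \<in> elts f. \<not> (\<exists>y. p = opair i y)})"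

definition transitive_set :: "'v::zfc \<Rightarrow> bool" where
  "transitive_set x \<longleftrightarrow> (\<forall>y\<in>elts x. elts y \<subseteq> elts x)"

definition ordinal :: "'v::zfc \<Rightarrow> bool" where
  "ordinal \<alpha> \<longleftrightarrow> transitive_set \<alpha> \<and> (\<forall>\<beta>\<in>elts \<alpha>. transitive_set \<beta>)"

definition cardinal :: "'v::zfc \<Rightarrow> bool" where
  "cardinal \<kappa> \<longleftrightarrow> ordinal \<kappa> \<and> \<not> (\<exists>\<alpha>\<in>elts \<kappa>. \<exists>f. bijects f \<alpha> \<kappa>)"

definition inaccessible :: "'v::zfc \<Rightarrow> bool" where
  "inaccessible \<kappa> \<longleftrightarrow> cardinal \<kappa> \<and> omega \<epsilon> \<kappa> \<and>
    (\<forall>\<alpha>\<in>elts \<kappa>. \<forall>f. maps f \<alpha> \<kappa> \<longrightarrow> (\<exists>\<beta>\<in>elts \<kappa>. \<forall>\<xi>\<in>elts \<alpha>. app f \<xi> \<epsilon> \<beta>)) \<and>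
    (\<forall>\<alpha>\<in>elts \<kappa>. \<exists>\<beta>\<in>elts \<kappa>. \<exists>f. injects f (pow \<alpha>) \<beta>)"

text \<open>Transfinite recursion: \<open>ord_rec G \<alpha> = G {ord_rec G \<gamma> | \<gamma> \<epsilon> \<alpha>}\<close>.\<close>

definition ord_rec :: "('v::zfc \<Rightarrow> 'v) \<Rightarrow> 'v \<Rightarrow> 'v" where
  "ord_rec G \<alpha> = (THE v. \<exists>f. fun_on f (succ \<alpha>) \<and>
    (\<forall>\<beta>\<in>elts (succ \<alpha>). app f \<beta> = G (set_of {app f \<gamma> | \<gamma>. \<gamma> \<epsilon> \<beta>})) \<and> v = app f \<alpha>)"

definition V :: "'v::zfc \<Rightarrow> 'v" where
  "V = ord_rec (\<lambda>X. set_of {z. \<exists>x\<in>elts X. elts z \<subseteq> elts x})"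

definition mem_rel :: "'v::zfc \<Rightarrow> 'v" where
  "mem_rel a = set_of {opair x y | x y. x \<epsilon> a \<and> y \<epsilon> a \<and> x \<epsilon> y}"

section \<open>Coded formulas and satisfaction\<close>

text \<open>
  The coded language has variables indexed by \<open>\<omega>\<close>, a binary membership symbol, equality, and two
  existential quantifiers: \<open>c_ex\<close> over the objects of a structure, and \<open>c_ex2\<close> over its
  higher-order objects.
\<close>

definition c_mem :: "'v::zfc \<Rightarrow> 'v \<Rightarrow> 'v" where
  "c_mem i j = opair (numeral_set 0) (opair i j)"
definition c_eq :: "'v::zfc \<Rightarrow> 'v \<Rightarrow> 'v" where
  "c_eq i j = opair (numeral_set 1) (opair i j)"
definition c_neg :: "'v::zfc \<Rightarrow> 'v" where
  "c_neg f = opair (numeral_set 2) f"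
definition c_and :: "'v::zfc \<Rightarrow> 'v \<Rightarrow> 'v" where
  "c_and f g = opair (numeral_set 3) (opair f g)"
definition c_ex :: "'v::zfc \<Rightarrow> 'v \<Rightarrow> 'v" where
  "c_ex i f = opair (numeral_set 4) (opair i f)"
definition c_ex2 :: "'v::zfc \<Rightarrow> 'v \<Rightarrow> 'v" where
  "c_ex2 i f = opair (numeral_set 5) (opair i f)"

definition bool_closed :: "'v::zfc \<Rightarrow> bool" where
  "bool_closed X \<longleftrightarrow>
    (\<forall>i\<in>elts omega. \<forall>j\<in>elts omega. c_mem i j \<epsilon> X \<and> c_eq i j \<epsilon> X) \<and>
    (\<forall>f\<in>elts X. c_neg f \<epsilon> X) \<and> (\<forall>f\<in>elts X. \<forall>g\<in>elts X. c_and f g \<epsilon> X)"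

definition formula :: "'v::zfc \<Rightarrow> bool" where
  "formula f \<longleftrightarrow> (\<forall>X. bool_closed X \<and>
    (\<forall>i\<in>elts omega. \<forall>g\<in>elts X. c_ex i g \<epsilon> X \<and> c_ex2 i g \<epsilon> X) \<longrightarrow> f \<epsilon> X)"

definition fo_formula :: "'v::zfc \<Rightarrow> bool" where
  "fo_formula f \<longleftrightarrow> (\<forall>X. bool_closed X \<and>
    (\<forall>i\<in>elts omega. \<forall>g\<in>elts X. c_ex i g \<epsilon> X) \<longrightarrow> f \<epsilon> X)"

definition delta0 :: "'v::zfc \<Rightarrow> bool" where
  "delta0 f \<longleftrightarrow> (\<forall>X. bool_closed X \<and>
    (\<forall>i\<in>elts omega. \<forall>j\<in>elts omega. \<forall>g\<in>elts X. i \<noteq> j \<longrightarrow> c_ex i (c_and (c_mem i j) g) \<epsilon> X)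
    \<longrightarrow> f \<epsilon> X)"

definition free_closed :: "'v::zfc \<Rightarrow> bool" where
  "free_closed Z \<longleftrightarrow> (\<forall>i\<in>elts omega. \<forall>j\<in>elts omega.
      opair i (c_mem i j) \<epsilon> Z \<and> opair j (c_mem i j) \<epsilon> Z \<and>
      opair i (c_eq i j) \<epsilon> Z \<and> opair j (c_eq i j) \<epsilon> Z) \<and>
    (\<forall>k\<in>elts omega. \<forall>f. formula f \<and> opair k f \<epsilon> Z \<longrightarrow>
      opair k (c_neg f) \<epsilon> Z \<and>
      (\<forall>g. formula g \<longrightarrow> opair k (c_and f g) \<epsilon> Z \<and> opair k (c_and g f) \<epsilon> Z) \<and>
      (\<forall>i\<in>elts omega. i \<noteq> k \<longrightarrow> opair k (c_ex i f) \<epsilon> Z \<and> opair k (c_ex2 i f) \<epsilon> Z))"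

definition free_in :: "'v::zfc \<Rightarrow> 'v \<Rightarrow> bool" where
  "free_in k f \<longleftrightarrow> k \<epsilon> omega \<and> formula f \<and> (\<forall>Z. free_closed Z \<longrightarrow> opair k f \<epsilon> Z)"

definition closed_formula :: "'v::zfc \<Rightarrow> bool" where
  "closed_formula f \<longleftrightarrow> \<not> (\<exists>k. free_in k f)"

text \<open>
  A structure is given by the set \<open>D\<close> of its objects, the set \<open>H\<close> of its higher-order objects and
  the interpretation \<open>E\<close> of the membership symbol.  A satisfaction relation is a set of pairs of
  formulas and assignments obeying Tarski's recursive clauses.
\<close>

definition assignment :: "'v::zfc \<Rightarrow> 'v \<Rightarrow> 'v \<Rightarrow> bool" where
  "assignment D H s \<longleftrightarrow> fun_on s omega \<and> (\<forall>i\<in>elts omega. app s i \<epsilon> D \<or> app s i \<epsilon> H)"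

definition satisfaction_relation :: "'v::zfc \<Rightarrow> 'v \<Rightarrow> 'v \<Rightarrow> 'v \<Rightarrow> bool" where
  "satisfaction_relation D H E S \<longleftrightarrow> (\<forall>s. assignment D H s \<longrightarrow>
    (\<forall>i\<in>elts omega. \<forall>j\<in>elts omega.
      (opair (c_mem i j) s \<epsilon> S \<longleftrightarrow> opair (app s i) (app s j) \<epsilon> E) \<and>
      (opair (c_eq i j) s \<epsilon> S \<longleftrightarrow> app s i = app s j)) \<and>
    (\<forall>f. formula f \<longrightarrow>
      (opair (c_neg f) s \<epsilon> S \<longleftrightarrow> \<not> opair f s \<epsilon> S) \<and>
      (\<forall>g. formula g \<longrightarrow>
        (opair (c_and f g) s \<epsilon> S \<longleftrightarrow> opair f s \<epsilon> S \<and> opair g s \<epsilon> S)) \<and>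
      (\<forall>i\<in>elts omega.
        (opair (c_ex i f) s \<epsilon> S \<longleftrightarrow> (\<exists>x\<in>elts D. opair f (upd s i x) \<epsilon> S)) \<and>
        (opair (c_ex2 i f) s \<epsilon> S \<longleftrightarrow> (\<exists>x\<in>elts H. opair f (upd s i x) \<epsilon> S)))))"

definition sat :: "'v::zfc \<Rightarrow> 'v \<Rightarrow> 'v \<Rightarrow> 'v \<Rightarrow> 'v \<Rightarrow> bool" where
  "sat D H E f s \<longleftrightarrow> formula f \<and> assignment D H s \<and>
    (\<exists>S. satisfaction_relation D H E S \<and> opair f s \<epsilon> S)"

definition sat_in :: "'v::zfc \<Rightarrow> 'v \<Rightarrow> 'v \<Rightarrow> bool" where
  "sat_in a f s \<longleftrightarrow> sat a empty (mem_rel a) f s"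

section \<open>Higher-order logic over a structure, and categoricity\<close>

definition is_structure :: "'v::zfc \<Rightarrow> 'v \<Rightarrow> bool" where
  "is_structure M R \<longleftrightarrow> M \<noteq> empty \<and> elts R \<subseteq> elts (cprod M M)"

definition isomorphic :: "'v::zfc \<Rightarrow> 'v \<Rightarrow> 'v \<Rightarrow> 'v \<Rightarrow> bool" where
  "isomorphic M R N S \<longleftrightarrow> (\<exists>f. bijects f M N \<and>
    (\<forall>x\<in>elts M. \<forall>y\<in>elts M. opair x y \<epsilon> R \<longleftrightarrow> opair (app f x) (app f y) \<epsilon> S))"

text \<open>
  The cumulative hierarchy over \<open>M\<close> with the elements of \<open>M\<close> as urelements:
  level \<open>\<alpha>\<close> is \<open>{0} \<times> M \<union> {1} \<times> (\<Union>\<beta><\<alpha>. pow (level \<beta>))\<close>.  The tags keep the elements of \<open>M\<close>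
  apart from the collections of them.
\<close>

definition objects :: "'v::zfc \<Rightarrow> 'v" where
  "objects M = set_of {opair (numeral_set 0) m | m. m \<epsilon> M}"

definition ho_level :: "'v::zfc \<Rightarrow> 'v \<Rightarrow> 'v" where
  "ho_level M = ord_rec (\<lambda>X. set_of (elts (objects M) \<union>
    {opair (numeral_set 1) z | z. \<exists>x\<in>elts X. elts z \<subseteq> elts x}))"

definition ho_objects :: "'v::zfc \<Rightarrow> 'v \<Rightarrow> 'v" where
  "ho_objects M \<alpha> = set_of (elts (ho_level M \<alpha>) - elts (objects M))"

definition ho_mem_rel :: "'v::zfc \<Rightarrow> 'v \<Rightarrow> 'v \<Rightarrow> 'v" where
  "ho_mem_rel M R \<alpha> = set_of {opair u v | u v. u \<epsilon> ho_level M \<alpha> \<and> v \<epsilon> ho_level M \<alpha> \<and>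
    ((\<exists>m n. u = opair (numeral_set 0) m \<and> v = opair (numeral_set 0) n \<and> opair m n \<epsilon> R) \<or>
     (\<exists>X. v = opair (numeral_set 1) X \<and> u \<epsilon> X))}"

text \<open>
  The parameter \<open>\<alpha>\<close> counts the levels above the objects: \<open>\<alpha> = 0\<close> is first-order logic,
  \<open>\<alpha> = 1\<close> is full second-order logic (\<open>c_ex2\<close> ranges over all subsets of \<open>M\<close>; relation variables
  are superfluous over models of ZFC, which have pairing), \<open>\<alpha> = n\<close> is logic of order \<open>n + 1\<close>, and
  generally \<open>\<alpha>\<close> is logic of order \<open>1 + \<alpha>\<close>, which is order \<open>\<alpha>\<close> for infinite \<open>\<alpha>\<close>.
\<close>

definition sentence :: "'v::zfc \<Rightarrow> 'v \<Rightarrow> bool" where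
  "sentence \<alpha> \<sigma> \<longleftrightarrow> (if \<alpha> = empty then fo_formula \<sigma> else formula \<sigma>) \<and> closed_formula \<sigma>"

text \<open>For a sentence and a nonempty \<open>M\<close>, truth under some and under all assignments coincide.\<close>

definition models :: "'v::zfc \<Rightarrow> 'v \<Rightarrow> 'v \<Rightarrow> 'v \<Rightarrow> bool" where
  "models \<alpha> M R \<sigma> \<longleftrightarrow> (\<exists>s. sat (objects M) (ho_objects M \<alpha>) (ho_mem_rel M R \<alpha>) \<sigma> s)"

definition zfc2_model :: "'v::zfc \<Rightarrow> 'v \<Rightarrow> bool" where
  "zfc2_model M R \<longleftrightarrow> (let r = (\<lambda>x y. opair x y \<epsilon> R) in
    base_axioms (elts M) r \<and>
    (\<forall>A. elts A \<subseteq> elts M \<longrightarrow> separation_for (elts M) r (\<lambda>z. z \<epsilon> A)) \<and>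
    (\<forall>F. elts F \<subseteq> elts (cprod M M) \<longrightarrow> replacement_for (elts M) r (\<lambda>x y. opair x y \<epsilon> F)))"

text \<open>
  An ordinal is absolutely definable if one and the same first-order formula defines it in every
  \<open>V \<kappa>\<close> with \<open>\<kappa>\<close> inaccessible, so that the logic is understood alike in all these models.
\<close>

definition absolutely_definable :: "'v::zfc \<Rightarrow> bool" where
  "absolutely_definable \<alpha> \<longleftrightarrow> ordinal \<alpha> \<and>
    (\<exists>\<phi>. fo_formula \<phi> \<and> (\<forall>k. free_in k \<phi> \<longrightarrow> k = numeral_set 0) \<and>
      (\<forall>\<kappa>. inaccessible \<kappa> \<longrightarrow> \<alpha> \<epsilon> V \<kappa> \<and>
        (\<forall>x\<in>elts (V \<kappa>). (\<exists>s. app s (numeral_set 0) = x \<and> sat_in (V \<kappa>) \<phi> s) \<longleftrightarrow> x = \<alpha>)))"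

definition logic_order :: "'v::zfc \<Rightarrow> bool" where
  "logic_order \<alpha> \<longleftrightarrow> \<alpha> = numeral_set 0 \<or> \<alpha> = numeral_set 1 \<or> absolutely_definable \<alpha>"

definition theory_categorical_for :: "'v::zfc \<Rightarrow> 'v \<Rightarrow> 'v \<Rightarrow> bool" where
  "theory_categorical_for \<alpha> T \<kappa> \<longleftrightarrow>
    zfc2_model (V \<kappa>) (mem_rel (V \<kappa>)) \<and>
    (\<forall>\<sigma>\<in>elts T. models \<alpha> (V \<kappa>) (mem_rel (V \<kappa>)) \<sigma>) \<and>
    (\<forall>M R. is_structure M R \<and> zfc2_model M R \<and> (\<forall>\<sigma>\<in>elts T. models \<alpha> M R \<sigma>) \<longrightarrow>
      isomorphic M R (V \<kappa>) (mem_rel (V \<kappa>)))"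

definition sententially_categorical :: "'v::zfc \<Rightarrow> 'v \<Rightarrow> bool" where
  "sententially_categorical \<alpha> \<kappa> \<longleftrightarrow>
    cardinal \<kappa> \<and> (\<exists>\<sigma>. sentence \<alpha> \<sigma> \<and> theory_categorical_for \<alpha> (set_of {\<sigma>}) \<kappa>)"

definition theory_categorical :: "'v::zfc \<Rightarrow> 'v \<Rightarrow> bool" where
  "theory_categorical \<alpha> \<kappa> \<longleftrightarrow>
    cardinal \<kappa> \<and> (\<exists>T. (\<forall>\<sigma>\<in>elts T. sentence \<alpha> \<sigma>) \<and> theory_categorical_for \<alpha> T \<kappa>)"

definition theory_of_V :: "'v::zfc \<Rightarrow> 'v \<Rightarrow> 'v" where
  "theory_of_V \<alpha> \<kappa> = set_of {\<sigma>. sentence \<alpha> \<sigma> \<and> models \<alpha> (V \<kappa>) (mem_rel (V \<kappa>)) \<sigma>}"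

definition fresh :: "'v::zfc \<Rightarrow> 'v \<Rightarrow> bool" where
  "fresh \<alpha> \<kappa> \<longleftrightarrow> inaccessible \<kappa> \<and>
    (\<forall>\<delta>\<in>elts \<kappa>. inaccessible \<delta> \<longrightarrow> theory_of_V \<alpha> \<kappa> \<noteq> theory_of_V \<alpha> \<delta>)"

section \<open>\<open>\<Sigma>\<^sub>2\<close>-correctness\<close>

definition sigma2_form :: "'v::zfc \<Rightarrow> 'v \<Rightarrow> 'v \<Rightarrow> 'v \<Rightarrow> bool" where
  "sigma2_form i j g f \<longleftrightarrow> i \<epsilon> omega \<and> j \<epsilon> omega \<and> delta0 g \<and>
    f = c_ex i (c_neg (c_ex j (c_neg g)))"

definition sigma2 :: "'v::zfc \<Rightarrow> bool" where
  "sigma2 f \<longleftrightarrow> (\<exists>i j g. sigma2_form i j g f)"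

text \<open>
  Truth in the whole universe of coded \<open>\<Delta>\<^sub>0\<close> formulas, via any transitive set containing the values
  of the assignment, and thence of coded \<open>\<Sigma>\<^sub>2\<close> formulas.
\<close>

definition delta0_true :: "'v::zfc \<Rightarrow> 'v \<Rightarrow> bool" where
  "delta0_true g s \<longleftrightarrow> (\<exists>t. transitive_set t \<and> maps s omega t \<and> sat_in t g s)"

definition sigma2_true :: "'v::zfc \<Rightarrow> 'v \<Rightarrow> bool" where
  "sigma2_true f s \<longleftrightarrow> fun_on s omega \<and>
    (\<exists>i j g. sigma2_form i j g f \<and> (\<exists>x. \<forall>y. delta0_true g (upd (upd s i x) j y)))"

definition lightface_correct :: "'v::zfc \<Rightarrow> bool" where
  "lightface_correct \<delta> \<longleftrightarrow> ordinal \<delta> \<and>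
    (\<forall>\<phi>. sigma2 \<phi> \<and> closed_formula \<phi> \<longrightarrow>
      ((\<exists>s. sat_in (V \<delta>) \<phi> s) \<longleftrightarrow> (\<exists>s. sigma2_true \<phi> s)))"

text \<open>
  Reals are subsets of \<open>\<omega>\<close>.  As \<open>sat_in\<close> fails for assignments leaving \<open>V \<delta>\<close>, the following entails
  that \<open>V \<delta>\<close> contains all reals.
\<close>

definition real_correct :: "'v::zfc \<Rightarrow> bool" where
  "real_correct \<delta> \<longleftrightarrow> ordinal \<delta> \<and>
    (\<forall>\<phi> s. sigma2 \<phi> \<and> maps s omega (pow omega) \<longrightarrow> (sat_in (V \<delta>) \<phi> s \<longleftrightarrow> sigma2_true \<phi> s))"

text \<open>The empty structure \<open>V 0\<close> has no assignments and is excluded explicitly.\<close>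

definition fully_correct :: "'v::zfc \<Rightarrow> bool" where
  "fully_correct \<delta> \<longleftrightarrow> ordinal \<delta> \<and> V \<delta> \<noteq> empty \<and>
    (\<forall>\<phi> s. sigma2 \<phi> \<and> maps s omega (V \<delta>) \<longrightarrow> (sat_in (V \<delta>) \<phi> s \<longleftrightarrow> sigma2_true \<phi> s))"

definition least_cardinal :: "('v::zfc \<Rightarrow> bool) \<Rightarrow> 'v \<Rightarrow> bool" where
  "least_cardinal P \<delta> \<longleftrightarrow> cardinal \<delta> \<and> P \<delta> \<and> \<not> (\<exists>\<gamma>\<in>elts \<delta>. cardinal \<gamma> \<and> P \<gamma>)"

end

theory Submission imports Defs
begin

text \<open>
  A true statement of the form ``there are a set \<open>z\<close> with \<open>Q\<close> and a transitive set that contains \<open>z\<close>,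
  is closed under subsets, powersets and the like, and satisfies \<open>Q(z)\<close>'' is \<open>\<Sigma>\<^sub>2\<close>, for every \<open>Q\<close>
  that such sets evaluate correctly; this covers satisfaction in \<open>V \<kappa>\<close>, inaccessibility and
  correctness of \<open>V \<kappa>\<close> for a given theory.  Hence a \<open>\<Sigma>\<^sub>2\<close>-correct \<open>\<delta>\<close> has a witness \<open>z\<close> in \<open>V \<delta>\<close>.
  A sentence that characterises \<open>\<kappa>\<close> thus has its inaccessible model \<open>V \<kappa>\<close> inside \<open>V \<delta>\<close>.  A theory, and
  likewise the lightface \<open>\<Sigma>\<^sub>2\<close> theory of the universe, is coded by a real, which gives (2) and the
  first inequality of (3); the \<open>\<Sigma>\<^sub>2\<close> truths about reals form a set in \<open>V \<delta>\<close>, which serves as a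
  parameter for the second inequality.  A fully correct cardinal comes from closing under witnesses.

  The universe may be \<open>\<omega>\<close>-nonstandard, so its coded formulas, and with them the given sentence,
  need not be formulas of the metatheory.
\<close>

section \<open>Definability\<close>

text \<open>Separation and replacement, and with them every induction and recursion, hold only for
  first-order definable properties, whereas the statement is written with HOL predicates. Each
  notion is therefore proved definable (\<open>dfn\<close> for predicates, \<open>dft\<close> for
  operations), along the structure of its HOL term. Through a flag the same derivations serve twice:
  with \<open>True\<close> they justify comprehension in the universe; with \<open>False\<close>
  they show that one parameter-free formula expresses the notion correctly in every
  \<open>nice\<close> class, which is the absoluteness behind transfer.

  A Sigma2 formula has the form: there is x such that for all y something bounded holds. The
  quantifier over y is spent on the closure of x under subsets; all else about x becomes bounded by
  relativisation to x.

  A formula of the metatheory can name only a standard number. In the lightface case, where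
  parameters are not allowed, the number that codes the given sentence is instead defined by a coded
  Delta0 formula, obtained by induction inside the model.\<close>

primrec hold :: "'v::zfc set \<Rightarrow> fm \<Rightarrow> (nat \<Rightarrow> 'v) \<Rightarrow> bool" where
  "hold U (FMem i j) s \<longleftrightarrow> s i \<epsilon> s j"
| "hold U (FEq i j) s \<longleftrightarrow> s i = s j"
| "hold U (FNeg p) s \<longleftrightarrow> \<not> hold U p s"
| "hold U (FAnd p q) s \<longleftrightarrow> hold U p s \<and> hold U q s"
| "hold U (FEx i p) s \<longleftrightarrow> (\<exists>x\<in>U. hold U p (s(i := x)))"

lemma hold_UNIV: "hold UNIV p s = holds (\<epsilon>) p s"
  by (induction p arbitrary: s) auto

text \<open>Makes fresh variables available: from n on the assignment is irrelevant, with the same n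
  for every \<open>U\<close>.\<close>

lemma hold_support: "\<exists>n. \<forall>U (s :: nat \<Rightarrow> 'v::zfc) s'. (\<forall>k<n. s k = s' k) \<longrightarrow> hold U p s = hold U p s'"
proof (induction p)
  case (FMem i j) show ?case by (rule exI[of _ "Suc (max i j)"]) auto
next
  case (FEq i j) show ?case by (rule exI[of _ "Suc (max i j)"]) auto
next
  case (FNeg p) then show ?case by auto
next
  case (FAnd p q)
  obtain n where n: "\<forall>U (s :: nat \<Rightarrow> 'v) s'. (\<forall>k<n. s k = s' k) \<longrightarrow> hold U p s = hold U p s'"
    using FAnd(1) by (rule exE)
  obtain m where m: "\<forall>U (s :: nat \<Rightarrow> 'v) s'. (\<forall>k<m. s k = s' k) \<longrightarrow> hold U q s = hold U q s'"
    using FAnd(2) by (rule exE)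
  have "hold U (FAnd p q) s = hold U (FAnd p q) s'" if "\<forall>k<max n m. s k = s' k" for U and s s' :: "nat \<Rightarrow> 'v"
    using n[rule_format, of s s' U] m[rule_format, of s s' U] that by simp
  then show ?case by blast
next
  case (FEx i p)
  then obtain n where n: "\<forall>U (s :: nat \<Rightarrow> 'v) s'. (\<forall>k<n. s k = s' k) \<longrightarrow> hold U p s = hold U p s'" by blast
  have *: "hold U p (s(i := x)) = hold U p (s'(i := x))" if "\<forall>k<n. s k = s' k" for U x and s s' :: "nat \<Rightarrow> 'v"
    by (rule n[rule_format]) (use that in auto)
  have "hold U (FEx i p) s = hold U (FEx i p) s'" if "\<forall>k<n. s k = s' k" for U and s s' :: "nat \<Rightarrow> 'v"
    unfolding hold.simps by (rule bex_cong[OF refl]) (rule *[OF that])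
  then show ?case by blast
qed

lemma hold_rename: "\<exists>q. \<forall>U (s :: nat \<Rightarrow> 'v::zfc). hold U q s = hold U p (s \<circ> f)"
proof (induction p arbitrary: f)
  case (FMem i j) show ?case by (rule exI[of _ "FMem (f i) (f j)"]) auto
next
  case (FEq i j) show ?case by (rule exI[of _ "FEq (f i) (f j)"]) auto
next
  case (FNeg p)
  then obtain q where "\<forall>U (s :: nat \<Rightarrow> 'v). hold U q s = hold U p (s \<circ> f)" by blast
  then show ?case by (intro exI[of _ "FNeg q"]) (simp add: comp_def)
next
  case (FAnd p1 p2)
  obtain q1 where "\<forall>U (s :: nat \<Rightarrow> 'v). hold U q1 s = hold U p1 (s \<circ> f)" using FAnd(1) by blast
  moreover obtain q2 where "\<forall>U (s :: nat \<Rightarrow> 'v). hold U q2 s = hold U p2 (s \<circ> f)" using FAnd(2) by blast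
  ultimately show ?case by (intro exI[of _ "FAnd q1 q2"]) (simp add: comp_def)
next
  case (FEx i p)
  obtain n where n: "\<forall>U (s :: nat \<Rightarrow> 'v) s'. (\<forall>k<n. s k = s' k) \<longrightarrow> hold U p s = hold U p s'"
    using hold_support[of p] by blast
  \<comment> \<open>The bound variable moves to an index outside the image of the relevant ones,
    which prevents capture although \<open>f\<close> may fail to be injective.\<close>
  obtain m where m: "m \<notin> f ` {..<n}"
    using ex_new_if_finite[OF infinite_UNIV_nat, of "f ` {..<n}"] by auto
  obtain q where q: "\<forall>U (s :: nat \<Rightarrow> 'v). hold U q s = hold U p (s \<circ> (f(i := m)))" using FEx by blast
  have "hold U p ((s(m := x)) \<circ> (f(i := m))) = hold U p ((s \<circ> f)(i := x))" for U and s :: "nat \<Rightarrow> 'v" and x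
    using m by (intro n[rule_format]) auto
  then have "hold U (FEx m q) s = hold U (FEx i p) (s \<circ> f)" for U and s :: "nat \<Rightarrow> 'v"
    using q by simp
  then show ?case by blast
qed

text \<open>
  The clauses are relativised to \<open>U\<close> literally, so that they can be read off a first-order formula
  evaluated in \<open>U\<close>.  The last one provides a set that contains \<open>\<omega>\<close> and is closed under ordered
  pairs; in particular it contains all codes of formulas.
\<close>

definition nice :: "'v::zfc set \<Rightarrow> bool" where
  "nice U \<longleftrightarrow> (\<forall>x\<in>U. \<forall>y. y \<epsilon> x \<longrightarrow> y \<in> U) \<and> (\<forall>x\<in>U. \<forall>y. elts y \<subseteq> elts x \<longrightarrow> y \<in> U) \<and>
    (\<forall>x\<in>U. \<forall>y\<in>U. \<exists>p\<in>U. x \<epsilon> p \<and> y \<epsilon> p) \<and>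
    (\<forall>x\<in>U. \<exists>u\<in>U. \<forall>y\<in>U. y \<epsilon> x \<longrightarrow> (\<forall>z\<in>U. z \<epsilon> y \<longrightarrow> z \<epsilon> u)) \<and>
    (\<forall>x\<in>U. \<exists>p\<in>U. \<forall>y\<in>U. (\<forall>z\<in>U. z \<epsilon> y \<longrightarrow> z \<epsilon> x) \<longrightarrow> y \<epsilon> p) \<and>
    (\<exists>W\<in>U. (\<exists>z\<in>U. z \<epsilon> W \<and> (\<forall>u\<in>U. \<not> u \<epsilon> z)) \<and>
      (\<forall>a\<in>U. a \<epsilon> W \<longrightarrow> (\<exists>c\<in>U. c \<epsilon> W \<and> (\<forall>u\<in>U. u \<epsilon> c \<longleftrightarrow> u \<epsilon> a \<or> u = a)) \<and>
        (\<forall>b\<in>U. b \<epsilon> W \<longrightarrow> (\<exists>c\<in>U. c \<epsilon> W \<and> (\<forall>u\<in>U. u \<epsilon> c \<longleftrightarrow> u = a \<or> u = b)))))"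

text \<open>
  The flag selects between definability in the universe with parameters and definability by one
  parameter-free formula in all nice classes at once.
\<close>

definition univ :: "bool \<Rightarrow> 'v::zfc set \<Rightarrow> bool" where
  "univ b U \<longleftrightarrow> (if b then U = UNIV else nice U)"

text \<open>Arguments sit on the even variables and parameters on the odd ones; without the flag
  there are no parameters.\<close>

definition join :: "bool \<Rightarrow> (nat \<Rightarrow> 'v) \<Rightarrow> (nat \<Rightarrow> 'v) \<Rightarrow> nat \<Rightarrow> 'v" where
  "join b e c = (if b then (\<lambda>k. if even k then e (k div 2) else c (k div 2)) else e)"

text \<open>\<open>q\<close> and \<open>c\<close> are chosen before \<open>U\<close> and
  \<open>e\<close>. Without the flag this is absoluteness: \<open>P\<close>, read in the universe,
  agrees with one fixed formula read in any nice class that contains the arguments.\<close>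

definition dfn :: "bool \<Rightarrow> ((nat \<Rightarrow> 'v::zfc) \<Rightarrow> bool) \<Rightarrow> bool" where
  "dfn b P \<longleftrightarrow> (\<exists>q c. \<forall>U e. univ b U \<longrightarrow> range e \<subseteq> U \<longrightarrow> (P e \<longleftrightarrow> hold U q (join b e c)))"

lemma univ_True [simp]: "univ True U \<longleftrightarrow> U = UNIV"
  by (simp add: univ_def)

text \<open>Renaming arguments, merging parameter lists and prefixing an argument are all renamings
  of variables that do not depend on the assignment, so \<open>hold_rename\<close> can absorb them
  into the formula.\<close>

lemma join_rename: "\<exists>g. \<forall>e. join b (e \<circ> f) c = join b e c \<circ> g"
  by (rule exI[of _ "if b then (\<lambda>k. if even k then 2 * f (k div 2) else k) else f"])
    (auto simp: join_def fun_eq_iff)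

lemma join_left: "\<exists>g. \<forall>e. join b e c1 = join b e (join True c1 c2) \<circ> g"
  by (rule exI[of _ "if b then (\<lambda>k. if even k then k else 2 * (2 * (k div 2)) + 1) else id"])
    (auto simp: join_def fun_eq_iff elim!: oddE)

lemma join_right: "\<exists>g. \<forall>e. join b e c2 = join b e (join True c1 c2) \<circ> g"
  by (rule exI[of _ "if b then (\<lambda>k. if even k then k else 2 * (2 * (k div 2) + 1) + 1) else id"])
    (auto simp: join_def fun_eq_iff)

lemma join_case: "\<exists>g. \<forall>e x. join b (case_nat x e) c = case_nat x (join b e c) \<circ> g"
proof (cases b)
  case True
  \<comment> \<open>On the left \<open>x\<close> pushes only the even positions, by two; on the
    right it pushes every position by one. Hence the correction by one, downwards for even and
    upwards for odd \<open>k\<close>.\<close>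
  have "join True (case_nat x e) c k =
    case_nat x (join True e c) (if k = 0 then 0 else if even k then k - 1 else k + 1)"
    for e :: "nat \<Rightarrow> 'a" and x k
  proof (cases "even k")
    case True
    then obtain m where "k = 2 * m" by (rule evenE)
    then show ?thesis by (cases m) (simp_all add: join_def)
  next
    case False
    then have "k \<noteq> 0" by (metis even_zero)
    with False show ?thesis by (simp add: join_def)
  qed
  then show ?thesis
    using True by (intro exI[of _ "\<lambda>k. if k = 0 then 0 else if even k then k - 1 else k + 1"]) (simp add: fun_eq_iff)
qed (auto simp: join_def intro: exI[of _ id])

section \<open>Closure of definability under the logical operations\<close>

lemma dfn_ren:
  fixes P :: "(nat \<Rightarrow> 'v::zfc) \<Rightarrow> bool"
  assumes "dfn b P" shows "dfn b (\<lambda>e. P (\<lambda>k. e (f k)))"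
proof -
  obtain q c where q: "\<forall>U e. univ b U \<longrightarrow> range e \<subseteq> U \<longrightarrow> (P e \<longleftrightarrow> hold U q (join b e c))"
    using assms unfolding dfn_def by blast
  obtain g where g: "\<forall>e. join b (e \<circ> f) c = join b e c \<circ> g" using join_rename by blast
  obtain q' where q': "\<forall>U (s :: nat \<Rightarrow> 'v). hold U q' s = hold U q (s \<circ> g)" using hold_rename by blast
  have "P (\<lambda>k. e (f k)) \<longleftrightarrow> hold U q' (join b e c)" if "univ b U" "range e \<subseteq> U" for U e
  proof -
    have "range (e \<circ> f) \<subseteq> U" using that by auto
    then have "P (e \<circ> f) \<longleftrightarrow> hold U q (join b (e \<circ> f) c)" using q that by blast
    also have "\<dots> \<longleftrightarrow> hold U q' (join b e c)" by (simp only: g q')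
    finally show ?thesis by (simp add: comp_def)
  qed
  then show ?thesis unfolding dfn_def by blast
qed

lemma dfn_neg:
  fixes P :: "(nat \<Rightarrow> 'v::zfc) \<Rightarrow> bool"
  assumes "dfn b P" shows "dfn b (\<lambda>e. \<not> P e)"
proof -
  obtain q c where "\<forall>U e. univ b U \<longrightarrow> range e \<subseteq> U \<longrightarrow> (P e \<longleftrightarrow> hold U q (join b e c))"
    using assms unfolding dfn_def by blast
  then show ?thesis unfolding dfn_def by (intro exI[of _ "FNeg q"] exI[of _ c]) auto
qed

lemma dfn_conj:
  fixes P :: "(nat \<Rightarrow> 'v::zfc) \<Rightarrow> bool"
  assumes "dfn b P" "dfn b Q" shows "dfn b (\<lambda>e. P e \<and> Q e)"
proof -
  obtain q c where q: "\<forall>U e. univ b U \<longrightarrow> range e \<subseteq> U \<longrightarrow> (P e \<longleftrightarrow> hold U q (join b e c))"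
    using assms unfolding dfn_def by blast
  obtain r d where r: "\<forall>U e. univ b U \<longrightarrow> range e \<subseteq> U \<longrightarrow> (Q e \<longleftrightarrow> hold U r (join b e d))"
    using assms unfolding dfn_def by blast
  obtain g where g: "\<forall>e. join b e c = join b e (join True c d) \<circ> g" using join_left by blast
  obtain h where h: "\<forall>e. join b e d = join b e (join True c d) \<circ> h" using join_right by blast
  obtain q' where q': "\<forall>U (s :: nat \<Rightarrow> 'v). hold U q' s = hold U q (s \<circ> g)" using hold_rename by blast
  obtain r' where r': "\<forall>U (s :: nat \<Rightarrow> 'v). hold U r' s = hold U r (s \<circ> h)" using hold_rename by blast
  show ?thesis unfolding dfn_def
    using q r g h q' r' by (intro exI[of _ "FAnd q' r'"] exI[of _ "join True c d"]) auto
qed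

text \<open>\<open>closed\<close> carries the difference between the two readings: a formula
  searches only \<open>U\<close>, whereas \<open>Q\<close> is asked for a witness anywhere.\<close>

lemma dfn_ex:
  fixes Q :: "'v::zfc \<Rightarrow> (nat \<Rightarrow> 'v) \<Rightarrow> bool"
  assumes "dfn b (\<lambda>e. Q (e 0) (\<lambda>k. e (Suc k)))"
    and closed: "\<And>U e. univ b U \<Longrightarrow> range e \<subseteq> U \<Longrightarrow> \<exists>x. Q x e \<Longrightarrow> \<exists>x\<in>U. Q x e"
  shows "dfn b (\<lambda>e. \<exists>x. Q x e)"
proof -
  obtain q c where q: "\<forall>U e. univ b U \<longrightarrow> range e \<subseteq> U \<longrightarrow> (Q (e 0) (\<lambda>k. e (Suc k)) \<longleftrightarrow> hold U q (join b e c))"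
    using assms unfolding dfn_def by blast
  obtain g where g: "\<forall>e x. join b (case_nat x e) c = case_nat x (join b e c) \<circ> g"
    using join_case by blast
  obtain q' where q': "\<forall>U (s :: nat \<Rightarrow> 'v). hold U q' s = hold U q (s \<circ> g)" using hold_rename by blast
  obtain n where n: "\<forall>U (s :: nat \<Rightarrow> 'v) s'. (\<forall>k<n. s k = s' k) \<longrightarrow> hold U q' s = hold U q' s'"
    using hold_support[of q'] by blast
  \<comment> \<open>Variable \<open>n\<close> plays the part of the bound variable 0 and the other
    indices move down by one. Overwriting \<open>n\<close> is harmless: it is read at index
    \<open>Suc n\<close>, beyond the support of \<open>q'\<close>.\<close>
  obtain r where r: "\<forall>U (s :: nat \<Rightarrow> 'v). hold U r s = hold U q' (s \<circ> case_nat n id)"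
    using hold_rename by blast
  have "(\<exists>x. Q x e) \<longleftrightarrow> hold U (FEx n r) (join b e c)" if U: "univ b U" "range e \<subseteq> U" for U e
  proof -
    have "Q x e \<longleftrightarrow> hold U r ((join b e c)(n := x))" if "x \<in> U" for x
    proof -
      have "range (case_nat x e) \<subseteq> U" using that U by (auto split: nat.splits simp: image_subset_iff)
      then have "Q x e \<longleftrightarrow> hold U q (join b (case_nat x e) c)" using q[rule_format, of U "case_nat x e"] U by simp
      also have "\<dots> \<longleftrightarrow> hold U q' (case_nat x (join b e c))" using g q' by simp
      also have "\<dots> \<longleftrightarrow> hold U q' ((join b e c)(n := x) \<circ> case_nat n id)"
        by (intro n[rule_format]) (auto split: nat.splits)
      finally show ?thesis using r by simp
    qed
    then show ?thesis using closed[OF U] by auto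
  qed
  then show ?thesis unfolding dfn_def by blast
qed

text \<open>Backward application of these rules decomposes a HOL term along its structure and so
  assembles the defining formula; a proof by \<open>intro dfn_intros\<close> is such a
  computation.\<close>

named_theorems dfn_intros

lemma dfn_ex_True [dfn_intros]:
  "dfn True (\<lambda>e. Q (e 0) (\<lambda>k. e (Suc k))) \<Longrightarrow> dfn True (\<lambda>e. \<exists>x. Q x e)"
  by (rule dfn_ex) auto

lemma dfn_cong: "dfn b P \<Longrightarrow> (\<And>e. P e \<longleftrightarrow> Q e) \<Longrightarrow> dfn b Q"
  by (subgoal_tac "P = Q") auto

lemma dfn_disj: "dfn b P \<Longrightarrow> dfn b Q \<Longrightarrow> dfn b (\<lambda>e. P e \<or> Q e)"
  by (rule dfn_cong[of b "\<lambda>e. \<not> (\<not> P e \<and> \<not> Q e)"], rule dfn_neg, rule dfn_conj, erule dfn_neg, erule dfn_neg) simp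

lemma dfn_imp: "dfn b P \<Longrightarrow> dfn b Q \<Longrightarrow> dfn b (\<lambda>e. P e \<longrightarrow> Q e)"
  by (rule dfn_cong[of b "\<lambda>e. \<not> P e \<or> Q e"], rule dfn_disj, erule dfn_neg) auto

lemma dfn_iff: "dfn b P \<Longrightarrow> dfn b Q \<Longrightarrow> dfn b (\<lambda>e. P e \<longleftrightarrow> Q e)"
  by (rule dfn_cong[of b "\<lambda>e. (P e \<longrightarrow> Q e) \<and> (Q e \<longrightarrow> P e)"], rule dfn_conj; (rule dfn_imp)?) auto

lemma dfn_all:
  assumes "dfn b (\<lambda>e. Q (e 0) (\<lambda>k. e (Suc k)))"
    and "\<And>U e. univ b U \<Longrightarrow> range e \<subseteq> U \<Longrightarrow> \<exists>x. \<not> Q x e \<Longrightarrow> \<exists>x\<in>U. \<not> Q x e"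
  shows "dfn b (\<lambda>e. \<forall>x. Q x e)"
  by (rule dfn_cong[of b "\<lambda>e. \<not> (\<exists>x. \<not> Q x e)"], rule dfn_neg, rule dfn_ex, rule dfn_neg, rule assms(1))
    (use assms(2) in auto)

lemma dfn_all_True [dfn_intros]:
  "dfn True (\<lambda>e. Q (e 0) (\<lambda>k. e (Suc k))) \<Longrightarrow> dfn True (\<lambda>e. \<forall>x. Q x e)"
  by (rule dfn_all) auto

lemma dfn_mem_var: "dfn b (\<lambda>e. e i \<epsilon> e j)"
  unfolding dfn_def
  by (rule exI[of _ "if b then FMem (2 * i) (2 * j) else FMem i j"]) (auto simp: join_def)

lemma dfn_eq_var: "dfn b (\<lambda>e. e i = e j)"
  unfolding dfn_def
  by (rule exI[of _ "if b then FEq (2 * i) (2 * j) else FEq i j"]) (auto simp: join_def)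

lemma dfn_eq_const: "dfn True (\<lambda>e. e i = c)"
  unfolding dfn_def
  by (rule exI[of _ "FEq (2 * i) 1"], rule exI[of _ "\<lambda>_. c"]) (auto simp: join_def)

lemma dfn_triv [dfn_intros]: "dfn b (\<lambda>e. Q)"
proof -
  have "dfn b (\<lambda>e :: nat \<Rightarrow> 'v::zfc. e 0 = e 0)" by (rule dfn_eq_var)
  then have "dfn b (\<lambda>e :: nat \<Rightarrow> 'v::zfc. True)" by simp
  with dfn_neg[OF this] show ?thesis by (cases Q) auto
qed

text \<open>The second conjunct keeps the value inside \<open>U\<close>, so that a term can be
  substituted as \<open>x = t\<close> under an existential quantifier over \<open>U\<close>.\<close>

definition dft :: "bool \<Rightarrow> ((nat \<Rightarrow> 'v::zfc) \<Rightarrow> 'v) \<Rightarrow> bool" where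
  "dft b t \<longleftrightarrow> dfn b (\<lambda>e. e 0 = t (\<lambda>k. e (Suc k))) \<and>
    (\<forall>U e. univ b U \<longrightarrow> range e \<subseteq> U \<longrightarrow> t e \<in> U)"

lemma dft_graph: "dft b t \<Longrightarrow> dfn b (\<lambda>e. e i = t (\<lambda>k. e (f k)))"
  using dfn_ren[of b "\<lambda>e. e 0 = t (\<lambda>k. e (Suc k))" "case_nat i f"] by (simp add: dft_def)

lemma dft_closed: "dft b t \<Longrightarrow> univ b U \<Longrightarrow> range e \<subseteq> U \<Longrightarrow> t e \<in> U"
  by (simp add: dft_def)

lemma dft_ren: "dft b t \<Longrightarrow> dft b (\<lambda>e. t (\<lambda>k. e (f k)))"
  unfolding dft_def[of b "\<lambda>e. t (\<lambda>k. e (f k))"]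
  using dft_graph[of b t 0 "\<lambda>k. Suc (f k)"] dft_closed[of b t] by (auto simp: image_subset_iff)

lemma dft_var [dfn_intros]: "dft b (\<lambda>e. e i)"
  unfolding dft_def using dfn_eq_var[of b 0 "Suc i"] by auto

lemma dft_const: "dft True (\<lambda>e. c)"
  unfolding dft_def using dfn_eq_const[of 0 c] by auto

section \<open>Substitution of definable terms\<close>

lemma dfn_subst:
  assumes "dfn b (\<lambda>e. Q (e 0) (\<lambda>k. e (Suc k)))" "dft b t"
  shows "dfn b (\<lambda>e. Q (t e) e)"
proof -
  have "dfn b (\<lambda>e. \<exists>x. x = t e \<and> Q x e)"
    by (rule dfn_ex, rule dfn_conj) (auto intro: assms dft_graph dft_closed)
  then show ?thesis by simp
qed

lemma dft_subst:
  assumes "dft b (\<lambda>e. f (e 0) (\<lambda>k. e (Suc k)))" "dft b t"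
  shows "dft b (\<lambda>e. f (t e) e)"
proof -
  have "dfn b (\<lambda>e. e 0 = f (t (\<lambda>k. e (Suc k))) (\<lambda>k. e (Suc k)))"
    by (rule dfn_subst[of b "\<lambda>x e. e 0 = f x (\<lambda>k. e (Suc k))"])
      (use dft_graph[OF assms(1), of 1 "case_nat 0 (\<lambda>k. Suc (Suc k))"] dft_ren[OF assms(2)] in auto)
  moreover have "f (t e) e \<in> U" if "univ b U" "range e \<subseteq> U" for U e
    using dft_closed[OF assms(1), of U "case_nat (t e) e"] dft_closed[OF assms(2) that] that
    by (auto split: nat.splits simp: image_subset_iff)
  ultimately show ?thesis by (simp add: dft_def)
qed

text \<open>Each notion is shown definable once, on the variables \<open>e 0\<close>,
  \<open>e 1\<close> and so on; these rules extend that to arbitrary terms, one argument at a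
  time.\<close>

lemma dfn_subst1:
  assumes "dfn b (\<lambda>e. P (e 0))" "dft b t"
  shows "dfn b (\<lambda>e. P (t e))"
  using dfn_subst[of b "\<lambda>x e. P x"] assms by simp

lemma dfn_subst2:
  assumes "dfn b (\<lambda>e. P (e 0) (e 1))" "dft b t" "dft b u"
  shows "dfn b (\<lambda>e. P (t e) (u e))"
proof (rule dfn_subst[where Q = "\<lambda>x e. P x (u e)", OF _ assms(2)],
    rule dfn_subst[where Q = "\<lambda>x e. P (e 0) x", OF _ dft_ren[OF assms(3)]])
  show "dfn b (\<lambda>e. P (e (Suc 0)) (e 0))"
    using dfn_ren[OF assms(1), of "case_nat 1 (\<lambda>_. 0)"] by simp
qed

lemma dfn_subst3:
  assumes "dfn b (\<lambda>e. P (e 0) (e 1) (e 2))" "dft b t" "dft b u" "dft b v"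
  shows "dfn b (\<lambda>e. P (t e) (u e) (v e))"
proof (rule dfn_subst[where Q = "\<lambda>x e. P x (u e) (v e)", OF _ assms(2)],
    rule dfn_subst[where Q = "\<lambda>x e. P (e 0) x (v (\<lambda>k. e (Suc k)))", OF _ dft_ren[OF assms(3)]],
    rule dfn_subst[where Q = "\<lambda>x e. P (e 1) (e 0) x", OF _ dft_ren[OF assms(4)], THEN dfn_cong])
  show "dfn b (\<lambda>e. P (e (Suc 1)) (e (Suc 0)) (e 0))"
    using dfn_ren[OF assms(1), of "case_nat 2 (case_nat 1 (\<lambda>_. 0))"] by (simp add: numeral_2_eq_2)
qed simp

lemma dfn_subst4:
  assumes "dfn b (\<lambda>e. P (e 0) (e 1) (e 2) (e 3))" "dft b t" "dft b u" "dft b v" "dft b w"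
  shows "dfn b (\<lambda>e. P (t e) (u e) (v e) (w e))"
proof (rule dfn_subst[where Q = "\<lambda>x e. P x (u e) (v e) (w e)", OF _ assms(2)],
    rule dfn_subst[where Q = "\<lambda>x e. P (e 0) x (v (\<lambda>k. e (Suc k))) (w (\<lambda>k. e (Suc k)))", OF _ dft_ren[OF assms(3)]],
    rule dfn_subst[where Q = "\<lambda>x e. P (e 1) (e 0) x (w (\<lambda>k. e (Suc (Suc k))))", OF _ dft_ren[OF assms(4)], THEN dfn_cong],
    rule dfn_subst[where Q = "\<lambda>x e. P (e 2) (e 1) (e 0) x", OF _ dft_ren[OF assms(5)], THEN dfn_cong])
  show "dfn b (\<lambda>e. P (e (Suc 2)) (e (Suc 1)) (e (Suc 0)) (e 0))"
    using dfn_ren[OF assms(1), of "case_nat 3 (case_nat 2 (case_nat 1 (\<lambda>_. 0)))"]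
    by (simp add: numeral_2_eq_2 numeral_3_eq_3)
qed (simp_all add: numeral_2_eq_2)

lemma dft_subst1:
  assumes "dft b (\<lambda>e. f (e 0))" "dft b t"
  shows "dft b (\<lambda>e. f (t e))"
  using dft_subst[of b "\<lambda>x e. f x"] assms by simp

lemma dft_subst2:
  assumes "dft b (\<lambda>e. f (e 0) (e 1))" "dft b t" "dft b u"
  shows "dft b (\<lambda>e. f (t e) (u e))"
proof (rule dft_subst[where f = "\<lambda>x e. f x (u e)", OF _ assms(2)],
    rule dft_subst[where f = "\<lambda>x e. f (e 0) x", OF _ dft_ren[OF assms(3)]])
  show "dft b (\<lambda>e. f (e (Suc 0)) (e 0))"
    using dft_ren[OF assms(1), of "case_nat 1 (\<lambda>_. 0)"] by simp
qed

lemma dft_cong: "dft b t \<Longrightarrow> (\<And>e. t e = u e) \<Longrightarrow> dft b u"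
  by (subgoal_tac "t = u") auto

lemma dft_subst3:
  assumes "dft b (\<lambda>e. f (e 0) (e 1) (e 2))" "dft b t" "dft b u" "dft b v"
  shows "dft b (\<lambda>e. f (t e) (u e) (v e))"
proof (rule dft_subst[where f = "\<lambda>x e. f x (u e) (v e)", OF _ assms(2)],
    rule dft_subst[where f = "\<lambda>x e. f (e 0) x (v (\<lambda>k. e (Suc k)))", OF _ dft_ren[OF assms(3)]],
    rule dft_subst[where f = "\<lambda>x e. f (e 1) (e 0) x", OF _ dft_ren[OF assms(4)], THEN dft_cong])
  show "dft b (\<lambda>e. f (e (Suc 1)) (e (Suc 0)) (e 0))"
    using dft_ren[OF assms(1), of "case_nat 2 (case_nat 1 (\<lambda>_. 0))"] by (simp add: numeral_2_eq_2)
qed simp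

lemmas dfn_mem = dfn_subst2[where P = "(\<epsilon>)", OF dfn_mem_var]
lemmas dfn_eq = dfn_subst2[where P = "(=)", OF dfn_eq_var]

lemma dfn_eq_bool [dfn_intros]: "dfn b (\<lambda>e. P e = Q e)" if "dfn b P" "dfn b Q"
  using that by (rule dfn_iff)

lemmas [dfn_intros] = dft_const dfn_mem dfn_eq dfn_neg dfn_conj dfn_disj dfn_imp

section \<open>Basic set theory\<close>

lemma in_elts [simp]: "z \<in> elts x \<longleftrightarrow> z \<epsilon> x"
  by (simp add: elts_def)

lemma set_ext: "(\<And>z. z \<epsilon> x \<longleftrightarrow> z \<epsilon> y) \<Longrightarrow> x = (y :: 'v::zfc)"
  using base_axioms by (auto simp: base_axioms_def ax_extensionality_def)

lemma elts_eq: "elts x = elts y \<longleftrightarrow> x = (y :: 'v::zfc)"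
  by (auto simp: set_eq_iff intro: set_ext)

definition small :: "'v::zfc set \<Rightarrow> bool" where
  "small A \<longleftrightarrow> (\<exists>x. elts x = A)"

lemma set_of_eqI: "elts x = A \<Longrightarrow> set_of A = x"
  unfolding set_of_def by (rule the_equality) (auto simp: elts_eq)

lemma elts_set_of: "small A \<Longrightarrow> elts (set_of A) = A"
  unfolding small_def by (auto simp: set_of_eqI)

lemma in_set_of: "small A \<Longrightarrow> x \<epsilon> set_of A \<longleftrightarrow> x \<in> A"
  using elts_set_of[of A] by (auto simp: set_eq_iff)

lemma foundation: "y \<epsilon> x \<Longrightarrow> \<exists>y :: 'v::zfc. y \<epsilon> x \<and> (\<forall>z. z \<epsilon> x \<longrightarrow> \<not> z \<epsilon> y)"
  using base_axioms by (auto simp: base_axioms_def ax_foundation_def)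

lemma pairing_ex: "\<exists>p :: 'v::zfc. \<forall>z. z \<epsilon> p \<longleftrightarrow> z = x \<or> z = y"
  using base_axioms[where 'a = 'v] by (simp add: base_axioms_def ax_pairing_def)

lemma union_ex: "\<exists>p :: 'v::zfc. \<forall>z. z \<epsilon> p \<longleftrightarrow> (\<exists>y. z \<epsilon> y \<and> y \<epsilon> x)"
  using base_axioms[where 'a = 'v] by (simp add: base_axioms_def ax_union_def)

lemma mem_irrefl [simp]: "\<not> x \<epsilon> (x :: 'v::zfc)"
proof -
  obtain p where "\<forall>z. z \<epsilon> p \<longleftrightarrow> z = x \<or> z = x"
    using pairing_ex[of x x] by (rule exE) 
  then show ?thesis using foundation[of x p] by auto
qed

lemma mem_asym: "x \<epsilon> y \<Longrightarrow> \<not> y \<epsilon> (x :: 'v::zfc)"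
proof -
  obtain p where "\<forall>z. z \<epsilon> p \<longleftrightarrow> z = x \<or> z = y"
    using pairing_ex[of x y] by (rule exE) 
  then show "x \<epsilon> y \<Longrightarrow> \<not> y \<epsilon> x" using foundation[of x p] by auto
qed

lemma small_Collect:
  assumes "dfn True (\<lambda>e. P (e 0))" and "\<And>z. P z \<Longrightarrow> z \<epsilon> x"
  shows "small {z :: 'v::zfc. P z}"
proof -
  obtain q c where q: "\<forall>e. P (e 0) \<longleftrightarrow> hold UNIV q (join True e c)"
    using assms(1) unfolding dfn_def by auto
  \<comment> \<open>Separation substitutes into variable 0 only. In a constant environment all even
    variables carry \<open>z\<close>, so they can be collapsed to 0, while the odd ones keep the
    parameters.\<close>
  obtain q' where q': "\<forall>U (s :: nat \<Rightarrow> 'v). hold U q' s = hold U q (s \<circ> (\<lambda>k. if even k then 0 else k))"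
    using hold_rename by blast
  have "P z \<longleftrightarrow> holds (\<epsilon>) q' ((\<lambda>k. c (k div 2))(0 := z))" for z
  proof -
    have "(\<lambda>k. c (k div 2))(0 := z) \<circ> (\<lambda>k. if even k then 0 else k) = join True (\<lambda>_. z) c"
      by (auto simp: join_def fun_eq_iff odd_pos)
    then show ?thesis using q[rule_format, of "\<lambda>_. z"] by (simp add: q' flip: hold_UNIV)
  qed
  then have "\<exists>y. \<forall>z. z \<epsilon> y \<longleftrightarrow> z \<epsilon> x \<and> P z"
    using separation_schema[of q' "\<lambda>k. c (k div 2)"] by (simp add: separation_for_def)
  then obtain y where "\<forall>z. z \<epsilon> y \<longleftrightarrow> z \<epsilon> x \<and> P z" by (rule exE)
  then have "elts y = {z. P z}" using assms(2) by auto
  then show ?thesis by (auto simp: small_def)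
qed

lemma small_replacement:
  assumes "dfn True (\<lambda>e. F (e 0) (e 1))" and ex1: "\<And>x. x \<epsilon> a \<Longrightarrow> \<exists>!y. F x y"
  shows "small {y :: 'v::zfc. \<exists>x. x \<epsilon> a \<and> F x y}"
proof -
  obtain q c where q: "\<forall>e. F (e 0) (e 1) \<longleftrightarrow> hold UNIV q (join True e c)"
    using assms(1) unfolding dfn_def by auto
  \<comment> \<open>\<open>x\<close> occupies variable 0, and all other arguments carry
    \<open>y\<close> and go to variable 1; the parameters move up by one from the odd positions to
    make room.\<close>
  let ?g = "\<lambda>k. if even k then (if k = 0 then 0 else 1) else k + 1"
  obtain q' where q': "\<forall>U (s :: nat \<Rightarrow> 'v). hold U q' s = hold U q (s \<circ> ?g)"
    using hold_rename by blast
  let ?s = "\<lambda>k. c ((k - 1) div 2)"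
  have "F x y \<longleftrightarrow> holds (\<epsilon>) q' (?s(0 := x, 1 := y))" for x y
  proof -
    have "?s(0 := x, 1 := y) \<circ> ?g = join True (case_nat x (\<lambda>_. y)) c"
    proof
      fix k show "(?s(0 := x, 1 := y) \<circ> ?g) k = join True (case_nat x (\<lambda>_. y)) c k"
      proof (cases "even k")
        case True
        then obtain m where "k = 2 * m" by (rule evenE)
        then show ?thesis by (cases m) (simp_all add: join_def)
      next
        case False
        then obtain m where "k = 2 * m + 1" by (rule oddE)
        then show ?thesis by (simp add: join_def)
      qed
    qed
    then show ?thesis using q[rule_format, of "case_nat x (\<lambda>_. y)"] by (simp add: q' flip: hold_UNIV)
  qed
  then obtain b where "\<forall>y. y \<epsilon> b \<longleftrightarrow> (\<exists>x. x \<epsilon> a \<and> F x y)"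
    using replacement_schema[of q' ?s] ex1 unfolding replacement_for_def by simp blast
  then have "elts b = {y. \<exists>x. x \<epsilon> a \<and> F x y}" by auto
  then show ?thesis by (auto simp: small_def)
qed

definition upair :: "'v::zfc \<Rightarrow> 'v \<Rightarrow> 'v" where
  "upair x y = set_of {x, y}"

definition sUn :: "'v::zfc \<Rightarrow> 'v" where
  "sUn x = set_of {z. \<exists>y. y \<epsilon> x \<and> z \<epsilon> y}"

definition un :: "'v::zfc \<Rightarrow> 'v \<Rightarrow> 'v" where
  "un x y = sUn (upair x y)"

lemma small_pair: "small {x, y :: 'v::zfc}"
  using pairing_ex[of x y] unfolding small_def by (rule ex_forward) (simp add: set_eq_iff)

lemma mem_upair [simp]: "z \<epsilon> upair x y \<longleftrightarrow> z = x \<or> z = y"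
  by (simp add: upair_def in_set_of small_pair)

lemma mem_sUn [simp]: "z \<epsilon> sUn x \<longleftrightarrow> (\<exists>y. y \<epsilon> x \<and> z \<epsilon> y)"
proof -
  have "small {z. \<exists>y. y \<epsilon> x \<and> z \<epsilon> y}"
    using union_ex[of x] unfolding small_def by (rule ex_forward) (simp add: set_eq_iff conj_commute)
  then show ?thesis by (simp add: sUn_def in_set_of)
qed

lemma mem_un [simp]: "z \<epsilon> un x y \<longleftrightarrow> z \<epsilon> x \<or> z \<epsilon> y"
  by (auto simp: un_def)

lemma small_empty: "small ({} :: 'v::zfc set)"
  using small_Collect[of "\<lambda>_. False" undefined, OF dfn_triv] by simp

lemma mem_empty [simp]: "\<not> z \<epsilon> empty"
  by (simp add: empty_def in_set_of small_empty)

lemma small_insert: "small (insert x (elts y))"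
proof -
  have "elts (un (upair x x) y) = insert x (elts y)" by auto
  then show ?thesis by (auto simp: small_def)
qed

lemma mem_succ [simp]: "z \<epsilon> succ x \<longleftrightarrow> z = x \<or> z \<epsilon> x"
  by (simp add: succ_def in_set_of small_insert)

lemma mem_pow [simp]: "z \<epsilon> pow x \<longleftrightarrow> elts z \<subseteq> elts x"
proof -
  have "\<exists>p. \<forall>y. y \<epsilon> p \<longleftrightarrow> (\<forall>z. z \<epsilon> y \<longrightarrow> z \<epsilon> x)"
    using base_axioms[where 'a = 'a] by (simp add: base_axioms_def ax_power_def)
  then have "small {y. elts y \<subseteq> elts x}"
    unfolding small_def by (rule ex_forward) (simp add: set_eq_iff subset_iff)
  then show ?thesis by (simp add: pow_def in_set_of)
qed

lemma empty_iff: "x = empty \<longleftrightarrow> (\<forall>z. \<not> z \<epsilon> x)"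
  by (auto intro: set_ext)

lemma opair_upair: "opair x y = upair (upair x x) (upair x y)"
  by (simp add: opair_def upair_def)

lemma upair_eq: "upair a b = upair c d \<longleftrightarrow> (a = c \<and> b = d) \<or> (a = d \<and> b = c)"
proof
  assume eq: "upair a b = upair c d"
  have "a \<epsilon> upair c d" "b \<epsilon> upair c d" by (simp_all flip: eq)
  moreover have "c \<epsilon> upair a b" "d \<epsilon> upair a b" by (simp_all add: eq)
  ultimately show "(a = c \<and> b = d) \<or> (a = d \<and> b = c)" unfolding mem_upair by argo
next
  assume "(a = c \<and> b = d) \<or> (a = d \<and> b = c)"
  then show "upair a b = upair c d"
    by (elim disjE conjE) (simp, intro set_ext, simp add: disj_commute)
qed

lemma opair_inject [simp]: "opair a b = opair c d \<longleftrightarrow> a = c \<and> b = (d :: 'v::zfc)"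
  unfolding opair_upair upair_eq by argo

section \<open>Closure of nice classes under the basic operations\<close>

lemmas nice_transitive = nice_def[THEN iffD1, THEN conjunct1, rule_format]
lemmas nice_subset = nice_def[THEN iffD1, THEN conjunct2, THEN conjunct1, rule_format]
lemmas nice_pair = nice_def[THEN iffD1, THEN conjunct2, THEN conjunct2, THEN conjunct1, rule_format]
lemmas nice_union = nice_def[THEN iffD1, THEN conjunct2, THEN conjunct2, THEN conjunct2, THEN conjunct1, rule_format]
lemmas nice_power = nice_def[THEN iffD1, THEN conjunct2, THEN conjunct2, THEN conjunct2, THEN conjunct2,
  THEN conjunct1, rule_format]
lemmas nice_closed_set = nice_def[THEN iffD1, THEN conjunct2, THEN conjunct2, THEN conjunct2, THEN conjunct2,
  THEN conjunct2]

lemma univ_False [simp]: "univ False U \<longleftrightarrow> nice U"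
  by (simp add: univ_def)

lemma univ_trans: "univ b U \<Longrightarrow> x \<in> U \<Longrightarrow> y \<epsilon> x \<Longrightarrow> y \<in> U"
  by (cases b) (simp_all add: nice_transitive)

lemma univ_sub: "univ b U \<Longrightarrow> x \<in> U \<Longrightarrow> (\<And>z. z \<epsilon> y \<Longrightarrow> z \<epsilon> x) \<Longrightarrow> y \<in> U"
  by (cases b) (simp_all add: nice_subset subset_iff)

text \<open>Here and for union and power set, niceness only promises a set that includes the
  intended one; closure under subsets trims it to the exact set.\<close>

lemma univ_upair: "univ b U \<Longrightarrow> x \<in> U \<Longrightarrow> y \<in> U \<Longrightarrow> upair x y \<in> U"
proof (cases b)
  case False
  assume U: "univ b U" "x \<in> U" "y \<in> U"
  then obtain p where "p \<in> U" "x \<epsilon> p" "y \<epsilon> p"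
    using False nice_pair[of U x y] by auto
  then show ?thesis by (auto intro: univ_sub[OF U(1) \<open>p \<in> U\<close>])
qed auto

lemma univ_sUn: "univ b U \<Longrightarrow> x \<in> U \<Longrightarrow> sUn x \<in> U"
proof (cases b)
  case False
  assume U: "univ b U" "x \<in> U"
  then obtain u where "u \<in> U" "\<forall>y\<in>U. y \<epsilon> x \<longrightarrow> (\<forall>z\<in>U. z \<epsilon> y \<longrightarrow> z \<epsilon> u)"
    using False nice_union[of U x] by auto
  moreover have "z \<in> U" if "z \<epsilon> y" "y \<epsilon> x" for z y
    using that U univ_trans by blast
  ultimately show ?thesis
    by (intro univ_sub[OF U(1) \<open>u \<in> U\<close>, of "sUn x"]) (use univ_trans[OF U] in auto)
qed auto

lemma univ_pow: "univ b U \<Longrightarrow> x \<in> U \<Longrightarrow> pow x \<in> U"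
proof (cases b)
  case False
  assume U: "univ b U" "x \<in> U"
  then obtain p where p: "p \<in> U" "\<forall>y\<in>U. (\<forall>z\<in>U. z \<epsilon> y \<longrightarrow> z \<epsilon> x) \<longrightarrow> y \<epsilon> p"
    using False nice_power[of U x] by auto
  have "z \<epsilon> p" if "z \<epsilon> pow x" for z
    using that p(2) univ_sub[OF U, of z] by (auto simp: subset_iff)
  then show ?thesis by (rule univ_sub[OF U(1) p(1)])
qed auto

lemma univ_un: "univ b U \<Longrightarrow> x \<in> U \<Longrightarrow> y \<in> U \<Longrightarrow> un x y \<in> U"
  by (simp add: un_def univ_sUn univ_upair)

lemma univ_opair: "univ b U \<Longrightarrow> x \<in> U \<Longrightarrow> y \<in> U \<Longrightarrow> opair x y \<in> U"
  by (simp add: opair_upair univ_upair)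

lemma univ_opairD: "univ b U \<Longrightarrow> opair x y \<in> U \<Longrightarrow> x \<in> U \<and> y \<in> U"
  unfolding opair_upair by (meson mem_upair univ_trans)

lemma univ_ex_mem: "univ b U \<Longrightarrow> \<exists>x. x \<in> U"
  using nice_closed_set[of U] by (cases b) auto

lemma univ_empty: "univ b U \<Longrightarrow> empty \<in> U"
  using univ_ex_mem univ_sub by (metis mem_empty)

lemma univ_succ: "univ b U \<Longrightarrow> x \<in> U \<Longrightarrow> succ x \<in> U"
  by (rule univ_sub[of b U "un x (upair x x)"]) (auto intro: univ_un univ_upair)

named_theorems univ_intros
lemmas [univ_intros] = univ_upair univ_sUn univ_pow univ_un univ_opair univ_empty univ_succ

lemma dfn_bex [dfn_intros]:
  assumes "dfn b (\<lambda>e. Q (e 0) (\<lambda>k. e (Suc k)))" "dft b t"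
  shows "dfn b (\<lambda>e. \<exists>x\<in>elts (t e). Q x e)"
  unfolding Bex_def in_elts
  by (rule dfn_ex, rule dfn_conj, rule dfn_mem[OF dft_var dft_ren[OF assms(2)]], rule assms(1))
    (use univ_trans dft_closed[OF assms(2)] in blast)

lemma dfn_ball [dfn_intros]:
  assumes "dfn b (\<lambda>e. Q (e 0) (\<lambda>k. e (Suc k)))" "dft b t"
  shows "dfn b (\<lambda>e. \<forall>x\<in>elts (t e). Q x e)"
  unfolding Ball_def in_elts
  by (rule dfn_all, rule dfn_imp, rule dfn_mem[OF dft_var dft_ren[OF assms(2)]], rule assms(1))
    (use univ_trans dft_closed[OF assms(2)] in blast)

lemma dfn_bex_mem [dfn_intros]:
  assumes "dfn b (\<lambda>e. Q (e 0) (\<lambda>k. e (Suc k)))" "dft b t"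
  shows "dfn b (\<lambda>e. \<exists>x. x \<epsilon> t e \<and> Q x e)"
  using dfn_bex[of b Q t] assms by (simp add: Bex_def)

lemma dfn_ball_mem [dfn_intros]:
  assumes "dfn b (\<lambda>e. Q (e 0) (\<lambda>k. e (Suc k)))" "dft b t"
  shows "dfn b (\<lambda>e. \<forall>x. x \<epsilon> t e \<longrightarrow> Q x e)"
  using dfn_ball[of b Q t] assms by (simp add: Ball_def)

lemma dfn_subset [dfn_intros]:
  assumes "dft b t" "dft b u" shows "dfn b (\<lambda>e. elts (t e) \<subseteq> elts (u e))"
  unfolding subset_iff in_elts
  by (rule dfn_ball_mem, rule dfn_mem[OF dft_var dft_ren[OF assms(2)]]) (rule assms)

text \<open>By extensionality \<open>e 0 = t\<close> becomes a condition on all \<open>z\<close>. A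
  \<open>z\<close> on which the two sides differ is an element of one of two members of
  \<open>U\<close>, so searching \<open>U\<close> is enough.\<close>

lemma dft_setI:
  assumes "\<And>z e. z \<epsilon> t e \<longleftrightarrow> A z e" "dfn b (\<lambda>e. A (e 0) (\<lambda>k. e (Suc k)))"
    and "\<And>U e. univ b U \<Longrightarrow> range e \<subseteq> U \<Longrightarrow> t e \<in> U"
  shows "dft b t"
proof -
  have "dfn b (\<lambda>e. \<forall>z. z \<epsilon> e 0 \<longleftrightarrow> A z (\<lambda>k. e (Suc k)))"
  proof (rule dfn_all, rule dfn_iff)
    show "dfn b (\<lambda>e. e 0 \<epsilon> e (Suc 0))" by (rule dfn_mem_var)
    show "dfn b (\<lambda>e. A (e 0) (\<lambda>k. e (Suc (Suc k))))"
      using dfn_ren[OF assms(2), of "case_nat 0 (\<lambda>k. Suc (Suc k))"] by simp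
    fix U and e :: "nat \<Rightarrow> 'a" assume U: "univ b U" "range e \<subseteq> U"
    then have "range (\<lambda>k. e (Suc k)) \<subseteq> U" by auto
    then have "t (\<lambda>k. e (Suc k)) \<in> U" using assms(3) U by blast
    then show "\<exists>x. (x \<epsilon> e 0) \<noteq> A x (\<lambda>k. e (Suc k)) \<Longrightarrow> \<exists>x\<in>U. (x \<epsilon> e 0) \<noteq> A x (\<lambda>k. e (Suc k))"
      using U univ_trans[OF U(1)] assms(1)[of _ "\<lambda>k. e (Suc k)"] by (auto simp: image_subset_iff)
  qed
  then have "dfn b (\<lambda>e. e 0 = t (\<lambda>k. e (Suc k)))"
    by (rule dfn_cong) (use assms(1) in \<open>auto intro: set_ext\<close>)
  then show ?thesis using assms(3) by (simp add: dft_def)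
qed

lemma comprehension:
  assumes "dfn True (\<lambda>e. P (e 0))" "\<And>z. P z \<Longrightarrow> z \<epsilon> x"
  shows "\<exists>y. \<forall>z. z \<epsilon> y \<longleftrightarrow> P z"
  using small_Collect[OF assms] by (intro exI[of _ "set_of {z. P z}"]) (simp add: in_set_of)

lemma range_mem: "range e \<subseteq> U \<Longrightarrow> e k \<in> U"
  by auto

lemma upair_d0: "dft b (\<lambda>e. upair (e 0) (e 1))"
  by (rule dft_setI, rule mem_upair, intro dfn_intros) (auto intro!: univ_intros)
lemmas [dfn_intros] = dft_subst2[where f = upair, OF upair_d0]

lemma sUn_d0: "dft b (\<lambda>e. sUn (e 0))"
  by (rule dft_setI, rule mem_sUn, intro dfn_intros) (auto intro!: univ_intros)
lemmas [dfn_intros] = dft_subst1[where f = sUn, OF sUn_d0]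

lemma un_d0: "dft b (\<lambda>e. un (e 0) (e 1))"
  unfolding un_def by (intro dfn_intros)
lemmas [dfn_intros] = dft_subst2[where f = un, OF un_d0]

lemma pow_d0: "dft b (\<lambda>e. pow (e 0))"
  by (rule dft_setI, rule mem_pow, intro dfn_intros) (auto intro!: univ_intros)
lemmas [dfn_intros] = dft_subst1[where f = pow, OF pow_d0]

lemma empty_dft [dfn_intros]: "dft b (\<lambda>e. empty)"
proof (rule dft_setI)
  show "z \<epsilon> empty \<longleftrightarrow> (\<lambda>_ _. False) z e" for z and e :: "nat \<Rightarrow> 'a" by simp
qed (auto intro: dfn_triv univ_intros)

lemma succ_d0: "dft b (\<lambda>e. succ (e 0))"
  by (rule dft_setI, rule mem_succ, intro dfn_intros) (auto intro!: univ_intros)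
lemmas [dfn_intros] = dft_subst1[where f = succ, OF succ_d0]

lemma opair_d0: "dft b (\<lambda>e. opair (e 0) (e 1))"
  unfolding opair_upair by (intro dfn_intros)
lemmas [dfn_intros] = dft_subst2[where f = opair, OF opair_d0]

lemma numeral_set_dft [dfn_intros]: "dft b (\<lambda>e. numeral_set n)"
  by (induction n) (auto intro: dfn_intros)

subsection \<open>Relations and functions\<close>

lemma opair_in_pow: "x \<epsilon> c \<Longrightarrow> y \<epsilon> c \<Longrightarrow> opair x y \<epsilon> pow (pow c)"
  by (auto simp: opair_upair)

lemma mem_cprod: "z \<epsilon> cprod a b \<longleftrightarrow> (\<exists>x. x \<epsilon> a \<and> (\<exists>y. y \<epsilon> b \<and> z = opair x y))"
proof -
  have "small {z. \<exists>x. x \<epsilon> a \<and> (\<exists>y. y \<epsilon> b \<and> z = opair x y)}"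
    by (rule small_Collect[of _ "pow (pow (un a b))"], intro dfn_intros)
      (elim exE conjE, hypsubst, rule opair_in_pow, simp_all)
  moreover have "{opair x y |x y. x \<epsilon> a \<and> y \<epsilon> b} = {z. \<exists>x. x \<epsilon> a \<and> (\<exists>y. y \<epsilon> b \<and> z = opair x y)}"
    by blast
  ultimately show ?thesis by (simp add: cprod_def in_set_of)
qed

lemma opair_in_cprod [simp]: "opair x y \<epsilon> cprod a b \<longleftrightarrow> x \<epsilon> a \<and> y \<epsilon> b"
  by (auto simp: mem_cprod)

lemma univ_cprod [univ_intros]: "univ b U \<Longrightarrow> x \<in> U \<Longrightarrow> y \<in> U \<Longrightarrow> cprod x y \<in> U"
proof -
  assume U: "univ b U" "x \<in> U" "y \<in> U"
  have "pow (pow (un x y)) \<in> U" using U by (intro univ_intros)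
  moreover have "z \<epsilon> pow (pow (un x y))" if "z \<epsilon> cprod x y" for z
    using that unfolding mem_cprod by (elim exE conjE, hypsubst) (rule opair_in_pow; simp)
  ultimately show ?thesis by (rule univ_sub[OF U(1)])
qed

lemma cprod_d0: "dft b (\<lambda>e. cprod (e 0) (e 1))"
  by (rule dft_setI, rule mem_cprod, intro dfn_intros) (auto intro!: univ_intros)
lemmas [dfn_intros] = dft_subst2[where f = cprod, OF cprod_d0]

text \<open>\<open>app\<close> is a definite description with an unknown value where no unique one
  exists, so it cannot be shown to be a definable operation. The default \<open>empty\<close> makes
  \<open>ap\<close> one, and both agree wherever the value is unique.\<close>

definition ap :: "'v::zfc \<Rightarrow> 'v \<Rightarrow> 'v" where
  "ap f x = (if \<exists>!y. opair x y \<epsilon> f then app f x else empty)"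

lemma app_eqI: "opair x y \<epsilon> f \<Longrightarrow> (\<And>y'. opair x y' \<epsilon> f \<Longrightarrow> y' = y) \<Longrightarrow> app f x = y"
  unfolding app_def by (rule the_equality)

lemma ap_app: "\<exists>!y. opair x y \<epsilon> f \<Longrightarrow> app f x = ap f x"
  by (simp add: ap_def)

lemma ap_eqI:
  assumes "opair x y \<epsilon> f" "\<And>y'. opair x y' \<epsilon> f \<Longrightarrow> y' = y"
  shows "ap f x = y"
proof -
  have "\<exists>!y. opair x y \<epsilon> f" using assms by (rule ex1I)
  then show ?thesis using ap_app app_eqI[OF assms] by metis
qed

lemma mem_ap: "z \<epsilon> ap f x \<longleftrightarrow> (\<exists>y. opair x y \<epsilon> f \<and> (\<forall>y'. opair x y' \<epsilon> f \<longrightarrow> y' = y) \<and> z \<epsilon> y)"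
proof (cases "\<exists>!y. opair x y \<epsilon> f")
  case True
  then obtain y where y: "opair x y \<epsilon> f" "\<And>y'. opair x y' \<epsilon> f \<Longrightarrow> y' = y" by blast
  then have "ap f x = y" by (rule ap_eqI)
  with y show ?thesis by blast
next
  case False
  then have "ap f x = empty" by (simp add: ap_def)
  with False show ?thesis by auto
qed

lemma univ_ap: "univ b U \<Longrightarrow> f \<in> U \<Longrightarrow> ap f x \<in> U"
proof (cases "\<exists>!y. opair x y \<epsilon> f")
  case True
  assume U: "univ b U" "f \<in> U"
  obtain y where y: "opair x y \<epsilon> f" "\<And>y'. opair x y' \<epsilon> f \<Longrightarrow> y' = y" using True by blast
  then have "ap f x = y" by (rule ap_eqI)
  with y U show ?thesis using univ_trans univ_opairD by metis
qed (simp add: ap_def univ_empty)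

text \<open>Bounds the components of the pairs in \<open>f\<close>, so that quantifiers over them
  become bounded.\<close>

lemma opair_sUn: "opair x y \<epsilon> f \<Longrightarrow> x \<epsilon> sUn (sUn f) \<and> y \<epsilon> sUn (sUn f)"
proof -
  assume "opair x y \<epsilon> f"
  moreover have "upair x y \<epsilon> opair x y" "x \<epsilon> upair x y" "y \<epsilon> upair x y" by (simp_all add: opair_upair)
  ultimately show ?thesis unfolding mem_sUn by blast
qed

lemma ap_d0: "dft b (\<lambda>e. ap (e 0) (e 1))"
proof (rule dft_setI)
  show "z \<epsilon> ap (e 0) (e 1) \<longleftrightarrow> (\<lambda>z e. \<exists>y. y \<epsilon> sUn (sUn (e 0)) \<and> opair (e 1) y \<epsilon> e 0 \<and>
      (\<forall>y'. y' \<epsilon> sUn (sUn (e 0)) \<longrightarrow> opair (e 1) y' \<epsilon> e 0 \<longrightarrow> y' = y) \<and> z \<epsilon> y) z e" for z and e :: "nat \<Rightarrow> 'a"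
    unfolding mem_ap using opair_sUn[of "e 1" _ "e 0"] by blast
qed (intro dfn_intros, rule univ_ap, assumption, erule range_mem)
lemmas [dfn_intros] = dft_subst2[where f = ap, OF ap_d0]

lemma fun_onD: "fun_on f d \<Longrightarrow> p \<epsilon> f \<Longrightarrow> \<exists>x. x \<epsilon> d \<and> p = opair x (ap f x)"
  unfolding fun_on_def in_elts by (metis (no_types, lifting) ap_eqI in_elts opair_inject)

lemma fun_on_ap: "fun_on f d \<Longrightarrow> x \<epsilon> d \<Longrightarrow> opair x y \<epsilon> f \<longleftrightarrow> y = ap f x"
  unfolding fun_on_def by (metis ap_eqI in_elts)

lemma fun_on_app: "fun_on f d \<Longrightarrow> x \<epsilon> d \<Longrightarrow> app f x = ap f x"
  unfolding fun_on_def by (simp add: ap_app)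

text \<open>Expressing values by \<open>ap\<close> removes the unbounded quantifiers over them; only
  quantifiers over elements of \<open>f\<close> and \<open>d\<close> remain.\<close>

lemma fun_on_iff: "fun_on f d \<longleftrightarrow> (\<forall>p. p \<epsilon> f \<longrightarrow> (\<exists>x. x \<epsilon> d \<and> p = opair x (ap f x))) \<and>
    (\<forall>x. x \<epsilon> d \<longrightarrow> opair x (ap f x) \<epsilon> f)"
proof
  assume "fun_on f d"
  then show "(\<forall>p. p \<epsilon> f \<longrightarrow> (\<exists>x. x \<epsilon> d \<and> p = opair x (ap f x))) \<and> (\<forall>x. x \<epsilon> d \<longrightarrow> opair x (ap f x) \<epsilon> f)"
    using fun_onD fun_on_ap by blast
next
  assume *: "(\<forall>p. p \<epsilon> f \<longrightarrow> (\<exists>x. x \<epsilon> d \<and> p = opair x (ap f x))) \<and> (\<forall>x. x \<epsilon> d \<longrightarrow> opair x (ap f x) \<epsilon> f)"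
  then have "\<exists>!y. opair x y \<epsilon> f" if "x \<epsilon> d" for x
    using that by (metis opair_inject)
  with * show "fun_on f d" unfolding fun_on_def by auto
qed

lemma fun_on_d0: "dfn b (\<lambda>e. fun_on (e 0) (e 1))"
  unfolding fun_on_iff by (intro dfn_intros)
lemmas [dfn_intros] = dfn_subst2[where P = fun_on, OF fun_on_d0]

lemma fun_onI:
  assumes "\<And>p. p \<epsilon> f \<Longrightarrow> \<exists>x y. x \<epsilon> d \<and> p = opair x y" "\<And>x. x \<epsilon> d \<Longrightarrow> \<exists>y. opair x y \<epsilon> f"
    "\<And>x y y'. opair x y \<epsilon> f \<Longrightarrow> opair x y' \<epsilon> f \<Longrightarrow> y = y'"
  shows "fun_on f d"
  unfolding fun_on_def using assms by (metis in_elts)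

lemma maps_iff: "maps f a b \<longleftrightarrow> fun_on f a \<and> (\<forall>x. x \<epsilon> a \<longrightarrow> ap f x \<epsilon> b)"
  unfolding maps_def by (auto simp: fun_on_app)

lemma maps_d0: "dfn b (\<lambda>e. maps (e 0) (e 1) (e 2))"
  unfolding maps_iff by (intro dfn_intros)
lemmas [dfn_intros] = dfn_subst3[where P = maps, OF maps_d0]

lemma maps_sub: "maps f a b \<Longrightarrow> p \<epsilon> f \<Longrightarrow> p \<epsilon> cprod a b"
  unfolding maps_iff using fun_onD by fastforce

text \<open>A function is a subset of a product, and \<open>U\<close> has products and subsets. For
  this reason quantifiers over functions, and with them cardinality and inaccessibility, are
  absolute for nice classes.\<close>

lemma univ_maps: "univ c U \<Longrightarrow> maps f a b \<Longrightarrow> a \<in> U \<Longrightarrow> b \<in> U \<Longrightarrow> f \<in> U"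
  by (rule univ_sub[of c U "cprod a b"]) (auto intro: univ_intros maps_sub)

lemma injects_iff: "injects f a b \<longleftrightarrow> maps f a b \<and> (\<forall>x. x \<epsilon> a \<longrightarrow> (\<forall>y. y \<epsilon> a \<longrightarrow> ap f x = ap f y \<longrightarrow> x = y))"
  unfolding injects_def maps_def by (auto simp: fun_on_app)

lemma injects_d0: "dfn b (\<lambda>e. injects (e 0) (e 1) (e 2))"
  unfolding injects_iff by (intro dfn_intros)
lemmas [dfn_intros] = dfn_subst3[where P = injects, OF injects_d0]

lemma bijects_iff: "bijects f a b \<longleftrightarrow> injects f a b \<and> (\<forall>y. y \<epsilon> b \<longrightarrow> (\<exists>x. x \<epsilon> a \<and> ap f x = y))"
proof (cases "fun_on f a")
  case True
  then have "(\<exists>x\<in>elts a. app f x = y) \<longleftrightarrow> (\<exists>x. x \<epsilon> a \<and> ap f x = y)" for y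
    using fun_on_app by (metis in_elts)
  then show ?thesis unfolding bijects_def by (simp add: Ball_def)
qed (simp add: bijects_def injects_def maps_def)

lemma bijects_d0: "dfn b (\<lambda>e. bijects (e 0) (e 1) (e 2))"
  unfolding bijects_iff by (intro dfn_intros)
lemmas [dfn_intros] = dfn_subst3[where P = bijects, OF bijects_d0]

lemma dfn_ex_injects [dfn_intros]:
  assumes "dft b t" "dft b u" shows "dfn b (\<lambda>e. \<exists>f. injects f (t e) (u e))"
proof (rule dfn_ex)
  fix U and e :: "nat \<Rightarrow> 'a" assume U: "univ b U" "range e \<subseteq> U" and "\<exists>f. injects f (t e) (u e)"
  then obtain f where "injects f (t e) (u e)" by blast
  moreover from this have "f \<in> U"
    using univ_maps[OF U(1), of f] dft_closed[OF assms(1) U] dft_closed[OF assms(2) U]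
    unfolding injects_iff by metis
  ultimately show "\<exists>f\<in>U. injects f (t e) (u e)" by blast
qed (intro dfn_intros dft_ren[OF assms(1)] dft_ren[OF assms(2)])

lemma dfn_ex_bijects [dfn_intros]:
  assumes "dft b t" "dft b u" shows "dfn b (\<lambda>e. \<exists>f. bijects f (t e) (u e))"
proof (rule dfn_ex)
  fix U and e :: "nat \<Rightarrow> 'a" assume U: "univ b U" "range e \<subseteq> U" and "\<exists>f. bijects f (t e) (u e)"
  then obtain f where "bijects f (t e) (u e)" by blast
  moreover from this have "f \<in> U"
    using univ_maps[OF U(1), of f] dft_closed[OF assms(1) U] dft_closed[OF assms(2) U]
    unfolding bijects_iff injects_iff by metis
  ultimately show "\<exists>f\<in>U. bijects f (t e) (u e)" by blast
qed (intro dfn_intros dft_ren[OF assms(1)] dft_ren[OF assms(2)])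

section \<open>Functions given by definable operations\<close>

definition lam :: "'v::zfc \<Rightarrow> ('v \<Rightarrow> 'v) \<Rightarrow> 'v" where
  "lam d F = set_of {z. \<exists>x. x \<epsilon> d \<and> z = opair x (F x)}"

definition rep :: "('v::zfc \<Rightarrow> 'v) \<Rightarrow> 'v \<Rightarrow> 'v" where
  "rep F d = set_of {z. \<exists>x. x \<epsilon> d \<and> z = F x}"

lemma mem_rep:
  assumes "dft True (\<lambda>e. F (e 0))"
  shows "z \<epsilon> rep F d \<longleftrightarrow> (\<exists>x. x \<epsilon> d \<and> z = F x)"
proof -
  have "small {z. \<exists>x. x \<epsilon> d \<and> z = F x}"
    by (rule small_replacement, rule dfn_eq[OF dft_var], rule dft_ren[OF assms, of "\<lambda>_. 0"]) simp
  then show ?thesis by (simp add: rep_def in_set_of)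
qed

lemma mem_lam:
  assumes "dft True (\<lambda>e. F (e 0))"
  shows "z \<epsilon> lam d F \<longleftrightarrow> (\<exists>x. x \<epsilon> d \<and> z = opair x (F x))"
  using mem_rep[of "\<lambda>x. opair x (F x)" z d] dfn_intros(1)
  unfolding lam_def rep_def by (simp add: assms dft_subst2[where f = opair, OF opair_d0] dft_var)

lemma fun_on_lam: "dft True (\<lambda>e. F (e 0)) \<Longrightarrow> fun_on (lam d F) d"
  by (rule fun_onI) (auto simp: mem_lam)

lemma ap_lam: "dft True (\<lambda>e. F (e 0)) \<Longrightarrow> x \<epsilon> d \<Longrightarrow> ap (lam d F) x = F x"
  by (rule ap_eqI) (auto simp: mem_lam)

definition imgf :: "'v::zfc \<Rightarrow> 'v \<Rightarrow> 'v" where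
  "imgf f d = rep (ap f) d"

lemma mem_imgf [simp]: "z \<epsilon> imgf f d \<longleftrightarrow> (\<exists>x. x \<epsilon> d \<and> z = ap f x)"
  unfolding imgf_def by (rule mem_rep) (intro dfn_intros)

text \<open>The singleton of \<open>empty\<close> accounts for the default value of
  \<open>ap\<close>.\<close>

lemma ap_bound: "ap f x \<epsilon> un (upair empty empty) (sUn (sUn f))"
proof (cases "\<exists>!y. opair x y \<epsilon> f")
  case True
  then obtain y where y: "opair x y \<epsilon> f" "\<And>y'. opair x y' \<epsilon> f \<Longrightarrow> y' = y" by blast
  then have "ap f x = y" by (rule ap_eqI)
  moreover have "y \<epsilon> upair x y" "upair x y \<epsilon> opair x y" by (simp_all add: opair_upair)
  ultimately show ?thesis using y(1) by auto
qed (simp add: ap_def)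

lemma imgf_d0: "dft b (\<lambda>e. imgf (e 0) (e 1))"
proof (rule dft_setI, rule mem_imgf, intro dfn_intros)
  fix U and e :: "nat \<Rightarrow> 'a" assume "univ b U" "range e \<subseteq> U"
  then show "imgf (e 0) (e 1) \<in> U"
    by (intro univ_sub[of b U "un (upair empty empty) (sUn (sUn (e 0)))" "imgf (e 0) (e 1)"] univ_intros)
      (auto simp only: mem_imgf ap_bound)
qed
lemmas [dfn_intros] = dft_subst2[where f = imgf, OF imgf_d0]

lemma mem_upd: "z \<epsilon> upd f i x \<longleftrightarrow> z = opair i x \<or> (z \<epsilon> f \<and> \<not> (\<exists>y. z = opair i y))"
proof -
  have "small {p. p \<epsilon> f \<and> \<not> (\<exists>y. p = opair i y)}"
    by (rule small_Collect, intro dfn_intros) auto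
  then obtain g where g: "elts g = {p. p \<epsilon> f \<and> \<not> (\<exists>y. p = opair i y)}"
    unfolding small_def by blast
  have "{p \<in> elts f. \<not> (\<exists>y. p = opair i y)} = elts g" unfolding g by simp
  then show ?thesis unfolding upd_def by (simp add: in_set_of small_insert) (simp add: g flip: in_elts)
qed

lemma upd_d0: "dft b (\<lambda>e. upd (e 0) (e 1) (e 2))"
proof (rule dft_setI, rule mem_upd, intro dfn_disj dfn_conj dfn_neg)
  show "dfn b (\<lambda>e. \<exists>y. e 0 = opair (e (Suc 1)) y)"
    by (rule dfn_ex, intro dfn_intros) (metis range_mem univ_opairD)
next
  fix U and e :: "nat \<Rightarrow> 'a" assume "univ b U" "range e \<subseteq> U"
  then show "upd (e 0) (e 1) (e 2) \<in> U"
    by (intro univ_sub[of b U "un (e 0) (upair (opair (e 1) (e 2)) (opair (e 1) (e 2)))" "upd (e 0) (e 1) (e 2)"] univ_intros)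
      (auto simp: mem_upd)
qed (intro dfn_intros)+
lemmas [dfn_intros] = dft_subst3[where f = upd, OF upd_d0]

lemma fun_on_upd: "fun_on f d \<Longrightarrow> i \<epsilon> d \<Longrightarrow> fun_on (upd f i x) d"
proof (rule fun_onI)
  assume f: "fun_on f d" and i: "i \<epsilon> d"
  show "\<exists>x' y. x' \<epsilon> d \<and> p = opair x' y" if "p \<epsilon> upd f i x" for p
    using that i fun_onD[OF f, of p] unfolding mem_upd by metis
  show "\<exists>y. opair k y \<epsilon> upd f i x" if "k \<epsilon> d" for k
    using that fun_on_ap[OF f that] unfolding mem_upd opair_inject by metis
  show "y = y'" if y: "opair k y \<epsilon> upd f i x" "opair k y' \<epsilon> upd f i x" for k y y'
  proof (cases "k = i")
    case True
    with y show ?thesis by (simp add: mem_upd)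
  next
    case False
    with y have *: "opair k y \<epsilon> f" "opair k y' \<epsilon> f" by (simp_all add: mem_upd)
    moreover have "k \<epsilon> d" using fun_onD[OF f *(1)] by auto
    ultimately show ?thesis using fun_on_ap[OF f, of k] by metis
  qed
qed

lemma ap_upd:
  assumes "fun_on f d" "k \<epsilon> d"
  shows "ap (upd f i x) k = (if k = i then x else ap f k)"
proof (rule ap_eqI)
  show "opair k (if k = i then x else ap f k) \<epsilon> upd f i x"
    using fun_on_ap[OF assms] by (simp add: mem_upd)
  show "y = (if k = i then x else ap f k)" if "opair k y \<epsilon> upd f i x" for y
    using that fun_on_ap[OF assms] unfolding mem_upd opair_inject by metis
qed

lemma maps_upd: "maps s d t \<Longrightarrow> i \<epsilon> d \<Longrightarrow> x \<epsilon> t \<Longrightarrow> maps (upd s i x) d t"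
  by (auto simp: maps_iff fun_on_upd ap_upd)

lemma mem_mem_rel: "z \<epsilon> mem_rel a \<longleftrightarrow> (\<exists>x. x \<epsilon> a \<and> (\<exists>y. y \<epsilon> a \<and> x \<epsilon> y \<and> z = opair x y))"
proof -
  have "small {z. \<exists>x. x \<epsilon> a \<and> (\<exists>y. y \<epsilon> a \<and> x \<epsilon> y \<and> z = opair x y)}"
    by (rule small_Collect[of _ "cprod a a"], intro dfn_intros) auto
  moreover have "{opair x y |x y. x \<epsilon> a \<and> y \<epsilon> a \<and> x \<epsilon> y} = {z. \<exists>x. x \<epsilon> a \<and> (\<exists>y. y \<epsilon> a \<and> x \<epsilon> y \<and> z = opair x y)}"
    by blast
  ultimately show ?thesis by (simp add: mem_rel_def in_set_of)
qed

lemma opair_mem_rel [simp]: "opair x y \<epsilon> mem_rel a \<longleftrightarrow> x \<epsilon> a \<and> y \<epsilon> a \<and> x \<epsilon> y"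
  by (auto simp: mem_mem_rel)

lemma mem_rel_d0: "dft b (\<lambda>e. mem_rel (e 0))"
proof (rule dft_setI, rule mem_mem_rel, intro dfn_intros)
  fix U and e :: "nat \<Rightarrow> 'a" assume "univ b U" "range e \<subseteq> U"
  then show "mem_rel (e 0) \<in> U"
    by (intro univ_sub[of b U "cprod (e 0) (e 0)" "mem_rel (e 0)"] univ_intros) (auto simp: mem_mem_rel)
qed
lemmas [dfn_intros] = dft_subst1[where f = mem_rel, OF mem_rel_d0]

definition dif :: "'v::zfc \<Rightarrow> 'v \<Rightarrow> 'v" where
  "dif x y = set_of (elts x - elts y)"

lemma mem_dif [simp]: "z \<epsilon> dif x y \<longleftrightarrow> z \<epsilon> x \<and> \<not> z \<epsilon> y"
proof -
  have "small {z. z \<epsilon> x \<and> \<not> z \<epsilon> y}" by (rule small_Collect, intro dfn_intros) auto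
  moreover have "elts x - elts y = {z. z \<epsilon> x \<and> \<not> z \<epsilon> y}" by auto
  ultimately show ?thesis by (simp add: dif_def in_set_of)
qed

lemma dif_d0: "dft b (\<lambda>e. dif (e 0) (e 1))"
proof (rule dft_setI, rule mem_dif, intro dfn_intros)
  fix U and e :: "nat \<Rightarrow> 'a" assume "univ b U" "range e \<subseteq> U"
  then show "dif (e 0) (e 1) \<in> U"
    by (intro univ_sub[of b U "e 0" "dif (e 0) (e 1)"]) auto
qed
lemmas [dfn_intros] = dft_subst2[where f = dif, OF dif_d0]

section \<open>Ordinals\<close>

lemma transitive_d0: "dfn b (\<lambda>e. transitive_set (e 0))"
  unfolding transitive_set_def by (intro dfn_intros)
lemmas [dfn_intros] = dfn_subst1[where P = transitive_set, OF transitive_d0]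

lemma ordinal_d0: "dfn b (\<lambda>e. ordinal (e 0))"
  unfolding ordinal_def by (intro dfn_intros)
lemmas [dfn_intros] = dfn_subst1[where P = ordinal, OF ordinal_d0]

lemma transitive_setD: "transitive_set x \<Longrightarrow> y \<epsilon> x \<Longrightarrow> z \<epsilon> y \<Longrightarrow> z \<epsilon> x"
  by (auto simp: transitive_set_def subset_iff)

lemma ordinal_trans: "ordinal \<alpha> \<Longrightarrow> y \<epsilon> \<alpha> \<Longrightarrow> z \<epsilon> y \<Longrightarrow> z \<epsilon> \<alpha>"
  using transitive_setD ordinal_def by blast

lemma ordinal_elt: "ordinal \<alpha> \<Longrightarrow> \<beta> \<epsilon> \<alpha> \<Longrightarrow> ordinal \<beta>"
  unfolding ordinal_def by (metis in_elts transitive_setD)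

lemma ordinalI: "(\<And>y z. y \<epsilon> \<alpha> \<Longrightarrow> z \<epsilon> y \<Longrightarrow> z \<epsilon> \<alpha>) \<Longrightarrow> (\<And>\<beta>. \<beta> \<epsilon> \<alpha> \<Longrightarrow> ordinal \<beta>) \<Longrightarrow> ordinal \<alpha>"
  unfolding ordinal_def transitive_set_def by auto

lemma ordinal_empty: "ordinal empty"
  by (rule ordinalI) auto

lemma ordinal_succ: "ordinal \<alpha> \<Longrightarrow> ordinal (succ \<alpha>)"
  by (rule ordinalI) (auto dest: ordinal_elt ordinal_trans)

lemma ordinal_sUn: "(\<And>\<alpha>. \<alpha> \<epsilon> x \<Longrightarrow> ordinal \<alpha>) \<Longrightarrow> ordinal (sUn x)"
  by (rule ordinalI) (auto dest: ordinal_elt ordinal_trans)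

lemma ordinal_un: "ordinal \<alpha> \<Longrightarrow> ordinal \<beta> \<Longrightarrow> ordinal (un \<alpha> \<beta>)"
  unfolding un_def by (rule ordinal_sUn) auto

text \<open>Foundation applies to sets only, so the counterexamples up to \<alpha> have to form a
  set; hence the definability of \<open>P\<close>. Seen from outside, the ordinals of the model may
  be ill-founded.\<close>

lemma ordinal_induct:
  assumes P: "dfn True (\<lambda>e. P (e 0))" and "ordinal \<alpha>"
    and step: "\<And>\<alpha>. ordinal \<alpha> \<Longrightarrow> (\<And>\<beta>. \<beta> \<epsilon> \<alpha> \<Longrightarrow> P \<beta>) \<Longrightarrow> P \<alpha>"
  shows "P \<alpha>"
proof (rule ccontr)
  assume "\<not> P \<alpha>"
  have "\<exists>x. \<forall>\<beta>. \<beta> \<epsilon> x \<longleftrightarrow> \<beta> \<epsilon> succ \<alpha> \<and> \<not> P \<beta>"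
    by (rule comprehension[of _ "succ \<alpha>"], intro dfn_intros P) simp
  then obtain x where x: "\<And>\<beta>. \<beta> \<epsilon> x \<longleftrightarrow> \<beta> \<epsilon> succ \<alpha> \<and> \<not> P \<beta>" by metis
  then have "\<alpha> \<epsilon> x" using \<open>\<not> P \<alpha>\<close> by simp
  then obtain \<beta> where "\<beta> \<epsilon> x" "\<forall>z. z \<epsilon> x \<longrightarrow> \<not> z \<epsilon> \<beta>" using foundation by blast
  moreover have "ordinal \<beta>" using \<open>\<beta> \<epsilon> x\<close> x ordinal_succ[OF \<open>ordinal \<alpha>\<close>] ordinal_elt by blast
  ultimately have "P \<gamma>" if "\<gamma> \<epsilon> \<beta>" for \<gamma>
    using that x ordinal_trans[OF ordinal_succ[OF \<open>ordinal \<alpha>\<close>]] by blast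
  then show False using step \<open>ordinal \<beta>\<close> \<open>\<beta> \<epsilon> x\<close> x by blast
qed

lemma ordinal_least:
  assumes "dfn True (\<lambda>e. P (e 0))" "ordinal \<alpha>" "P \<alpha>"
  obtains \<beta> where "ordinal \<beta>" "P \<beta>" "\<And>\<gamma>. \<gamma> \<epsilon> \<beta> \<Longrightarrow> \<not> P \<gamma>"
proof -
  have "\<exists>\<beta>. ordinal \<beta> \<and> P \<beta> \<and> (\<forall>\<gamma>. \<gamma> \<epsilon> \<beta> \<longrightarrow> \<not> P \<gamma>)"
  proof (rule ccontr)
    assume none: "\<not> ?thesis"
    have "\<not> P \<alpha>"
    proof (rule ordinal_induct[where P = "\<lambda>x. \<not> P x", OF dfn_neg[OF assms(1)] assms(2)])
      fix \<beta> assume "ordinal \<beta>" "\<And>\<gamma>. \<gamma> \<epsilon> \<beta> \<Longrightarrow> \<not> P \<gamma>"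
      then show "\<not> P \<beta>" using none by metis
    qed
    with assms show False by simp
  qed
  then show ?thesis using that by metis
qed

lemma ordinal_linear: "ordinal \<alpha> \<Longrightarrow> ordinal \<beta> \<Longrightarrow> \<alpha> \<epsilon> \<beta> \<or> \<alpha> = \<beta> \<or> \<beta> \<epsilon> \<alpha>"
proof -
  assume a: "ordinal \<alpha>" and b: "ordinal \<beta>"
  have "\<forall>\<beta>. ordinal \<beta> \<longrightarrow> \<alpha> \<epsilon> \<beta> \<or> \<alpha> = \<beta> \<or> \<beta> \<epsilon> \<alpha>" using a
  proof (rule ordinal_induct[rotated])
    fix \<alpha> :: 'a assume a: "ordinal \<alpha>" and IH: "\<And>\<gamma>. \<gamma> \<epsilon> \<alpha> \<Longrightarrow> \<forall>\<beta>. ordinal \<beta> \<longrightarrow> \<gamma> \<epsilon> \<beta> \<or> \<gamma> = \<beta> \<or> \<beta> \<epsilon> \<gamma>"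
    have "\<alpha> \<epsilon> \<beta> \<or> \<alpha> = \<beta> \<or> \<beta> \<epsilon> \<alpha>" if "ordinal \<beta>" for \<beta> using that
    proof (rule ordinal_induct[rotated])
      fix \<beta> assume b: "ordinal \<beta>" and IH2: "\<And>\<eta>. \<eta> \<epsilon> \<beta> \<Longrightarrow> \<alpha> \<epsilon> \<eta> \<or> \<alpha> = \<eta> \<or> \<eta> \<epsilon> \<alpha>"
      show "\<alpha> \<epsilon> \<beta> \<or> \<alpha> = \<beta> \<or> \<beta> \<epsilon> \<alpha>"
      proof (rule ccontr)
        assume n: "\<not> (\<alpha> \<epsilon> \<beta> \<or> \<alpha> = \<beta> \<or> \<beta> \<epsilon> \<alpha>)"
        have "z \<epsilon> \<beta>" if "z \<epsilon> \<alpha>" for z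
          using n IH[OF that] that b ordinal_trans[OF a that, of \<beta>] by metis
        moreover have "z \<epsilon> \<alpha>" if "z \<epsilon> \<beta>" for z
          using n IH2[OF that] that a ordinal_trans[OF b that, of \<alpha>] by metis
        ultimately have "\<alpha> = \<beta>" by (intro set_ext) blast
        then show False using n by blast
      qed
    qed (intro dfn_intros)
    then show "\<forall>\<beta>. ordinal \<beta> \<longrightarrow> \<alpha> \<epsilon> \<beta> \<or> \<alpha> = \<beta> \<or> \<beta> \<epsilon> \<alpha>" by blast
  qed (intro dfn_intros)
  with b show ?thesis by blast
qed

lemma ordinal_sub: "ordinal \<alpha> \<Longrightarrow> ordinal \<beta> \<Longrightarrow> (\<And>z. z \<epsilon> \<alpha> \<Longrightarrow> z \<epsilon> \<beta>) \<Longrightarrow> \<alpha> = \<beta> \<or> \<alpha> \<epsilon> \<beta>"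
  using ordinal_linear mem_irrefl by blast

lemma ordinal_succ_cases: "ordinal \<alpha> \<Longrightarrow> ordinal \<beta> \<Longrightarrow> \<alpha> \<epsilon> \<beta> \<Longrightarrow> succ \<alpha> = \<beta> \<or> succ \<alpha> \<epsilon> \<beta>"
  by (rule ordinal_sub) (auto simp: ordinal_succ dest: ordinal_trans)

lemma small_ex: "small {z. P z} \<Longrightarrow> \<exists>y. \<forall>z. z \<epsilon> y \<longleftrightarrow> P z"
  by (intro exI[of _ "set_of {z. P z}"]) (simp add: in_set_of)

subsection \<open>The natural numbers\<close>

lemma inductive_ex: "\<exists>w :: 'v::zfc. empty \<epsilon> w \<and> (\<forall>y. y \<epsilon> w \<longrightarrow> succ y \<epsilon> w)"
proof -
  have "\<exists>w :: 'v. (\<exists>e. e \<epsilon> w \<and> (\<forall>z. \<not> z \<epsilon> e)) \<and> (\<forall>x. x \<epsilon> w \<longrightarrow> (\<exists>y. y \<epsilon> w \<and> (\<forall>z. z \<epsilon> y \<longleftrightarrow> z \<epsilon> x \<or> z = x)))"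
    using base_axioms[where 'a = 'v] by (simp add: base_axioms_def ax_infinity_def)
  then obtain w :: 'v where w: "(\<exists>e. e \<epsilon> w \<and> (\<forall>z. \<not> z \<epsilon> e)) \<and>
    (\<forall>x. x \<epsilon> w \<longrightarrow> (\<exists>y. y \<epsilon> w \<and> (\<forall>z. z \<epsilon> y \<longleftrightarrow> z \<epsilon> x \<or> z = x)))" by (rule exE)
  note e = conjunct1[OF w] and s = conjunct2[OF w]
  have "empty \<epsilon> w" using e by (metis empty_iff)
  moreover have "succ x \<epsilon> w" if x: "x \<epsilon> w" for x
  proof -
    obtain y where y: "y \<epsilon> w \<and> (\<forall>z. z \<epsilon> y \<longleftrightarrow> z \<epsilon> x \<or> z = x)"
      using s[rule_format, OF x] by (rule exE)
    have "y = succ x" by (rule set_ext) (simp add: y disj_commute)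
    with y show ?thesis by simp
  qed
  ultimately show ?thesis by metis
qed

lemma mem_omega: "n \<epsilon> omega \<longleftrightarrow> (\<forall>x. empty \<epsilon> x \<and> (\<forall>y. y \<epsilon> x \<longrightarrow> succ y \<epsilon> x) \<longrightarrow> n \<epsilon> x)"
proof -
  obtain w :: 'a where "empty \<epsilon> w \<and> (\<forall>y. y \<epsilon> w \<longrightarrow> succ y \<epsilon> w)" using inductive_ex by metis
  then have "small {n :: 'a. \<forall>x. empty \<epsilon> x \<and> (\<forall>y. y \<epsilon> x \<longrightarrow> succ y \<epsilon> x) \<longrightarrow> n \<epsilon> x}"
    by (intro small_Collect[of _ w] dfn_intros) simp
  then show ?thesis by (simp add: omega_def in_set_of Ball_def)
qed

lemma empty_omega [simp]: "empty \<epsilon> omega"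
  by (simp add: mem_omega)

lemma succ_omega [simp]: "n \<epsilon> omega \<Longrightarrow> succ n \<epsilon> omega"
  by (simp add: mem_omega)

lemma omega_induct:
  assumes "dfn True (\<lambda>e. P (e 0))" "n \<epsilon> omega" "P empty"
    and "\<And>k. k \<epsilon> omega \<Longrightarrow> P k \<Longrightarrow> P (succ k)"
  shows "P n"
proof -
  have "\<exists>x. \<forall>n. n \<epsilon> x \<longleftrightarrow> n \<epsilon> omega \<and> P n"
    by (rule comprehension[of _ omega], intro dfn_intros assms(1)) simp
  then obtain x where x: "\<forall>n. n \<epsilon> x \<longleftrightarrow> n \<epsilon> omega \<and> P n" by (rule exE)
  have "n \<epsilon> x" using assms(2)[unfolded mem_omega, rule_format, of x] assms(3,4) x by simp
  with x show ?thesis by simp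
qed

lemma omega_subset: "n \<epsilon> omega \<Longrightarrow> k \<epsilon> n \<Longrightarrow> k \<epsilon> omega"
proof -
  assume n: "n \<epsilon> omega"
  have "\<forall>k. k \<epsilon> n \<longrightarrow> k \<epsilon> omega"
    by (rule omega_induct[where P = "\<lambda>n. \<forall>k. k \<epsilon> n \<longrightarrow> k \<epsilon> omega", OF _ n]) (intro dfn_intros, auto)
  then show "k \<epsilon> n \<Longrightarrow> k \<epsilon> omega" by simp
qed

lemma ordinal_nat: "n \<epsilon> omega \<Longrightarrow> ordinal n"
  by (rule omega_induct[where P = ordinal]) (intro dfn_intros, auto intro: ordinal_empty ordinal_succ)

lemma ordinal_omega: "ordinal omega"
  by (rule ordinalI) (auto intro: omega_subset ordinal_nat)

lemma succ_inject [simp]: "succ m = succ n \<longleftrightarrow> m = n"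
  by (metis mem_succ mem_asym)

lemma succ_neq_empty [simp]: "succ n \<noteq> empty" "empty \<noteq> succ n"
  by (metis mem_empty mem_succ)+

lemma numeral_set_omega [simp]: "numeral_set n \<epsilon> omega"
  by (induction n) auto

lemma numeral_set_less: "m < n \<Longrightarrow> numeral_set m \<epsilon> numeral_set n"
  by (induction n) (auto simp: less_Suc_eq)

lemma numeral_set_inject [simp]: "numeral_set m = numeral_set n \<longleftrightarrow> m = n"
  by (metis numeral_set_less mem_irrefl linorder_neqE_nat)

text \<open>Transitivity of \<open>U\<close> turns the relativised descriptions of zero, successor
  and pair into the true sets.\<close>

lemma nice_omega_closed:
  assumes "nice U"
  obtains W where "W \<in> U" "empty \<epsilon> W" "\<And>a. a \<epsilon> W \<Longrightarrow> succ a \<epsilon> W" "\<And>a b. a \<epsilon> W \<Longrightarrow> b \<epsilon> W \<Longrightarrow> upair a b \<epsilon> W"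
proof -
  have tr: "y \<in> U" if "x \<in> U" "y \<epsilon> x" for x y using that assms nice_transitive by metis
  obtain W where W: "W \<in> U" and clauses: "(\<exists>z\<in>U. z \<epsilon> W \<and> (\<forall>u\<in>U. \<not> u \<epsilon> z)) \<and>
      (\<forall>a\<in>U. a \<epsilon> W \<longrightarrow> (\<exists>c\<in>U. c \<epsilon> W \<and> (\<forall>u\<in>U. u \<epsilon> c \<longleftrightarrow> u \<epsilon> a \<or> u = a)) \<and>
        (\<forall>b\<in>U. b \<epsilon> W \<longrightarrow> (\<exists>c\<in>U. c \<epsilon> W \<and> (\<forall>u\<in>U. u \<epsilon> c \<longleftrightarrow> u = a \<or> u = b))))"
    using nice_closed_set[OF assms] by (rule bexE)
  note z = conjunct1[OF clauses] and * = conjunct2[OF clauses, rule_format, THEN conjunct1]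
    and ** = conjunct2[OF clauses, rule_format, THEN conjunct2, rule_format]
  have "empty \<epsilon> W" using z tr by (metis empty_iff)
  moreover have "succ a \<epsilon> W" if a: "a \<epsilon> W" for a
  proof -
    have aU: "a \<in> U" using a W tr by metis
    obtain c where c: "c \<in> U" "c \<epsilon> W \<and> (\<forall>u\<in>U. u \<epsilon> c \<longleftrightarrow> u \<epsilon> a \<or> u = a)" using *[OF aU a] by (rule bexE)
    have "c = succ a" by (rule set_ext) (use c aU tr[OF c(1)] tr[OF aU] in auto)
    with c show ?thesis by simp
  qed
  moreover have "upair a b \<epsilon> W" if a: "a \<epsilon> W" and b: "b \<epsilon> W" for a b
  proof -
    have aU: "a \<in> U" "b \<in> U" using a b W tr by metis+
    obtain c where c: "c \<in> U" "c \<epsilon> W \<and> (\<forall>u\<in>U. u \<epsilon> c \<longleftrightarrow> u = a \<or> u = b)" using **[OF aU(1) a aU(2) b] by (rule bexE)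
    have "c = upair a b" by (rule set_ext) (use c aU tr[OF c(1)] in auto)
    with c show ?thesis by simp
  qed
  ultimately show ?thesis using W that by metis
qed

lemma univ_omega [univ_intros]: "univ b U \<Longrightarrow> omega \<in> U"
proof (cases b)
  case False
  assume U: "univ b U"
  with False have "nice U" by simp
  then obtain W where W: "W \<in> U" "empty \<epsilon> W" "\<And>a. a \<epsilon> W \<Longrightarrow> succ a \<epsilon> W"
    by (rule nice_omega_closed) auto
  then have "n \<epsilon> W" if "n \<epsilon> omega" for n using that unfolding mem_omega by simp
  then show ?thesis by (rule univ_sub[OF U W(1)])
qed simp

lemma omega_dft [dfn_intros]: "dft b (\<lambda>e. omega)"
proof (rule dft_setI)
  show "z \<epsilon> omega \<longleftrightarrow> (\<lambda>z e. \<forall>x. empty \<epsilon> x \<and> (\<forall>y. y \<epsilon> x \<longrightarrow> succ y \<epsilon> x) \<longrightarrow> z \<epsilon> x) z e" for z and e :: "nat \<Rightarrow> 'a"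
    by (rule mem_omega)
  show "dfn b (\<lambda>e. \<forall>x. empty \<epsilon> x \<and> (\<forall>y. y \<epsilon> x \<longrightarrow> succ y \<epsilon> x) \<longrightarrow> e 0 \<epsilon> x)"
  proof (rule dfn_all, goal_cases)
    case (2 U e)
    then have "\<not> e 0 \<epsilon> omega" unfolding mem_omega by blast
    then show ?case
      using 2 by (intro bexI[of _ omega] univ_omega[of b]) auto
  qed (intro dfn_intros)
qed (rule univ_omega)

subsection \<open>Transfinite recursion\<close>

definition isrec :: "('v::zfc \<Rightarrow> 'v) \<Rightarrow> 'v \<Rightarrow> 'v \<Rightarrow> bool" where
  "isrec G f \<alpha> \<longleftrightarrow> fun_on f \<alpha> \<and> (\<forall>\<beta>. \<beta> \<epsilon> \<alpha> \<longrightarrow> ap f \<beta> = G (imgf f \<beta>))"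

lemma isrec_agree:
  assumes f: "isrec G f \<alpha>" and g: "isrec G g \<alpha>'" and \<alpha>: "ordinal \<alpha>" "ordinal \<alpha>'"
  shows "\<beta> \<epsilon> \<alpha> \<Longrightarrow> \<beta> \<epsilon> \<alpha>' \<Longrightarrow> ap f \<beta> = ap g \<beta>"
proof -
  assume \<beta>: "\<beta> \<epsilon> \<alpha>" "\<beta> \<epsilon> \<alpha>'"
  have "\<beta> \<epsilon> \<alpha> \<and> \<beta> \<epsilon> \<alpha>' \<longrightarrow> ap f \<beta> = ap g \<beta>" using ordinal_elt[OF \<alpha>(1) \<beta>(1)]
  proof (rule ordinal_induct[rotated])
    fix \<beta> assume IH: "\<And>\<gamma>. \<gamma> \<epsilon> \<beta> \<Longrightarrow> \<gamma> \<epsilon> \<alpha> \<and> \<gamma> \<epsilon> \<alpha>' \<longrightarrow> ap f \<gamma> = ap g \<gamma>"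
    show "\<beta> \<epsilon> \<alpha> \<and> \<beta> \<epsilon> \<alpha>' \<longrightarrow> ap f \<beta> = ap g \<beta>"
    proof
      assume \<beta>: "\<beta> \<epsilon> \<alpha> \<and> \<beta> \<epsilon> \<alpha>'"
      have "ap f \<gamma> = ap g \<gamma>" if "\<gamma> \<epsilon> \<beta>" for \<gamma>
        using IH[OF that] that \<beta> ordinal_trans \<alpha> by metis
      then have "imgf f \<beta> = imgf g \<beta>" by (intro set_ext) (simp, metis)
      then show "ap f \<beta> = ap g \<beta>" using f g \<beta> unfolding isrec_def by metis
    qed
  qed (intro dfn_intros)
  with \<beta> show ?thesis by simp
qed

context
  fixes G :: "'v::zfc \<Rightarrow> 'v"
  assumes G: "dft True (\<lambda>e. G (e 0))"
begin

lemma isrec_dfn_True: "dft True t \<Longrightarrow> dft True u \<Longrightarrow> dfn True (\<lambda>e. isrec G (t e) (u e))"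
  by (rule dfn_subst2[where P = "isrec G"]) (unfold isrec_def, intro dfn_intros dft_subst1[where f = G, OF G])

lemma isrec_succ:
  assumes h: "isrec G h \<alpha>" and \<alpha>: "ordinal \<alpha>"
  shows "\<exists>f. isrec G f (succ \<alpha>)"
proof -
  let ?p = "opair \<alpha> (G (imgf h \<alpha>))"
  let ?f = "un h (upair ?p ?p)"
  have hD: "\<exists>x. x \<epsilon> \<alpha> \<and> p = opair x (ap h x)" if "p \<epsilon> h" for p
    using h fun_onD that unfolding isrec_def by metis
  have mem: "opair x y \<epsilon> ?f \<longleftrightarrow> (x \<epsilon> \<alpha> \<and> y = ap h x) \<or> (x = \<alpha> \<and> y = G (imgf h \<alpha>))" for x y
  proof -
    have "opair x y \<epsilon> h \<longleftrightarrow> x \<epsilon> \<alpha> \<and> y = ap h x"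
      using hD[of "opair x y"] h fun_on_ap unfolding isrec_def by (metis opair_inject)
    then show ?thesis by simp
  qed
  have f: "fun_on ?f (succ \<alpha>)"
  proof (rule fun_onI)
    show "\<exists>x y. x \<epsilon> succ \<alpha> \<and> p = opair x y" if "p \<epsilon> ?f" for p
      using that hD[of p] by (auto simp del: opair_inject) 
    show "\<exists>y. opair x y \<epsilon> ?f" if "x \<epsilon> succ \<alpha>" for x
      unfolding mem using that by auto
    show "y = y'" if "opair x y \<epsilon> ?f" "opair x y' \<epsilon> ?f" for x y y'
      using that unfolding mem by (metis mem_irrefl)
  qed
  have ap1: "ap ?f x = ap h x" if "x \<epsilon> \<alpha>" for x
    using fun_on_ap[OF f, of x "ap h x"] that unfolding mem by simp
  have ap2: "ap ?f \<alpha> = G (imgf h \<alpha>)"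
    using fun_on_ap[OF f, of \<alpha> "G (imgf h \<alpha>)"] unfolding mem by simp
  have img: "imgf ?f \<beta> = imgf h \<beta>" if "\<beta> \<epsilon> succ \<alpha>" for \<beta>
  proof -
    have "\<gamma> \<epsilon> \<alpha>" if "\<gamma> \<epsilon> \<beta>" for \<gamma> using that \<open>\<beta> \<epsilon> succ \<alpha>\<close> \<alpha> ordinal_trans by (metis mem_succ)
    then show ?thesis by (intro set_ext) (simp only: mem_imgf, metis ap1)
  qed
  have "ap ?f \<beta> = G (imgf ?f \<beta>)" if "\<beta> \<epsilon> succ \<alpha>" for \<beta>
    using that h ap1 ap2 unfolding isrec_def img[OF that] by (metis mem_succ)
  with f show ?thesis unfolding isrec_def by metis
qed

text \<open>Approximations below \<alpha> agree, so replacement collects their last values into a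
  function on \<alpha>; \<open>isrec_succ\<close> adds the value at \<alpha>.\<close>

lemma isrec_ex: "ordinal \<alpha> \<Longrightarrow> \<exists>f. isrec G f (succ \<alpha>)"
proof (rule ordinal_induct[where P = "\<lambda>\<alpha>. \<exists>f. isrec G f (succ \<alpha>)"])
  show "dfn True (\<lambda>e. \<exists>f. isrec G f (succ (e 0)))" by (intro dfn_intros isrec_dfn_True)
  fix \<alpha> assume \<alpha>: "ordinal \<alpha>" and IH: "\<And>\<beta>. \<beta> \<epsilon> \<alpha> \<Longrightarrow> \<exists>f. isrec G f (succ \<beta>)"
  let ?F = "\<lambda>\<beta> p. \<exists>f. isrec G f (succ \<beta>) \<and> p = opair \<beta> (ap f \<beta>)"
  have uniq: "ap f \<beta> = ap g \<beta>" if "\<beta> \<epsilon> \<alpha>" "isrec G f (succ \<beta>)" "isrec G g (succ \<beta>)" for f g \<beta>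
    using isrec_agree[OF that(2,3), of \<beta>] ordinal_succ[OF ordinal_elt[OF \<alpha> that(1)]] by simp
  have "small {p. \<exists>\<beta>. \<beta> \<epsilon> \<alpha> \<and> ?F \<beta> p}"
  proof (rule small_replacement)
    show "\<exists>!p. ?F \<beta> p" if b: "\<beta> \<epsilon> \<alpha>" for \<beta>
    proof -
      obtain f where f: "isrec G f (succ \<beta>)" using IH[OF b] by (rule exE)
      show ?thesis
      proof (rule ex1I)
        show "?F \<beta> (opair \<beta> (ap f \<beta>))" using f by blast
        fix p assume "?F \<beta> p"
        then obtain g where "isrec G g (succ \<beta>)" "p = opair \<beta> (ap g \<beta>)" by (elim exE conjE)
        then show "p = opair \<beta> (ap f \<beta>)" using uniq[OF b _ f] by simp
      qed
    qed
  qed (intro dfn_intros isrec_dfn_True)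
  then obtain h where "\<forall>p. p \<epsilon> h \<longleftrightarrow> (\<exists>\<beta>. \<beta> \<epsilon> \<alpha> \<and> ?F \<beta> p)"
    by (rule small_ex[THEN exE])
  then have h: "p \<epsilon> h \<longleftrightarrow> (\<exists>\<beta>. \<beta> \<epsilon> \<alpha> \<and> ?F \<beta> p)" for p by (rule spec)
  have mem: "opair \<beta> y \<epsilon> h \<longleftrightarrow> \<beta> \<epsilon> \<alpha> \<and> (\<exists>f. isrec G f (succ \<beta>) \<and> y = ap f \<beta>)" for \<beta> y
    unfolding h by auto
  have f: "fun_on h \<alpha>"
  proof (rule fun_onI)
    show "\<exists>x y. x \<epsilon> \<alpha> \<and> p = opair x y" if "p \<epsilon> h" for p using that unfolding h by blast
    show "\<exists>y. opair x y \<epsilon> h" if "x \<epsilon> \<alpha>" for x unfolding mem using that IH by metis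
    show "y = y'" if "opair x y \<epsilon> h" "opair x y' \<epsilon> h" for x y y'
      using that uniq unfolding mem by metis
  qed
  have ap: "ap h \<beta> = ap f \<beta>" if "\<beta> \<epsilon> \<alpha>" "isrec G f (succ \<beta>)" for \<beta> f
    using fun_on_ap[OF f that(1), of "ap f \<beta>"] that unfolding mem by metis
  have "ap h \<beta> = G (imgf h \<beta>)" if \<beta>: "\<beta> \<epsilon> \<alpha>" for \<beta>
  proof -
    obtain f where f: "isrec G f (succ \<beta>)" using IH[OF \<beta>] by metis
    have ord: "ordinal \<beta>" using \<alpha> \<beta> ordinal_elt by metis
    have "ap h \<gamma> = ap f \<gamma>" if "\<gamma> \<epsilon> \<beta>" for \<gamma>
    proof -
      have "\<gamma> \<epsilon> \<alpha>" using that \<alpha> \<beta> ordinal_trans by metis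
      then obtain g where g: "isrec G g (succ \<gamma>)" using IH by metis
      have "ap g \<gamma> = ap f \<gamma>"
        using isrec_agree[OF g f] that ord ordinal_elt ordinal_succ by (metis mem_succ)
      then show ?thesis using ap[OF \<open>\<gamma> \<epsilon> \<alpha>\<close> g] by simp
    qed
    then have "imgf h \<beta> = imgf f \<beta>" by (intro set_ext) (simp, metis)
    moreover have "ap f \<beta> = G (imgf f \<beta>)" using f unfolding isrec_def by simp
    ultimately show ?thesis using ap[OF \<beta> f] by simp
  qed
  with f have "isrec G h \<alpha>" unfolding isrec_def by simp
  then show "\<exists>f. isrec G f (succ \<alpha>)" using isrec_succ \<alpha> by metis
qed

text \<open>Replaces the definite description in \<open>ord_rec\<close> by an existential statement,
  a form for which definability can be derived.\<close>

lemma ord_rec_isrec: "ordinal \<alpha> \<Longrightarrow> v = ord_rec G \<alpha> \<longleftrightarrow> (\<exists>f. isrec G f (succ \<alpha>) \<and> v = ap f \<alpha>)"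
proof -
  assume \<alpha>: "ordinal \<alpha>"
  have "fun_on f (succ \<alpha>) \<and> (\<forall>\<beta>\<in>elts (succ \<alpha>). app f \<beta> = G (set_of {app f \<gamma> | \<gamma>. \<gamma> \<epsilon> \<beta>})) \<longleftrightarrow> isrec G f (succ \<alpha>)" for f
  proof (cases "fun_on f (succ \<alpha>)")
    case True
    have "set_of {app f \<gamma> | \<gamma>. \<gamma> \<epsilon> \<beta>} = imgf f \<beta>" if "\<beta> \<epsilon> succ \<alpha>" for \<beta>
    proof (rule set_of_eqI)
      have "app f \<gamma> = ap f \<gamma>" if "\<gamma> \<epsilon> \<beta>" for \<gamma>
        using fun_on_app[OF True] that \<open>\<beta> \<epsilon> succ \<alpha>\<close> ordinal_trans ordinal_succ \<alpha> by metis
      then show "elts (imgf f \<beta>) = {app f \<gamma> | \<gamma>. \<gamma> \<epsilon> \<beta>}"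
        by (intro set_eqI) (simp only: in_elts mem_imgf mem_Collect_eq, metis)
    qed
    with True show ?thesis unfolding isrec_def by (auto simp: fun_on_app[OF True] Ball_def)
  qed (simp add: isrec_def)
  then have *: "fun_on f (succ \<alpha>) \<and> (\<forall>\<beta>\<in>elts (succ \<alpha>). app f \<beta> = G (set_of {app f \<gamma> | \<gamma>. \<gamma> \<epsilon> \<beta>})) \<and> v = app f \<alpha>
      \<longleftrightarrow> isrec G f (succ \<alpha>) \<and> v = ap f \<alpha>" for f v
    using fun_on_app[of f "succ \<alpha>" \<alpha>] unfolding isrec_def by auto
  have eq: "ord_rec G \<alpha> = (THE v. \<exists>f. isrec G f (succ \<alpha>) \<and> v = ap f \<alpha>)"
    unfolding ord_rec_def * ..
  obtain f where f: "isrec G f (succ \<alpha>)" using isrec_ex \<alpha> by metis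
  have "ap g \<alpha> = ap f \<alpha>" if "isrec G g (succ \<alpha>)" for g
    using isrec_agree[OF that f, of \<alpha>] ordinal_succ[OF \<alpha>] by simp
  then have "ord_rec G \<alpha> = ap f \<alpha>" unfolding eq using f by (intro the_equality) blast+
  then show ?thesis using f \<open>\<And>g. isrec G g (succ \<alpha>) \<Longrightarrow> ap g \<alpha> = ap f \<alpha>\<close> by metis
qed

lemma isrec_ord_rec: "ordinal \<alpha> \<Longrightarrow> isrec G f (succ \<alpha>) \<Longrightarrow> \<gamma> \<epsilon> succ \<alpha> \<Longrightarrow> ap f \<gamma> = ord_rec G \<gamma>"
proof -
  assume a: "ordinal \<alpha>" and f: "isrec G f (succ \<alpha>)" and \<gamma>: "\<gamma> \<epsilon> succ \<alpha>"
  have o: "ordinal \<gamma>" using a \<gamma> ordinal_succ ordinal_elt by metis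
  then obtain g where g: "isrec G g (succ \<gamma>)" "ord_rec G \<gamma> = ap g \<gamma>" using ord_rec_isrec by metis
  then show ?thesis using isrec_agree[OF f g(1)] a o \<gamma> ordinal_succ by (metis mem_succ)
qed

lemma ord_rec_unfold:
  assumes \<alpha>: "ordinal \<alpha>"
  obtains X where "\<And>z. z \<epsilon> X \<longleftrightarrow> (\<exists>\<gamma>. \<gamma> \<epsilon> \<alpha> \<and> z = ord_rec G \<gamma>)" "ord_rec G \<alpha> = G X"
proof -
  obtain f where f: "isrec G f (succ \<alpha>)" using isrec_ex \<alpha> by metis
  have "z \<epsilon> imgf f \<alpha> \<longleftrightarrow> (\<exists>\<gamma>. \<gamma> \<epsilon> \<alpha> \<and> z = ord_rec G \<gamma>)" for z
    unfolding mem_imgf using isrec_ord_rec[OF \<alpha> f] by (metis mem_succ)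
  moreover have "ord_rec G \<alpha> = G (imgf f \<alpha>)"
    using isrec_ord_rec[OF \<alpha> f] f unfolding isrec_def by (metis mem_succ)
  ultimately show ?thesis using that by metis
qed

text \<open>The conjunct \<open>ordinal\<close> confines the claim to arguments where the
  description in \<open>ord_rec\<close> is known to have a value; \<open>V\<close> and
  \<open>ho_level\<close> are treated in the same form.\<close>

lemma ord_rec_dfn_True:
  assumes "dft True t" "dft True u"
  shows "dfn True (\<lambda>e. ordinal (t e) \<and> u e = ord_rec G (t e))"
proof (rule dfn_cong)
  show "dfn True (\<lambda>e. ordinal (t e) \<and> (\<exists>f. isrec G f (succ (t e)) \<and> u e = ap f (t e)))"
    by (intro dfn_intros isrec_dfn_True assms dft_ren[OF assms(1)] dft_ren[OF assms(2)])
qed (use ord_rec_isrec in metis)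

end

lemma dft_rep [dfn_intros]:
  assumes "dft True (\<lambda>e. F (e 0))" "dft True t"
  shows "dft True (\<lambda>e. rep F (t e))"
  by (rule dft_setI, rule mem_rep[OF assms(1)], intro dfn_intros dft_ren[OF assms(2)] dft_subst1[where f = F, OF assms(1)]) simp

text \<open>An omega-iteration carried out as transfinite recursion: a stage consists of
  \<open>a\<close> and of the elements of all \<open>H x\<close> with x in an earlier stage.
  Whatever appears at stage \<open>omega\<close> appears at a finite stage already, so that stage is
  closed.\<close>

lemma closing_off:
  assumes H: "dft True (\<lambda>e. H (e 0))"
  shows "\<exists>w. (\<forall>x. x \<epsilon> a \<longrightarrow> x \<epsilon> w) \<and> (\<forall>x y. x \<epsilon> w \<longrightarrow> y \<epsilon> H x \<longrightarrow> y \<epsilon> w)"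
proof -
  let ?G = "\<lambda>X. un a (sUn (rep H (sUn X)))"
  have G: "dft True (\<lambda>e. ?G (e 0))" by (intro dfn_intros H)
  have mem: "z \<epsilon> ?G X \<longleftrightarrow> z \<epsilon> a \<or> (\<exists>x F. F \<epsilon> X \<and> x \<epsilon> F \<and> z \<epsilon> H x)" for z X
    by (simp add: mem_rep[OF H]) metis
  obtain X where X: "\<And>z. z \<epsilon> X \<longleftrightarrow> (\<exists>\<gamma>. \<gamma> \<epsilon> omega \<and> z = ord_rec ?G \<gamma>)" "ord_rec ?G omega = ?G X"
    using ord_rec_unfold[OF G ordinal_omega] by metis
  have stage: "\<exists>n. n \<epsilon> omega \<and> x \<epsilon> ord_rec ?G n" if x: "x \<epsilon> ?G X" for x
  proof -
    have "x \<epsilon> a \<or> (\<exists>m y. m \<epsilon> omega \<and> y \<epsilon> ord_rec ?G m \<and> x \<epsilon> H y)"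
      using x X(1) unfolding mem by metis
    then show ?thesis
    proof (elim disjE exE conjE)
      assume "x \<epsilon> a"
      obtain Y where "ord_rec ?G empty = ?G Y" using ord_rec_unfold[OF G ordinal_empty] by metis
      then have "x \<epsilon> ord_rec ?G empty" using \<open>x \<epsilon> a\<close> mem by metis
      then show ?thesis using empty_omega by metis
    next
      fix m y assume m: "m \<epsilon> omega" "y \<epsilon> ord_rec ?G m" "x \<epsilon> H y"
      obtain Y where Y: "\<And>z. z \<epsilon> Y \<longleftrightarrow> (\<exists>\<gamma>. \<gamma> \<epsilon> succ m \<and> z = ord_rec ?G \<gamma>)" "ord_rec ?G (succ m) = ?G Y"
        using ord_rec_unfold[OF G ordinal_succ[OF ordinal_nat[OF m(1)]]] by metis
      have "ord_rec ?G m \<epsilon> Y" unfolding Y by (rule exI[of _ m]) simp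
      then have "x \<epsilon> ord_rec ?G (succ m)" unfolding Y(2) mem using m by metis
      then show ?thesis using m succ_omega by metis
    qed
  qed
  have "y \<epsilon> ?G X" if "x \<epsilon> ?G X" "y \<epsilon> H x" for x y
    using stage[OF that(1)] that(2) X(1) unfolding mem by metis
  then show ?thesis using mem by metis
qed

lemma transitive_closure: "\<exists>w. transitive_set w \<and> (\<forall>x. x \<epsilon> a \<longrightarrow> x \<epsilon> w)"
proof -
  obtain w where "\<forall>x. x \<epsilon> a \<longrightarrow> x \<epsilon> w" "\<forall>x y. x \<epsilon> w \<longrightarrow> y \<epsilon> x \<longrightarrow> y \<epsilon> w"
    using closing_off[of "\<lambda>x. x" a] dft_var by metis
  then show ?thesis unfolding transitive_set_def by (metis in_elts subsetI)
qed

lemma mem_induct: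
  assumes "dfn True (\<lambda>e. P (e 0))" "\<And>x. (\<And>y. y \<epsilon> x \<Longrightarrow> P y) \<Longrightarrow> P x"
  shows "P x"
proof (rule ccontr)
  assume "\<not> P x"
  obtain w where w: "transitive_set w" "x \<epsilon> w" using transitive_closure[of "upair x x"] by (metis mem_upair)
  have "\<exists>z. \<forall>y. y \<epsilon> z \<longleftrightarrow> y \<epsilon> w \<and> \<not> P y"
    by (rule comprehension[of _ w], intro dfn_intros assms(1)) simp
  then obtain z where z: "\<forall>y. y \<epsilon> z \<longleftrightarrow> y \<epsilon> w \<and> \<not> P y" by (rule exE)
  then have "x \<epsilon> z" using \<open>\<not> P x\<close> w by simp
  then obtain y where y: "y \<epsilon> z" "\<forall>u. u \<epsilon> z \<longrightarrow> \<not> u \<epsilon> y" using foundation by metis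
  have "P u" if "u \<epsilon> y" for u using that y z w transitive_setD by metis
  then show False using assms(2) y z by metis
qed

text \<open>Uniqueness of the Mostowski collapse, by membership induction: \<open>h\<close> can only
  be the identity. A relation instead of a function also fits the comparison of two injections in
  \<open>hartogs\<close>.\<close>

lemma transitive_iso:
  assumes h: "dfn True (\<lambda>e. h (e 0) (e 1))" and tr: "transitive_set M" "transitive_set N"
    and l: "\<And>x. x \<epsilon> M \<Longrightarrow> \<exists>y. y \<epsilon> N \<and> h x y" and r: "\<And>y. y \<epsilon> N \<Longrightarrow> \<exists>x. x \<epsilon> M \<and> h x y"
    and iso: "\<And>x x' y y'. x \<epsilon> M \<Longrightarrow> y \<epsilon> M \<Longrightarrow> x' \<epsilon> N \<Longrightarrow> y' \<epsilon> N \<Longrightarrow> h x x' \<Longrightarrow> h y y' \<Longrightarrow> y \<epsilon> x \<longleftrightarrow> y' \<epsilon> x'"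
  shows "M = N"
proof -
  have eq: "x \<epsilon> M \<longrightarrow> (\<forall>x'. x' \<epsilon> N \<longrightarrow> h x x' \<longrightarrow> x = x')" for x
  proof (rule mem_induct[where P = "\<lambda>x. x \<epsilon> M \<longrightarrow> (\<forall>x'. x' \<epsilon> N \<longrightarrow> h x x' \<longrightarrow> x = x')"], intro dfn_intros dfn_subst2[where P = h, OF h])
    fix x assume IH: "\<And>y. y \<epsilon> x \<Longrightarrow> y \<epsilon> M \<longrightarrow> (\<forall>y'. y' \<epsilon> N \<longrightarrow> h y y' \<longrightarrow> y = y')"
    show "x \<epsilon> M \<longrightarrow> (\<forall>x'. x' \<epsilon> N \<longrightarrow> h x x' \<longrightarrow> x = x')"
    proof (intro impI allI)
      fix x' assume x: "x \<epsilon> M" "x' \<epsilon> N" "h x x'"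
      show "x = x'"
      proof (rule set_ext)
        fix y show "y \<epsilon> x \<longleftrightarrow> y \<epsilon> x'"
        proof
          assume y: "y \<epsilon> x"
          then have "y \<epsilon> M" using x tr transitive_setD by metis
          then obtain y' where y': "y' \<epsilon> N" "h y y'" using l by metis
          have "y = y'" using IH[OF y] \<open>y \<epsilon> M\<close> y' by blast
          then show "y \<epsilon> x'" using iso[OF x(1) \<open>y \<epsilon> M\<close> x(2) y'(1) x(3) y'(2)] y by simp
        next
          assume y: "y \<epsilon> x'"
          then have "y \<epsilon> N" using x tr transitive_setD by metis
          then obtain u where u: "u \<epsilon> M" "h u y" using r by metis
          then have "u \<epsilon> x" using iso[OF x(1) u(1) x(2) \<open>y \<epsilon> N\<close> x(3) u(2)] y by simp
          moreover have "u = y" using IH[OF \<open>u \<epsilon> x\<close>] u \<open>y \<epsilon> N\<close> by blast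
          ultimately show "y \<epsilon> x" by simp
        qed
      qed
    qed
  qed
  show ?thesis by (rule set_ext) (use eq l r in metis)
qed

subsection \<open>The cumulative hierarchy\<close>

lemma isrec_dfn:
  assumes "dft b (\<lambda>e. G (e 0) (e 1))"
  shows "dfn b (\<lambda>e. isrec (G (e 0)) (e 1) (e 2))"
  unfolding isrec_def by (intro dfn_intros dft_subst2[where f = G, OF assms])

lemma ord_rec_mono:
  assumes G: "dft True (\<lambda>e. G (e 0))" and mono: "\<And>X Y. (\<And>z. z \<epsilon> X \<Longrightarrow> z \<epsilon> Y) \<Longrightarrow> elts (G X) \<subseteq> elts (G Y)"
    and o: "ordinal \<alpha>" and c: "\<gamma> \<epsilon> succ \<alpha>"
  shows "elts (ord_rec G \<gamma>) \<subseteq> elts (ord_rec G \<alpha>)"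
proof -
  have o': "ordinal \<gamma>" using o c ordinal_succ ordinal_elt by metis
  obtain X where X: "\<And>z. z \<epsilon> X \<longleftrightarrow> (\<exists>\<delta>. \<delta> \<epsilon> \<gamma> \<and> z = ord_rec G \<delta>)" "ord_rec G \<gamma> = G X"
    using ord_rec_unfold[OF G o'] by blast
  obtain Y where Y: "\<And>z. z \<epsilon> Y \<longleftrightarrow> (\<exists>\<delta>. \<delta> \<epsilon> \<alpha> \<and> z = ord_rec G \<delta>)" "ord_rec G \<alpha> = G Y"
    using ord_rec_unfold[OF G o] by blast
  have "\<delta> \<epsilon> \<alpha>" if "\<delta> \<epsilon> \<gamma>" for \<delta> using that o c ordinal_trans by (metis mem_succ)
  then have "z \<epsilon> Y" if "z \<epsilon> X" for z using that unfolding X Y by blast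
  then show ?thesis unfolding X(2) Y(2) by (rule mono)
qed

text \<open>A nice class must contain the approximation itself. Monotonicity makes all its values
  subsets of the last one, which is given as \<open>e 2\<close>; the approximation thus maps into a
  power set that lies in \<open>U\<close>.\<close>

lemma ord_rec_dfn:
  assumes G: "\<And>b. dft b (\<lambda>e. G (e 0) (e 1))"
    and mono: "\<And>M X Y. (\<And>z. z \<epsilon> X \<Longrightarrow> z \<epsilon> Y) \<Longrightarrow> elts (G M X) \<subseteq> elts (G M Y)"
  shows "dfn b (\<lambda>e. ordinal (e 1) \<and> e 2 = ord_rec (G (e 0)) (e 1))"
proof -
  have GM: "dft True (\<lambda>e. G M (e 0))" for M
    by (rule dft_subst2[where f = G, OF G]) (intro dfn_intros)+
  show ?thesis
  proof (rule dfn_cong)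
    show "dfn b (\<lambda>e. ordinal (e 1) \<and> (\<exists>f. ordinal (e 1) \<and> isrec (G (e 0)) f (succ (e 1)) \<and> e 2 = ap f (e 1)))"
    proof (rule dfn_conj[OF _ dfn_ex], goal_cases)
      case 2 show ?case by (intro dfn_intros dfn_subst3[where P = "\<lambda>x. isrec (G x)", OF isrec_dfn[OF G]])
    next
      case (3 U e)
      then obtain f where f: "ordinal (e 1)" "isrec (G (e 0)) f (succ (e 1))" "e 2 = ap f (e 1)" by blast
      have "e 2 = ord_rec (G (e 0)) (e 1)" using ord_rec_isrec[OF GM f(1)] f by blast
      then have "ap f x \<epsilon> pow (e 2)" if "x \<epsilon> succ (e 1)" for x
        using ord_rec_mono[OF GM mono f(1) that] isrec_ord_rec[OF GM f(1) f(2) that] by simp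
      then have "maps f (succ (e 1)) (pow (e 2))" using f(2) unfolding maps_iff isrec_def by simp
      moreover have "succ (e 1) \<in> U" "pow (e 2) \<in> U" using 3 by (auto intro!: univ_intros)
      ultimately have "f \<in> U" using univ_maps[OF 3(1)] by blast
      with f show ?case by blast
    qed (intro dfn_intros)
    show "ordinal (e 1) \<and> (\<exists>f. ordinal (e 1) \<and> isrec (G (e 0)) f (succ (e 1)) \<and> e 2 = ap f (e 1)) \<longleftrightarrow>
        ordinal (e 1) \<and> e 2 = ord_rec (G (e 0)) (e 1)" for e
      by (simp add: ord_rec_isrec[OF GM] cong: conj_cong)
  qed
qed

definition VG :: "'v::zfc \<Rightarrow> 'v" where
  "VG X = set_of {z. \<exists>x\<in>elts X. elts z \<subseteq> elts x}"

lemma mem_VG: "z \<epsilon> VG X \<longleftrightarrow> (\<exists>x. x \<epsilon> X \<and> elts z \<subseteq> elts x)"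
proof -
  have "small {z. \<exists>x\<in>elts X. elts z \<subseteq> elts x}"
    by (rule small_Collect[of _ "pow (sUn X)"], intro dfn_intros) (auto simp: subset_iff)
  then show ?thesis by (simp add: VG_def in_set_of Bex_def)
qed

lemma VG_d0: "dft b (\<lambda>e. VG (e 0))"
proof (rule dft_setI, rule mem_VG, intro dfn_intros)
  fix U and e :: "nat \<Rightarrow> 'a" assume U: "univ b U" "range e \<subseteq> U"
  have "pow (sUn (e 0)) \<in> U" using U by (auto intro!: univ_intros)
  then show "VG (e 0) \<in> U" by (rule univ_sub[OF U(1)]) (auto simp: mem_VG subset_iff)
qed
lemmas [dfn_intros] = dft_subst1[where f = VG, OF VG_d0]

lemma V_rec: "V = ord_rec VG"
  unfolding V_def VG_def ..

lemma VG_mono: "(\<And>z. z \<epsilon> X \<Longrightarrow> z \<epsilon> Y) \<Longrightarrow> elts (VG X) \<subseteq> elts (VG Y)"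
  by (rule subsetI) (simp add: mem_VG, metis)

lemma mem_V: "ordinal \<alpha> \<Longrightarrow> z \<epsilon> V \<alpha> \<longleftrightarrow> (\<exists>\<gamma>. \<gamma> \<epsilon> \<alpha> \<and> elts z \<subseteq> elts (V \<gamma>))"
proof -
  assume "ordinal \<alpha>"
  then obtain X where "\<And>z. z \<epsilon> X \<longleftrightarrow> (\<exists>\<gamma>. \<gamma> \<epsilon> \<alpha> \<and> z = V \<gamma>)" "V \<alpha> = VG X"
    using ord_rec_unfold[OF VG_d0] unfolding V_rec by blast
  then show ?thesis using mem_VG by metis
qed

lemma V_d0: "dfn b (\<lambda>e. ordinal (e 0) \<and> e 1 = V (e 0))"
proof -
  have *: "dfn b (\<lambda>e. ordinal (e 1) \<and> e 2 = ord_rec ((\<lambda>_. VG) (e 0)) (e 1))"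
    by (rule ord_rec_dfn) (intro dfn_intros, rule VG_mono)
  show ?thesis using dfn_ren[OF *, of "case_nat 0 (case_nat 0 (\<lambda>_. 1))"]
    by (simp add: V_rec numeral_2_eq_2)
qed
lemmas V_dfn [dfn_intros] = dfn_subst2[where P = "\<lambda>x y. ordinal x \<and> y = V x", OF V_d0]

text \<open>A total version of \<open>V\<close>, so that it is a definable operation and not merely
  a definable relation.\<close>

definition VV :: "'v::zfc \<Rightarrow> 'v" where
  "VV \<alpha> = (if ordinal \<alpha> then V \<alpha> else empty)"

lemma VV_V [simp]: "ordinal \<alpha> \<Longrightarrow> VV \<alpha> = V \<alpha>"
  by (simp add: VV_def)

lemma VV_d0: "dft True (\<lambda>e. VV (e 0))"
proof (rule dft_setI)
  show "z \<epsilon> VV (e 0) \<longleftrightarrow> (\<lambda>z e. \<exists>v. (ordinal (e 0) \<and> v = V (e 0)) \<and> z \<epsilon> v) z e" for z and e :: "nat \<Rightarrow> 'a"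
    by (simp add: VV_def)
qed (intro dfn_intros, simp)
lemmas [dfn_intros] = dft_subst1[where f = VV, OF VV_d0]

lemma V_transitive: "ordinal \<alpha> \<Longrightarrow> transitive_set (V \<alpha>)"
proof -
  assume o: "ordinal \<alpha>"
  have "\<forall>z w. z \<epsilon> VV \<alpha> \<longrightarrow> w \<epsilon> z \<longrightarrow> w \<epsilon> VV \<alpha>" using o
  proof (rule ordinal_induct[rotated])
    fix \<alpha> :: 'a assume o: "ordinal \<alpha>" and IH: "\<And>\<beta>. \<beta> \<epsilon> \<alpha> \<Longrightarrow> \<forall>z w. z \<epsilon> VV \<beta> \<longrightarrow> w \<epsilon> z \<longrightarrow> w \<epsilon> VV \<beta>"
    have "w \<epsilon> V \<alpha>" if z: "z \<epsilon> V \<alpha>" and w: "w \<epsilon> z" for z w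
    proof -
      obtain \<gamma> where c: "\<gamma> \<epsilon> \<alpha>" "elts z \<subseteq> elts (V \<gamma>)" using z mem_V[OF o] by blast
      have "ordinal \<gamma>" using o c ordinal_elt by metis
      then have "elts w \<subseteq> elts (V \<gamma>)" using c(2) w IH[OF c(1)] by auto
      then show ?thesis using mem_V[OF o] c by blast
    qed
    then show "\<forall>z w. z \<epsilon> VV \<alpha> \<longrightarrow> w \<epsilon> z \<longrightarrow> w \<epsilon> VV \<alpha>" using o by simp
  qed (intro dfn_intros)
  then show ?thesis using o by (auto simp: transitive_set_def)
qed

lemma V_trans: "ordinal \<alpha> \<Longrightarrow> z \<epsilon> V \<alpha> \<Longrightarrow> w \<epsilon> z \<Longrightarrow> w \<epsilon> V \<alpha>"
  using V_transitive transitive_setD by blast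

lemma V_subset: "ordinal \<alpha> \<Longrightarrow> z \<epsilon> V \<alpha> \<Longrightarrow> elts y \<subseteq> elts z \<Longrightarrow> y \<epsilon> V \<alpha>"
  using mem_V by (metis subset_trans)

lemma V_mem: "ordinal \<alpha> \<Longrightarrow> \<beta> \<epsilon> \<alpha> \<Longrightarrow> V \<beta> \<epsilon> V \<alpha>"
  using mem_V by blast

lemma V_mono: "ordinal \<alpha> \<Longrightarrow> \<beta> \<epsilon> \<alpha> \<Longrightarrow> z \<epsilon> V \<beta> \<Longrightarrow> z \<epsilon> V \<alpha>"
  using V_mem V_trans by blast

lemma ordinal_subset_V: "ordinal \<alpha> \<Longrightarrow> x \<epsilon> \<alpha> \<Longrightarrow> x \<epsilon> V \<alpha>"
proof -
  assume o: "ordinal \<alpha>"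
  have "\<forall>x. x \<epsilon> \<alpha> \<longrightarrow> x \<epsilon> VV \<alpha>" using o
  proof (rule ordinal_induct[rotated])
    fix \<alpha> :: 'a assume o: "ordinal \<alpha>" and IH: "\<And>\<beta>. \<beta> \<epsilon> \<alpha> \<Longrightarrow> \<forall>x. x \<epsilon> \<beta> \<longrightarrow> x \<epsilon> VV \<beta>"
    have "x \<epsilon> V \<alpha>" if x: "x \<epsilon> \<alpha>" for x
    proof -
      have "elts x \<subseteq> elts (V x)" using IH[OF x] ordinal_elt[OF o x] by auto
      then show ?thesis using mem_V[OF o] x by blast
    qed
    then show "\<forall>x. x \<epsilon> \<alpha> \<longrightarrow> x \<epsilon> VV \<alpha>" using o by simp
  qed (intro dfn_intros)
  then show "x \<epsilon> \<alpha> \<Longrightarrow> x \<epsilon> V \<alpha>" using o by simp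
qed

lemma ordinal_in_V: "ordinal \<alpha> \<Longrightarrow> ordinal \<kappa> \<Longrightarrow> \<kappa> \<epsilon> V \<alpha> \<longleftrightarrow> \<kappa> \<epsilon> \<alpha>"
proof
  assume o: "ordinal \<alpha>" and k: "ordinal \<kappa>" "\<kappa> \<epsilon> V \<alpha>"
  have "\<forall>\<kappa>. ordinal \<kappa> \<longrightarrow> \<kappa> \<epsilon> VV \<alpha> \<longrightarrow> \<kappa> \<epsilon> \<alpha>" using o
  proof (rule ordinal_induct[rotated])
    fix \<alpha> :: 'a assume o: "ordinal \<alpha>" and IH: "\<And>\<beta>. \<beta> \<epsilon> \<alpha> \<Longrightarrow> \<forall>\<kappa>. ordinal \<kappa> \<longrightarrow> \<kappa> \<epsilon> VV \<beta> \<longrightarrow> \<kappa> \<epsilon> \<beta>"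
    have "\<kappa> \<epsilon> \<alpha>" if k: "ordinal \<kappa>" "\<kappa> \<epsilon> V \<alpha>" for \<kappa>
    proof -
      obtain \<gamma> where c: "\<gamma> \<epsilon> \<alpha>" "elts \<kappa> \<subseteq> elts (V \<gamma>)" using k mem_V[OF o] by blast
      have oc: "ordinal \<gamma>" using o c ordinal_elt by metis
      have "x \<epsilon> \<gamma>" if x: "x \<epsilon> \<kappa>" for x
        using IH[OF c(1)] c(2) x oc ordinal_elt[OF k(1) x] by auto
      then have "\<kappa> = \<gamma> \<or> \<kappa> \<epsilon> \<gamma>" using ordinal_sub k oc by metis
      then show ?thesis using c o ordinal_trans by metis
    qed
    then show "\<forall>\<kappa>. ordinal \<kappa> \<longrightarrow> \<kappa> \<epsilon> VV \<alpha> \<longrightarrow> \<kappa> \<epsilon> \<alpha>" using o by simp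
  qed (intro dfn_intros)
  then show "\<kappa> \<epsilon> \<alpha>" using o k by simp
qed (rule ordinal_subset_V)

section \<open>Collection, and ordinals closed under definable relations\<close>

lemma collection_ord:
  assumes R: "dfn True (\<lambda>e. R (e 0) (e 1))"
  shows "\<exists>\<gamma>. ordinal \<gamma> \<and> (\<forall>x. x \<epsilon> a \<longrightarrow> (\<exists>\<alpha>. ordinal \<alpha> \<and> R x \<alpha>) \<longrightarrow> (\<exists>\<alpha>. \<alpha> \<epsilon> \<gamma> \<and> R x \<alpha>))"
proof -
  \<comment> \<open>The least suitable ordinal, or \<open>empty\<close> if there is none, makes the
    relation functional as replacement demands.\<close>
  let ?F = "\<lambda>x \<beta>. (ordinal \<beta> \<and> R x \<beta> \<and> (\<forall>\<delta>. \<delta> \<epsilon> \<beta> \<longrightarrow> \<not> R x \<delta>)) \<or> (\<not> (\<exists>\<alpha>. ordinal \<alpha> \<and> R x \<alpha>) \<and> \<beta> = empty)"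
  have ex1: "\<exists>!\<beta>. ?F x \<beta>" for x
  proof (cases "\<exists>\<alpha>. ordinal \<alpha> \<and> R x \<alpha>")
    case True
    then obtain \<alpha> where a: "ordinal \<alpha>" "R x \<alpha>" by blast
    have "dfn True (\<lambda>e. R x (e 0))" by (rule dfn_subst2[where P = R, OF R]) (intro dfn_intros)+
    then obtain \<beta> where b: "ordinal \<beta>" "R x \<beta>" "\<And>\<delta>. \<delta> \<epsilon> \<beta> \<Longrightarrow> \<not> R x \<delta>"
      using ordinal_least[of "R x", OF _ a] by blast
    show ?thesis
    proof (rule ex1I)
      show "?F x \<beta>" using b by blast
      fix \<beta>' assume "?F x \<beta>'"
      then have b': "ordinal \<beta>'" "R x \<beta>'" "\<forall>\<delta>. \<delta> \<epsilon> \<beta>' \<longrightarrow> \<not> R x \<delta>" using True by blast+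
      then show "\<beta>' = \<beta>" using ordinal_linear[OF b'(1) b(1)] b by blast
    qed
  next
    case False
    then show ?thesis by (intro ex1I[of _ empty]) blast+
  qed
  have "small {\<beta>. \<exists>x. x \<epsilon> a \<and> ?F x \<beta>}"
    by (rule small_replacement, intro dfn_intros dfn_subst2[where P = R, OF R], rule ex1)
  then obtain B where "\<forall>\<beta>. \<beta> \<epsilon> B \<longleftrightarrow> (\<exists>x. x \<epsilon> a \<and> ?F x \<beta>)" by (rule small_ex[THEN exE])
  then have B: "\<beta> \<epsilon> B \<longleftrightarrow> (\<exists>x. x \<epsilon> a \<and> ?F x \<beta>)" for \<beta> by (rule spec)
  have ord: "ordinal \<beta>" if "\<beta> \<epsilon> B" for \<beta> using that ordinal_empty unfolding B by blast
  have o: "ordinal (succ (sUn B))" by (intro ordinal_succ ordinal_sUn ord)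
  have "\<exists>\<alpha>. \<alpha> \<epsilon> succ (sUn B) \<and> R x \<alpha>" if x: "x \<epsilon> a" "\<exists>\<alpha>. ordinal \<alpha> \<and> R x \<alpha>" for x
  proof -
    obtain \<beta> where b: "?F x \<beta>" using ex1[of x] by blast
    then have r: "ordinal \<beta>" "R x \<beta>" using x by blast+
    have "\<beta> \<epsilon> B" using b x unfolding B by blast
    then have "\<beta> = sUn B \<or> \<beta> \<epsilon> sUn B" using r by (intro ordinal_sub) (auto intro: ordinal_sUn ord)
    with r show ?thesis by (metis mem_succ)
  qed
  with o show ?thesis by blast
qed

lemma all_in_V: "\<exists>\<alpha>. ordinal \<alpha> \<and> x \<epsilon> V \<alpha>"
proof -
  have "\<exists>\<alpha>. ordinal \<alpha> \<and> x \<epsilon> VV \<alpha>"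
  proof (rule mem_induct[where P = "\<lambda>x. \<exists>\<alpha>. ordinal \<alpha> \<and> x \<epsilon> VV \<alpha>"], intro dfn_intros)
    fix x :: 'a assume IH: "\<And>y. y \<epsilon> x \<Longrightarrow> \<exists>\<alpha>. ordinal \<alpha> \<and> y \<epsilon> VV \<alpha>"
    have "\<exists>\<gamma>. ordinal \<gamma> \<and> (\<forall>y. y \<epsilon> x \<longrightarrow> (\<exists>\<alpha>. ordinal \<alpha> \<and> y \<epsilon> VV \<alpha>) \<longrightarrow> (\<exists>\<alpha>. \<alpha> \<epsilon> \<gamma> \<and> y \<epsilon> VV \<alpha>))"
      by (rule collection_ord) (intro dfn_intros)
    then obtain \<gamma> where c: "ordinal \<gamma>" "\<forall>y. y \<epsilon> x \<longrightarrow> (\<exists>\<alpha>. ordinal \<alpha> \<and> y \<epsilon> VV \<alpha>) \<longrightarrow> (\<exists>\<alpha>. \<alpha> \<epsilon> \<gamma> \<and> y \<epsilon> VV \<alpha>)"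
      by (elim exE conjE)
    have "y \<epsilon> V \<gamma>" if y: "y \<epsilon> x" for y
      using c y IH[OF y] V_mono[OF c(1)] ordinal_elt[OF c(1)] by (metis VV_V)
    then have "x \<epsilon> V (succ \<gamma>)" using mem_V[OF ordinal_succ[OF c(1)]] by (intro iffD2[OF mem_V] exI[of _ \<gamma>]) (auto simp: c ordinal_succ)
    then show "\<exists>\<alpha>. ordinal \<alpha> \<and> x \<epsilon> VV \<alpha>" using c ordinal_succ by (metis VV_V)
  qed
  then show ?thesis by auto
qed

text \<open>Instead of the witnesses themselves, one collects levels of the hierarchy that contain
  some.\<close>

lemma collection:
  assumes R: "dfn True (\<lambda>e. R (e 0) (e 1))"
  shows "\<exists>\<gamma>. ordinal \<gamma> \<and> (\<forall>x. x \<epsilon> a \<longrightarrow> (\<exists>y. R x y) \<longrightarrow> (\<exists>y. y \<epsilon> V \<gamma> \<and> R x y))"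
proof -
  have "dfn True (\<lambda>e. \<exists>y. y \<epsilon> VV (e 1) \<and> R (e 0) y)"
    by (intro dfn_intros dfn_subst2[where P = R, OF R])
  from collection_ord[OF this, of a] obtain \<gamma> where c: "ordinal \<gamma>"
    "\<And>x. x \<epsilon> a \<Longrightarrow> \<exists>\<alpha>. ordinal \<alpha> \<and> (\<exists>y. y \<epsilon> VV \<alpha> \<and> R x y) \<Longrightarrow> \<exists>\<alpha>. \<alpha> \<epsilon> \<gamma> \<and> (\<exists>y. y \<epsilon> VV \<alpha> \<and> R x y)" by blast
  have "\<exists>y. y \<epsilon> V \<gamma> \<and> R x y" if x: "x \<epsilon> a" "\<exists>y. R x y" for x
  proof -
    obtain y where y: "R x y" using x by blast
    obtain \<alpha> where "ordinal \<alpha>" "y \<epsilon> V \<alpha>" using all_in_V by blast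
    then have "\<exists>\<alpha>. ordinal \<alpha> \<and> (\<exists>y. y \<epsilon> VV \<alpha> \<and> R x y)" using y by (metis VV_V)
    then obtain \<alpha> y where "\<alpha> \<epsilon> \<gamma>" "y \<epsilon> VV \<alpha>" "R x y" using c(2)[OF x(1)] by blast
    then show ?thesis using V_mono[OF c(1)] ordinal_elt[OF c(1)] by (metis VV_V)
  qed
  with c(1) show ?thesis by blast
qed

text \<open>Least values turn \<open>C\<close> into a function, and \<open>closing_off\<close>
  closes \<open>succ \<alpha>\<close> under it; the ordinals so reached form an initial
  segment.\<close>

lemma ord_closing:
  assumes C: "dfn True (\<lambda>e. C (e 0) (e 1))" and tot: "\<And>\<beta>. ordinal \<beta> \<Longrightarrow> \<exists>\<gamma>. ordinal \<gamma> \<and> C \<beta> \<gamma>"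
    and o: "ordinal \<alpha>"
  shows "\<exists>l. ordinal l \<and> \<alpha> \<epsilon> l \<and> (\<forall>\<beta>. \<beta> \<epsilon> l \<longrightarrow> succ \<beta> \<epsilon> l \<and> (\<exists>\<gamma>. \<gamma> \<epsilon> l \<and> C \<beta> \<gamma>))"
proof -
  let ?L = "\<lambda>\<beta> \<gamma>. ordinal \<beta> \<and> ordinal \<gamma> \<and> C \<beta> \<gamma> \<and> (\<forall>\<delta>. \<delta> \<epsilon> \<gamma> \<longrightarrow> \<not> C \<beta> \<delta>)"
  \<comment> \<open>Besides \<open>succ \<beta>\<close> and the least \<open>\<gamma>\<close>, the
    predecessors of both are added; this makes the set of ordinals reached transitive, hence an
    ordinal.\<close>
  let ?H = "\<lambda>\<beta> z. \<exists>\<gamma>. ?L \<beta> \<gamma> \<and> (z \<epsilon> succ (succ \<beta>) \<or> z \<epsilon> succ \<gamma>)"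
  have least: "\<exists>\<gamma>. ?L \<beta> \<gamma>" if b: "ordinal \<beta>" for \<beta>
  proof -
    have "dfn True (\<lambda>e. C \<beta> (e 0))" by (rule dfn_subst2[where P = C, OF C]) (intro dfn_intros)+
    then show ?thesis using ordinal_least[of "C \<beta>"] tot[OF b] b by metis
  qed
  have uniq: "\<gamma> = \<gamma>'" if "?L \<beta> \<gamma>" "?L \<beta> \<gamma>'" for \<beta> \<gamma> \<gamma>'
    using that ordinal_linear[of \<gamma> \<gamma>'] by blast
  define H where "H \<beta> = set_of {z. ?H \<beta> z}" for \<beta>
  have mem: "z \<epsilon> H \<beta> \<longleftrightarrow> ?H \<beta> z" for z \<beta>
  proof -
    have "small {z. ?H \<beta> z}"
    proof (cases "\<exists>\<gamma>. ?L \<beta> \<gamma>")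
      case True
      then obtain \<gamma> where c: "?L \<beta> \<gamma>" by (rule exE)
      show ?thesis
      proof (rule small_Collect[of _ "un (succ (succ \<beta>)) (succ \<gamma>)"])
        show "dfn True (\<lambda>e. ?H \<beta> (e 0))" by (intro dfn_intros dfn_subst2[where P = C, OF C])
        fix z assume "?H \<beta> z"
        then obtain \<gamma>' where c': "?L \<beta> \<gamma>'" "z \<epsilon> succ (succ \<beta>) \<or> z \<epsilon> succ \<gamma>'" by (elim exE conjE) simp
        have "\<gamma> = \<gamma>'" by (rule uniq[OF c c'(1)])
        then show "z \<epsilon> un (succ (succ \<beta>)) (succ \<gamma>)" using c'(2) unfolding mem_un by simp
      qed
    next
      case False
      then have "{z. ?H \<beta> z} = {}" by blast
      then show ?thesis by (simp only: small_empty)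
    qed
    then show ?thesis by (simp only: H_def in_set_of mem_Collect_eq)
  qed
  have "dft True (\<lambda>e. H (e 0))"
    by (rule dft_setI, rule mem, intro dfn_intros dfn_subst2[where P = C, OF C]) simp
  then obtain w where w: "\<forall>x. x \<epsilon> succ \<alpha> \<longrightarrow> x \<epsilon> w" "\<forall>x y. x \<epsilon> w \<longrightarrow> y \<epsilon> H x \<longrightarrow> y \<epsilon> w"
    using closing_off[of H "succ \<alpha>"] by blast
  have "\<exists>l. \<forall>x. x \<epsilon> l \<longleftrightarrow> x \<epsilon> w \<and> ordinal x"
    by (rule comprehension[of _ w], intro dfn_intros) simp
  then obtain l where "\<forall>x. x \<epsilon> l \<longleftrightarrow> x \<epsilon> w \<and> ordinal x" by (rule exE)
  then have l: "x \<epsilon> l \<longleftrightarrow> x \<epsilon> w \<and> ordinal x" for x by (rule spec)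
  have step: "succ \<beta> \<epsilon> l \<and> (\<exists>\<gamma>. \<gamma> \<epsilon> l \<and> C \<beta> \<gamma>)" if b: "\<beta> \<epsilon> l" for \<beta>
  proof -
    have ob: "ordinal \<beta>" "\<beta> \<epsilon> w" using b l by blast+
    obtain \<gamma> where c: "?L \<beta> \<gamma>" using least[OF ob(1)] by (rule exE)
    have "succ \<beta> \<epsilon> w" "\<gamma> \<epsilon> w" using w(2) ob(2) c mem by (meson mem_succ)+
    then show ?thesis using l ob c ordinal_succ by blast
  qed
  have "z \<epsilon> l" if b: "\<beta> \<epsilon> l" and z: "z \<epsilon> \<beta>" for \<beta> z
  proof -
    have ob: "ordinal \<beta>" "\<beta> \<epsilon> w" using b l by blast+
    obtain \<gamma> where c: "?L \<beta> \<gamma>" using least[OF ob(1)] by (rule exE)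
    have "z \<epsilon> H \<beta>" unfolding mem using c z by (intro exI[of _ \<gamma>]) simp
    then show ?thesis using w(2) ob l z ordinal_elt by blast
  qed
  then have "ordinal l" by (rule ordinalI) (auto simp: l)
  moreover have "\<alpha> \<epsilon> l" using l w(1) o by simp
  ultimately show ?thesis using step by blast
qed

lemma nice_V:
  assumes o: "ordinal l" and lim: "\<And>\<beta>. \<beta> \<epsilon> l \<Longrightarrow> succ \<beta> \<epsilon> l" and om: "omega \<epsilon> l"
  shows "nice (elts (V l))"
proof -
  have tr: "y \<epsilon> V l" if "x \<epsilon> V l" "y \<epsilon> x" for x y using V_trans[OF o] that .
  have in_V: "x \<epsilon> V l" if "\<gamma> \<epsilon> l" "\<And>y. y \<epsilon> x \<Longrightarrow> y \<epsilon> V \<gamma>" for x \<gamma>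
  proof -
    have "elts x \<subseteq> elts (V \<gamma>)" using that(2) by auto
    then show ?thesis unfolding mem_V[OF o] using that(1) by (intro exI conjI)
  qed
  have stage: "\<exists>\<alpha>. \<alpha> \<epsilon> l \<and> x \<epsilon> V \<alpha>" if x: "x \<epsilon> V l" for x
  proof -
    obtain \<gamma> where c: "\<gamma> \<epsilon> l" "elts x \<subseteq> elts (V \<gamma>)" using x mem_V[OF o] by blast
    then have "x \<epsilon> V (succ \<gamma>)" using mem_V[of "succ \<gamma>"] ordinal_succ ordinal_elt[OF o] by (metis mem_succ)
    then show ?thesis using lim c by blast
  qed
  have stage2: "\<exists>\<alpha>. \<alpha> \<epsilon> l \<and> x \<epsilon> V \<alpha> \<and> y \<epsilon> V \<alpha>" if xy: "x \<epsilon> V l" "y \<epsilon> V l" for x y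
  proof -
    obtain \<alpha> \<beta> where ab: "\<alpha> \<epsilon> l" "x \<epsilon> V \<alpha>" "\<beta> \<epsilon> l" "y \<epsilon> V \<beta>" using stage xy by blast
    have "ordinal \<alpha>" "ordinal \<beta>" using ab ordinal_elt o by blast+
    then show ?thesis using ab ordinal_linear[of \<alpha> \<beta>] V_mono by blast
  qed
  have ordl: "ordinal \<gamma>" if "\<gamma> \<epsilon> l" for \<gamma> using that o ordinal_elt by blast
  \<comment> \<open>The hereditarily finite sets witness the last clause of
    \<open>nice\<close>.\<close>
  let ?W = "V omega"
  have W: "?W \<epsilon> V l" using V_mem[OF o om] .
  have om_in: "x \<epsilon> ?W" if "\<gamma> \<epsilon> omega" "\<And>y. y \<epsilon> x \<Longrightarrow> y \<epsilon> V \<gamma>" for x \<gamma>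
  proof -
    have "elts x \<subseteq> elts (V \<gamma>)" using that(2) by auto
    then show ?thesis unfolding mem_V[OF ordinal_omega] using that(1) by (intro exI conjI)
  qed
  have om_stage: "\<exists>\<alpha>. \<alpha> \<epsilon> omega \<and> x \<epsilon> V \<alpha>" if x: "x \<epsilon> ?W" for x
  proof -
    obtain \<gamma> where c: "\<gamma> \<epsilon> omega" "elts x \<subseteq> elts (V \<gamma>)" using x mem_V[OF ordinal_omega] by blast
    then have "x \<epsilon> V (succ \<gamma>)" using mem_V[of "succ \<gamma>"] ordinal_succ ordinal_elt[OF ordinal_omega] by (metis mem_succ)
    then show ?thesis using c succ_omega by blast
  qed
  have emptyW: "empty \<epsilon> ?W" by (rule om_in[of empty]) simp_all
  have succW: "succ a \<epsilon> ?W" if a: "a \<epsilon> ?W" for a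
  proof -
    obtain \<alpha> where a: "\<alpha> \<epsilon> omega" "a \<epsilon> V \<alpha>" using om_stage[OF a] by blast
    show ?thesis by (rule om_in[OF a(1)]) (use a V_trans[OF ordinal_nat[OF a(1)]] in auto)
  qed
  have pairW: "upair a b \<epsilon> ?W" if a: "a \<epsilon> ?W" and b: "b \<epsilon> ?W" for a b
  proof -
    obtain \<alpha> \<beta> where ab: "\<alpha> \<epsilon> omega" "a \<epsilon> V \<alpha>" "\<beta> \<epsilon> omega" "b \<epsilon> V \<beta>" using om_stage a b by blast
    have "ordinal \<alpha>" "ordinal \<beta>" using ab ordinal_nat by blast+
    then have "\<exists>\<alpha>. \<alpha> \<epsilon> omega \<and> a \<epsilon> V \<alpha> \<and> b \<epsilon> V \<alpha>" using ab ordinal_linear[of \<alpha> \<beta>] V_mono by blast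
    then obtain \<alpha> where "\<alpha> \<epsilon> omega" "a \<epsilon> V \<alpha>" "b \<epsilon> V \<alpha>" by blast
    then show ?thesis by (intro om_in[of \<alpha>]) auto
  qed
  show ?thesis unfolding nice_def
  proof (intro conjI)
    show "\<forall>x\<in>elts (V l). \<forall>y. y \<epsilon> x \<longrightarrow> y \<in> elts (V l)" using tr by simp
    show "\<forall>x\<in>elts (V l). \<forall>y. elts y \<subseteq> elts x \<longrightarrow> y \<in> elts (V l)" using V_subset[OF o] by simp
    show "\<forall>x\<in>elts (V l). \<forall>y\<in>elts (V l). \<exists>p\<in>elts (V l). x \<epsilon> p \<and> y \<epsilon> p"
    proof (intro ballI)
      fix x y assume "x \<in> elts (V l)" "y \<in> elts (V l)"
      then obtain \<alpha> where "\<alpha> \<epsilon> l" "x \<epsilon> V \<alpha>" "y \<epsilon> V \<alpha>" using stage2 by auto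
      then have "upair x y \<epsilon> V l" by (intro in_V[of \<alpha>]) auto
      then show "\<exists>p\<in>elts (V l). x \<epsilon> p \<and> y \<epsilon> p" by (intro bexI[of _ "upair x y"]) auto
    qed
    show "\<forall>x\<in>elts (V l). \<exists>u\<in>elts (V l). \<forall>y\<in>elts (V l). y \<epsilon> x \<longrightarrow> (\<forall>z\<in>elts (V l). z \<epsilon> y \<longrightarrow> z \<epsilon> u)"
    proof
      fix x assume "x \<in> elts (V l)"
      then obtain \<alpha> where a: "\<alpha> \<epsilon> l" "x \<epsilon> V \<alpha>" using stage by auto
      have "sUn x \<epsilon> V l" by (rule in_V[OF a(1)]) (metis mem_sUn V_trans[OF ordl[OF a(1)]] a(2))
      then show "\<exists>u\<in>elts (V l). \<forall>y\<in>elts (V l). y \<epsilon> x \<longrightarrow> (\<forall>z\<in>elts (V l). z \<epsilon> y \<longrightarrow> z \<epsilon> u)"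
        by (intro bexI[of _ "sUn x"]) auto
    qed
    show "\<forall>x\<in>elts (V l). \<exists>p\<in>elts (V l). \<forall>y\<in>elts (V l). (\<forall>z\<in>elts (V l). z \<epsilon> y \<longrightarrow> z \<epsilon> x) \<longrightarrow> y \<epsilon> p"
    proof
      fix x assume x: "x \<in> elts (V l)"
      then obtain \<alpha> where a: "\<alpha> \<epsilon> l" "x \<epsilon> V \<alpha>" using stage by auto
      have "pow x \<epsilon> V l" using V_subset[OF ordl a(2)] a by (intro in_V[of \<alpha>]) auto
      then show "\<exists>p\<in>elts (V l). \<forall>y\<in>elts (V l). (\<forall>z\<in>elts (V l). z \<epsilon> y \<longrightarrow> z \<epsilon> x) \<longrightarrow> y \<epsilon> p"
        using tr by (intro bexI[of _ "pow x"]) (auto simp: subset_iff)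
    qed
    show "\<exists>W\<in>elts (V l). (\<exists>z\<in>elts (V l). z \<epsilon> W \<and> (\<forall>u\<in>elts (V l). \<not> u \<epsilon> z)) \<and>
      (\<forall>a\<in>elts (V l). a \<epsilon> W \<longrightarrow> (\<exists>c\<in>elts (V l). c \<epsilon> W \<and> (\<forall>u\<in>elts (V l). u \<epsilon> c \<longleftrightarrow> u \<epsilon> a \<or> u = a)) \<and>
        (\<forall>b\<in>elts (V l). b \<epsilon> W \<longrightarrow> (\<exists>c\<in>elts (V l). c \<epsilon> W \<and> (\<forall>u\<in>elts (V l). u \<epsilon> c \<longleftrightarrow> u = a \<or> u = b))))"
    proof (rule bexI[of _ ?W], intro conjI ballI impI)
      show "\<exists>z\<in>elts (V l). z \<epsilon> ?W \<and> (\<forall>u\<in>elts (V l). \<not> u \<epsilon> z)"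
        by (rule bexI[of _ empty]) (use emptyW tr[OF W] in auto)
      show "\<exists>c\<in>elts (V l). c \<epsilon> ?W \<and> (\<forall>u\<in>elts (V l). u \<epsilon> c \<longleftrightarrow> u \<epsilon> a \<or> u = a)" if "a \<epsilon> ?W" for a
        by (rule bexI[of _ "succ a"]) (use succW[OF that] tr[OF W] in auto)
      show "\<exists>c\<in>elts (V l). c \<epsilon> ?W \<and> (\<forall>u\<in>elts (V l). u \<epsilon> c \<longleftrightarrow> u = a \<or> u = b)" if "a \<epsilon> ?W" "b \<epsilon> ?W" for a b
        by (rule bexI[of _ "upair a b"]) (use pairW[OF that] tr[OF W] in auto)
    qed (simp add: W)
  qed
qed

lemma ex_nice: "\<exists>l. ordinal l \<and> nice (elts (V l)) \<and> x \<epsilon> V l"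
proof -
  obtain \<alpha> where a: "ordinal \<alpha>" "x \<epsilon> V \<alpha>" using all_in_V by blast
  \<comment> \<open>With the trivial relation, \<open>ord_closing\<close> just yields a limit above
    \<alpha> and \<open>omega\<close>.\<close>
  have "\<exists>l. ordinal l \<and> un \<alpha> omega \<epsilon> l \<and> (\<forall>\<beta>. \<beta> \<epsilon> l \<longrightarrow> succ \<beta> \<epsilon> l \<and> (\<exists>\<gamma>. \<gamma> \<epsilon> l \<and> True))"
    by (rule ord_closing) (intro dfn_intros ordinal_un a ordinal_omega | use ordinal_empty in blast)+
  then obtain l where l: "ordinal l" "un \<alpha> omega \<epsilon> l" "\<And>\<beta>. \<beta> \<epsilon> l \<Longrightarrow> succ \<beta> \<epsilon> l" by blast
  have "\<beta> \<epsilon> l" if "ordinal \<beta>" "\<And>z. z \<epsilon> \<beta> \<Longrightarrow> z \<epsilon> un \<alpha> omega" for \<beta>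
    using ordinal_sub[OF that(1) ordinal_un[OF a(1) ordinal_omega]] that(2) l ordinal_trans by metis
  then have "\<alpha> \<epsilon> l" "omega \<epsilon> l" using a ordinal_omega by auto
  then show ?thesis using l nice_V[OF l(1) l(3)] a V_mono by blast
qed

text \<open>If every ordinal injected into \<open>a\<close>, each would be coded by its order
  carried over to \<open>a\<close>, a subset of \<open>cprod a a\<close>. Collection yields an
  ordinal \<gamma> such that every code in use is the code of some ordinal below \<gamma>. But
  \<gamma> has a code too, and a code determines its ordinal.\<close>

lemma hartogs: "\<exists>\<gamma>. ordinal \<gamma> \<and> \<not> (\<exists>f. injects f \<gamma> a)"
proof (rule ccontr)
  assume "\<not> ?thesis"
  then have inj: "\<exists>f. injects f \<gamma> a" if "ordinal \<gamma>" for \<gamma> using that by blast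
  \<comment> \<open>Taking \<open>succ y\<close> gives the reflexive order. It puts each image on
    the diagonal, so the range of \<open>f\<close> can be read off even if the ordinal has a single
    element.\<close>
  let ?M = "\<lambda>f \<gamma> z. \<exists>x y. y \<epsilon> \<gamma> \<and> x \<epsilon> succ y \<and> z = opair (ap f x) (ap f y)"
  let ?R = "\<lambda>r \<gamma>. \<exists>f. injects f \<gamma> a \<and> (\<forall>z. z \<epsilon> r \<longleftrightarrow> ?M f \<gamma> z)"
  have "\<exists>\<gamma>. ordinal \<gamma> \<and> (\<forall>x. x \<epsilon> pow (cprod a a) \<longrightarrow> (\<exists>\<alpha>. ordinal \<alpha> \<and> ?R x \<alpha>) \<longrightarrow> (\<exists>\<alpha>. \<alpha> \<epsilon> \<gamma> \<and> ?R x \<alpha>))"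
    by (rule collection_ord) (intro dfn_intros)
  then obtain \<gamma> where c: "ordinal \<gamma>" "\<And>x. x \<epsilon> pow (cprod a a) \<Longrightarrow> \<exists>\<alpha>. ordinal \<alpha> \<and> ?R x \<alpha> \<Longrightarrow> \<exists>\<alpha>. \<alpha> \<epsilon> \<gamma> \<and> ?R x \<alpha>"
    by blast
  obtain g where g: "injects g \<gamma> a" using inj[OF c(1)] by blast
  have dom: "x \<epsilon> \<alpha>" if "ordinal \<alpha>" "y \<epsilon> \<alpha>" "x \<epsilon> succ y" for x y \<alpha> using that ordinal_trans by (metis mem_succ)
  have bnd: "?M f \<alpha> z \<Longrightarrow> z \<epsilon> cprod a a" if "injects f \<alpha> a" "ordinal \<alpha>" for f \<alpha> z
  proof (elim exE conjE)
    fix x y assume "y \<epsilon> \<alpha>" "x \<epsilon> succ y" "z = opair (ap f x) (ap f y)"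
    then show "z \<epsilon> cprod a a" using that dom[OF that(2), of y x] unfolding injects_iff maps_iff by simp
  qed
  have "\<exists>r. \<forall>z. z \<epsilon> r \<longleftrightarrow> ?M g \<gamma> z"
    by (rule comprehension[of _ "cprod a a"], intro dfn_intros) (rule bnd[OF g c(1)])
  then obtain r where r: "\<forall>z. z \<epsilon> r \<longleftrightarrow> ?M g \<gamma> z" by (rule exE)
  have "r \<epsilon> pow (cprod a a)" using r bnd[OF g c(1)] by auto
  moreover have "\<exists>\<alpha>. ordinal \<alpha> \<and> ?R r \<alpha>" using c g r by blast
  ultimately obtain \<alpha> where a: "\<alpha> \<epsilon> \<gamma>" "?R r \<alpha>" using c(2) by blast
  then obtain f where f: "injects f \<alpha> a" "\<forall>z. z \<epsilon> r \<longleftrightarrow> ?M f \<alpha> z" by blast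
  have oa: "ordinal \<alpha>" using a c ordinal_elt by blast
  have mem: "opair (ap f x) (ap f y) \<epsilon> r \<longleftrightarrow> x \<epsilon> succ y" if "injects f \<alpha> a" "\<forall>z. z \<epsilon> r \<longleftrightarrow> ?M f \<alpha> z" "ordinal \<alpha>" "x \<epsilon> \<alpha>" "y \<epsilon> \<alpha>" for f \<alpha> x y
  proof
    assume "opair (ap f x) (ap f y) \<epsilon> r"
    then have "?M f \<alpha> (opair (ap f x) (ap f y))" using that(2) by blast
    then obtain u v where uv: "v \<epsilon> \<alpha>" "u \<epsilon> succ v" "ap f x = ap f u" "ap f y = ap f v"
      by (elim exE conjE) (simp only: opair_inject)
    have "x = u" "y = v" using that(1,4,5) uv dom[OF that(3) uv(1,2)] unfolding injects_iff by blast+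
    then show "x \<epsilon> succ y" using uv by simp
  next
    assume "x \<epsilon> succ y"
    then show "opair (ap f x) (ap f y) \<epsilon> r" using that by blast
  qed
  have fld: "x \<epsilon> \<alpha> \<Longrightarrow> opair (ap f x) (ap f x) \<epsilon> r" if "injects f \<alpha> a" "\<forall>z. z \<epsilon> r \<longleftrightarrow> ?M f \<alpha> z" "ordinal \<alpha>" for f \<alpha> x
    using mem[OF that, of x x] by simp
  have fld2: "\<exists>x. x \<epsilon> \<alpha> \<and> ap f x = u" if "injects f \<alpha> a" "\<forall>z. z \<epsilon> r \<longleftrightarrow> ?M f \<alpha> z" "ordinal \<alpha>" "opair u u \<epsilon> r" for f \<alpha> u
  proof -
    have "?M f \<alpha> (opair u u)" using that(2,4) by blast
    then show ?thesis by (elim exE conjE) (metis opair_inject)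
  qed
  have "\<alpha> = \<gamma>"
  proof (rule transitive_iso[where h = "\<lambda>x y. ap f x = ap g y"])
    show "dfn True (\<lambda>e. ap f (e 0) = ap g (e 1))" by (intro dfn_intros)
    show "transitive_set \<alpha>" "transitive_set \<gamma>" using oa c(1) ordinal_def by blast+
    show "\<exists>y. y \<epsilon> \<gamma> \<and> ap f x = ap g y" if "x \<epsilon> \<alpha>" for x
      using fld2[OF g r c(1) fld[OF f oa that]] by metis
    show "\<exists>x. x \<epsilon> \<alpha> \<and> ap f x = ap g y" if "y \<epsilon> \<gamma>" for y
      using fld2[OF f oa fld[OF g r c(1) that]] by metis
    show "y \<epsilon> x \<longleftrightarrow> y' \<epsilon> x'" if "x \<epsilon> \<alpha>" "y \<epsilon> \<alpha>" "x' \<epsilon> \<gamma>" "y' \<epsilon> \<gamma>" "ap f x = ap g x'" "ap f y = ap g y'" for x x' y y'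
    proof -
      have "y \<epsilon> succ x \<longleftrightarrow> y' \<epsilon> succ x'"
        using mem[OF f oa that(2,1)] mem[OF g r c(1) that(4,3)] that(5,6) by simp
      moreover have "y = x \<longleftrightarrow> y' = x'"
        using f(1) g that unfolding injects_iff by metis
      ultimately show ?thesis by (metis mem_succ mem_irrefl)
    qed
  qed
  then show False using a by simp
qed

subsection \<open>Choice and inaccessible cardinals\<close>

lemma choice_fun: "\<exists>c. \<forall>s. elts s \<subseteq> elts A \<longrightarrow> s \<noteq> empty \<longrightarrow> ap c s \<epsilon> s"
proof -
  have "\<exists>N. \<forall>s. s \<epsilon> N \<longleftrightarrow> elts s \<subseteq> elts A \<and> s \<noteq> empty"
    by (rule comprehension[of _ "pow A"], intro dfn_intros) simp
  then obtain N where "\<forall>s. s \<epsilon> N \<longleftrightarrow> elts s \<subseteq> elts A \<and> s \<noteq> empty" by (rule exE)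
  then have N: "s \<epsilon> N \<longleftrightarrow> elts s \<subseteq> elts A \<and> s \<noteq> empty" for s by (rule spec)
  \<comment> \<open>Tagging the elements of s with s makes the sets disjoint, as this form of the
    axiom of choice demands.\<close>
  let ?F = "\<lambda>s. cprod (upair s s) s"
  have F: "dft True (\<lambda>e. ?F (e 0))" by (intro dfn_intros)
  have pair: "z \<epsilon> ?F s \<longleftrightarrow> (\<exists>y. y \<epsilon> s \<and> z = opair s y)" for z s by (auto simp: mem_cprod)
  have "\<forall>x. (\<forall>y. y \<epsilon> x \<longrightarrow> (\<exists>z. z \<epsilon> y)) \<and>
      (\<forall>y y'. y \<epsilon> x \<and> y' \<epsilon> x \<and> y \<noteq> y' \<longrightarrow> \<not> (\<exists>z. z \<epsilon> y \<and> z \<epsilon> y')) \<longrightarrow>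
      (\<exists>c. \<forall>y. y \<epsilon> x \<longrightarrow> (\<exists>!z :: 'a. z \<epsilon> y \<and> z \<epsilon> c))"
  proof -
    have "ax_choice UNIV ((\<epsilon>) :: 'a \<Rightarrow> 'a \<Rightarrow> bool)"
      using base_axioms[where 'a = 'a] unfolding base_axioms_def by (elim conjE)
    then show ?thesis unfolding ax_choice_def by simp
  qed
  from spec[OF this, of "rep ?F N"]
  have "\<exists>c. \<forall>y. y \<epsilon> rep ?F N \<longrightarrow> (\<exists>!z. z \<epsilon> y \<and> z \<epsilon> c)"
  proof (rule mp, intro conjI allI impI)
    fix y assume "y \<epsilon> rep ?F N"
    then obtain s where s: "s \<epsilon> N" "y = ?F s" unfolding mem_rep[OF F] by (elim exE conjE)
    then obtain u where "u \<epsilon> s" unfolding N empty_iff by blast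
    then have "opair s u \<epsilon> y" unfolding s(2) by simp
    then show "\<exists>z. z \<epsilon> y" by (rule exI)
  next
    fix y y' assume y: "y \<epsilon> rep ?F N \<and> y' \<epsilon> rep ?F N \<and> y \<noteq> y'"
    obtain s where s: "y = ?F s" using y unfolding mem_rep[OF F] by (elim exE conjE)
    obtain s' where s': "y' = ?F s'" using y unfolding mem_rep[OF F] by (elim exE conjE)
    have "s \<noteq> s'" using y s s' by blast
    then show "\<not> (\<exists>z. z \<epsilon> y \<and> z \<epsilon> y')" unfolding s s' pair by (metis opair_inject)
  qed
  then obtain c where c: "\<forall>y. y \<epsilon> rep ?F N \<longrightarrow> (\<exists>!z. z \<epsilon> y \<and> z \<epsilon> c)" by (rule exE)
  let ?P = "\<lambda>p. p \<epsilon> c \<and> (\<exists>s. s \<epsilon> pow A \<and> (\<exists>y. y \<epsilon> s \<and> p = opair s y))"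
  have "\<exists>d. \<forall>p. p \<epsilon> d \<longleftrightarrow> ?P p"
    by (rule comprehension[of _ c], intro dfn_intros) simp
  then obtain d where "\<forall>p. p \<epsilon> d \<longleftrightarrow> ?P p" by (rule exE)
  then have d: "p \<epsilon> d \<longleftrightarrow> ?P p" for p by (rule spec)
  have "ap d s \<epsilon> s" if s: "elts s \<subseteq> elts A" "s \<noteq> empty" for s
  proof -
    have "?F s \<epsilon> rep ?F N" unfolding mem_rep[OF F] using s by (intro exI[of _ s]) (simp add: N)
    then have ex1: "\<exists>!z. z \<epsilon> ?F s \<and> z \<epsilon> c" using c by blast
    then obtain z where z: "z \<epsilon> ?F s" "z \<epsilon> c" by blast
    then obtain y where y: "y \<epsilon> s" "z = opair s y" unfolding pair by blast
    have "ap d s = y"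
    proof (rule ap_eqI)
      show "opair s y \<epsilon> d" unfolding d using y z s by auto
      fix y' assume "opair s y' \<epsilon> d"
      then have "opair s y' \<epsilon> ?F s \<and> opair s y' \<epsilon> c" unfolding d by auto
      then show "y' = y" using ex1 z y by (metis opair_inject)
    qed
    with y show ?thesis by simp
  qed
  then show ?thesis by blast
qed

text \<open>Zermelo's argument: new elements are chosen along the ordinals until none is left, and
  \<open>hartogs\<close> forces the process to stop.\<close>

lemma well_ordering: "\<exists>\<gamma> f. ordinal \<gamma> \<and> bijects f \<gamma> A"
proof -
  obtain c where c: "\<And>s. elts s \<subseteq> elts A \<Longrightarrow> s \<noteq> empty \<Longrightarrow> ap c s \<epsilon> s" using choice_fun[of A] by blast
  \<comment> \<open>The value \<open>A\<close>, which is not an element of \<open>A\<close>, signals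
    exhaustion.\<close>
  define G where "G X = (if elts A \<subseteq> elts X then A else ap c (dif A X))" for X
  have G: "dft True (\<lambda>e. G (e 0))"
  proof (rule dft_setI)
    show "z \<epsilon> G (e 0) \<longleftrightarrow> (\<lambda>z e. (elts A \<subseteq> elts (e 0) \<and> z \<epsilon> A) \<or> (\<not> elts A \<subseteq> elts (e 0) \<and> z \<epsilon> ap c (dif A (e 0)))) z e"
      for z and e :: "nat \<Rightarrow> 'a" by (simp add: G_def)
  qed (intro dfn_intros, simp)
  have pick: "ap c (dif A X) \<epsilon> A \<and> \<not> ap c (dif A X) \<epsilon> X" if "\<not> elts A \<subseteq> elts X" for X
  proof -
    have "dif A X \<noteq> empty" using that unfolding empty_iff by auto
    then have "ap c (dif A X) \<epsilon> dif A X" by (intro c) auto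
    then show ?thesis by simp
  qed
  have rec: "(ord_rec G \<alpha> = A \<and> (\<forall>y. y \<epsilon> A \<longrightarrow> (\<exists>\<gamma>. \<gamma> \<epsilon> \<alpha> \<and> y = ord_rec G \<gamma>))) \<or>
      (ord_rec G \<alpha> \<epsilon> A \<and> (\<forall>\<gamma>. \<gamma> \<epsilon> \<alpha> \<longrightarrow> ord_rec G \<alpha> \<noteq> ord_rec G \<gamma>))" if o: "ordinal \<alpha>" for \<alpha>
  proof -
    obtain X where X: "\<And>z. z \<epsilon> X \<longleftrightarrow> (\<exists>\<gamma>. \<gamma> \<epsilon> \<alpha> \<and> z = ord_rec G \<gamma>)" "ord_rec G \<alpha> = G X"
      using ord_rec_unfold[OF G o] by blast
    show ?thesis
    proof (cases "elts A \<subseteq> elts X")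
      case True
      then have "ord_rec G \<alpha> = A" using X by (simp add: G_def)
      moreover have "\<exists>\<gamma>. \<gamma> \<epsilon> \<alpha> \<and> y = ord_rec G \<gamma>" if "y \<epsilon> A" for y
        using True that X(1)[of y] by auto
      ultimately show ?thesis by blast
    next
      case False
      then have "ord_rec G \<alpha> = ap c (dif A X)" using X by (simp add: G_def)
      then have "ord_rec G \<alpha> \<epsilon> A" "\<not> ord_rec G \<alpha> \<epsilon> X" using pick[OF False] by simp_all
      then show ?thesis unfolding X(1) by blast
    qed
  qed
  have "\<exists>\<alpha>. ordinal \<alpha> \<and> ord_rec G \<alpha> = A"
  proof (rule ccontr)
    assume none: "\<not> ?thesis"
    obtain \<gamma> where g: "ordinal \<gamma>" "\<not> (\<exists>f. injects f \<gamma> A)" using hartogs by blast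
    obtain f where f: "isrec G f (succ \<gamma>)" using isrec_ex[OF G g(1)] by blast
    have ap: "ap (lam \<gamma> (ap f)) x = ord_rec G x" if "x \<epsilon> \<gamma>" for x
      using ap_lam[of "ap f" x \<gamma>] isrec_ord_rec[OF G g(1) f, of x] that by (simp add: dfn_intros)
    have o: "ordinal x" if "x \<epsilon> \<gamma>" for x using that g ordinal_elt by blast
    have r: "ord_rec G x \<epsilon> A" "\<And>y. y \<epsilon> x \<Longrightarrow> ord_rec G x \<noteq> ord_rec G y" if "x \<epsilon> \<gamma>" for x
      using rec[OF o[OF that]] none o[OF that] by blast+
    have "injects (lam \<gamma> (ap f)) \<gamma> A" unfolding injects_iff maps_iff
    proof (intro conjI allI impI)
      show "fun_on (lam \<gamma> (ap f)) \<gamma>" by (rule fun_on_lam) (intro dfn_intros)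
      show "ap (lam \<gamma> (ap f)) x \<epsilon> A" if "x \<epsilon> \<gamma>" for x using ap r that by simp
      show "x = y" if "x \<epsilon> \<gamma>" "y \<epsilon> \<gamma>" "ap (lam \<gamma> (ap f)) x = ap (lam \<gamma> (ap f)) y" for x y
        using that ap r(2) ordinal_linear[OF o[OF that(1)] o[OF that(2)]] by metis
    qed
    then show False using g by blast
  qed
  then obtain \<alpha>0 where a0: "ordinal \<alpha>0" "ord_rec G \<alpha>0 = A" by blast
  have "dfn True (\<lambda>e. ordinal (e 0) \<and> A = ord_rec G (e 0))"
    by (rule ord_rec_dfn_True[OF G]) (intro dfn_intros)+
  then obtain \<alpha> where a: "ordinal \<alpha>" "A = ord_rec G \<alpha>"
    and least: "\<And>\<gamma>. \<gamma> \<epsilon> \<alpha> \<Longrightarrow> \<not> (ordinal \<gamma> \<and> A = ord_rec G \<gamma>)"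
    using ordinal_least[of "\<lambda>x. ordinal x \<and> A = ord_rec G x" \<alpha>0] a0 by blast
  obtain f where f: "isrec G f (succ \<alpha>)" using isrec_ex[OF G a(1)] by blast
  have ap: "ap (lam \<alpha> (ap f)) x = ord_rec G x" if "x \<epsilon> \<alpha>" for x
    using ap_lam[of "ap f" x \<alpha>] isrec_ord_rec[OF G a(1) f, of x] that by (simp add: dfn_intros)
  have o: "ordinal x" if "x \<epsilon> \<alpha>" for x using that a ordinal_elt by blast
  have r: "ord_rec G x \<epsilon> A" "\<And>y. y \<epsilon> x \<Longrightarrow> ord_rec G x \<noteq> ord_rec G y" if "x \<epsilon> \<alpha>" for x
    using rec[OF o[OF that]] least[OF that] o[OF that] by blast+
  have onto: "\<exists>\<gamma>. \<gamma> \<epsilon> \<alpha> \<and> y = ord_rec G \<gamma>" if "y \<epsilon> A" for y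
    using rec[OF a(1)] a(2) that by (metis mem_irrefl)
  have "bijects (lam \<alpha> (ap f)) \<alpha> A" unfolding bijects_iff injects_iff maps_iff
  proof (intro conjI allI impI)
    show "fun_on (lam \<alpha> (ap f)) \<alpha>" by (rule fun_on_lam) (intro dfn_intros)
    show "ap (lam \<alpha> (ap f)) x \<epsilon> A" if "x \<epsilon> \<alpha>" for x using ap r that by simp
    show "x = y" if "x \<epsilon> \<alpha>" "y \<epsilon> \<alpha>" "ap (lam \<alpha> (ap f)) x = ap (lam \<alpha> (ap f)) y" for x y
      using that ap r(2) ordinal_linear[OF o[OF that(1)] o[OF that(2)]] by metis
    show "\<exists>x. x \<epsilon> \<alpha> \<and> ap (lam \<alpha> (ap f)) x = y" if "y \<epsilon> A" for y
      using onto[OF that] ap by metis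
  qed
  with a show ?thesis by blast
qed

lemma bijects_inverse: "bijects f a b \<Longrightarrow> \<exists>g. injects g b a"
proof -
  assume b: "bijects f a b"
  have f: "fun_on f a" "\<And>x. x \<epsilon> a \<Longrightarrow> ap f x \<epsilon> b" "\<And>x y. x \<epsilon> a \<Longrightarrow> y \<epsilon> a \<Longrightarrow> ap f x = ap f y \<Longrightarrow> x = y"
    "\<And>y. y \<epsilon> b \<Longrightarrow> \<exists>x. x \<epsilon> a \<and> ap f x = y"
    using b unfolding bijects_iff injects_iff maps_iff by blast+
  let ?g = "rep (\<lambda>x. opair (ap f x) x) a"
  have mem: "p \<epsilon> ?g \<longleftrightarrow> (\<exists>x. x \<epsilon> a \<and> p = opair (ap f x) x)" for p
    by (rule mem_rep) (intro dfn_intros)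
  have g: "fun_on ?g b"
  proof (rule fun_onI)
    show "\<exists>x y. x \<epsilon> b \<and> p = opair x y" if "p \<epsilon> ?g" for p using that f(2) unfolding mem by blast
    show "\<exists>x. opair y x \<epsilon> ?g" if "y \<epsilon> b" for y using f(4)[OF that] unfolding mem by metis
    show "x = x'" if "opair y x \<epsilon> ?g" "opair y x' \<epsilon> ?g" for y x x'
      using that f(3) unfolding mem opair_inject by metis
  qed
  have inv: "ap ?g y \<epsilon> a \<and> ap f (ap ?g y) = y" if "y \<epsilon> b" for y
  proof -
    have "opair y (ap ?g y) \<epsilon> ?g" using fun_on_ap[OF g that] by simp
    then show ?thesis unfolding mem opair_inject by metis
  qed
  have "injects ?g b a" unfolding injects_iff maps_iff using g inv by metis
  then show ?thesis by blast
qed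

text \<open>The definition of inaccessibility does not mention limits; regularity for a constant
  function on one point supplies an ordinal strictly between \<alpha> and \<kappa>.\<close>

lemma inaccessible_succ: "inaccessible \<kappa> \<Longrightarrow> \<alpha> \<epsilon> \<kappa> \<Longrightarrow> succ \<alpha> \<epsilon> \<kappa>"
proof -
  assume k: "inaccessible \<kappa>" and a: "\<alpha> \<epsilon> \<kappa>"
  have o: "ordinal \<kappa>" and om: "omega \<epsilon> \<kappa>" using k by (simp_all add: inaccessible_def cardinal_def)
  have reg: "\<exists>\<delta>. \<delta> \<epsilon> \<kappa> \<and> (\<forall>x. x \<epsilon> \<beta> \<longrightarrow> app f x \<epsilon> \<delta>)" if "\<beta> \<epsilon> \<kappa>" "maps f \<beta> \<kappa>" for \<beta> f
    using k that unfolding inaccessible_def Ball_def Bex_def in_elts by blast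
  let ?f = "lam (succ empty) (\<lambda>_. \<alpha>)"
  have c: "dft True (\<lambda>e :: nat \<Rightarrow> 'a. \<alpha>)" by (intro dfn_intros)
  have m: "maps ?f (succ empty) \<kappa>" unfolding maps_iff using fun_on_lam[OF c] ap_lam[OF c] a by simp
  have "succ empty \<epsilon> \<kappa>" using ordinal_trans[OF o om] by simp
  then obtain \<delta> where d: "\<delta> \<epsilon> \<kappa>" "app ?f empty \<epsilon> \<delta>" using reg m by (metis mem_succ)
  have "app ?f empty = \<alpha>" using fun_on_app[OF fun_on_lam[OF c], of empty] ap_lam[OF c] by simp
  then have "\<alpha> \<epsilon> \<delta>" using d by simp
  then have "succ \<alpha> = \<delta> \<or> succ \<alpha> \<epsilon> \<delta>"
    using ordinal_succ_cases d o a ordinal_elt by metis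
  then show ?thesis using d ordinal_trans[OF o] by metis
qed

lemma inaccessible_ordinal: "inaccessible \<kappa> \<Longrightarrow> ordinal \<kappa>"
  by (simp add: inaccessible_def cardinal_def)

lemma inaccessible_omega: "inaccessible \<kappa> \<Longrightarrow> omega \<epsilon> \<kappa>"
  by (simp add: inaccessible_def)

lemma nice_V_inaccessible: "inaccessible \<kappa> \<Longrightarrow> nice (elts (V \<kappa>))"
  by (rule nice_V) (auto intro: inaccessible_succ inaccessible_ordinal inaccessible_omega)

text \<open>Zermelo's theorem. Infinity gives \<open>omega\<close>, and second-order replacement
  bounds functions into \<kappa>. For the strong limit property, a well-order of a power set cannot
  have length \<kappa> or more, since replacement would then put \<kappa> itself into
  \<open>V \<kappa>\<close>.\<close>

lemma zfc2_model_inaccessible: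
  assumes card: "cardinal \<kappa>" and z: "zfc2_model (V \<kappa>) (mem_rel (V \<kappa>))"
  shows "inaccessible \<kappa>"
proof -
  have o: "ordinal \<kappa>" using card by (simp add: cardinal_def)
  let ?r = "\<lambda>x y. opair x y \<epsilon> mem_rel (V \<kappa>)"
  have base: "base_axioms (elts (V \<kappa>)) ?r"
    and repl: "\<And>F. elts F \<subseteq> elts (cprod (V \<kappa>) (V \<kappa>)) \<Longrightarrow> replacement_for (elts (V \<kappa>)) ?r (\<lambda>x y. opair x y \<epsilon> F)"
    using z unfolding zfc2_model_def Let_def by blast+
  have tr: "y \<epsilon> V \<kappa>" if "x \<epsilon> V \<kappa>" "y \<epsilon> x" for x y using V_trans[OF o] that .
  have "\<exists>w\<in>elts (V \<kappa>). (\<exists>e\<in>elts (V \<kappa>). ?r e w \<and> (\<forall>z\<in>elts (V \<kappa>). \<not> ?r z e)) \<and>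
      (\<forall>x\<in>elts (V \<kappa>). ?r x w \<longrightarrow> (\<exists>y\<in>elts (V \<kappa>). ?r y w \<and> (\<forall>z\<in>elts (V \<kappa>). ?r z y \<longleftrightarrow> ?r z x \<or> z = x)))"
    using base unfolding base_axioms_def ax_infinity_def by (elim conjE)
  then obtain w where w: "w \<in> elts (V \<kappa>)" and es: "(\<exists>e\<in>elts (V \<kappa>). ?r e w \<and> (\<forall>z\<in>elts (V \<kappa>). \<not> ?r z e)) \<and>
      (\<forall>x\<in>elts (V \<kappa>). ?r x w \<longrightarrow> (\<exists>y\<in>elts (V \<kappa>). ?r y w \<and> (\<forall>z\<in>elts (V \<kappa>). ?r z y \<longleftrightarrow> ?r z x \<or> z = x)))"
    by (rule bexE)
  have w: "w \<epsilon> V \<kappa>" using w by simp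
  note e = conjunct1[OF es] and s = conjunct2[OF es]
  obtain e0 where e0: "e0 \<in> elts (V \<kappa>)" "?r e0 w \<and> (\<forall>z\<in>elts (V \<kappa>). \<not> ?r z e0)" using e by (rule bexE)
  then have "e0 = empty" unfolding empty_iff using tr[of e0] by auto
  then have "empty \<epsilon> w" using e0 by simp
  moreover have "succ x \<epsilon> w" if x: "x \<epsilon> w" for x
  proof -
    have xV: "x \<epsilon> V \<kappa>" using tr w x by blast
    then have "x \<in> elts (V \<kappa>)" "?r x w" using w x by simp_all
    then obtain y where "y \<in> elts (V \<kappa>)" and y': "?r y w \<and> (\<forall>z\<in>elts (V \<kappa>). ?r z y \<longleftrightarrow> ?r z x \<or> z = x)"
      using s by blast
    then have y: "y \<epsilon> V \<kappa> \<and> y \<epsilon> w \<and> (\<forall>z. z \<epsilon> V \<kappa> \<longrightarrow> (z \<epsilon> y \<longleftrightarrow> z \<epsilon> x \<or> z = x))" using xV by simp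
    have "y = succ x"
    proof (rule set_ext)
      fix z show "z \<epsilon> y \<longleftrightarrow> z \<epsilon> succ x"
        using y xV tr[of y z] tr[OF xV, of z] unfolding mem_succ by blast
    qed
    with y show ?thesis by simp
  qed
  ultimately have "n \<epsilon> w" if "n \<epsilon> omega" for n using that unfolding mem_omega by blast
  then have "omega \<epsilon> V \<kappa>" by (intro V_subset[OF o w]) auto
  then have om: "omega \<epsilon> \<kappa>" using ordinal_in_V[OF o ordinal_omega] by simp
  have image: "\<exists>b. b \<epsilon> V \<kappa> \<and> (\<forall>y. y \<epsilon> b \<longleftrightarrow> (\<exists>x. x \<epsilon> a \<and> opair x y \<epsilon> F))"
    if a: "a \<epsilon> V \<kappa>" and F: "\<And>x y. opair x y \<epsilon> F \<Longrightarrow> x \<epsilon> V \<kappa> \<and> y \<epsilon> V \<kappa>" "\<And>p. p \<epsilon> F \<Longrightarrow> \<exists>x y. p = opair x y"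
      and ex1: "\<And>x. x \<epsilon> a \<Longrightarrow> \<exists>!y. opair x y \<epsilon> F" for a F
  proof -
    have "elts F \<subseteq> elts (cprod (V \<kappa>) (V \<kappa>))" using F by (metis in_elts opair_in_cprod subsetI)
    from repl[OF this] have "(\<forall>x. x \<epsilon> V \<kappa> \<longrightarrow> x \<epsilon> a \<longrightarrow> (\<exists>!y. y \<epsilon> V \<kappa> \<and> opair x y \<epsilon> F)) \<longrightarrow>
      (\<exists>b. b \<epsilon> V \<kappa> \<and> (\<forall>y. y \<epsilon> V \<kappa> \<longrightarrow> (y \<epsilon> b \<longleftrightarrow> (\<exists>x. x \<epsilon> V \<kappa> \<and> x \<epsilon> a \<and> opair x y \<epsilon> F))))"
      unfolding replacement_for_def using a by (simp add: Bex_def Ball_def)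
    moreover have "\<exists>!y. y \<epsilon> V \<kappa> \<and> opair x y \<epsilon> F" if "x \<epsilon> a" for x using ex1[OF that] F(1) by blast
    ultimately obtain b where b: "b \<epsilon> V \<kappa>" "\<And>y. y \<epsilon> V \<kappa> \<Longrightarrow> y \<epsilon> b \<longleftrightarrow> (\<exists>x. x \<epsilon> V \<kappa> \<and> x \<epsilon> a \<and> opair x y \<epsilon> F)" by blast
    have "y \<epsilon> b \<longleftrightarrow> (\<exists>x. x \<epsilon> a \<and> opair x y \<epsilon> F)" for y
      using b(2)[of y] tr[OF b(1), of y] F(1)[of _ y] by blast
    with b(1) show ?thesis by blast
  qed
  have kV: "x \<epsilon> V \<kappa>" if "x \<epsilon> \<kappa>" for x using ordinal_subset_V[OF o that] .
  have bounded: "\<exists>\<beta>. \<beta> \<epsilon> \<kappa> \<and> (\<forall>x. x \<epsilon> b \<longrightarrow> x \<epsilon> \<beta>)" if b: "b \<epsilon> V \<kappa>" "\<And>x. x \<epsilon> b \<Longrightarrow> ordinal x" for b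
  proof -
    obtain \<gamma> where c: "\<gamma> \<epsilon> \<kappa>" "elts b \<subseteq> elts (V \<gamma>)" using mem_V[OF o] b by blast
    have "x \<epsilon> \<gamma>" if "x \<epsilon> b" for x
      using ordinal_in_V[of \<gamma> x] ordinal_elt[OF o c(1)] b(2)[OF that] c(2) that by auto
    with c show ?thesis by blast
  qed
  have reg: "\<exists>\<beta>. \<beta> \<epsilon> \<kappa> \<and> (\<forall>\<xi>. \<xi> \<epsilon> \<alpha> \<longrightarrow> app f \<xi> \<epsilon> \<beta>)" if a: "\<alpha> \<epsilon> \<kappa>" and f: "maps f \<alpha> \<kappa>" for \<alpha> f
  proof -
    have fo: "fun_on f \<alpha>" and fk: "\<And>x. x \<epsilon> \<alpha> \<Longrightarrow> ap f x \<epsilon> \<kappa>" using f unfolding maps_iff by blast+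
    have op: "opair x y \<epsilon> f \<Longrightarrow> x \<epsilon> \<alpha> \<and> y = ap f x" for x y
      using fun_onD[OF fo, of "opair x y"] by auto
    have "\<exists>b. b \<epsilon> V \<kappa> \<and> (\<forall>y. y \<epsilon> b \<longleftrightarrow> (\<exists>x. x \<epsilon> \<alpha> \<and> opair x y \<epsilon> f))"
    proof (rule image)
      show "\<alpha> \<epsilon> V \<kappa>" using kV[OF a] .
      show "opair x y \<epsilon> f \<Longrightarrow> x \<epsilon> V \<kappa> \<and> y \<epsilon> V \<kappa>" for x y
        using op[of x y] fk[of x] kV ordinal_trans[OF o a] by blast
      show "p \<epsilon> f \<Longrightarrow> \<exists>x y. p = opair x y" for p using fun_onD[OF fo, of p] by blast
      show "\<exists>!y. opair x y \<epsilon> f" if "x \<epsilon> \<alpha>" for x using fun_on_ap[OF fo that] by simp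
    qed
    then obtain b where b: "b \<epsilon> V \<kappa>" "\<forall>y. y \<epsilon> b \<longleftrightarrow> (\<exists>x. x \<epsilon> \<alpha> \<and> opair x y \<epsilon> f)" by (elim exE conjE)
    have bm: "ap f x \<epsilon> b" if "x \<epsilon> \<alpha>" for x using b(2) fun_on_ap[OF fo that] that by blast
    have "ordinal y" if "y \<epsilon> b" for y using that b(2) op fk ordinal_elt[OF o] by metis
    from bounded[OF b(1) this] obtain \<beta> where "\<beta> \<epsilon> \<kappa>" "\<forall>x. x \<epsilon> b \<longrightarrow> x \<epsilon> \<beta>" by blast
    then show ?thesis using bm fun_on_app[OF fo] by metis
  qed
  have slim: "\<exists>\<beta>. \<beta> \<epsilon> \<kappa> \<and> (\<exists>f. injects f (pow \<alpha>) \<beta>)" if a: "\<alpha> \<epsilon> \<kappa>" for \<alpha>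
  proof -
    have "succ empty \<epsilon> \<kappa>" using ordinal_trans[OF o om] by simp
    have c: "dft True (\<lambda>e :: nat \<Rightarrow> 'a. \<alpha>)" by (intro dfn_intros)
    \<comment> \<open>As in \<open>inaccessible_succ\<close>, a constant function yields a level
      above \<alpha>, so that the power set of \<alpha> lies in \<open>V \<kappa>\<close>.\<close>
    have m: "maps (lam (succ empty) (\<lambda>_. \<alpha>)) (succ empty) \<kappa>"
      unfolding maps_iff using fun_on_lam[OF c] ap_lam[OF c] a by simp
    obtain \<delta> where d: "\<delta> \<epsilon> \<kappa>" "app (lam (succ empty) (\<lambda>_. \<alpha>)) empty \<epsilon> \<delta>"
      using reg[OF \<open>succ empty \<epsilon> \<kappa>\<close> m] by (metis mem_succ)
    then have "\<alpha> \<epsilon> \<delta>" using fun_on_app[OF fun_on_lam[OF c], of empty] ap_lam[OF c] by simp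
    have od: "ordinal \<delta>" using o d(1) ordinal_elt by blast
    have "elts \<alpha> \<subseteq> elts (V \<alpha>)" using ordinal_subset_V ordinal_elt[OF o a] by auto
    then have sub: "y \<epsilon> V \<delta>" if "y \<epsilon> pow \<alpha>" for y
      using that mem_V[OF od] \<open>\<alpha> \<epsilon> \<delta>\<close> by (metis mem_pow subset_trans)
    then have powV: "pow \<alpha> \<epsilon> V \<kappa>" unfolding mem_V[OF o] using d(1) by (intro exI[of _ \<delta>]) auto
    obtain \<gamma> f where g: "ordinal \<gamma>" "bijects f \<gamma> (pow \<alpha>)" using well_ordering by blast
    have f: "fun_on f \<gamma>" "\<And>x. x \<epsilon> \<gamma> \<Longrightarrow> ap f x \<epsilon> pow \<alpha>" "\<And>x y. x \<epsilon> \<gamma> \<Longrightarrow> y \<epsilon> \<gamma> \<Longrightarrow> ap f x = ap f y \<Longrightarrow> x = y"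
      using g unfolding bijects_iff injects_iff maps_iff by blast+
    have "\<gamma> \<epsilon> \<kappa>"
    proof (rule ccontr)
      assume n: "\<not> \<gamma> \<epsilon> \<kappa>"
      then have sub: "x \<epsilon> \<gamma>" if "x \<epsilon> \<kappa>" for x using that ordinal_linear[OF g(1) o] ordinal_trans[OF g(1)] by blast
      \<comment> \<open>The inverse of \<open>f\<close> on \<kappa>. Its domain is a subset of
        \<open>pow \<alpha>\<close> and therefore in \<open>V \<kappa>\<close>; its range would be
        \<kappa>.\<close>
      let ?F = "rep (\<lambda>x. opair (ap f x) x) \<kappa>"
      have mem: "p \<epsilon> ?F \<longleftrightarrow> (\<exists>x. x \<epsilon> \<kappa> \<and> p = opair (ap f x) x)" for p
        by (rule mem_rep) (intro dfn_intros)
      have op: "opair y x \<epsilon> ?F \<longleftrightarrow> x \<epsilon> \<kappa> \<and> y = ap f x" for x y unfolding mem by auto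
      have "\<exists>a. \<forall>y. y \<epsilon> a \<longleftrightarrow> y \<epsilon> pow \<alpha> \<and> (\<exists>x. x \<epsilon> \<kappa> \<and> y = ap f x)"
        by (rule comprehension[of _ "pow \<alpha>"], intro dfn_intros) simp
      then obtain a where a: "\<forall>y. y \<epsilon> a \<longleftrightarrow> y \<epsilon> pow \<alpha> \<and> (\<exists>x. x \<epsilon> \<kappa> \<and> y = ap f x)" by (rule exE)
      then have "elts a \<subseteq> elts (pow \<alpha>)" by auto
      then have aV: "a \<epsilon> V \<kappa>" using V_subset[OF o powV] by blast
      have "\<exists>b. b \<epsilon> V \<kappa> \<and> (\<forall>x. x \<epsilon> b \<longleftrightarrow> (\<exists>y. y \<epsilon> a \<and> opair y x \<epsilon> ?F))"
      proof (rule image[OF aV])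
        show "opair x y \<epsilon> ?F \<Longrightarrow> x \<epsilon> V \<kappa> \<and> y \<epsilon> V \<kappa>" for x y
          using op[of x y] f(2)[OF sub, of y] kV[of y] tr[OF powV, of x] by simp
        show "p \<epsilon> ?F \<Longrightarrow> \<exists>x y. p = opair x y" for p unfolding mem by blast
        show "\<exists>!x. opair y x \<epsilon> ?F" if y: "y \<epsilon> a" for y
        proof -
          obtain x where x: "x \<epsilon> \<kappa>" "y = ap f x" using y a by blast
          show ?thesis
          proof (rule ex1I)
            show "opair y x \<epsilon> ?F" unfolding op using x by simp
            fix x' assume "opair y x' \<epsilon> ?F"
            then show "x' = x" unfolding op using x f(3)[of x' x] sub by simp
          qed
        qed
      qed
      then obtain b where b: "b \<epsilon> V \<kappa>" "\<forall>x. x \<epsilon> b \<longleftrightarrow> (\<exists>y. y \<epsilon> a \<and> opair y x \<epsilon> ?F)" by (elim exE conjE)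
      have bk: "x \<epsilon> b \<longleftrightarrow> x \<epsilon> \<kappa>" for x
      proof
        assume "x \<epsilon> b"
        then show "x \<epsilon> \<kappa>" using b(2) op by blast
      next
        assume x: "x \<epsilon> \<kappa>"
        then have "ap f x \<epsilon> a" using a f(2)[OF sub[OF x]] by blast
        then show "x \<epsilon> b" using b(2) op x by blast
      qed
      have "ordinal x" if "x \<epsilon> b" for x using that bk ordinal_elt[OF o] by blast
      from bounded[OF b(1) this] obtain \<beta> where "\<beta> \<epsilon> \<kappa>" "\<forall>x. x \<epsilon> b \<longrightarrow> x \<epsilon> \<beta>" by blast
      then show False using bk mem_irrefl by blast
    qed
    then show ?thesis using bijects_inverse[OF g(2)] by blast
  qed
  show ?thesis unfolding inaccessible_def using card om reg slim by (simp add: Ball_def Bex_def)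
qed

lemma isomorphic_V:
  assumes o: "ordinal \<kappa>" "ordinal l" and iso: "isomorphic (V \<kappa>) (mem_rel (V \<kappa>)) (V l) (mem_rel (V l))"
  shows "\<kappa> = l"
proof -
  obtain f where b: "bijects f (V \<kappa>) (V l)" and
    m: "\<forall>x\<in>elts (V \<kappa>). \<forall>y\<in>elts (V \<kappa>). opair x y \<epsilon> mem_rel (V \<kappa>) \<longleftrightarrow> opair (app f x) (app f y) \<epsilon> mem_rel (V l)"
    using iso unfolding isomorphic_def by blast
  have f: "fun_on f (V \<kappa>)" "\<And>x. x \<epsilon> V \<kappa> \<Longrightarrow> ap f x \<epsilon> V l" "\<And>y. y \<epsilon> V l \<Longrightarrow> \<exists>x. x \<epsilon> V \<kappa> \<and> ap f x = y"
    using b unfolding bijects_iff injects_iff maps_iff by blast+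
  have "V \<kappa> = V l"
  proof (rule transitive_iso[where h = "\<lambda>x y. ap f x = y"])
    show "dfn True (\<lambda>e. ap f (e 0) = e 1)" by (intro dfn_intros)
    show "y \<epsilon> x \<longleftrightarrow> y' \<epsilon> x'" if "x \<epsilon> V \<kappa>" "y \<epsilon> V \<kappa>" "x' \<epsilon> V l" "y' \<epsilon> V l" "ap f x = x'" "ap f y = y'" for x x' y y'
      using m that fun_on_app[OF f(1)] by auto
  qed (use V_transitive o f in blast)+
  then show ?thesis using ordinal_in_V o ordinal_linear[OF o] by (metis mem_irrefl)
qed

subsection \<open>Definability of the notions of the statement\<close>

lemma dfn_all_maps [dfn_intros]:
  assumes "dfn b (\<lambda>e. Q (e 0) (\<lambda>k. e (Suc k)))" "dft b t" "dft b u"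
  shows "dfn b (\<lambda>e. \<forall>f. maps f (t e) (u e) \<longrightarrow> Q f e)"
proof (rule dfn_all, goal_cases)
  case 1 show ?case by (intro dfn_intros dft_ren[OF assms(2)] dft_ren[OF assms(3)] assms(1))
next
  case (2 U e)
  then obtain f where f: "maps f (t e) (u e)" "\<not> Q f e" by blast
  then have "f \<in> U" using univ_maps[OF 2(1)] dft_closed[OF assms(2) 2(1,2)] dft_closed[OF assms(3) 2(1,2)] by blast
  with f show ?case by blast
qed

lemma dfn_all_subset [dfn_intros]:
  assumes "dfn b (\<lambda>e. Q (e 0) (\<lambda>k. e (Suc k)))" "dft b t"
  shows "dfn b (\<lambda>e. \<forall>A. elts A \<subseteq> elts (t e) \<longrightarrow> Q A e)"
proof -
  have "dfn b (\<lambda>e. \<forall>A. A \<epsilon> pow (t e) \<longrightarrow> Q A e)"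
    by (intro dfn_ball_mem dfn_intros assms)
  then show ?thesis by simp
qed

lemma cardinal_d0: "dfn b (\<lambda>e. cardinal (e 0))"
  unfolding cardinal_def by (intro dfn_intros)
lemmas [dfn_intros] = dfn_subst1[where P = cardinal, OF cardinal_d0]

lemma inaccessible_iff: "inaccessible \<kappa> \<longleftrightarrow> cardinal \<kappa> \<and> omega \<epsilon> \<kappa> \<and>
    (\<forall>\<alpha>\<in>elts \<kappa>. \<forall>f. maps f \<alpha> \<kappa> \<longrightarrow> (\<exists>\<beta>\<in>elts \<kappa>. \<forall>\<xi>\<in>elts \<alpha>. ap f \<xi> \<epsilon> \<beta>)) \<and>
    (\<forall>\<alpha>\<in>elts \<kappa>. \<exists>\<beta>\<in>elts \<kappa>. \<exists>f. injects f (pow \<alpha>) \<beta>)"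
proof -
  have "(\<forall>\<xi>\<in>elts \<alpha>. app f \<xi> \<epsilon> \<beta>) \<longleftrightarrow> (\<forall>\<xi>\<in>elts \<alpha>. ap f \<xi> \<epsilon> \<beta>)" if "maps f \<alpha> \<kappa>" for \<alpha> f \<beta>
    using that fun_on_app[of f \<alpha>] unfolding maps_iff by (intro ball_cong) auto
  then show ?thesis unfolding inaccessible_def by (simp cong: imp_cong)
qed

lemma inaccessible_d0: "dfn b (\<lambda>e. inaccessible (e 0))"
  unfolding inaccessible_iff by (intro dfn_intros)
lemmas [dfn_intros] = dfn_subst1[where P = inaccessible, OF inaccessible_d0]

lemma dfn_Ex1_mem [dfn_intros]:
  assumes "dfn b (\<lambda>e. Q (e 0) (\<lambda>k. e (Suc k)))" "dft b t"
  shows "dfn b (\<lambda>e. \<exists>!x. x \<in> elts (t e) \<and> Q x e)"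
proof (rule dfn_cong)
  show "dfn b (\<lambda>e. \<exists>x\<in>elts (t e). Q x e \<and> (\<forall>y\<in>elts (t e). Q y e \<longrightarrow> y = x))"
    using dfn_ren[OF assms(1), of "case_nat 0 (\<lambda>k. Suc (Suc k))"]
    by (intro dfn_intros assms dft_ren[OF assms(2)]) simp
qed blast

text \<open>The second-order quantifiers run over subsets of given sets, which
  \<open>dfn_all_subset\<close> covers for nice classes too.\<close>

lemma zfc2_model_d0: "dfn b (\<lambda>e. zfc2_model (e 0) (e 1))"
  unfolding zfc2_model_def Let_def base_axioms_def ax_extensionality_def ax_foundation_def ax_pairing_def
    ax_union_def ax_power_def ax_infinity_def ax_choice_def separation_for_def replacement_for_def
  by (intro dfn_intros)

section \<open>Coded formulas\<close>

text \<open>Stands in for the hereditarily finite sets: such a set bounds the codes of formulas and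
  the values of \<open>enum\<close>.\<close>

definition hf_closed :: "'v::zfc \<Rightarrow> bool" where
  "hf_closed W \<longleftrightarrow> empty \<epsilon> W \<and> (\<forall>a. a \<epsilon> W \<longrightarrow> succ a \<epsilon> W) \<and> (\<forall>a. a \<epsilon> W \<longrightarrow> (\<forall>b. b \<epsilon> W \<longrightarrow> upair a b \<epsilon> W))"

lemma nice_hf_closed: "nice U \<Longrightarrow> \<exists>W\<in>U. hf_closed W"
  unfolding hf_closed_def by (erule nice_omega_closed) blast

lemma univ_hf_closed: "univ b U \<Longrightarrow> \<exists>W\<in>U. hf_closed W"
proof (cases b)
  case True
  assume "univ b U"
  moreover obtain l :: 'a where "nice (elts (V l))" using ex_nice by blast
  ultimately show ?thesis using True nice_hf_closed by fastforce
qed (use nice_hf_closed in auto)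

lemma hf_closed_omega:
  assumes "hf_closed W" "n \<epsilon> omega"
  shows "n \<epsilon> W"
  using assms(2)[unfolded mem_omega, rule_format, of W] assms(1) unfolding hf_closed_def by simp

lemma hf_closed_opair: "hf_closed W \<Longrightarrow> x \<epsilon> W \<Longrightarrow> y \<epsilon> W \<Longrightarrow> opair x y \<epsilon> W"
  unfolding opair_upair by (simp add: hf_closed_def)

lemma hf_closed_numeral: "hf_closed W \<Longrightarrow> numeral_set n \<epsilon> W"
  by (rule hf_closed_omega[OF _ numeral_set_omega])

lemmas c_defs = c_mem_def c_eq_def c_neg_def c_and_def c_ex_def c_ex2_def

lemma c_inject [simp]:
  "c_mem i j = c_mem k l \<longleftrightarrow> i = k \<and> j = l" "c_eq i j = c_eq k l \<longleftrightarrow> i = k \<and> j = l"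
  "c_neg f = c_neg g \<longleftrightarrow> f = g" "c_and f g = c_and f' g' \<longleftrightarrow> f = f' \<and> g = g'"
  "c_ex i f = c_ex j g \<longleftrightarrow> i = j \<and> f = g" "c_ex2 i f = c_ex2 j g \<longleftrightarrow> i = j \<and> f = g"
  by (simp_all add: c_defs)

lemma c_distinct [simp]:
  "c_mem i j \<noteq> c_eq k l" "c_mem i j \<noteq> c_neg f" "c_mem i j \<noteq> c_and f g" "c_mem i j \<noteq> c_ex k f" "c_mem i j \<noteq> c_ex2 k f"
  "c_eq i j \<noteq> c_mem k l" "c_eq i j \<noteq> c_neg f" "c_eq i j \<noteq> c_and f g" "c_eq i j \<noteq> c_ex k f" "c_eq i j \<noteq> c_ex2 k f"
  "c_neg h \<noteq> c_mem k l" "c_neg h \<noteq> c_eq k l" "c_neg h \<noteq> c_and f g" "c_neg h \<noteq> c_ex k f" "c_neg h \<noteq> c_ex2 k f"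
  "c_and p q \<noteq> c_mem k l" "c_and p q \<noteq> c_eq k l" "c_and p q \<noteq> c_neg f" "c_and p q \<noteq> c_ex k f" "c_and p q \<noteq> c_ex2 k f"
  "c_ex i h \<noteq> c_mem k l" "c_ex i h \<noteq> c_eq k l" "c_ex i h \<noteq> c_neg f" "c_ex i h \<noteq> c_and f g" "c_ex i h \<noteq> c_ex2 k f"
  "c_ex2 i h \<noteq> c_mem k l" "c_ex2 i h \<noteq> c_eq k l" "c_ex2 i h \<noteq> c_neg f" "c_ex2 i h \<noteq> c_and f g" "c_ex2 i h \<noteq> c_ex k f"
  unfolding c_defs opair_inject numeral_set_inject by simp_all

lemma hf_closed_c:
  assumes W: "hf_closed W"
  shows "i \<epsilon> W \<Longrightarrow> j \<epsilon> W \<Longrightarrow> c_mem i j \<epsilon> W" "i \<epsilon> W \<Longrightarrow> j \<epsilon> W \<Longrightarrow> c_eq i j \<epsilon> W" "f \<epsilon> W \<Longrightarrow> c_neg f \<epsilon> W"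
    "f \<epsilon> W \<Longrightarrow> g \<epsilon> W \<Longrightarrow> c_and f g \<epsilon> W" "i \<epsilon> W \<Longrightarrow> f \<epsilon> W \<Longrightarrow> c_ex i f \<epsilon> W" "i \<epsilon> W \<Longrightarrow> f \<epsilon> W \<Longrightarrow> c_ex2 i f \<epsilon> W"
  unfolding c_defs by (intro hf_closed_opair[OF W] hf_closed_numeral[OF W]; assumption)+

lemma c_dft [dfn_intros]:
  assumes "dft b t" "dft b u"
  shows "dft b (\<lambda>e. c_mem (t e) (u e))" "dft b (\<lambda>e. c_eq (t e) (u e))"
    "dft b (\<lambda>e. c_and (t e) (u e))" "dft b (\<lambda>e. c_ex (t e) (u e))" "dft b (\<lambda>e. c_ex2 (t e) (u e))"
  unfolding c_defs by (intro dfn_intros assms)+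

lemma c_neg_dft [dfn_intros]: "dft b t \<Longrightarrow> dft b (\<lambda>e. c_neg (t e))"
  unfolding c_defs by (intro dfn_intros)

lemma bool_closed_iff: "bool_closed X \<longleftrightarrow>
    (\<forall>i. i \<epsilon> omega \<longrightarrow> (\<forall>j. j \<epsilon> omega \<longrightarrow> c_mem i j \<epsilon> X \<and> c_eq i j \<epsilon> X)) \<and>
    (\<forall>f. f \<epsilon> X \<longrightarrow> c_neg f \<epsilon> X) \<and> (\<forall>f. f \<epsilon> X \<longrightarrow> (\<forall>g. g \<epsilon> X \<longrightarrow> c_and f g \<epsilon> X))"
  by (simp add: bool_closed_def Ball_def)

lemma bool_closed_d0: "dfn b (\<lambda>e. bool_closed (e 0))"
  unfolding bool_closed_iff by (intro dfn_intros dfn_ball_mem)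
lemmas [dfn_intros] = dfn_subst1[where P = bool_closed, OF bool_closed_d0]

definition form_closed :: "'v::zfc \<Rightarrow> bool" where
  "form_closed X \<longleftrightarrow> bool_closed X \<and> (\<forall>i. i \<epsilon> omega \<longrightarrow> (\<forall>g. g \<epsilon> X \<longrightarrow> c_ex i g \<epsilon> X \<and> c_ex2 i g \<epsilon> X))"

lemma form_closed_d0: "dfn b (\<lambda>e. form_closed (e 0))"
  unfolding form_closed_def by (intro dfn_intros)
lemmas [dfn_intros] = dfn_subst1[where P = form_closed, OF form_closed_d0]

lemma formula_iff: "formula f \<longleftrightarrow> (\<forall>X. form_closed X \<longrightarrow> f \<epsilon> X)"
  by (simp add: formula_def form_closed_def Ball_def)

lemma formula_intros:
  "i \<epsilon> omega \<Longrightarrow> j \<epsilon> omega \<Longrightarrow> formula (c_mem i j)" "i \<epsilon> omega \<Longrightarrow> j \<epsilon> omega \<Longrightarrow> formula (c_eq i j)"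
  "formula f \<Longrightarrow> formula (c_neg f)" "formula f \<Longrightarrow> formula g \<Longrightarrow> formula (c_and f g)"
  "i \<epsilon> omega \<Longrightarrow> formula f \<Longrightarrow> formula (c_ex i f)" "i \<epsilon> omega \<Longrightarrow> formula f \<Longrightarrow> formula (c_ex2 i f)"
  unfolding formula_iff form_closed_def bool_closed_iff by simp_all

lemma hf_closed_form_closed: "hf_closed W \<Longrightarrow> form_closed W"
  unfolding form_closed_def bool_closed_iff by (simp add: hf_closed_c hf_closed_omega)

lemma formula_hf: "hf_closed W \<Longrightarrow> formula f \<Longrightarrow> f \<epsilon> W"
  using hf_closed_form_closed formula_iff by blast

definition Form :: "'v::zfc" where
  "Form = set_of {f. formula f}"

lemma formula_dfn_True: "dfn True (\<lambda>e. formula (e 0))"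
  unfolding formula_iff by (intro dfn_intros)

lemma mem_Form: "f \<epsilon> Form \<longleftrightarrow> formula f"
proof -
  obtain W :: 'a where "hf_closed W" using univ_hf_closed[of True UNIV] by auto
  then have "small {f :: 'a. formula f}"
    using small_Collect[OF formula_dfn_True] formula_hf by blast
  then show ?thesis by (simp add: Form_def in_set_of)
qed

lemma form_closed_Form: "form_closed Form"
  unfolding form_closed_def bool_closed_iff mem_Form by (simp add: formula_intros)

lemma univ_Form [univ_intros]: "univ b U \<Longrightarrow> Form \<in> U"
proof -
  assume U: "univ b U"
  then obtain W where "W \<in> U" "hf_closed W" using univ_hf_closed by blast
  then show ?thesis using univ_sub[OF U, of W Form] formula_hf mem_Form by blast
qed

lemma formula_d0: "dfn b (\<lambda>e. formula (e 0))"
  unfolding formula_iff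
proof (rule dfn_all, goal_cases)
  case (2 U e)
  then have "\<not> e 0 \<epsilon> Form" unfolding mem_Form formula_iff by blast
  then show ?case using form_closed_Form univ_Form[OF 2(1)] by blast
qed (intro dfn_intros)
lemmas [dfn_intros] = dfn_subst1[where P = formula, OF formula_d0]

lemma Form_dft [dfn_intros]: "dft b (\<lambda>e. Form)"
proof (rule dft_setI)
  show "z \<epsilon> Form \<longleftrightarrow> (\<lambda>z e. formula z) z e" for z and e :: "nat \<Rightarrow> 'a" by (simp add: mem_Form)
qed (intro dfn_intros, rule univ_Form)

lemma formula_induct [consumes 2]:
  assumes P: "dfn True (\<lambda>e. P (e 0))" and f: "formula f"
    and "\<And>i j. i \<epsilon> omega \<Longrightarrow> j \<epsilon> omega \<Longrightarrow> P (c_mem i j)" "\<And>i j. i \<epsilon> omega \<Longrightarrow> j \<epsilon> omega \<Longrightarrow> P (c_eq i j)"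
    and "\<And>f. formula f \<Longrightarrow> P f \<Longrightarrow> P (c_neg f)"
    and "\<And>f g. formula f \<Longrightarrow> formula g \<Longrightarrow> P f \<Longrightarrow> P g \<Longrightarrow> P (c_and f g)"
    and "\<And>i f. i \<epsilon> omega \<Longrightarrow> formula f \<Longrightarrow> P f \<Longrightarrow> P (c_ex i f)"
    and "\<And>i f. i \<epsilon> omega \<Longrightarrow> formula f \<Longrightarrow> P f \<Longrightarrow> P (c_ex2 i f)"
  shows "P f"
proof -
  have "\<exists>X. \<forall>f. f \<epsilon> X \<longleftrightarrow> f \<epsilon> Form \<and> P f"
    by (rule comprehension[of _ Form], intro dfn_intros P) simp
  then obtain X where "\<forall>f. f \<epsilon> X \<longleftrightarrow> f \<epsilon> Form \<and> P f" by (rule exE)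
  then have X: "f \<epsilon> X \<longleftrightarrow> formula f \<and> P f" for f using mem_Form by blast
  have "form_closed X"
    unfolding form_closed_def bool_closed_iff X using assms(3-) by (simp add: formula_intros)
  then show ?thesis using f X formula_iff by blast
qed

lemma dfn_all_formula [dfn_intros]:
  assumes "dfn b (\<lambda>e. Q (e 0) (\<lambda>k. e (Suc k)))"
  shows "dfn b (\<lambda>e. \<forall>f. formula f \<longrightarrow> Q f e)"
  using dfn_ball_mem[OF assms Form_dft] by (simp add: mem_Form)

definition fo_closed :: "'v::zfc \<Rightarrow> bool" where
  "fo_closed X \<longleftrightarrow> bool_closed X \<and> (\<forall>i. i \<epsilon> omega \<longrightarrow> (\<forall>g. g \<epsilon> X \<longrightarrow> c_ex i g \<epsilon> X))"

lemma fo_formula_iff: "fo_formula f \<longleftrightarrow> (\<forall>X. fo_closed X \<longrightarrow> f \<epsilon> X)"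
  by (simp add: fo_formula_def fo_closed_def Ball_def)

lemma fo_formula_formula: "fo_formula f \<Longrightarrow> formula f"
  unfolding fo_formula_iff formula_iff fo_closed_def form_closed_def by blast

lemma fo_formula_intros:
  "i \<epsilon> omega \<Longrightarrow> j \<epsilon> omega \<Longrightarrow> fo_formula (c_mem i j)" "i \<epsilon> omega \<Longrightarrow> j \<epsilon> omega \<Longrightarrow> fo_formula (c_eq i j)"
  "fo_formula f \<Longrightarrow> fo_formula (c_neg f)" "fo_formula f \<Longrightarrow> fo_formula g \<Longrightarrow> fo_formula (c_and f g)"
  "i \<epsilon> omega \<Longrightarrow> fo_formula f \<Longrightarrow> fo_formula (c_ex i f)"
  unfolding fo_formula_iff fo_closed_def bool_closed_iff by simp_all

definition delta0_closed :: "'v::zfc \<Rightarrow> bool" where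
  "delta0_closed X \<longleftrightarrow> bool_closed X \<and> (\<forall>i. i \<epsilon> omega \<longrightarrow> (\<forall>j. j \<epsilon> omega \<longrightarrow>
     (i \<noteq> j \<longrightarrow> (\<forall>g. g \<epsilon> X \<longrightarrow> c_ex i (c_and (c_mem i j) g) \<epsilon> X))))"

lemma delta0_iff: "delta0 f \<longleftrightarrow> (\<forall>X. delta0_closed X \<longrightarrow> f \<epsilon> X)"
proof -
  have *: "(\<forall>g. g \<epsilon> X \<longrightarrow> i \<noteq> j \<longrightarrow> P g) \<longleftrightarrow> (i \<noteq> j \<longrightarrow> (\<forall>g. g \<epsilon> X \<longrightarrow> P g))" for P and X i j :: 'a by blast
  show ?thesis by (simp add: delta0_def delta0_closed_def Ball_def *)
qed

lemma delta0_dfn_True: "dfn True (\<lambda>e. delta0 (e 0))"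
  unfolding delta0_iff delta0_closed_def by (intro dfn_intros)
lemmas [dfn_intros] = dfn_subst1[where P = delta0, OF delta0_dfn_True]

lemma fo_formula_dfn_True: "dfn True (\<lambda>e. fo_formula (e 0))"
  unfolding fo_formula_iff fo_closed_def by (intro dfn_intros)
lemmas [dfn_intros] = dfn_subst1[where P = fo_formula, OF fo_formula_dfn_True]

lemma delta0_intros:
  "i \<epsilon> omega \<Longrightarrow> j \<epsilon> omega \<Longrightarrow> delta0 (c_mem i j)" "i \<epsilon> omega \<Longrightarrow> j \<epsilon> omega \<Longrightarrow> delta0 (c_eq i j)"
  "delta0 f \<Longrightarrow> delta0 (c_neg f)" "delta0 f \<Longrightarrow> delta0 g \<Longrightarrow> delta0 (c_and f g)"
  "i \<epsilon> omega \<Longrightarrow> j \<epsilon> omega \<Longrightarrow> i \<noteq> j \<Longrightarrow> delta0 f \<Longrightarrow> delta0 (c_ex i (c_and (c_mem i j) f))"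
  unfolding delta0_iff delta0_closed_def bool_closed_iff by simp_all

lemma delta0_fo_formula: "delta0 f \<Longrightarrow> fo_formula f"
  unfolding fo_formula_iff
proof (intro allI impI)
  fix X :: 'a assume f: "delta0 f" and X: "fo_closed X"
  have "delta0_closed X" using X unfolding fo_closed_def delta0_closed_def bool_closed_iff by simp
  then show "f \<epsilon> X" using f unfolding delta0_iff by blast
qed

lemma delta0_formula: "delta0 f \<Longrightarrow> formula f"
  by (intro fo_formula_formula delta0_fo_formula)

lemma delta0_induct:
  assumes P: "dfn True (\<lambda>e. P (e 0))" and f: "delta0 f"
    and "\<And>i j. i \<epsilon> omega \<Longrightarrow> j \<epsilon> omega \<Longrightarrow> P (c_mem i j)" "\<And>i j. i \<epsilon> omega \<Longrightarrow> j \<epsilon> omega \<Longrightarrow> P (c_eq i j)"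
    and "\<And>f. formula f \<Longrightarrow> P f \<Longrightarrow> P (c_neg f)"
    and "\<And>f g. formula f \<Longrightarrow> formula g \<Longrightarrow> P f \<Longrightarrow> P g \<Longrightarrow> P (c_and f g)"
    and "\<And>i j f. i \<epsilon> omega \<Longrightarrow> j \<epsilon> omega \<Longrightarrow> i \<noteq> j \<Longrightarrow> formula f \<Longrightarrow> P f \<Longrightarrow> P (c_ex i (c_and (c_mem i j) f))"
  shows "P f"
proof -
  have "\<exists>X. \<forall>f. f \<epsilon> X \<longleftrightarrow> f \<epsilon> Form \<and> P f"
    by (rule comprehension[of _ Form], intro dfn_intros P) simp
  then obtain X where "\<forall>f. f \<epsilon> X \<longleftrightarrow> f \<epsilon> Form \<and> P f" by (rule exE)
  then have X: "f \<epsilon> X \<longleftrightarrow> formula f \<and> P f" for f using mem_Form by blast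
  have "delta0_closed X"
    unfolding delta0_closed_def bool_closed_iff X using assms(3-) by (simp add: formula_intros)
  then show ?thesis using f X delta0_iff by blast
qed

subsection \<open>Satisfaction\<close>

lemma pair_set:
  assumes "\<forall>p. p \<epsilon> X \<longleftrightarrow> p \<epsilon> B \<and> (\<exists>f T. p = opair f T \<and> R f T)"
  shows "opair f T \<epsilon> X \<longleftrightarrow> opair f T \<epsilon> B \<and> R f T"
  using spec[OF assms, of "opair f T"] by auto

lemma assignment_iff: "assignment D H s \<longleftrightarrow> maps s omega (un D H)"
  unfolding assignment_def maps_iff by (auto simp: fun_on_app Ball_def)

lemma assignment_upd: "assignment D H s \<Longrightarrow> i \<epsilon> omega \<Longrightarrow> x \<epsilon> D \<or> x \<epsilon> H \<Longrightarrow> assignment D H (upd s i x)"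
  unfolding assignment_iff by (rule maps_upd) auto

lemma satisfaction_relation_iff: "satisfaction_relation D H E S \<longleftrightarrow>
    (\<forall>s. maps s omega (un D H) \<longrightarrow>
      (\<forall>i. i \<epsilon> omega \<longrightarrow> (\<forall>j. j \<epsilon> omega \<longrightarrow>
        (opair (c_mem i j) s \<epsilon> S \<longleftrightarrow> opair (ap s i) (ap s j) \<epsilon> E) \<and>
        (opair (c_eq i j) s \<epsilon> S \<longleftrightarrow> ap s i = ap s j))) \<and>
      (\<forall>f. formula f \<longrightarrow>
        (opair (c_neg f) s \<epsilon> S \<longleftrightarrow> \<not> opair f s \<epsilon> S) \<and>
        (\<forall>g. formula g \<longrightarrow> (opair (c_and f g) s \<epsilon> S \<longleftrightarrow> opair f s \<epsilon> S \<and> opair g s \<epsilon> S)) \<and>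
        (\<forall>i. i \<epsilon> omega \<longrightarrow>
          (opair (c_ex i f) s \<epsilon> S \<longleftrightarrow> (\<exists>x. x \<epsilon> D \<and> opair f (upd s i x) \<epsilon> S)) \<and>
          (opair (c_ex2 i f) s \<epsilon> S \<longleftrightarrow> (\<exists>x. x \<epsilon> H \<and> opair f (upd s i x) \<epsilon> S)))))"
proof -
  have *: "app s i = ap s i" if "maps s omega (un D H)" "i \<epsilon> omega" for s i
    using that fun_on_app maps_iff by blast
  show ?thesis unfolding satisfaction_relation_def assignment_iff
    by (simp add: Ball_def Bex_def * cong: imp_cong conj_cong)
qed

lemma satisfaction_relation_d0: "dfn b (\<lambda>e. satisfaction_relation (e 0) (e 1) (e 2) (e 3))"
  unfolding satisfaction_relation_iff by (intro dfn_all_maps dfn_intros)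
lemmas [dfn_intros] = dfn_subst4[where P = satisfaction_relation, OF satisfaction_relation_d0]

lemma satisfaction_unique:
  assumes S: "satisfaction_relation D H E S" "satisfaction_relation D H E S'"
    and f: "formula f" and s: "assignment D H s"
  shows "opair f s \<epsilon> S \<longleftrightarrow> opair f s \<epsilon> S'"
proof -
  note S1 = S(1)[unfolded satisfaction_relation_iff, rule_format]
  note S2 = S(2)[unfolded satisfaction_relation_iff, rule_format]
  have up: "maps (upd s i x) omega (un D H)" if "maps s omega (un D H)" "i \<epsilon> omega" "x \<epsilon> D \<or> x \<epsilon> H" for s and i x :: 'a
    using that by (intro maps_upd) auto
  have "\<forall>s. maps s omega (un D H) \<longrightarrow> (opair f s \<epsilon> S \<longleftrightarrow> opair f s \<epsilon> S')" using _ f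
  proof (rule formula_induct)
    show "dfn True (\<lambda>e. \<forall>s. maps s omega (un D H) \<longrightarrow> (opair (e 0) s \<epsilon> S \<longleftrightarrow> opair (e 0) s \<epsilon> S'))"
      by (intro dfn_intros)
  next
    fix i f :: 'a assume i: "i \<epsilon> omega" and f: "formula f"
      and IH: "\<forall>s. maps s omega (un D H) \<longrightarrow> (opair f s \<epsilon> S \<longleftrightarrow> opair f s \<epsilon> S')"
    have "opair f (upd s i x) \<epsilon> S \<longleftrightarrow> opair f (upd s i x) \<epsilon> S'" if "maps s omega (un D H)" "x \<epsilon> D \<or> x \<epsilon> H" for s x
      using IH up[OF that(1) i that(2)] by blast
    then show "\<forall>s. maps s omega (un D H) \<longrightarrow> (opair (c_ex i f) s \<epsilon> S \<longleftrightarrow> opair (c_ex i f) s \<epsilon> S')"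
      "\<forall>s. maps s omega (un D H) \<longrightarrow> (opair (c_ex2 i f) s \<epsilon> S \<longleftrightarrow> opair (c_ex2 i f) s \<epsilon> S')"
      using S1 S2 i f by (simp, metis)+
  qed (use S1 S2 in simp_all)
  then show ?thesis using s unfolding assignment_iff by blast
qed

context
  fixes D H E :: "'v::zfc"
begin

definition Asg :: 'v where
  "Asg = set_of {s. maps s omega (un D H)}"

lemma mem_Asg: "s \<epsilon> Asg \<longleftrightarrow> maps s omega (un D H)"
proof -
  have "small {s. maps s omega (un D H)}"
    by (rule small_Collect[of _ "pow (cprod omega (un D H))"], intro dfn_intros) (auto intro: maps_sub)
  then show ?thesis by (simp add: Asg_def in_set_of)
qed

definition S_mem :: "'v \<Rightarrow> 'v \<Rightarrow> 'v" where
  "S_mem i j = set_of {s. s \<epsilon> Asg \<and> opair (ap s i) (ap s j) \<epsilon> E}"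

definition S_eq :: "'v \<Rightarrow> 'v \<Rightarrow> 'v" where
  "S_eq i j = set_of {s. s \<epsilon> Asg \<and> ap s i = ap s j}"

definition S_ex :: "'v \<Rightarrow> 'v \<Rightarrow> 'v \<Rightarrow> 'v" where
  "S_ex B i T = set_of {s. s \<epsilon> Asg \<and> (\<exists>x. x \<epsilon> B \<and> upd s i x \<epsilon> T)}"

definition S_and :: "'v \<Rightarrow> 'v \<Rightarrow> 'v" where
  "S_and T T' = set_of {s. s \<epsilon> T \<and> s \<epsilon> T'}"

lemma mem_S:
  "s \<epsilon> S_mem i j \<longleftrightarrow> s \<epsilon> Asg \<and> opair (ap s i) (ap s j) \<epsilon> E"
  "s \<epsilon> S_eq i j \<longleftrightarrow> s \<epsilon> Asg \<and> ap s i = ap s j"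
  "s \<epsilon> S_ex B i T \<longleftrightarrow> s \<epsilon> Asg \<and> (\<exists>x. x \<epsilon> B \<and> upd s i x \<epsilon> T)"
  "s \<epsilon> S_and T T' \<longleftrightarrow> s \<epsilon> T \<and> s \<epsilon> T'"
proof -
  have 1: "small {s. s \<epsilon> Asg \<and> opair (ap s i) (ap s j) \<epsilon> E}"
    by (rule small_Collect[of _ Asg], intro dfn_intros) simp
  have 2: "small {s. s \<epsilon> Asg \<and> ap s i = ap s j}"
    by (rule small_Collect[of _ Asg], intro dfn_intros) simp
  have 3: "small {s. s \<epsilon> Asg \<and> (\<exists>x. x \<epsilon> B \<and> upd s i x \<epsilon> T)}"
    by (rule small_Collect[of _ Asg], intro dfn_intros) simp
  have 4: "small {s. s \<epsilon> T \<and> s \<epsilon> T'}"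
    by (rule small_Collect[of _ T], intro dfn_intros) simp
  show "s \<epsilon> S_mem i j \<longleftrightarrow> s \<epsilon> Asg \<and> opair (ap s i) (ap s j) \<epsilon> E"
    "s \<epsilon> S_eq i j \<longleftrightarrow> s \<epsilon> Asg \<and> ap s i = ap s j"
    "s \<epsilon> S_ex B i T \<longleftrightarrow> s \<epsilon> Asg \<and> (\<exists>x. x \<epsilon> B \<and> upd s i x \<epsilon> T)"
    "s \<epsilon> S_and T T' \<longleftrightarrow> s \<epsilon> T \<and> s \<epsilon> T'"
    unfolding S_mem_def S_eq_def S_ex_def S_and_def
    by (simp_all only: in_set_of[OF 1] in_set_of[OF 2] in_set_of[OF 3] in_set_of[OF 4] mem_Collect_eq)
qed

lemma S_dft:
  assumes "dft True t" "dft True u"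
  shows "dft True (\<lambda>e. S_mem (t e) (u e))" "dft True (\<lambda>e. S_eq (t e) (u e))" "dft True (\<lambda>e. S_ex B (t e) (u e))"
    "dft True (\<lambda>e. S_and (t e) (u e))"
  by (rule dft_setI, rule mem_S, intro dfn_intros dft_ren[OF assms(1)] dft_ren[OF assms(2)], simp)+

definition sat_closed :: "'v \<Rightarrow> bool" where
  "sat_closed X \<longleftrightarrow> (\<forall>i. i \<epsilon> omega \<longrightarrow> (\<forall>j. j \<epsilon> omega \<longrightarrow>
      opair (c_mem i j) (S_mem i j) \<epsilon> X \<and> opair (c_eq i j) (S_eq i j) \<epsilon> X)) \<and>
    (\<forall>f T. opair f T \<epsilon> X \<longrightarrow> opair (c_neg f) (dif Asg T) \<epsilon> X \<and>
      (\<forall>g T'. opair g T' \<epsilon> X \<longrightarrow> opair (c_and f g) (S_and T T') \<epsilon> X) \<and>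
      (\<forall>i. i \<epsilon> omega \<longrightarrow> opair (c_ex i f) (S_ex D i T) \<epsilon> X \<and> opair (c_ex2 i f) (S_ex H i T) \<epsilon> X))"

text \<open>\<open>T\<close> is the set of assignments that satisfy \<open>f\<close>. This inductive
  definition takes the place of a recursion on codes.\<close>

definition tr :: "'v \<Rightarrow> 'v \<Rightarrow> bool" where
  "tr f T \<longleftrightarrow> (\<forall>X. sat_closed X \<longrightarrow> opair f T \<epsilon> X)"

lemma tr_dfn: "dft True t \<Longrightarrow> dft True u \<Longrightarrow> dfn True (\<lambda>e. tr (t e) (u e))"
  by (rule dfn_subst2[where P = tr]) (unfold tr_def sat_closed_def, intro dfn_intros S_dft)

lemma tr_intros:
  "i \<epsilon> omega \<Longrightarrow> j \<epsilon> omega \<Longrightarrow> tr (c_mem i j) (S_mem i j)" "i \<epsilon> omega \<Longrightarrow> j \<epsilon> omega \<Longrightarrow> tr (c_eq i j) (S_eq i j)"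
  "tr f T \<Longrightarrow> tr (c_neg f) (dif Asg T)" "tr f T \<Longrightarrow> tr g T' \<Longrightarrow> tr (c_and f g) (S_and T T')"
  "tr f T \<Longrightarrow> i \<epsilon> omega \<Longrightarrow> tr (c_ex i f) (S_ex D i T)" "tr f T \<Longrightarrow> i \<epsilon> omega \<Longrightarrow> tr (c_ex2 i f) (S_ex H i T)"
  unfolding tr_def sat_closed_def by simp_all

text \<open>\<open>tr\<close> quantifies over closed sets; this one shows that there are some, and
  it bounds the comprehension in \<open>tr_cases\<close>.\<close>

definition Bnd :: 'v where
  "Bnd = cprod Form (pow Asg)"

lemma sat_closed_Bnd: "sat_closed Bnd"
  unfolding sat_closed_def Bnd_def opair_in_cprod mem_Form mem_pow
  by (auto simp: formula_intros mem_S)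

lemma tr_in_Bnd: "tr f T \<Longrightarrow> opair f T \<epsilon> Bnd"
  using sat_closed_Bnd unfolding tr_def by blast

lemma tr_Bnd: "tr f T \<Longrightarrow> formula f \<and> elts T \<subseteq> elts Asg"
  using tr_in_Bnd[of f T] unfolding Bnd_def opair_in_cprod mem_Form mem_pow .

text \<open>Inversion for the inductive definition: the pairs in \<open>tr\<close> that arise by one
  of the clauses already form a closed set.\<close>

lemma tr_cases:
  assumes "tr f T"
  shows "(\<exists>i. i \<epsilon> omega \<and> (\<exists>j. j \<epsilon> omega \<and> (f = c_mem i j \<and> T = S_mem i j \<or> f = c_eq i j \<and> T = S_eq i j))) \<or>
    (\<exists>g B. tr g B \<and> f = c_neg g \<and> T = dif Asg B) \<or>
    (\<exists>g B. tr g B \<and> (\<exists>h C. tr h C \<and> f = c_and g h \<and> T = S_and B C)) \<or>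
    (\<exists>g B. tr g B \<and> (\<exists>i. i \<epsilon> omega \<and> (f = c_ex i g \<and> T = S_ex D i B \<or> f = c_ex2 i g \<and> T = S_ex H i B)))"
    (is "?P f T")
proof -
  have "\<exists>X. \<forall>p. p \<epsilon> X \<longleftrightarrow> p \<epsilon> Bnd \<and> (\<exists>f T. p = opair f T \<and> tr f T \<and> ?P f T)"
    by (rule comprehension[of _ Bnd], intro dfn_intros tr_dfn S_dft) (erule conjunct1)
  then obtain X where X0: "\<forall>p. p \<epsilon> X \<longleftrightarrow> p \<epsilon> Bnd \<and> (\<exists>f T. p = opair f T \<and> tr f T \<and> ?P f T)" by (rule exE)
  have X: "opair f T \<epsilon> X \<longleftrightarrow> tr f T \<and> ?P f T" for f T
    using pair_set[OF X0, of f T] tr_in_Bnd[of f T] by argo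
  have P: "i \<epsilon> omega \<Longrightarrow> j \<epsilon> omega \<Longrightarrow> ?P (c_mem i j) (S_mem i j)" "i \<epsilon> omega \<Longrightarrow> j \<epsilon> omega \<Longrightarrow> ?P (c_eq i j) (S_eq i j)"
    "tr f T \<Longrightarrow> ?P (c_neg f) (dif Asg T)" "tr f T \<Longrightarrow> tr g T' \<Longrightarrow> ?P (c_and f g) (S_and T T')"
    "tr f T \<Longrightarrow> i \<epsilon> omega \<Longrightarrow> ?P (c_ex i f) (S_ex D i T)" "tr f T \<Longrightarrow> i \<epsilon> omega \<Longrightarrow> ?P (c_ex2 i f) (S_ex H i T)"
    for i j f g T T'
    by (simp_all, blast+)
  have "sat_closed X" unfolding sat_closed_def X
    by (intro conjI allI impI; ((drule conjunct1)+)?; (rule tr_intros P; assumption))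
  have "opair f T \<epsilon> X" using spec[OF assms[unfolded tr_def], of X] \<open>sat_closed X\<close> by (rule mp)
  then show ?thesis unfolding X by (rule conjunct2)
qed

lemma tr_unique: "formula f \<Longrightarrow> \<exists>T. tr f T \<and> (\<forall>T'. tr f T' \<longrightarrow> T' = T)"
proof (rule formula_induct)
  show "dfn True (\<lambda>e. \<exists>T. tr (e 0) T \<and> (\<forall>T'. tr (e 0) T' \<longrightarrow> T' = T))" by (intro dfn_intros tr_dfn)
next
  fix i j :: 'v assume ij: "i \<epsilon> omega" "j \<epsilon> omega"
  show "\<exists>T. tr (c_mem i j) T \<and> (\<forall>T'. tr (c_mem i j) T' \<longrightarrow> T' = T)"
    using tr_intros(1)[OF ij] tr_cases[of "c_mem i j"] by simp blast
  show "\<exists>T. tr (c_eq i j) T \<and> (\<forall>T'. tr (c_eq i j) T' \<longrightarrow> T' = T)"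
    using tr_intros(2)[OF ij] tr_cases[of "c_eq i j"] by simp blast
next
  fix f assume "\<exists>T. tr f T \<and> (\<forall>T'. tr f T' \<longrightarrow> T' = T)"
  then obtain T where T: "tr f T" "\<And>T'. tr f T' \<Longrightarrow> T' = T" by blast
  show "\<exists>T. tr (c_neg f) T \<and> (\<forall>T'. tr (c_neg f) T' \<longrightarrow> T' = T)"
    using tr_intros(3)[OF T(1)] tr_cases[of "c_neg f"] T(2) by simp metis
  fix i assume i: "(i :: 'v) \<epsilon> omega"
  show "\<exists>T. tr (c_ex i f) T \<and> (\<forall>T'. tr (c_ex i f) T' \<longrightarrow> T' = T)"
    using tr_intros(5)[OF T(1) i] tr_cases[of "c_ex i f"] T(2) by simp metis
  show "\<exists>T. tr (c_ex2 i f) T \<and> (\<forall>T'. tr (c_ex2 i f) T' \<longrightarrow> T' = T)"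
    using tr_intros(6)[OF T(1) i] tr_cases[of "c_ex2 i f"] T(2) by simp metis
next
  fix f g assume "\<exists>T. tr f T \<and> (\<forall>T'. tr f T' \<longrightarrow> T' = T)" "\<exists>T. tr g T \<and> (\<forall>T'. tr g T' \<longrightarrow> T' = T)"
  then obtain T B where T: "tr f T" "\<And>T'. tr f T' \<Longrightarrow> T' = T" and B: "tr g B" "\<And>T'. tr g T' \<Longrightarrow> T' = B" by blast
  show "\<exists>T. tr (c_and f g) T \<and> (\<forall>T'. tr (c_and f g) T' \<longrightarrow> T' = T)"
    using tr_intros(4)[OF T(1) B(1)] tr_cases[of "c_and f g"] T(2) B(2) by simp metis
qed

text \<open>The bound on \<open>S\<close> keeps a satisfaction relation inside every nice class that
  contains the structure; \<open>sat_dfn\<close> depends on it.\<close>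

lemma satisfaction_exists: "\<exists>S. satisfaction_relation D H E S \<and> elts S \<subseteq> elts (cprod Form Asg)"
proof -
  let ?P = "\<lambda>p. \<exists>f T s. p = opair f s \<and> tr f T \<and> s \<epsilon> T"
  have "\<exists>S. \<forall>p. p \<epsilon> S \<longleftrightarrow> ?P p"
    by (rule comprehension[of _ "cprod Form Asg"], intro dfn_intros tr_dfn)
      (use tr_Bnd in \<open>auto simp: mem_Form subset_iff\<close>)
  then obtain S where "\<forall>p. p \<epsilon> S \<longleftrightarrow> ?P p" by (rule exE)
  then have "opair f s \<epsilon> S \<longleftrightarrow> ?P (opair f s)" for f s by (rule spec)
  then have S: "opair f s \<epsilon> S \<longleftrightarrow> (\<exists>T. tr f T \<and> s \<epsilon> T)" for f s unfolding opair_inject by metis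
  have eq: "opair f s \<epsilon> S \<longleftrightarrow> s \<epsilon> T" if "tr f T" for f s T
    using that tr_unique tr_Bnd[OF that] unfolding S by metis
  have "satisfaction_relation D H E S" unfolding satisfaction_relation_iff
  proof (intro allI impI conjI)
    fix s assume s: "maps s omega (un D H)"
    then have sA: "s \<epsilon> Asg" by (simp add: mem_Asg)
    fix i j :: 'v assume ij: "i \<epsilon> omega" "j \<epsilon> omega"
    show "opair (c_mem i j) s \<epsilon> S \<longleftrightarrow> opair (ap s i) (ap s j) \<epsilon> E"
      using eq[OF tr_intros(1)[OF ij]] sA by (simp add: mem_S)
    show "opair (c_eq i j) s \<epsilon> S \<longleftrightarrow> ap s i = ap s j"
      using eq[OF tr_intros(2)[OF ij]] sA by (simp add: mem_S)
  next
    fix s assume s: "maps s omega (un D H)"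
    then have sA: "s \<epsilon> Asg" by (simp add: mem_Asg)
    fix f :: 'v assume "formula f"
    then obtain T where T: "tr f T" using tr_unique by blast
    show "opair (c_neg f) s \<epsilon> S \<longleftrightarrow> \<not> opair f s \<epsilon> S"
      unfolding eq[OF T] eq[OF tr_intros(3)[OF T]] using sA by simp
    {
      fix g :: 'v assume "formula g"
      then obtain B where B: "tr g B" using tr_unique by blast
      show "opair (c_and f g) s \<epsilon> S \<longleftrightarrow> opair f s \<epsilon> S \<and> opair g s \<epsilon> S"
        unfolding eq[OF T] eq[OF B] eq[OF tr_intros(4)[OF T B]] by (simp add: mem_S)
    }
    fix i :: 'v assume i: "i \<epsilon> omega"
    show "opair (c_ex i f) s \<epsilon> S \<longleftrightarrow> (\<exists>x. x \<epsilon> D \<and> opair f (upd s i x) \<epsilon> S)"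
      unfolding eq[OF T] eq[OF tr_intros(5)[OF T i]] using sA by (simp add: mem_S)
    show "opair (c_ex2 i f) s \<epsilon> S \<longleftrightarrow> (\<exists>x. x \<epsilon> H \<and> opair f (upd s i x) \<epsilon> S)"
      unfolding eq[OF T] eq[OF tr_intros(6)[OF T i]] using sA by (simp add: mem_S)
  qed
  moreover have "elts S \<subseteq> elts (cprod Form Asg)"
    using \<open>\<forall>p. p \<epsilon> S \<longleftrightarrow> ?P p\<close> tr_Bnd by (auto simp: mem_Form subset_iff)
  ultimately show ?thesis by blast
qed

lemma sat_iff: "satisfaction_relation D H E S \<Longrightarrow> assignment D H s \<Longrightarrow> formula f \<Longrightarrow>
    sat D H E f s \<longleftrightarrow> opair f s \<epsilon> S"
  unfolding sat_def using satisfaction_unique by blast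

lemma sat_clauses:
  assumes s: "assignment D H s"
  shows "i \<epsilon> omega \<Longrightarrow> j \<epsilon> omega \<Longrightarrow> sat D H E (c_mem i j) s \<longleftrightarrow> opair (ap s i) (ap s j) \<epsilon> E"
    "i \<epsilon> omega \<Longrightarrow> j \<epsilon> omega \<Longrightarrow> sat D H E (c_eq i j) s \<longleftrightarrow> ap s i = ap s j"
    "formula f \<Longrightarrow> sat D H E (c_neg f) s \<longleftrightarrow> \<not> sat D H E f s"
    "formula f \<Longrightarrow> formula g \<Longrightarrow> sat D H E (c_and f g) s \<longleftrightarrow> sat D H E f s \<and> sat D H E g s"
    "i \<epsilon> omega \<Longrightarrow> formula f \<Longrightarrow> sat D H E (c_ex i f) s \<longleftrightarrow> (\<exists>x. x \<epsilon> D \<and> sat D H E f (upd s i x))"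
    "i \<epsilon> omega \<Longrightarrow> formula f \<Longrightarrow> sat D H E (c_ex2 i f) s \<longleftrightarrow> (\<exists>x. x \<epsilon> H \<and> sat D H E f (upd s i x))"
proof -
  obtain S where S: "satisfaction_relation D H E S" using satisfaction_exists by blast
  note cl = S[unfolded satisfaction_relation_iff, rule_format, OF s[unfolded assignment_iff]]
  note iff = sat_iff[OF S s]
  show "i \<epsilon> omega \<Longrightarrow> j \<epsilon> omega \<Longrightarrow> sat D H E (c_mem i j) s \<longleftrightarrow> opair (ap s i) (ap s j) \<epsilon> E"
    "i \<epsilon> omega \<Longrightarrow> j \<epsilon> omega \<Longrightarrow> sat D H E (c_eq i j) s \<longleftrightarrow> ap s i = ap s j"
    "formula f \<Longrightarrow> sat D H E (c_neg f) s \<longleftrightarrow> \<not> sat D H E f s"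
    "formula f \<Longrightarrow> formula g \<Longrightarrow> sat D H E (c_and f g) s \<longleftrightarrow> sat D H E f s \<and> sat D H E g s"
    using cl by (simp_all add: iff formula_intros)
  have up: "sat D H E f (upd s i x) \<longleftrightarrow> opair f (upd s i x) \<epsilon> S" if "i \<epsilon> omega" "formula f" "x \<epsilon> D \<or> x \<epsilon> H" for x
    using sat_iff[OF S assignment_upd[OF s that(1,3)] that(2)] .
  show "i \<epsilon> omega \<Longrightarrow> formula f \<Longrightarrow> sat D H E (c_ex i f) s \<longleftrightarrow> (\<exists>x. x \<epsilon> D \<and> sat D H E f (upd s i x))"
    "i \<epsilon> omega \<Longrightarrow> formula f \<Longrightarrow> sat D H E (c_ex2 i f) s \<longleftrightarrow> (\<exists>x. x \<epsilon> H \<and> sat D H E f (upd s i x))"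
    using cl up by (simp_all add: iff formula_intros) metis+
qed

end

lemma univ_Asg: "univ b U \<Longrightarrow> D \<in> U \<Longrightarrow> H \<in> U \<Longrightarrow> Asg D H \<in> U"
proof -
  assume U: "univ b U" "D \<in> U" "H \<in> U"
  have "pow (cprod omega (un D H)) \<in> U" using U by (intro univ_intros)
  then show ?thesis by (rule univ_sub[OF U(1)]) (auto simp: mem_Asg intro: maps_sub)
qed

lemma sat_dfn:
  assumes "dft b d" "dft b h" "dft b r" "dft b t" "dft b u"
  shows "dfn b (\<lambda>e. sat (d e) (h e) (r e) (t e) (u e))"
proof -
  let ?Q = "\<lambda>S e. formula (t e) \<and> maps (u e) omega (un (d e) (h e)) \<and>
    satisfaction_relation (d e) (h e) (r e) S \<and> opair (t e) (u e) \<epsilon> S"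
  have "dfn b (\<lambda>e. \<exists>S. ?Q S e)"
  proof (rule dfn_ex, goal_cases)
    case 1
    show ?case
      by (intro dfn_intros dft_ren[OF assms(1)] dft_ren[OF assms(2)] dft_ren[OF assms(3)] dft_ren[OF assms(4)] dft_ren[OF assms(5)])
  next
    case (2 U e)
    then obtain S where S: "formula (t e)" "maps (u e) omega (un (d e) (h e))"
      "satisfaction_relation (d e) (h e) (r e) S" "opair (t e) (u e) \<epsilon> S" by blast
    \<comment> \<open>The given \<open>S\<close> may lie outside \<open>U\<close>; the bounded one
      does not, and the two agree on formulas and assignments.\<close>
    obtain S' where S': "satisfaction_relation (d e) (h e) (r e) S'" "elts S' \<subseteq> elts (cprod Form (Asg (d e) (h e)))"
      using satisfaction_exists by blast
    have "cprod Form (Asg (d e) (h e)) \<in> U"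
      using dft_closed[OF assms(1) 2(1,2)] dft_closed[OF assms(2) 2(1,2)] 2(1) by (intro univ_intros univ_Asg)
    then have "S' \<in> U" by (rule univ_sub[OF 2(1)]) (use S'(2) in auto)
    moreover have "opair (t e) (u e) \<epsilon> S'"
      using satisfaction_unique[OF S(3) S'(1) S(1)] S(2,4) assignment_iff by blast
    ultimately show ?case using S S' by blast
  qed
  then show ?thesis by (rule dfn_cong) (simp add: sat_def assignment_iff)
qed

lemma sat_in_dfn [dfn_intros]:
  assumes "dft b t" "dft b u" "dft b v"
  shows "dfn b (\<lambda>e. sat_in (t e) (u e) (v e))"
  unfolding sat_in_def by (intro sat_dfn dfn_intros assms)

lemma assignment_empty: "assignment a empty s \<longleftrightarrow> maps s omega a"
  unfolding assignment_iff maps_iff by simp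

lemma sat_inD: "sat_in a f s \<Longrightarrow> formula f \<and> maps s omega a"
  unfolding sat_in_def sat_def assignment_empty by blast

lemma sat_in_clauses:
  assumes s: "maps s omega a"
  shows "i \<epsilon> omega \<Longrightarrow> j \<epsilon> omega \<Longrightarrow> sat_in a (c_mem i j) s \<longleftrightarrow> ap s i \<epsilon> ap s j"
    "i \<epsilon> omega \<Longrightarrow> j \<epsilon> omega \<Longrightarrow> sat_in a (c_eq i j) s \<longleftrightarrow> ap s i = ap s j"
    "formula f \<Longrightarrow> sat_in a (c_neg f) s \<longleftrightarrow> \<not> sat_in a f s"
    "formula f \<Longrightarrow> formula g \<Longrightarrow> sat_in a (c_and f g) s \<longleftrightarrow> sat_in a f s \<and> sat_in a g s"
    "i \<epsilon> omega \<Longrightarrow> formula f \<Longrightarrow> sat_in a (c_ex i f) s \<longleftrightarrow> (\<exists>x. x \<epsilon> a \<and> sat_in a f (upd s i x))"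
proof -
  have "ap s k \<epsilon> a" if "k \<epsilon> omega" for k using s that maps_iff by blast
  then show "i \<epsilon> omega \<Longrightarrow> j \<epsilon> omega \<Longrightarrow> sat_in a (c_mem i j) s \<longleftrightarrow> ap s i \<epsilon> ap s j"
    unfolding sat_in_def by (simp add: sat_clauses(1)[OF s[folded assignment_empty]])
qed (unfold sat_in_def, simp_all add: sat_clauses[OF s[folded assignment_empty]])

section \<open>Support and absoluteness of coded Delta0 formulas\<close>

lemma ap_in: "maps s omega t \<Longrightarrow> k \<epsilon> omega \<Longrightarrow> ap s k \<epsilon> t"
  by (simp add: maps_iff)

lemma ap_upd_omega: "maps s omega t \<Longrightarrow> k \<epsilon> omega \<Longrightarrow> ap (upd s i x) k = (if k = i then x else ap s k)"
  unfolding maps_iff by (rule ap_upd) auto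

lemma sat_in_bex:
  assumes s: "maps s omega t" and t: "transitive_set t" and ij: "i \<epsilon> omega" "j \<epsilon> omega" "i \<noteq> j" and f: "formula f"
  shows "sat_in t (c_ex i (c_and (c_mem i j) f)) s \<longleftrightarrow> (\<exists>x. x \<epsilon> ap s j \<and> sat_in t f (upd s i x))"
proof -
  have "sat_in t (c_and (c_mem i j) f) (upd s i x) \<longleftrightarrow> x \<epsilon> ap s j \<and> sat_in t f (upd s i x)" if "x \<epsilon> t" for x
    using ij f sat_in_clauses[OF maps_upd[OF s ij(1) that]] ap_upd_omega[OF s]
    by (simp add: formula_intros)
  moreover have "x \<epsilon> t" if "x \<epsilon> ap s j" for x
    using transitive_setD[OF t ap_in[OF s ij(2)] that] .
  ultimately show ?thesis
    using sat_in_clauses(5)[OF s ij(1), of "c_and (c_mem i j) f"] ij f by (simp add: formula_intros) blast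
qed

lemma omega_un: "m \<epsilon> omega \<Longrightarrow> n \<epsilon> omega \<Longrightarrow> un m n \<epsilon> omega"
proof -
  assume mn: "m \<epsilon> omega" "n \<epsilon> omega"
  have "un m n = n" if "m = n \<or> m \<epsilon> n" by (rule set_ext) (use that ordinal_trans[OF ordinal_nat[OF mn(2)]] in auto)
  moreover have "un m n = m" if "n \<epsilon> m" by (rule set_ext) (use that ordinal_trans[OF ordinal_nat[OF mn(1)]] in auto)
  ultimately show ?thesis using ordinal_linear[OF ordinal_nat[OF mn(1)] ordinal_nat[OF mn(2)]] mn by metis
qed

definition supported :: "'v::zfc \<Rightarrow> 'v \<Rightarrow> bool" where
  "supported N g \<longleftrightarrow> (\<forall>t s s'. transitive_set t \<longrightarrow> maps s omega t \<longrightarrow> maps s' omega t \<longrightarrow>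
    (\<forall>k. k \<epsilon> N \<longrightarrow> ap s k = ap s' k) \<longrightarrow> (sat_in t g s \<longleftrightarrow> sat_in t g s'))"

lemma supportedD: "supported N g \<Longrightarrow> transitive_set t \<Longrightarrow> maps s omega t \<Longrightarrow> maps s' omega t \<Longrightarrow>
    (\<And>k. k \<epsilon> N \<Longrightarrow> ap s k = ap s' k) \<Longrightarrow> sat_in t g s \<longleftrightarrow> sat_in t g s'"
  unfolding supported_def by blast

lemma supportedI: "(\<And>t s s'. transitive_set t \<Longrightarrow> maps s omega t \<Longrightarrow> maps s' omega t \<Longrightarrow>
    (\<And>k. k \<epsilon> N \<Longrightarrow> ap s k = ap s' k) \<Longrightarrow> sat_in t g s \<longleftrightarrow> sat_in t g s') \<Longrightarrow> supported N g"
  unfolding supported_def by blast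

text \<open>\<open>N\<close> is a number of the model and may be nonstandard, like \<open>g\<close>;
  hence the induction on codes. The bound later allows an assignment of unbounded rank to be
  replaced by a bounded one.\<close>

lemma delta0_support:
  assumes "delta0 g"
  shows "\<exists>N. N \<epsilon> omega \<and> supported N g"
proof (rule delta0_induct[where P = "\<lambda>g. \<exists>N. N \<epsilon> omega \<and> supported N g", OF _ assms])
  show "dfn True (\<lambda>e. \<exists>N. N \<epsilon> omega \<and> supported N (e 0))" unfolding supported_def by (intro dfn_intros)
next
  fix i j :: 'a assume ij: "i \<epsilon> omega" "j \<epsilon> omega"
  then have "un (succ i) (succ j) \<epsilon> omega" by (simp add: omega_un)
  moreover have "supported (un (succ i) (succ j)) (c_mem i j)" "supported (un (succ i) (succ j)) (c_eq i j)"
    by (rule supportedI, simp add: sat_in_clauses ij)+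
  ultimately show "\<exists>N. N \<epsilon> omega \<and> supported N (c_mem i j)" "\<exists>N. N \<epsilon> omega \<and> supported N (c_eq i j)" by blast+
next
  fix f :: 'a assume f: "formula f" and "\<exists>N. N \<epsilon> omega \<and> supported N f"
  then obtain N where N: "N \<epsilon> omega" "supported N f" by blast
  have "supported N (c_neg f)"
  proof (rule supportedI)
    fix t s s' assume "transitive_set t" and s: "maps s omega t" "maps s' omega t"
      and "\<And>k. k \<epsilon> N \<Longrightarrow> ap s k = ap s' k"
    then have "sat_in t f s \<longleftrightarrow> sat_in t f s'" by (intro supportedD[OF N(2)])
    then show "sat_in t (c_neg f) s \<longleftrightarrow> sat_in t (c_neg f) s'"
      by (simp add: sat_in_clauses(3)[OF s(1)] sat_in_clauses(3)[OF s(2)] f)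
  qed
  with N show "\<exists>N. N \<epsilon> omega \<and> supported N (c_neg f)" by blast
next
  fix f g :: 'a assume fg: "formula f" "formula g" and "\<exists>N. N \<epsilon> omega \<and> supported N f" "\<exists>N. N \<epsilon> omega \<and> supported N g"
  then obtain N M where NM: "N \<epsilon> omega" "supported N f" "M \<epsilon> omega" "supported M g" by blast
  have "supported (un N M) (c_and f g)"
  proof (rule supportedI)
    fix t s s' assume t: "transitive_set t" and s: "maps s omega t" "maps s' omega t"
      and eq: "\<And>k. k \<epsilon> un N M \<Longrightarrow> ap s k = ap s' k"
    have "sat_in t f s \<longleftrightarrow> sat_in t f s'" by (rule supportedD[OF NM(2) t s]) (simp add: eq)
    moreover have "sat_in t g s \<longleftrightarrow> sat_in t g s'" by (rule supportedD[OF NM(4) t s]) (simp add: eq)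
    ultimately show "sat_in t (c_and f g) s \<longleftrightarrow> sat_in t (c_and f g) s'"
      by (simp add: sat_in_clauses(4)[OF s(1)] sat_in_clauses(4)[OF s(2)] fg)
  qed
  then show "\<exists>N. N \<epsilon> omega \<and> supported N (c_and f g)" using omega_un[OF NM(1,3)] by blast
next
  fix i j f :: 'a assume ij: "i \<epsilon> omega" "j \<epsilon> omega" "i \<noteq> j" and f: "formula f" and "\<exists>N. N \<epsilon> omega \<and> supported N f"
  then obtain N where N: "N \<epsilon> omega" "supported N f" by blast
  have "supported (un N (succ j)) (c_ex i (c_and (c_mem i j) f))"
  proof (rule supportedI)
    fix t s s' assume t: "transitive_set t" and s: "maps s omega t" "maps s' omega t"
      and eq: "\<And>k. k \<epsilon> un N (succ j) \<Longrightarrow> ap s k = ap s' k"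
    have j: "ap s j = ap s' j" using eq by simp
    have "sat_in t f (upd s i x) \<longleftrightarrow> sat_in t f (upd s' i x)" if "x \<epsilon> ap s j" for x
    proof (rule supportedD[OF N(2) t])
      have x: "x \<epsilon> t" using transitive_setD[OF t ap_in[OF s(1) ij(2)] that] .
      show "maps (upd s i x) omega t" by (rule maps_upd[OF s(1) ij(1) x])
      show "maps (upd s' i x) omega t" by (rule maps_upd[OF s(2) ij(1) x])
      show "ap (upd s i x) k = ap (upd s' i x) k" if "k \<epsilon> N" for k
        using eq[of k] that omega_subset[OF N(1) that] by (simp add: ap_upd_omega[OF s(1)] ap_upd_omega[OF s(2)])
    qed
    then show "sat_in t (c_ex i (c_and (c_mem i j) f)) s \<longleftrightarrow> sat_in t (c_ex i (c_and (c_mem i j) f)) s'"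
      unfolding sat_in_bex[OF s(1) t ij f] sat_in_bex[OF s(2) t ij f] j by blast
  qed
  then show "\<exists>N. N \<epsilon> omega \<and> supported N (c_ex i (c_and (c_mem i j) f))"
    using omega_un[OF N(1) succ_omega[OF ij(2)]] by blast
qed

text \<open>Makes the choice of the transitive set in \<open>delta0_true\<close> immaterial.\<close>

lemma delta0_absolute:
  assumes "delta0 g" and t: "transitive_set t" "transitive_set t'" and s: "maps s omega t" "maps s omega t'"
  shows "sat_in t g s \<longleftrightarrow> sat_in t' g s"
proof -
  have "\<forall>s. maps s omega t \<longrightarrow> maps s omega t' \<longrightarrow> (sat_in t g s \<longleftrightarrow> sat_in t' g s)" (is "?P g")
  proof (rule delta0_induct[where P = ?P, OF _ assms(1)])
    fix i j f :: 'a assume ij: "i \<epsilon> omega" "j \<epsilon> omega" "i \<noteq> j" and f: "formula f" and IH: "?P f"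
    show "?P (c_ex i (c_and (c_mem i j) f))"
    proof (intro allI impI)
      fix s assume s: "maps s omega t" "maps s omega t'"
      have "sat_in t f (upd s i x) \<longleftrightarrow> sat_in t' f (upd s i x)" if x: "x \<epsilon> ap s j" for x
      proof -
        have "x \<epsilon> t" "x \<epsilon> t'"
          using transitive_setD[OF t(1) ap_in[OF s(1) ij(2)] x] transitive_setD[OF t(2) ap_in[OF s(2) ij(2)] x] .
        then show ?thesis using IH maps_upd[OF s(1) ij(1)] maps_upd[OF s(2) ij(1)] by blast
      qed
      then show "sat_in t (c_ex i (c_and (c_mem i j) f)) s \<longleftrightarrow> sat_in t' (c_ex i (c_and (c_mem i j) f)) s"
        unfolding sat_in_bex[OF s(1) t(1) ij f] sat_in_bex[OF s(2) t(2) ij f] by blast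
    qed
  qed (intro dfn_intros, simp_all add: sat_in_clauses)
  then show ?thesis using s by blast
qed

lemma ex_transitive_range: "fun_on s omega \<Longrightarrow> \<exists>t. transitive_set t \<and> maps s omega t \<and> x \<epsilon> t"
proof -
  assume s: "fun_on s omega"
  obtain t where t: "transitive_set t" "\<forall>y. y \<epsilon> un (imgf s omega) (upair x x) \<longrightarrow> y \<epsilon> t"
    using transitive_closure by blast
  then have "ap s k \<epsilon> t" if "k \<epsilon> omega" for k using that by auto
  with s t show ?thesis unfolding maps_iff by auto
qed

section \<open>Truth of coded Delta0 and Sigma2 formulas in the universe\<close>

lemma delta0_true_iff:
  assumes "delta0 g" "transitive_set t" "maps s omega t"
  shows "delta0_true g s \<longleftrightarrow> sat_in t g s"
  unfolding delta0_true_def using assms delta0_absolute by blast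

lemma delta0_true_dfn [dfn_intros]:
  "dft True t \<Longrightarrow> dft True u \<Longrightarrow> dfn True (\<lambda>e. delta0_true (t e) (u e))"
  by (rule dfn_subst2[where P = delta0_true]) (unfold delta0_true_def, intro dfn_intros)

lemma sigma2_form_dfn: "dfn True (\<lambda>e. sigma2_form (e 0) (e 1) (e 2) (e 3))"
  unfolding sigma2_form_def by (intro dfn_intros)
lemmas [dfn_intros] = dfn_subst4[where P = sigma2_form, OF sigma2_form_dfn]

lemma sigma2_dfn [dfn_intros]: "dft True t \<Longrightarrow> dfn True (\<lambda>e. sigma2 (t e))"
  by (rule dfn_subst1[where P = sigma2]) (unfold sigma2_def, intro dfn_intros)

lemma sigma2_true_dfn [dfn_intros]:
  "dft True t \<Longrightarrow> dft True u \<Longrightarrow> dfn True (\<lambda>e. sigma2_true (t e) (u e))"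
  by (rule dfn_subst2[where P = sigma2_true]) (unfold sigma2_true_def, intro dfn_intros)

lemma sigma2_formula: "sigma2_form i j g f \<Longrightarrow> formula f"
  unfolding sigma2_form_def by (elim conjE, simp only:, intro formula_intros delta0_formula)

lemma sigma2_true_iff:
  assumes "sigma2_form i j g f" "fun_on s omega"
  shows "sigma2_true f s \<longleftrightarrow> (\<exists>x. \<forall>y. delta0_true g (upd (upd s i x) j y))"
proof -
  have "i' = i \<and> j' = j \<and> g' = g" if "sigma2_form i' j' g' f" for i' j' g'
    using that assms(1) unfolding sigma2_form_def by simp
  then show ?thesis unfolding sigma2_true_def using assms by metis
qed

lemma sigma2_sat_iff:
  assumes f: "sigma2_form i j g f" and s: "maps s omega a" 
  shows "sat_in a f s \<longleftrightarrow> (\<exists>x. x \<epsilon> a \<and> (\<forall>y. y \<epsilon> a \<longrightarrow> sat_in a g (upd (upd s i x) j y)))"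
proof -
  have ij: "i \<epsilon> omega" "j \<epsilon> omega" and g: "formula g" and f: "f = c_ex i (c_neg (c_ex j (c_neg g)))"
    using f delta0_formula unfolding sigma2_form_def by blast+
  have "sat_in a (c_neg (c_ex j (c_neg g))) (upd s i x) \<longleftrightarrow> (\<forall>y. y \<epsilon> a \<longrightarrow> sat_in a g (upd (upd s i x) j y))" if x: "x \<epsilon> a" for x
  proof -
    note s1 = maps_upd[OF s ij(1) x]
    have "sat_in a (c_neg g) (upd (upd s i x) j y) \<longleftrightarrow> \<not> sat_in a g (upd (upd s i x) j y)" if "y \<epsilon> a" for y
      using sat_in_clauses(3)[OF maps_upd[OF s1 ij(2) that] g] .
    then show ?thesis using ij g by (simp add: sat_in_clauses[OF s1] formula_intros)
  qed
  then show ?thesis unfolding f using ij g sat_in_clauses(5)[OF s ij(1)] by (simp add: formula_intros) blast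
qed

subsection \<open>Free variables\<close>

lemma free_closed_iff: "free_closed Z \<longleftrightarrow> (\<forall>i. i \<epsilon> omega \<longrightarrow> (\<forall>j. j \<epsilon> omega \<longrightarrow>
      opair i (c_mem i j) \<epsilon> Z \<and> opair j (c_mem i j) \<epsilon> Z \<and> opair i (c_eq i j) \<epsilon> Z \<and> opair j (c_eq i j) \<epsilon> Z)) \<and>
    (\<forall>k. k \<epsilon> omega \<longrightarrow> (\<forall>f. formula f \<longrightarrow> opair k f \<epsilon> Z \<longrightarrow> opair k (c_neg f) \<epsilon> Z \<and>
      (\<forall>g. formula g \<longrightarrow> opair k (c_and f g) \<epsilon> Z \<and> opair k (c_and g f) \<epsilon> Z) \<and>
      (\<forall>i. i \<epsilon> omega \<longrightarrow> i \<noteq> k \<longrightarrow> opair k (c_ex i f) \<epsilon> Z \<and> opair k (c_ex2 i f) \<epsilon> Z)))"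
  unfolding free_closed_def by (simp add: Ball_def imp_conjL)

lemma free_in_dfn [dfn_intros]: "dft True t \<Longrightarrow> dft True u \<Longrightarrow> dfn True (\<lambda>e. free_in (t e) (u e))"
  by (rule dfn_subst2[where P = free_in]) (unfold free_in_def free_closed_iff, intro dfn_intros)

lemma closed_formula_dfn [dfn_intros]: "dft True t \<Longrightarrow> dfn True (\<lambda>e. closed_formula (t e))"
  by (rule dfn_subst1[where P = closed_formula]) (unfold closed_formula_def, intro dfn_intros)

lemma free_in_intros:
  "i \<epsilon> omega \<Longrightarrow> j \<epsilon> omega \<Longrightarrow> free_in i (c_mem i j)" "i \<epsilon> omega \<Longrightarrow> j \<epsilon> omega \<Longrightarrow> free_in j (c_mem i j)"
  "i \<epsilon> omega \<Longrightarrow> j \<epsilon> omega \<Longrightarrow> free_in i (c_eq i j)" "i \<epsilon> omega \<Longrightarrow> j \<epsilon> omega \<Longrightarrow> free_in j (c_eq i j)"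
  "free_in k f \<Longrightarrow> free_in k (c_neg f)"
  "free_in k f \<Longrightarrow> formula g \<Longrightarrow> free_in k (c_and f g)" "free_in k f \<Longrightarrow> formula g \<Longrightarrow> free_in k (c_and g f)"
  "free_in k f \<Longrightarrow> i \<epsilon> omega \<Longrightarrow> i \<noteq> k \<Longrightarrow> free_in k (c_ex i f)" "free_in k f \<Longrightarrow> i \<epsilon> omega \<Longrightarrow> i \<noteq> k \<Longrightarrow> free_in k (c_ex2 i f)"
  unfolding free_in_def free_closed_iff by (simp_all add: formula_intros)

text \<open>The definition of \<open>free_in\<close> only provides closure under its clauses.
  Inversion comes from the set of those pairs that satisfy it, which is again closed.\<close>

lemma free_in_inversion:
  assumes "free_in k f"
  shows "(\<forall>i j. f = c_mem i j \<longrightarrow> k = i \<or> k = j) \<and> (\<forall>i j. f = c_eq i j \<longrightarrow> k = i \<or> k = j) \<and>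
    (\<forall>g. f = c_neg g \<longrightarrow> free_in k g) \<and> (\<forall>g h. f = c_and g h \<longrightarrow> free_in k g \<or> free_in k h) \<and>
    (\<forall>i g. f = c_ex i g \<longrightarrow> free_in k g \<and> k \<noteq> i)" (is "?P k f")
proof -
  have "\<exists>Z. \<forall>p. p \<epsilon> Z \<longleftrightarrow> p \<epsilon> cprod omega Form \<and> (\<exists>k f. p = opair k f \<and> free_in k f \<and> ?P k f)"
    by (rule comprehension[of _ "cprod omega Form"], intro dfn_intros) (erule conjunct1)
  then obtain Z where Z0: "\<forall>p. p \<epsilon> Z \<longleftrightarrow> p \<epsilon> cprod omega Form \<and> (\<exists>k f. p = opair k f \<and> free_in k f \<and> ?P k f)" by (rule exE)
  have Z: "opair k f \<epsilon> Z \<longleftrightarrow> free_in k f \<and> ?P k f" for k f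
  proof -
    have "free_in k f \<Longrightarrow> opair k f \<epsilon> cprod omega Form" unfolding free_in_def by (simp add: mem_Form)
    then show ?thesis using pair_set[OF Z0, of k f] by argo
  qed
  have "free_closed Z" unfolding free_closed_iff Z
    by (intro conjI allI impI; (elim conjE)?; (rule free_in_intros; assumption | simp))
  then have "opair k f \<epsilon> Z" using assms unfolding free_in_def by blast
  then show ?thesis unfolding Z by (rule conjunct2)
qed

lemma free_in_simps:
  "free_in k (c_mem i j) \<Longrightarrow> k = i \<or> k = j" "free_in k (c_eq i j) \<Longrightarrow> k = i \<or> k = j"
  "free_in k (c_neg g) \<Longrightarrow> free_in k g" "free_in k (c_and g h) \<Longrightarrow> free_in k g \<or> free_in k h"
  "free_in k (c_ex i g) \<Longrightarrow> free_in k g \<and> k \<noteq> i"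
  using free_in_inversion by blast+

subsection \<open>Codes of concrete formulas\<close>

primrec cd :: "fm \<Rightarrow> 'v::zfc" where
  "cd (FMem i j) = c_mem (numeral_set i) (numeral_set j)"
| "cd (FEq i j) = c_eq (numeral_set i) (numeral_set j)"
| "cd (FNeg p) = c_neg (cd p)"
| "cd (FAnd p q) = c_and (cd p) (cd q)"
| "cd (FEx i p) = c_ex (numeral_set i) (cd p)"

primrec fv :: "fm \<Rightarrow> nat set" where
  "fv (FMem i j) = {i, j}"
| "fv (FEq i j) = {i, j}"
| "fv (FNeg p) = fv p"
| "fv (FAnd p q) = fv p \<union> fv q"
| "fv (FEx i p) = fv p - {i}"

primrec rel :: "nat \<Rightarrow> fm \<Rightarrow> fm" where
  "rel m (FMem i j) = FMem i j"
| "rel m (FEq i j) = FEq i j"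
| "rel m (FNeg p) = FNeg (rel m p)"
| "rel m (FAnd p q) = FAnd (rel m p) (rel m q)"
| "rel m (FEx i p) = FEx i (FAnd (FMem i m) (rel m p))"

text \<open>Counts bound variables too, so that a variable from this bound on stays clear of every
  quantifier in \<open>rel\<close>.\<close>

primrec var_bound :: "fm \<Rightarrow> nat" where
  "var_bound (FMem i j) = Suc (max i j)"
| "var_bound (FEq i j) = Suc (max i j)"
| "var_bound (FNeg p) = var_bound p"
| "var_bound (FAnd p q) = max (var_bound p) (var_bound q)"
| "var_bound (FEx i p) = max (Suc i) (var_bound p)"

lemma formula_cd: "fo_formula (cd p)"
  by (induction p) (auto intro: fo_formula_intros)

lemma free_in_cd: "free_in k (cd p) \<Longrightarrow> \<exists>n\<in>fv p. k = numeral_set n"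
  by (induction p) (auto dest!: free_in_simps)

lemma fv_var_bound: "n \<in> fv p \<Longrightarrow> n < var_bound p"
  by (induction p) auto

lemma fv_rel: "fv (rel m p) \<subseteq> insert m (fv p)"
  by (induction p) auto

lemma sat_in_cd: "maps s omega t \<Longrightarrow> sat_in t (cd p) s \<longleftrightarrow> hold (elts t) p (\<lambda>k. ap s (numeral_set k))"
proof (induction p arbitrary: s)
  case (FEx i p)
  have "sat_in t (cd p) (upd s (numeral_set i) x) \<longleftrightarrow> hold (elts t) p ((\<lambda>k. ap s (numeral_set k))(i := x))" if "x \<epsilon> t" for x
  proof -
    have "(\<lambda>k. ap (upd s (numeral_set i) x) (numeral_set k)) = (\<lambda>k. ap s (numeral_set k))(i := x)"
      using ap_upd_omega[OF FEx.prems] by (auto simp: fun_eq_iff)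
    then show ?thesis using FEx.IH[OF maps_upd[OF FEx.prems _ that, of "numeral_set i"]] by simp
  qed
  then show ?case using sat_in_clauses(5)[OF FEx.prems] by (auto simp: formula_cd fo_formula_formula)
qed (simp_all add: sat_in_clauses formula_cd fo_formula_formula)

lemma hold_rel:
  "var_bound p \<le> m \<Longrightarrow> transitive_set t \<Longrightarrow> e m \<epsilon> t \<Longrightarrow> hold (elts t) (rel m p) e \<longleftrightarrow> hold (elts (e m)) p e"
proof (induction p arbitrary: e)
  case (FEx i p)
  have "hold (elts t) (rel m p) (e(i := x)) \<longleftrightarrow> hold (elts (e m)) p (e(i := x))" for x
    using FEx.IH[of "e(i := x)"] FEx.prems by (simp add: fun_upd_def)
  moreover have "x \<epsilon> t" if "x \<epsilon> e m" for x using FEx.prems that transitive_setD by blast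
  ultimately show ?case using FEx.prems by auto
qed auto

inductive d0 :: "fm \<Rightarrow> bool" where
  "d0 (FMem i j)"
| "d0 (FEq i j)"
| "d0 p \<Longrightarrow> d0 (FNeg p)"
| "d0 p \<Longrightarrow> d0 q \<Longrightarrow> d0 (FAnd p q)"
| "i \<noteq> j \<Longrightarrow> d0 p \<Longrightarrow> d0 (FEx i (FAnd (FMem i j) p))"

lemma delta0_cd: "d0 p \<Longrightarrow> delta0 (cd p)"
  by (induction rule: d0.induct) (auto intro: delta0_intros)

lemma d0_rel: "var_bound p \<le> m \<Longrightarrow> d0 (rel m p)"
  by (induction p) (auto intro: d0.intros)

subsection \<open>A formula for niceness\<close>

definition FAll :: "nat \<Rightarrow> fm \<Rightarrow> fm" where "FAll i p = FNeg (FEx i (FNeg p))"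
definition FImp :: "fm \<Rightarrow> fm \<Rightarrow> fm" where "FImp p q = FNeg (FAnd p (FNeg q))"
definition FOr :: "fm \<Rightarrow> fm \<Rightarrow> fm" where "FOr p q = FNeg (FAnd (FNeg p) (FNeg q))"
definition FIff :: "fm \<Rightarrow> fm \<Rightarrow> fm" where "FIff p q = FAnd (FImp p q) (FImp q p)"

lemma hold_connectives:
  "hold U (FAll i p) s \<longleftrightarrow> (\<forall>x\<in>U. hold U p (s(i := x)))" "hold U (FImp p q) s \<longleftrightarrow> (hold U p s \<longrightarrow> hold U q s)"
  "hold U (FOr p q) s \<longleftrightarrow> hold U p s \<or> hold U q s" "hold U (FIff p q) s \<longleftrightarrow> (hold U p s \<longleftrightarrow> hold U q s)"
  by (auto simp: FAll_def FImp_def FOr_def FIff_def)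

text \<open>The clauses of \<open>nice\<close> that are first-order over \<open>U\<close>. The first
  two clauses refer to sets that might lie outside \<open>U\<close> and are left to
  \<open>nice_matrix\<close>.\<close>

definition nice_fm :: fm where
  "nice_fm = FAnd (FAll 0 (FAll 1 (FEx 2 (FAnd (FMem 0 2) (FMem 1 2)))))
    (FAnd (FAll 0 (FEx 1 (FAll 2 (FImp (FMem 2 0) (FAll 3 (FImp (FMem 3 2) (FMem 3 1)))))))
    (FAnd (FAll 0 (FEx 1 (FAll 2 (FImp (FAll 3 (FImp (FMem 3 2) (FMem 3 0))) (FMem 2 1)))))
      (FEx 0 (FAnd (FEx 1 (FAnd (FMem 1 0) (FAll 2 (FNeg (FMem 2 1)))))
        (FAll 1 (FImp (FMem 1 0) (FAnd
          (FEx 2 (FAnd (FMem 2 0) (FAll 3 (FIff (FMem 3 2) (FOr (FMem 3 1) (FEq 3 1))))))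
          (FAll 4 (FImp (FMem 4 0)
            (FEx 2 (FAnd (FMem 2 0) (FAll 3 (FIff (FMem 3 2) (FOr (FEq 3 1) (FEq 3 4))))))))))))))) "

lemma nice_iff: "nice U \<longleftrightarrow> (\<forall>x\<in>U. \<forall>y. y \<epsilon> x \<longrightarrow> y \<in> U) \<and> (\<forall>x\<in>U. \<forall>y. elts y \<subseteq> elts x \<longrightarrow> y \<in> U) \<and> hold U nice_fm e"
  unfolding nice_def nice_fm_def by (simp add: hold_connectives)

text \<open>Variables 0 to 4 occur, whence the recurring assumption
  \<open>5 \<le> m\<close>.\<close>

lemma fv_nice_fm: "fv nice_fm = {}" "var_bound nice_fm = 5"
  by (auto simp: nice_fm_def FAll_def FImp_def FOr_def FIff_def)

text \<open>Variable \<open>m\<close> holds a candidate x and \<open>m + 1\<close> an arbitrary y: x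
  is transitive, contains y if y is a subset of one of its elements, and satisfies
  \<open>nice_fm\<close>. The subset clause is the one that uses y; to be quantified universally, it
  brings in the second quantifier of a Sigma2 formula.\<close>

definition nice_matrix :: "nat \<Rightarrow> fm" where
  "nice_matrix m = FAnd
    (FNeg (FEx (m + 2) (FAnd (FMem (m + 2) m) (FEx (m + 3) (FAnd (FMem (m + 3) (m + 2)) (FNeg (FMem (m + 3) m)))))))
    (FAnd (FNeg (FEx (m + 2) (FAnd (FMem (m + 2) m) (FAnd
       (FNeg (FEx (m + 3) (FAnd (FMem (m + 3) (m + 1)) (FNeg (FMem (m + 3) (m + 2)))))) (FNeg (FMem (m + 1) m))))))
     (rel m nice_fm))"

lemma d0_nice_matrix: "5 \<le> m \<Longrightarrow> d0 (nice_matrix m)"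
  unfolding nice_matrix_def by (intro d0.intros d0_rel) (auto simp: fv_nice_fm)

lemma fv_nice_matrix: "fv (nice_matrix m) \<subseteq> {m, m + 1}"
  using fv_rel[of m nice_fm] unfolding nice_matrix_def by (auto simp: fv_nice_fm)

lemma hold_nice_matrix:
  assumes m: "5 \<le> m" and t: "transitive_set t" and e: "e m \<epsilon> t" "e (m + 1) \<epsilon> t"
  shows "hold (elts t) (nice_matrix m) e \<longleftrightarrow> transitive_set (e m) \<and>
    (\<forall>z. z \<epsilon> e m \<longrightarrow> elts (e (m + 1)) \<subseteq> elts z \<longrightarrow> e (m + 1) \<epsilon> e m) \<and> hold (elts (e m)) nice_fm e"
proof -
  have tr: "y \<epsilon> t" if "x \<epsilon> t" "y \<epsilon> x" for x y using transitive_setD[OF t that] .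
  have 1: "hold (elts t) (rel m nice_fm) e \<longleftrightarrow> hold (elts (e m)) nice_fm e"
    using m t e(1) by (intro hold_rel) (simp_all add: fv_nice_fm)
  have 2: "(\<forall>z. z \<epsilon> t \<longrightarrow> z \<epsilon> e m \<longrightarrow> (\<forall>u. u \<epsilon> t \<longrightarrow> u \<epsilon> z \<longrightarrow> u \<epsilon> e m)) \<longleftrightarrow> transitive_set (e m)"
    using tr[OF e(1)] tr unfolding transitive_set_def subset_iff Ball_def in_elts by meson
  have 3: "(\<forall>z. z \<epsilon> t \<longrightarrow> z \<epsilon> e m \<longrightarrow> (\<forall>u. u \<epsilon> t \<longrightarrow> u \<epsilon> e (m + 1) \<longrightarrow> u \<epsilon> z) \<longrightarrow> e (m + 1) \<epsilon> e m) \<longleftrightarrow>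
      (\<forall>z. z \<epsilon> e m \<longrightarrow> elts (e (m + 1)) \<subseteq> elts z \<longrightarrow> e (m + 1) \<epsilon> e m)"
    using tr[OF e(1)] tr[OF e(2)] unfolding subset_iff in_elts by meson
  have "hold (elts t) (nice_matrix m) e \<longleftrightarrow>
      (\<forall>z. z \<epsilon> t \<longrightarrow> z \<epsilon> e m \<longrightarrow> (\<forall>u. u \<epsilon> t \<longrightarrow> u \<epsilon> z \<longrightarrow> u \<epsilon> e m)) \<and>
      (\<forall>z. z \<epsilon> t \<longrightarrow> z \<epsilon> e m \<longrightarrow> (\<forall>u. u \<epsilon> t \<longrightarrow> u \<epsilon> e (m + 1) \<longrightarrow> u \<epsilon> z) \<longrightarrow> e (m + 1) \<epsilon> e m) \<and>
      hold (elts t) (rel m nice_fm) e"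
    unfolding nice_matrix_def by (simp add: Bex_def) blast
  then show ?thesis unfolding 1 2 3 .
qed

subsection \<open>Transfer of true statements to correct cardinals\<close>

definition witness_formula :: "nat \<Rightarrow> 'v::zfc \<Rightarrow> 'v" where
  "witness_formula m g = c_ex (numeral_set m) (c_neg (c_ex (numeral_set (m + 1))
    (c_neg (c_and (cd (nice_matrix m)) g))))"

lemma sigma2_witness_formula:
  "5 \<le> m \<Longrightarrow> delta0 g \<Longrightarrow>
    sigma2_form (numeral_set m) (numeral_set (m + 1)) (c_and (cd (nice_matrix m)) g) (witness_formula m g)"
  unfolding sigma2_form_def witness_formula_def by (simp add: delta0_intros delta0_cd d0_nice_matrix del: numeral_set.simps)

text \<open>\<open>R\<close> is the meaning of \<open>g\<close>: a relation between the nice set in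
  variable \<open>m\<close> and the parameter in variable 0.\<close>

context
  fixes m :: nat and g :: "'v::zfc" and R :: "'v \<Rightarrow> 'v \<Rightarrow> bool"
  assumes m: "5 \<le> m" and g: "delta0 g"
    and R: "\<And>t s. transitive_set t \<Longrightarrow> maps s omega t \<Longrightarrow> nice (elts (ap s (numeral_set m))) \<Longrightarrow>
      sat_in t g s \<longleftrightarrow> R (ap s (numeral_set m)) (ap s (numeral_set 0))"
begin

lemma sat_witness_body:
  assumes s: "maps s omega t" and t: "transitive_set t" and x: "x \<epsilon> t" and y: "y \<epsilon> t"
  defines "s' \<equiv> upd (upd s (numeral_set m) x) (numeral_set (m + 1)) y"
  shows "sat_in t (c_and (cd (nice_matrix m)) g) s' \<longleftrightarrow> transitive_set x \<and>
    (\<forall>z. z \<epsilon> x \<longrightarrow> elts y \<subseteq> elts z \<longrightarrow> y \<epsilon> x) \<and> hold (elts x) nice_fm (\<lambda>k. ap s' (numeral_set k)) \<and> sat_in t g s'"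
    "maps s' omega t" "ap s' (numeral_set m) = x" "ap s' (numeral_set 0) = ap s (numeral_set 0)"
proof -
  have s1: "maps (upd s (numeral_set m) x) omega t" by (rule maps_upd[OF s numeral_set_omega x])
  show s': "maps s' omega t" unfolding s'_def by (rule maps_upd[OF s1 numeral_set_omega y])
  have ap: "ap s' k = (if k = numeral_set (m + 1) then y else if k = numeral_set m then x else ap s k)" if "k \<epsilon> omega" for k
    unfolding s'_def using that by (simp add: ap_upd_omega[OF s1] ap_upd_omega[OF s] del: numeral_set.simps)
  show e: "ap s' (numeral_set m) = x" by (simp add: ap del: numeral_set.simps)
  have e1: "ap s' (numeral_set (Suc m)) = y" by (simp add: ap del: numeral_set.simps)
  show "ap s' (numeral_set 0) = ap s (numeral_set 0)" using m by (simp add: ap del: numeral_set.simps)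
  show "sat_in t (c_and (cd (nice_matrix m)) g) s' \<longleftrightarrow> transitive_set x \<and>
    (\<forall>z. z \<epsilon> x \<longrightarrow> elts y \<subseteq> elts z \<longrightarrow> y \<epsilon> x) \<and> hold (elts x) nice_fm (\<lambda>k. ap s' (numeral_set k)) \<and> sat_in t g s'"
    using sat_in_clauses(4)[OF s', of "cd (nice_matrix m)" g] delta0_formula[OF g]
      hold_nice_matrix[OF m t, of "\<lambda>k. ap s' (numeral_set k)"] x y
    by (simp add: sat_in_cd[OF s'] formula_cd fo_formula_formula e e1 del: numeral_set.simps)
qed

text \<open>\<open>V \<delta>\<close> contains all subsets of its elements, so a y ranging over
  \<open>V \<delta>\<close> suffices to see that x is closed under subsets in the universe.\<close>

lemma witness_formula_sat:
  assumes o: "ordinal \<delta>" and sat: "sat_in (V \<delta>) (witness_formula m g) s"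
  shows "\<exists>x. x \<epsilon> V \<delta> \<and> nice (elts x) \<and> R x (ap s (numeral_set 0))"
proof -
  have s: "maps s omega (V \<delta>)" using sat_inD[OF sat] by blast
  have t: "transitive_set (V \<delta>)" by (rule V_transitive[OF o])
  obtain x where x: "x \<epsilon> V \<delta>" and *: "\<And>y. y \<epsilon> V \<delta> \<Longrightarrow>
      sat_in (V \<delta>) (c_and (cd (nice_matrix m)) g) (upd (upd s (numeral_set m) x) (numeral_set (m + 1)) y)"
    using sat unfolding sigma2_sat_iff[OF sigma2_witness_formula[OF m g] s] by blast
  note b = sat_witness_body[OF s t x]
  have all: "transitive_set x \<and> (\<forall>z. z \<epsilon> x \<longrightarrow> elts y \<subseteq> elts z \<longrightarrow> y \<epsilon> x)" if y: "y \<epsilon> V \<delta>" for y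
    using *[OF y] unfolding b(1)[OF y] by blast
  have "y \<epsilon> x" if "z \<epsilon> x" "elts y \<subseteq> elts z" for y z
    using all[of y] V_subset[OF o V_trans[OF o x that(1)] that(2)] that by blast
  moreover have "transitive_set x" using all[OF x] by blast
  moreover have "hold (elts x) nice_fm (\<lambda>k. ap (upd (upd s (numeral_set m) x) (numeral_set (m + 1)) x) (numeral_set k))"
    using *[OF x] unfolding b(1)[OF x] by blast
  ultimately have nice: "nice (elts x)" using nice_iff transitive_setD by (metis in_elts)
  have "sat_in (V \<delta>) g (upd (upd s (numeral_set m) x) (numeral_set (m + 1)) x)"
    using *[OF x] unfolding b(1)[OF x] by blast
  then have "R x (ap s (numeral_set 0))" using R[OF t b(2)[OF x]] nice b(3,4)[OF x] by simp
  with x nice show ?thesis by blast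
qed

lemma witness_formula_true:
  assumes s: "fun_on s omega" and x: "nice (elts x)" "R x (ap s (numeral_set 0))"
  shows "sigma2_true (witness_formula m g) s"
  unfolding sigma2_true_iff[OF sigma2_witness_formula[OF m g] s]
proof (intro exI allI)
  fix y
  let ?s' = "upd (upd s (numeral_set m) x) (numeral_set (m + 1)) y"
  have o: "numeral_set m \<epsilon> omega" "numeral_set (m + 1) \<epsilon> omega" by (simp_all del: numeral_set.simps)
  have "fun_on ?s' omega" using s o by (intro fun_on_upd)
  obtain t where t: "transitive_set t" "maps s omega t" "upair x y \<epsilon> t" using ex_transitive_range[OF s] by blast
  have xy: "x \<epsilon> t" "y \<epsilon> t" using t(1,3) transitive_setD by (metis mem_upair)+
  note b = sat_witness_body[OF t(2,1) xy]
  have nice: "transitive_set x" "\<And>z. z \<epsilon> x \<Longrightarrow> elts y \<subseteq> elts z \<Longrightarrow> y \<epsilon> x" "hold (elts x) nice_fm (\<lambda>k. ap ?s' (numeral_set k))"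
  proof -
    show "transitive_set x" unfolding transitive_set_def subset_iff in_elts
      using nice_transitive[OF x(1), unfolded in_elts] by auto
    show "y \<epsilon> x" if "z \<epsilon> x" "elts y \<subseteq> elts z" for z
      using nice_subset[OF x(1), unfolded in_elts] that .
    show "hold (elts x) nice_fm (\<lambda>k. ap ?s' (numeral_set k))" using x(1) nice_iff by blast
  qed
  have "sat_in t g ?s'" using R[OF t(1) b(2)] b(3,4) x by simp
  then have "sat_in t (c_and (cd (nice_matrix m)) g) ?s'" unfolding b(1) using nice by blast
  then show "delta0_true (c_and (cd (nice_matrix m)) g) ?s'" unfolding delta0_true_def using t b(2) by blast
qed

end

lemma absolute_fm:
  assumes "dfn False (\<lambda>e. Q (e 0) (e 1))"
  shows "\<exists>q. \<forall>U s. nice U \<longrightarrow> s 0 \<in> U \<longrightarrow> hold U q s \<longleftrightarrow> (\<exists>z\<in>U. Q z (s (0::nat)))"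
proof -
  obtain q where q: "\<forall>U e. nice U \<longrightarrow> range e \<subseteq> U \<longrightarrow> (Q (e 0) (e 1) \<longleftrightarrow> hold U q e)"
    using assms unfolding dfn_def join_def by auto
  \<comment> \<open>The witness moves to variable 1 and all further variables to the parameter at 0,
    so that besides the witness only \<open>s 0\<close> has to lie in \<open>U\<close>.\<close>
  obtain q' where q': "\<forall>U (s :: nat \<Rightarrow> 'a). hold U q' s = hold U q (s \<circ> (\<lambda>k. if k = 0 then 1 else 0))"
    using hold_rename by blast
  have "hold U (FEx 1 q') s \<longleftrightarrow> (\<exists>z\<in>U. Q z (s 0))" if U: "nice U" "s 0 \<in> U" for U s
  proof -
    have "hold U q' (s(1 := z)) \<longleftrightarrow> Q z (s 0)" if "z \<in> U" for z
    proof -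
      let ?e = "s(1 := z) \<circ> (\<lambda>k :: nat. if k = 0 then 1 else 0)"
      have "range ?e \<subseteq> U" using that U by auto
      then have "Q (?e 0) (?e 1) \<longleftrightarrow> hold U q ?e" 
        using spec[OF spec[OF q, of U], of ?e] U(1) by argo
      then show ?thesis using q' by simp
    qed
    then show ?thesis by simp
  qed
  then show ?thesis by blast
qed

text \<open>Quantifying away the variables \<open>a, \<dots>, a + n - 1\<close>, which do not matter, makes them bound.\<close>

primrec close :: "nat \<Rightarrow> nat \<Rightarrow> fm \<Rightarrow> fm" where
  "close a 0 p = p"
| "close a (Suc n) p = FEx (a + n) (close a n p)"

lemma fv_close: "x \<in> fv (close a n p) \<longleftrightarrow> x \<in> fv p \<and> \<not> (a \<le> x \<and> x < a + n)"
proof (induction n)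
  case (Suc n)
  then show ?case by simp linarith
qed simp

text \<open>\<open>f\<close> says that some nice set contains the parameter and, by absoluteness of
  \<open>Q\<close>, a witness for it. In the universe, a nice level of the hierarchy that contains
  both is such a set.\<close>

lemma transfer_parameter:
  assumes Q: "dfn False (\<lambda>e. Q (e 0) (e 1))"
  shows "\<exists>f. sigma2 f \<and> (\<forall>\<delta> s. ordinal \<delta> \<longrightarrow> sat_in (V \<delta>) f s \<longrightarrow> (\<exists>z. z \<epsilon> V \<delta> \<and> Q z (ap s (numeral_set 0)))) \<and>
    (\<forall>s z. fun_on s omega \<longrightarrow> Q z (ap s (numeral_set 0)) \<longrightarrow> sigma2_true f s)"
proof -
  obtain q where q: "\<forall>U s. nice U \<longrightarrow> s 0 \<in> U \<longrightarrow> hold U q s \<longleftrightarrow> (\<exists>z\<in>U. Q z (s 0))"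
    using absolute_fm[OF Q] by blast
  define m where "m = max 5 (var_bound q)"
  define g :: 'a where "g = cd (FAnd (FMem 0 m) (rel m q))"
  have m: "5 \<le> m" "var_bound q \<le> m" by (simp_all add: m_def)
  have g: "delta0 g" unfolding g_def by (intro delta0_cd d0.intros d0_rel m)
  have R: "sat_in t g s \<longleftrightarrow> (\<lambda>x r. r \<epsilon> x \<and> (\<exists>z. z \<epsilon> x \<and> Q z r)) (ap s (numeral_set m)) (ap s (numeral_set 0))"
    if "transitive_set t" "maps s omega t" "nice (elts (ap s (numeral_set m)))" for t s
  proof -
    have "ap s (numeral_set m) \<epsilon> t" using that by (intro ap_in) auto
    then have "hold (elts t) (rel m q) (\<lambda>k. ap s (numeral_set k)) \<longleftrightarrow>
        hold (elts (ap s (numeral_set m))) q (\<lambda>k. ap s (numeral_set k))"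
      using hold_rel[OF m(2) that(1), of "\<lambda>k. ap s (numeral_set k)"] by simp
    then show ?thesis unfolding g_def sat_in_cd[OF that(2)]
      using q[rule_format, OF that(3), of "\<lambda>k. ap s (numeral_set k)"]
      unfolding hold.simps Bex_def in_elts by blast
  qed
  let ?R = "\<lambda>x r. r \<epsilon> x \<and> (\<exists>z. z \<epsilon> x \<and> Q z r)"
  have w: "\<exists>x. x \<epsilon> V \<delta> \<and> nice (elts x) \<and> ?R x (ap s (numeral_set 0))"
    if "ordinal \<delta>" "sat_in (V \<delta>) (witness_formula m g) s" for \<delta> s
    by (rule witness_formula_sat[where R = ?R, OF m(1) g _ that]) (rule R)
  have w': "sigma2_true (witness_formula m g) s"
    if "fun_on s omega" "nice (elts x)" "?R x (ap s (numeral_set 0))" for s x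
    by (rule witness_formula_true[where R = ?R, OF m(1) g _ that]) (rule R)
  show ?thesis
  proof (rule exI[of _ "witness_formula m g"], intro conjI allI impI)
    show "sigma2 (witness_formula m g)" using sigma2_witness_formula[OF m(1) g] unfolding sigma2_def by blast
    show "\<exists>z. z \<epsilon> V \<delta> \<and> Q z (ap s (numeral_set 0))" if "ordinal \<delta>" "sat_in (V \<delta>) (witness_formula m g) s" for \<delta> s
      using w[OF that] V_trans[OF that(1)] by blast
    show "sigma2_true (witness_formula m g) s" if "fun_on s omega" "Q z (ap s (numeral_set 0))" for s z
    proof -
      obtain l where l: "nice (elts (V l))" "ordinal l" "upair z (ap s (numeral_set 0)) \<epsilon> V l" using ex_nice by blast
      then have "z \<epsilon> V l" "ap s (numeral_set 0) \<epsilon> V l" using V_trans by (metis mem_upair)+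
      then show ?thesis using w'[OF that(1) l(1)] that(2) by blast
    qed
  qed
qed

text \<open>
  A natural number of the model, possibly nonstandard, is defined by a coded formula.  Variable \<open>0\<close>
  is used over and over again, so that no substitution of variables is needed.
\<close>

lemma number_formula:
  assumes n: "n \<epsilon> omega" and m: "5 \<le> m"
  shows "\<exists>g. delta0 g \<and> (\<forall>k. free_in k g \<longrightarrow> k = numeral_set 0 \<or> k = numeral_set m) \<and>
    (\<forall>t s. transitive_set t \<longrightarrow> maps s omega t \<longrightarrow> (\<forall>k. k \<epsilon> omega \<longrightarrow> k \<epsilon> ap s (numeral_set m)) \<longrightarrow>
      (sat_in t g s \<longleftrightarrow> ap s (numeral_set 0) = n))" (is "\<exists>g. ?P n g")
proof (rule omega_induct[where P = "\<lambda>n. \<exists>g. ?P n g", OF _ n])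
  show "dfn True (\<lambda>e. \<exists>g. ?P (e 0) g)" by (intro dfn_intros)
next
  let ?z = "FNeg (FEx 1 (FAnd (FMem 1 0) (FEq 1 1)))"
  have *: "?P empty (cd ?z)"
  proof (intro conjI allI impI)
    show "delta0 (cd ?z)" by (intro delta0_cd d0.intros) simp
    show "k = numeral_set 0 \<or> k = numeral_set m" if "free_in k (cd ?z)" for k
      using free_in_cd[OF that] by auto
    show "sat_in t (cd ?z) s \<longleftrightarrow> ap s (numeral_set 0) = empty" if t: "transitive_set t" and s: "maps s omega t" for t s
    proof -
      have "x \<epsilon> t" if "x \<epsilon> ap s (numeral_set 0)" for x
        using transitive_setD[OF t ap_in[OF s numeral_set_omega] that] .
      moreover have "sat_in t (cd ?z) s \<longleftrightarrow> (\<forall>x. x \<epsilon> t \<longrightarrow> \<not> x \<epsilon> ap s (numeral_set 0))"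
        unfolding sat_in_cd[OF s] by (simp add: Ball_def del: numeral_set.simps)
      ultimately show ?thesis unfolding empty_iff by blast
    qed
  qed
  show "\<exists>g. ?P empty g" by (rule exI[of _ "cd ?z"], rule *)
next
  fix n :: 'a assume n: "n \<epsilon> omega" and "\<exists>g. ?P n g"
  then obtain g where g: "?P n g" by (elim exE)
  note g0 = conjunct1[OF g] and g1 = conjunct1[OF conjunct2[OF g], rule_format]
    and g2 = conjunct2[OF conjunct2[OF g], rule_format]
  have fg: "formula g" "delta0 g" using g0 delta0_formula by simp_all
  \<comment> \<open>Variable 0 is the successor of variable 1, as a bounded formula.\<close>
  let ?p = "FAnd (FMem 1 0) (FAnd (FNeg (FEx 2 (FAnd (FMem 2 1) (FNeg (FMem 2 0)))))
    (FNeg (FEx 2 (FAnd (FMem 2 0) (FAnd (FNeg (FMem 2 1)) (FNeg (FEq 2 1)))))))"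
  let ?N = numeral_set
  \<comment> \<open>Says that variable 1 satisfies \<open>g\<close>: variable 0 is bound anew and
    equated with 1. The quantifier can be bounded by the set in \<open>m\<close>, which contains all
    numbers.\<close>
  let ?h = "c_ex (?N 0) (c_and (c_mem (?N 0) (?N m)) (c_and (c_eq (?N 0) (?N 1)) g))"
  let ?g = "c_ex (?N 1) (c_and (c_mem (?N 1) (?N m)) (c_and (cd ?p) ?h))"
  have ne: "?N 0 \<noteq> ?N m" "?N 1 \<noteq> ?N m" "?N 0 \<noteq> ?N 1" using m by (simp_all only: numeral_set_inject)
  have om: "?N k \<epsilon> omega" for k by (rule numeral_set_omega)
  have dh: "delta0 ?h" using fg ne by (intro delta0_intros om)
  have dp: "delta0 (cd ?p)" by (intro delta0_cd d0.intros) simp_all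
  have *: "?P (succ n) ?g"
  proof (intro conjI allI impI)
    show "delta0 ?g" using dh dp ne fg by (intro delta0_intros om)
    show "k = ?N 0 \<or> k = ?N m" if k: "free_in k ?g" for k
    proof -
      have k1: "k \<noteq> ?N 1" and "free_in k (c_mem (?N 1) (?N m)) \<or> free_in k (cd ?p) \<or> free_in k ?h"
        using free_in_simps(5)[OF k] free_in_simps(4) by blast+
      moreover have "k = ?N 0 \<or> k = ?N 1" if "free_in k (cd ?p)" using free_in_cd[OF that] by auto
      moreover have "k = ?N 0 \<or> k = ?N 1 \<or> k = ?N m" if "free_in k ?h"
      proof -
        have "free_in k (c_mem (?N 0) (?N m)) \<or> free_in k (c_eq (?N 0) (?N 1)) \<or> free_in k g"
          using free_in_simps(5)[OF that] free_in_simps(4) by blast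
        then show ?thesis using free_in_simps(1,2) g1 by blast
      qed
      ultimately show ?thesis using free_in_simps(1) by blast
    qed
    fix t s :: 'a assume t: "transitive_set t" and s: "maps s omega t" and om_in: "\<forall>k. k \<epsilon> omega \<longrightarrow> k \<epsilon> ap s (?N m)"
    have tr: "y \<epsilon> t" if "x \<epsilon> t" "y \<epsilon> x" for x y using transitive_setD[OF t that] .
    have xt: "x \<epsilon> t" if "x \<epsilon> ap s (?N m)" for x using tr[OF ap_in[OF s om]] that .
    have h: "sat_in t ?h (upd s (?N 1) x) \<longleftrightarrow> x = n" if x: "x \<epsilon> ap s (?N m)" for x
    proof -
      have s1: "maps (upd s (?N 1) x) omega t" by (rule maps_upd[OF s om xt[OF x]])
      have m1: "ap (upd s (?N 1) x) (?N m) = ap s (?N m)" using ne by (simp add: ap_upd_omega[OF s om] del: numeral_set.simps)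
      have "sat_in t (c_and (c_eq (?N 0) (?N 1)) g) (upd (upd s (?N 1) x) (?N 0) y) \<longleftrightarrow> y = x \<and> y = n" if y: "y \<epsilon> ap s (?N m)" for y
      proof -
        have s2: "maps (upd (upd s (?N 1) x) (?N 0) y) omega t" by (rule maps_upd[OF s1 om xt[OF y]])
        have a: "ap (upd (upd s (?N 1) x) (?N 0) y) (?N 0) = y" "ap (upd (upd s (?N 1) x) (?N 0) y) (?N 1) = x"
          "ap (upd (upd s (?N 1) x) (?N 0) y) (?N m) = ap s (?N m)"
          by (simp_all only: ap_upd_omega[OF s1 om] ap_upd_omega[OF s om] ne ne[symmetric] if_False if_True simp_thms)
        have "sat_in t g (upd (upd s (?N 1) x) (?N 0) y) \<longleftrightarrow> y = n"
          using g2[OF t s2] om_in a by simp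
        then show ?thesis using sat_in_clauses(4)[OF s2 _ fg(1), of "c_eq (?N 0) (?N 1)"] sat_in_clauses(2)[OF s2 om om] a
          by (simp add: formula_intros om del: numeral_set.simps)
      qed
      then show ?thesis
        using sat_in_bex[OF s1 t om om ne(1), of "c_and (c_eq (?N 0) (?N 1)) g"] m1 x fg
        by (simp add: formula_intros om del: numeral_set.simps) blast
    qed
    have p: "sat_in t (cd ?p) (upd s (?N 1) x) \<longleftrightarrow> ap s (?N 0) = succ x" if x: "x \<epsilon> ap s (?N m)" for x
    proof -
      have s1: "maps (upd s (?N 1) x) omega t" by (rule maps_upd[OF s om xt[OF x]])
      have a: "ap (upd s (?N 1) x) (?N 0) = ap s (?N 0)" "ap (upd s (?N 1) x) (?N 1) = x"
        using ne by (simp_all add: ap_upd_omega[OF s om] del: numeral_set.simps)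
      have "hold U ?p e \<longleftrightarrow> e 1 \<epsilon> e 0 \<and> (\<forall>y\<in>U. y \<epsilon> e 1 \<longrightarrow> y \<epsilon> e 0) \<and> (\<forall>y\<in>U. y \<epsilon> e 0 \<longrightarrow> y \<epsilon> e 1 \<or> y = e 1)"
        for U and e :: "nat \<Rightarrow> 'a" by auto
      from this[of "elts t" "\<lambda>k. ap (upd s (?N 1) x) (?N k)"]
      have "sat_in t (cd ?p) (upd s (?N 1) x) \<longleftrightarrow> x \<epsilon> ap s (?N 0) \<and> (\<forall>y\<in>elts t. y \<epsilon> x \<longrightarrow> y \<epsilon> ap s (?N 0)) \<and>
          (\<forall>y\<in>elts t. y \<epsilon> ap s (?N 0) \<longrightarrow> y \<epsilon> x \<or> y = x)"
        unfolding sat_in_cd[OF s1] a .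
      also have "\<dots> \<longleftrightarrow> (\<forall>y. y \<epsilon> ap s (?N 0) \<longleftrightarrow> y \<epsilon> succ x)"
      proof -
        have 1: "y \<epsilon> t" if "y \<epsilon> x" for y using tr[OF xt[OF x] that] .
        have 2: "y \<epsilon> t" if "y \<epsilon> ap s (?N 0)" for y using tr[OF ap_in[OF s om] that] .
        show ?thesis unfolding mem_succ Ball_def in_elts
        proof (intro iffI conjI allI impI, goal_cases)
          case (1 y) then show ?case using 2 by blast
        next
          case (2 y) then show ?case using 1 by blast
        qed blast+
      qed
      also have "\<dots> \<longleftrightarrow> ap s (?N 0) = succ x" by (auto intro: set_ext simp del: numeral_set.simps)
      finally show ?thesis .
    qed
    have "sat_in t (c_and (cd ?p) ?h) (upd s (?N 1) x) \<longleftrightarrow> ap s (?N 0) = succ x \<and> x = n" if x: "x \<epsilon> ap s (?N m)" for x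
      using sat_in_clauses(4)[OF maps_upd[OF s om xt[OF x]] delta0_formula[OF dp] delta0_formula[OF dh]] h[OF x] p[OF x] by metis
    then show "sat_in t ?g s \<longleftrightarrow> ap s (?N 0) = succ n"
      using sat_in_bex[OF s t om om ne(2), of "c_and (cd ?p) ?h"] om_in n delta0_formula[OF delta0_intros(4)[OF dp dh]] by metis
  qed
  show "\<exists>g. ?P (succ n) g" by (rule exI[of _ ?g], rule *)
qed

text \<open>Correctness for sentences allows no parameter, so the number is bound by a quantifier
  and identified by its formula from \<open>number_formula\<close>. The result is closed even if
  \<open>n\<close> is nonstandard.\<close>

lemma transfer_number:
  assumes Q: "dfn False (\<lambda>e. Q (e 0) (e 1))" and n: "n \<epsilon> omega"
  shows "\<exists>f. sigma2 f \<and> closed_formula f \<and> (\<forall>\<delta> s. ordinal \<delta> \<longrightarrow> sat_in (V \<delta>) f s \<longrightarrow> (\<exists>z. z \<epsilon> V \<delta> \<and> Q z n)) \<and>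
    (\<forall>s z. fun_on s omega \<longrightarrow> Q z n \<longrightarrow> sigma2_true f s)"
proof -
  obtain q where q: "\<forall>U s. nice U \<longrightarrow> s 0 \<in> U \<longrightarrow> hold U q s \<longleftrightarrow> (\<exists>z\<in>U. Q z (s 0))"
    using absolute_fm[OF Q] by blast
  \<comment> \<open>\<open>q\<close> may mention variables besides 0 without depending on them. They
    have to be bound, since \<open>closed_formula\<close> is a syntactic condition on the
    code.\<close>
  define q' where "q' = close 1 (var_bound q) q"
  have q': "hold U q' s \<longleftrightarrow> (\<exists>z\<in>U. Q z (s 0))" if U: "nice U" "s 0 \<in> U" for U s
  proof -
    have eq: "hold U q' s \<longleftrightarrow> hold U q s" if *: "\<forall>s s'. s 0 \<in> U \<longrightarrow> s 0 = s' 0 \<longrightarrow> hold U q s = hold U q s'"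
      unfolding q'_def
    proof -
      have "s 0 \<in> U \<Longrightarrow> hold U (close 1 k q) s \<longleftrightarrow> hold U q s" for k s
      proof (induction k arbitrary: s)
        case (Suc k)
        have "hold U (close 1 k q) (s(1 + k := x)) \<longleftrightarrow> hold U q s" for x
        proof -
          have "hold U (close 1 k q) (s(1 + k := x)) \<longleftrightarrow> hold U q (s(1 + k := x))"
            by (rule Suc.IH) (use Suc.prems in simp)
          also have "\<dots> \<longleftrightarrow> hold U q s" using *[rule_format, of "s(1 + k := x)" s] Suc.prems by simp
          finally show ?thesis .
        qed
        then show ?case using Suc.prems by auto
      qed simp
      then show "hold U (close 1 (var_bound q) q) s \<longleftrightarrow> hold U q s" using U by blast
    qed
    have "hold U q s = hold U q s'" if "s 0 \<in> U" "s 0 = s' 0" for s s'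
      using q[rule_format, OF U(1), of s] q[rule_format, OF U(1), of s'] that by simp
    then have "hold U q' s \<longleftrightarrow> hold U q s" using eq by blast
    then show ?thesis using q U by blast
  qed
  define m where "m = max 5 (var_bound q')"
  have m: "5 \<le> m" "var_bound q' \<le> m" by (simp_all add: m_def)
  obtain g where g: "delta0 g" "\<forall>k. free_in k g \<longrightarrow> k = numeral_set 0 \<or> k = numeral_set m"
    "\<forall>t s. transitive_set t \<longrightarrow> maps s omega t \<longrightarrow> (\<forall>k. k \<epsilon> omega \<longrightarrow> k \<epsilon> ap s (numeral_set m)) \<longrightarrow>
      (sat_in t g s \<longleftrightarrow> ap s (numeral_set 0) = n)"
    using number_formula[OF n m(1)] by blast
  let ?N = numeral_set
  \<comment> \<open>The quantifier over variable 0 leaves at most \<open>m\<close> free, and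
    \<open>witness_formula\<close> binds that one.\<close>
  define h where "h = c_ex (?N 0) (c_and (c_mem (?N 0) (?N m)) (c_and g (cd (rel m q'))))"
  have ne: "?N 0 \<noteq> ?N m" using m by (simp only: numeral_set_inject)
  have om: "?N k \<epsilon> omega" for k by (rule numeral_set_omega)
  have dq: "delta0 (cd (rel m q'))" by (intro delta0_cd d0_rel m)
  have h: "delta0 h" unfolding h_def using g(1) dq ne by (intro delta0_intros om)
  have free: "k = ?N m" if k: "free_in k h" for k
  proof -
    have k0: "k \<noteq> ?N 0" and c: "free_in k (c_mem (?N 0) (?N m)) \<or> free_in k g \<or> free_in k (cd (rel m q'))"
      using free_in_simps(5)[OF k[unfolded h_def]] free_in_simps(4) by blast+
    have "k = ?N 0 \<or> k = ?N m" if kq: "free_in k (cd (rel m q'))"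
    proof -
      obtain j where j: "j \<in> fv (rel m q')" "k = ?N j" using free_in_cd[OF kq] by blast
      then have "j = m \<or> j \<in> fv q'" using fv_rel by blast
      moreover have "j = 0" if "j \<in> fv q'"
        using that fv_var_bound[of j q] unfolding q'_def fv_close by linarith
      ultimately show ?thesis using j by blast
    qed
    then show ?thesis using c k0 free_in_simps(1) g(2) by blast
  qed
  have R: "sat_in t h s \<longleftrightarrow> (\<lambda>x r. \<exists>z. z \<epsilon> x \<and> Q z n) (ap s (?N m)) (ap s (?N 0))"
    if t: "transitive_set t" and s: "maps s omega t" and nice: "nice (elts (ap s (?N m)))" for t s
  proof -
    have "omega \<in> elts (ap s (?N m))" using univ_omega[of False "elts (ap s (?N m))"] nice by simp
    then have om_in: "\<forall>k. k \<epsilon> omega \<longrightarrow> k \<epsilon> ap s (?N m)" using nice_transitive[OF nice] by auto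
    have "sat_in t (c_and g (cd (rel m q'))) (upd s (?N 0) x) \<longleftrightarrow> x = n \<and> (\<exists>z. z \<epsilon> ap s (?N m) \<and> Q z n)"
      if x: "x \<epsilon> ap s (?N m)" for x
    proof -
      have s1: "maps (upd s (?N 0) x) omega t"
        by (rule maps_upd[OF s om]) (rule transitive_setD[OF t ap_in[OF s om] x])
      have a: "ap (upd s (?N 0) x) (?N m) = ap s (?N m)" "ap (upd s (?N 0) x) (?N 0) = x"
        using ne by (simp_all add: ap_upd_omega[OF s om] del: numeral_set.simps)
      have 1: "sat_in t g (upd s (?N 0) x) \<longleftrightarrow> x = n" using g(3) t s1 om_in a by metis
      have "sat_in t (cd (rel m q')) (upd s (?N 0) x) \<longleftrightarrow>
          hold (elts (ap s (?N m))) q' (\<lambda>k. ap (upd s (?N 0) x) (?N k))"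
        unfolding sat_in_cd[OF s1]
        using hold_rel[OF m(2) t, of "\<lambda>k. ap (upd s (?N 0) x) (?N k)"] ap_in[OF s om] a by simp
      also have "\<dots> \<longleftrightarrow> (\<exists>z. z \<epsilon> ap s (?N m) \<and> Q z x)"
        using q'[OF nice, of "\<lambda>k. ap (upd s (?N 0) x) (?N k)"] a x by (simp add: Bex_def del: numeral_set.simps)
      finally show ?thesis
        using 1 sat_in_clauses(4)[OF s1 delta0_formula[OF g(1)] delta0_formula[OF dq]] by metis
    qed
    then show ?thesis unfolding h_def
      using sat_in_bex[OF s t om om ne delta0_formula[OF delta0_intros(4)[OF g(1) dq]]] om_in n by metis
  qed
  let ?R = "\<lambda>x r. \<exists>z. z \<epsilon> x \<and> Q z n"
  have w: "\<exists>x. x \<epsilon> V \<delta> \<and> nice (elts x) \<and> ?R x (ap s (?N 0))"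
    if "ordinal \<delta>" "sat_in (V \<delta>) (witness_formula m h) s" for \<delta> s
    by (rule witness_formula_sat[where R = ?R, OF m(1) h _ that]) (rule R)
  have w': "sigma2_true (witness_formula m h) s"
    if "fun_on s omega" "nice (elts x)" "?R x (ap s (?N 0))" for s x
    by (rule witness_formula_true[where R = ?R, OF m(1) h _ that]) (rule R)
  show ?thesis
  proof (rule exI[of _ "witness_formula m h"], intro conjI allI impI)
    show "sigma2 (witness_formula m h)" using sigma2_witness_formula[OF m(1) h] unfolding sigma2_def by blast
    show "closed_formula (witness_formula m h)" unfolding closed_formula_def
    proof
      assume "\<exists>k. free_in k (witness_formula m h)"
      then obtain k where k: "free_in k (witness_formula m h)" by blast
      have "k \<noteq> ?N m" "k \<noteq> ?N (m + 1)" "free_in k (cd (nice_matrix m)) \<or> free_in k h"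
        using free_in_simps(5)[OF k[unfolded witness_formula_def]] free_in_simps(3,4,5) by blast+
      then show False using free free_in_cd[of k "nice_matrix m"] fv_nice_matrix[of m] by blast
    qed
    show "\<exists>z. z \<epsilon> V \<delta> \<and> Q z n" if "ordinal \<delta>" "sat_in (V \<delta>) (witness_formula m h) s" for \<delta> s
      using w[OF that] V_trans[OF that(1)] by blast
    show "sigma2_true (witness_formula m h) s" if "fun_on s omega" "Q z n" for s z
    proof -
      obtain l where l: "nice (elts (V l))" "z \<epsilon> V l" using ex_nice by blast
      then show ?thesis using w'[OF that(1) l(1)] that(2) by blast
    qed
  qed
qed

section \<open>An enumeration of the formulas\<close>

lemma dfn_ex_opair:
  assumes "dfn b (\<lambda>e. Q (e 1) (e 0) (\<lambda>k. e (Suc (Suc k))))" "dft b t"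
  shows "dfn b (\<lambda>e. \<exists>x y. t e = opair x y \<and> Q x y e)"
proof (rule dfn_ex)
  show "dfn b (\<lambda>e. \<exists>y. t (\<lambda>k. e (Suc k)) = opair (e 0) y \<and> Q (e 0) y (\<lambda>k. e (Suc k)))"
  proof (rule dfn_ex, goal_cases)
    case 1 show ?case using assms(1) by (intro dfn_intros dft_ren[OF assms(2)]) simp
  next
    case (2 U e)
    have "t (\<lambda>k. e (Suc k)) \<in> U" using dft_closed[OF assms(2) 2(1), of "\<lambda>k. e (Suc k)"] 2(2) by auto
    then show ?case using 2(3) univ_opairD[OF 2(1)] by metis
  qed
next
  fix U and e :: "nat \<Rightarrow> 'a" assume U: "univ b U" "range e \<subseteq> U" and "\<exists>x y. t e = opair x y \<and> Q x y e"
  then show "\<exists>x\<in>U. \<exists>y. t e = opair x y \<and> Q x y e"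
    using dft_closed[OF assms(2) U] univ_opairD[OF U(1)] by metis
qed

lemma dfn_all_opair_mem:
  assumes "dfn b (\<lambda>e. Q (e 0) (\<lambda>k. e (Suc k)))" "dft b t" "dft b u"
  shows "dfn b (\<lambda>e. \<forall>x. opair (t e) x \<epsilon> u e \<longrightarrow> Q x e)"
proof (rule dfn_all, goal_cases)
  case 1 show ?case by (intro dfn_intros assms dft_ren[OF assms(2)] dft_ren[OF assms(3)])
next
  case (2 U e)
  then obtain x where x: "opair (t e) x \<epsilon> u e" "\<not> Q x e" by blast
  then have "x \<in> U" using univ_trans[OF 2(1) dft_closed[OF assms(3) 2(1,2)]] univ_opairD[OF 2(1)] by blast
  with x show ?case by blast
qed

text \<open>
  A surjective walk through \<open>\<omega> \<times> \<omega>\<close>: from \<open>(a, b)\<close> with \<open>a < b\<close> to \<open>(b, a)\<close>, from \<open>(a, b)\<close> with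
  \<open>b < a\<close> to \<open>(b + 1, a)\<close>, and from \<open>(a, a)\<close> to \<open>(0, a + 1)\<close>.
\<close>

definition walk_closed :: "'v::zfc \<Rightarrow> bool" where
  "walk_closed X \<longleftrightarrow> opair empty (opair empty empty) \<epsilon> X \<and>
    (\<forall>n. n \<epsilon> omega \<longrightarrow> (\<forall>a. a \<epsilon> omega \<longrightarrow> (\<forall>b. b \<epsilon> omega \<longrightarrow> opair n (opair a b) \<epsilon> X \<longrightarrow>
      (a \<epsilon> b \<longrightarrow> opair (succ n) (opair b a) \<epsilon> X) \<and> (b \<epsilon> a \<longrightarrow> opair (succ n) (opair (succ b) a) \<epsilon> X) \<and>
      (a = b \<longrightarrow> opair (succ n) (opair empty (succ a)) \<epsilon> X))))"

definition walk :: "'v::zfc \<Rightarrow> 'v \<Rightarrow> 'v \<Rightarrow> bool" where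
  "walk n a b \<longleftrightarrow> (\<forall>X. walk_closed X \<longrightarrow> opair n (opair a b) \<epsilon> X)"

lemma walk_True: "dfn True (\<lambda>e. walk (e 0) (e 1) (e 2))"
  unfolding walk_def walk_closed_def by (intro dfn_intros)

lemma walk_closed_omega: "walk_closed (cprod omega (cprod omega omega))"
  unfolding walk_closed_def by simp

lemma walk_omega: "walk n a b \<Longrightarrow> n \<epsilon> omega \<and> a \<epsilon> omega \<and> b \<epsilon> omega"
  using walk_closed_omega unfolding walk_def by (metis opair_in_cprod)

lemma walk_intros:
  fixes n a b :: "'v::zfc"
  shows "walk (empty :: 'v) empty empty" "walk n a b \<Longrightarrow> a \<epsilon> b \<Longrightarrow> walk (succ n) b a"
  "walk n a b \<Longrightarrow> b \<epsilon> a \<Longrightarrow> walk (succ n) (succ b) a" "walk n a a \<Longrightarrow> walk (succ n) empty (succ a)"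
proof -
  show "walk (empty :: 'v) empty empty" unfolding walk_def walk_closed_def by blast
  have *: "opair n (opair a b) \<epsilon> X \<and> n \<epsilon> omega \<and> a \<epsilon> omega \<and> b \<epsilon> omega" if "walk n a b" "walk_closed X" for n a b X :: 'v
    using that walk_omega[OF that(1)] unfolding walk_def by blast
  have step: "(a \<epsilon> b \<longrightarrow> opair (succ n) (opair b a) \<epsilon> X) \<and> (b \<epsilon> a \<longrightarrow> opair (succ n) (opair (succ b) a) \<epsilon> X) \<and>
      (a = b \<longrightarrow> opair (succ n) (opair empty (succ a)) \<epsilon> X)" if "walk n a b" "walk_closed X" for n a b X :: 'v
  proof -
    have "\<forall>n. n \<epsilon> omega \<longrightarrow> (\<forall>a. a \<epsilon> omega \<longrightarrow> (\<forall>b. b \<epsilon> omega \<longrightarrow> opair n (opair a b) \<epsilon> X \<longrightarrow>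
      (a \<epsilon> b \<longrightarrow> opair (succ n) (opair b a) \<epsilon> X) \<and> (b \<epsilon> a \<longrightarrow> opair (succ n) (opair (succ b) a) \<epsilon> X) \<and>
      (a = b \<longrightarrow> opair (succ n) (opair empty (succ a)) \<epsilon> X)))"
      using that(2) unfolding walk_closed_def by (rule conjunct2)
    then show ?thesis using *[OF that] by blast
  qed
  show "walk (succ n) b a" if w: "walk n a b" "a \<epsilon> b"
    unfolding walk_def[of "succ n"]
  proof (intro allI impI)
    fix X :: 'v assume "walk_closed X"
    then show "opair (succ n) (opair b a) \<epsilon> X" using step[OF w(1)] w(2) by blast
  qed
  show "walk (succ n) (succ b) a" if w: "walk n a b" "b \<epsilon> a"
    unfolding walk_def[of "succ n"]
  proof (intro allI impI)
    fix X :: 'v assume "walk_closed X"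
    then show "opair (succ n) (opair (succ b) a) \<epsilon> X" using step[OF w(1)] w(2) by blast
  qed
  show "walk (succ n) empty (succ a)" if w: "walk n a a"
    unfolding walk_def[of "succ n"]
  proof (intro allI impI)
    fix X :: 'v assume "walk_closed X"
    then show "opair (succ n) (opair empty (succ a)) \<epsilon> X" using step[OF w] by blast
  qed
qed

text \<open>The triples with \<open>P\<close> form a closed set, which gives induction along the
  walk; with trivial \<open>P\<close> the set itself serves in \<open>walk_dfn\<close>.\<close>

lemma walk_set: "\<exists>X. walk_closed X \<and> (\<forall>n a b. opair n (opair a b) \<epsilon> X \<longleftrightarrow> walk n a b \<and> P n a b)"
  if P: "dfn True (\<lambda>e. P (e 0) (e 1) (e 2))" and P1: "P empty empty empty"
    and P2: "\<And>n a b. walk n a b \<Longrightarrow> P n a b \<Longrightarrow> a \<epsilon> b \<Longrightarrow> P (succ n) b a"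
    "\<And>n a b. walk n a b \<Longrightarrow> P n a b \<Longrightarrow> b \<epsilon> a \<Longrightarrow> P (succ n) (succ b) a"
    "\<And>n a. walk n a a \<Longrightarrow> P n a a \<Longrightarrow> P (succ n) empty (succ a)"
  for P :: "'v::zfc \<Rightarrow> 'v \<Rightarrow> 'v \<Rightarrow> bool"
proof -
  let ?B = "cprod omega (cprod omega omega) :: 'v"
  have "\<exists>X. \<forall>p. p \<epsilon> X \<longleftrightarrow> p \<epsilon> ?B \<and> (\<exists>n c. p = opair n c \<and> (\<exists>a b. c = opair a b \<and> walk n a b \<and> P n a b))"
    by (rule comprehension[of _ ?B], intro dfn_intros dfn_subst3[where P = walk, OF walk_True] dfn_subst3[where P = P, OF P])
      (erule conjunct1)
  then obtain X where "\<forall>p. p \<epsilon> X \<longleftrightarrow> p \<epsilon> ?B \<and> (\<exists>n c. p = opair n c \<and> (\<exists>a b. c = opair a b \<and> walk n a b \<and> P n a b))"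
    by (rule exE)
  from pair_set[OF this] have X: "opair n (opair a b) \<epsilon> X \<longleftrightarrow> walk n a b \<and> P n a b" for n a b
    using walk_omega[of n a b] by auto
  have "walk_closed X" unfolding walk_closed_def X
  proof (intro conjI allI impI, goal_cases)
    case (3 n a b) then show ?case by (intro walk_intros(2)) blast+
  next
    case (4 n a b) then show ?case by (intro P2(1)) blast+
  next
    case (5 n a b) then show ?case by (intro walk_intros(3)) blast+
  next
    case (6 n a b) then show ?case by (intro P2(2)) blast+
  next
    case (7 n a b) then show ?case using walk_intros(4)[of n a] by blast
  next
    case (8 n a b) then show ?case using P2(3)[of n a] by blast
  qed (rule walk_intros(1), rule P1)
  with X show ?thesis by blast
qed

lemma walk_dfn [dfn_intros]:
  assumes "dft b t" "dft b u" "dft b v" shows "dfn b (\<lambda>e. walk (t e) (u e) (v e))"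
proof (rule dfn_subst3[where P = walk, OF _ assms])
  show "dfn b (\<lambda>e :: nat \<Rightarrow> 'a. walk (e 0) (e 1) (e 2))" unfolding walk_def
  proof (rule dfn_all, goal_cases)
    case 1 show ?case unfolding walk_closed_def by (intro dfn_intros)
  next
    case (2 U e)
    obtain X :: 'a where X: "walk_closed X" "\<forall>n a b. opair n (opair a b) \<epsilon> X \<longleftrightarrow> walk n a b \<and> True"
      using walk_set[of "\<lambda>_ _ _. True"] dfn_triv by blast
    let ?B = "cprod omega (cprod omega omega) :: 'a"
    \<comment> \<open>\<open>X\<close> is known only on triples; intersected with the product it
      becomes a subset of an element of \<open>U\<close>.\<close>
    have "\<exists>Y. \<forall>p. p \<epsilon> Y \<longleftrightarrow> p \<epsilon> X \<and> p \<epsilon> ?B" by (rule comprehension[of _ ?B], intro dfn_intros) simp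
    then obtain Y where Y: "\<forall>p. p \<epsilon> Y \<longleftrightarrow> p \<epsilon> X \<and> p \<epsilon> ?B" by (rule exE)
    have "walk_closed Y" using X(1) walk_closed_omega Y unfolding walk_closed_def by simp
    moreover have "\<not> opair (e 0) (opair (e 1) (e 2)) \<epsilon> Y"
      using 2(3) Y X unfolding walk_def by blast
    moreover have "?B \<in> U" using 2(1) by (intro univ_intros)
    then have "Y \<in> U" by (rule univ_sub[OF 2(1)]) (simp add: Y)
    ultimately show ?case by blast
  qed
qed

lemma walk_cases:
  assumes "walk n a b"
  shows "(n = empty \<and> a = empty \<and> b = empty) \<or> (\<exists>k. n = succ k \<and> (\<exists>c d. walk k c d \<and>
    (c \<epsilon> d \<and> a = d \<and> b = c \<or> d \<epsilon> c \<and> a = succ d \<and> b = c \<or> c = d \<and> a = empty \<and> b = succ c)))" (is "?P n a b")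
proof -
  have "\<exists>X. walk_closed X \<and> (\<forall>n a b. opair n (opair a b) \<epsilon> X \<longleftrightarrow> walk n a b \<and> ?P n a b)"
    by (rule walk_set) (intro dfn_intros, blast+)
  then show ?thesis using assms unfolding walk_def by blast
qed

lemma walk_unique: "walk n a b \<Longrightarrow> walk n a' b' \<Longrightarrow> a = a' \<and> b = b'"
proof -
  assume w: "walk n a b" and w': "walk n a' b'"
  have "\<forall>a b a' b'. walk n a b \<longrightarrow> walk n a' b' \<longrightarrow> a = a' \<and> b = b'"
  proof (rule omega_induct[where P = "\<lambda>n. \<forall>a b a' b'. walk n a b \<longrightarrow> walk n a' b' \<longrightarrow> a = a' \<and> b = b'"])
    show "n \<epsilon> omega" using walk_omega[OF w] by blast
    show "\<forall>a b a' b'. walk empty a b \<longrightarrow> walk empty a' b' \<longrightarrow> a = a' \<and> b = b'"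
      using walk_cases[of empty] by (metis succ_neq_empty(2))
    fix k :: 'a assume IH: "\<forall>a b a' b'. walk k a b \<longrightarrow> walk k a' b' \<longrightarrow> a = a' \<and> b = b'"
    have inv: "\<exists>c d. walk k c d \<and> (c \<epsilon> d \<and> a = d \<and> b = c \<or> d \<epsilon> c \<and> a = succ d \<and> b = c \<or> c = d \<and> a = empty \<and> b = succ c)"
      if "walk (succ k) a b" for a b using walk_cases[OF that] by simp
    show "\<forall>a b a' b'. walk (succ k) a b \<longrightarrow> walk (succ k) a' b' \<longrightarrow> a = a' \<and> b = b'"
    proof (intro allI impI)
      fix a b a' b' assume "walk (succ k) a b" "walk (succ k) a' b'"
      then have w2: "\<exists>c d. walk k c d \<and> (c \<epsilon> d \<and> a = d \<and> b = c \<or> d \<epsilon> c \<and> a = succ d \<and> b = c \<or> c = d \<and> a = empty \<and> b = succ c)"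
        "\<exists>c d. walk k c d \<and> (c \<epsilon> d \<and> a' = d \<and> b' = c \<or> d \<epsilon> c \<and> a' = succ d \<and> b' = c \<or> c = d \<and> a' = empty \<and> b' = succ c)"
        by (simp_all only: inv)
      obtain c d where 1: "walk k c d" "c \<epsilon> d \<and> a = d \<and> b = c \<or> d \<epsilon> c \<and> a = succ d \<and> b = c \<or> c = d \<and> a = empty \<and> b = succ c"
        using w2(1) by (elim exE conjE)
      obtain c' d' where 2: "walk k c' d'" "c' \<epsilon> d' \<and> a' = d' \<and> b' = c' \<or> d' \<epsilon> c' \<and> a' = succ d' \<and> b' = c' \<or> c' = d' \<and> a' = empty \<and> b' = succ c'"
        using w2(2) by (elim exE conjE)
      have eqs: "c' = c" "d' = d" using IH 1(1) 2(1) by blast+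
      have "\<not> (c \<epsilon> d \<and> d \<epsilon> c)" using mem_asym by blast
      then show "a = a' \<and> b = b'" using 1(2) 2(2)[unfolded eqs] by (elim disjE conjE) simp_all
    qed
  qed (intro dfn_intros)
  then show ?thesis using w w' by blast
qed

text \<open>From (0, N) the walk alternates between (k, N) and (N, k) with k increasing, until it
  reaches (N, N) and passes on to (0, N + 1). It thus meets every pair whose larger entry is
  N.\<close>

lemma walk_surjective:
  assumes "a \<epsilon> omega" "b \<epsilon> omega"
  shows "\<exists>n. walk n a b"
proof -
  have row: "\<exists>n. walk n k N" if N: "\<exists>n. walk n empty N" "N \<epsilon> omega" and k: "k \<epsilon> omega" "k \<epsilon> succ N" for k N
  proof -
    have "k \<epsilon> succ N \<longrightarrow> (\<exists>n. walk n k N)"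
    proof (rule omega_induct[where P = "\<lambda>k. k \<epsilon> succ N \<longrightarrow> (\<exists>n. walk n k N)", OF _ k(1)])
      show "dfn True (\<lambda>e. e 0 \<epsilon> succ N \<longrightarrow> (\<exists>n. walk n (e 0) N))" by (intro dfn_intros)
      fix k assume k: "k \<epsilon> omega" and IH: "k \<epsilon> succ N \<longrightarrow> (\<exists>n. walk n k N)"
      show "succ k \<epsilon> succ N \<longrightarrow> (\<exists>n. walk n (succ k) N)"
      proof
        assume "succ k \<epsilon> succ N"
        then have "k \<epsilon> N" using ordinal_trans[OF ordinal_nat[OF N(2)]] by (metis mem_succ)
        then show "\<exists>n. walk n (succ k) N" using IH walk_intros(2,3) by (metis mem_succ)
      qed
    qed (use N in simp)
    then show ?thesis using k by blast
  qed
  have top: "\<exists>n. walk n empty N" if "N \<epsilon> omega" for N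
  proof (rule omega_induct[where P = "\<lambda>N. \<exists>n. walk n empty N", OF _ that])
    show "dfn True (\<lambda>e. \<exists>n. walk n empty (e 0))" by (intro dfn_intros)
    show "\<exists>n. walk n empty empty" using walk_intros(1) by blast
    fix N assume "N \<epsilon> omega" "\<exists>n. walk n empty N"
    then show "\<exists>n. walk n empty (succ N)" using row[of N N] walk_intros(4) by (metis mem_succ)
  qed
  show ?thesis
  proof (cases "b \<epsilon> a")
    case True
    then have "\<exists>n. walk n b a" using row[OF top[OF assms(1)] assms(1,2)] by simp
    then show ?thesis using walk_intros(2) True by blast
  next
    case False
    then have "a \<epsilon> succ b" using ordinal_linear[OF ordinal_nat[OF assms(1)] ordinal_nat[OF assms(2)]] by auto
    then show ?thesis using row[OF top[OF assms(2)] assms(2,1)] by blast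
  qed
qed

text \<open>A number at place (0, k) of the walk denotes k, and one at place (a + 1, b) the pair of
  what a and b denote. Formula codes are built from numbers by pairing, so all of them are
  reached.\<close>

definition enum_closed :: "'v::zfc \<Rightarrow> bool" where
  "enum_closed X \<longleftrightarrow> (\<forall>n. n \<epsilon> omega \<longrightarrow> (\<forall>k. k \<epsilon> omega \<longrightarrow> walk n empty k \<longrightarrow> opair n k \<epsilon> X)) \<and>
    (\<forall>n. n \<epsilon> omega \<longrightarrow> (\<forall>a. a \<epsilon> omega \<longrightarrow> (\<forall>b. b \<epsilon> omega \<longrightarrow> walk n (succ a) b \<longrightarrow>
      (\<forall>x. opair a x \<epsilon> X \<longrightarrow> (\<forall>y. opair b y \<epsilon> X \<longrightarrow> opair n (opair x y) \<epsilon> X)))))"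

definition enum :: "'v::zfc \<Rightarrow> 'v \<Rightarrow> bool" where
  "enum n x \<longleftrightarrow> (\<forall>X. enum_closed X \<longrightarrow> opair n x \<epsilon> X)"

lemma enum_closed_dfn: "dfn b (\<lambda>e. enum_closed (e 0))"
  unfolding enum_closed_def by (intro dfn_conj dfn_ball_mem dfn_imp dfn_all_opair_mem dfn_intros)

lemma enum_True: "dfn True (\<lambda>e. enum (e 0) (e 1))"
  unfolding enum_def by (intro dfn_intros dfn_subst1[where P = enum_closed, OF enum_closed_dfn])

lemma enum_closed_hf: "hf_closed W \<Longrightarrow> enum_closed (cprod omega W)"
  unfolding enum_closed_def by (simp add: hf_closed_omega hf_closed_opair)

lemma enum_hf: "enum n x \<Longrightarrow> hf_closed W \<Longrightarrow> n \<epsilon> omega \<and> x \<epsilon> W"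
  using enum_closed_hf unfolding enum_def by (metis opair_in_cprod)

lemma enum_number: "walk n empty k \<Longrightarrow> enum n k"
  using walk_omega[of n empty k] unfolding enum_def enum_closed_def by blast

lemma enum_pair: "walk n (succ a) b \<Longrightarrow> enum a x \<Longrightarrow> enum b y \<Longrightarrow> enum n (opair x y)"
proof -
  assume w: "walk n (succ a) b" and e: "enum a x" "enum b y"
  have om: "n \<epsilon> omega" "succ a \<epsilon> omega" "b \<epsilon> omega" using walk_omega[OF w] by blast+
  have "a \<epsilon> omega" using omega_subset[OF om(2)] by simp
  then show ?thesis using w e om unfolding enum_def enum_closed_def by blast
qed

lemma enum_set: "\<exists>X. enum_closed X \<and> elts X \<subseteq> elts (cprod omega W) \<and> (\<forall>n x. opair n x \<epsilon> X \<longleftrightarrow> enum n x \<and> P n x)"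
  if W: "hf_closed W" and P: "dfn True (\<lambda>e. P (e 0) (e 1))" and P1: "\<And>n k. walk n empty k \<Longrightarrow> P n k"
    and P2: "\<And>n a b x y. walk n (succ a) b \<Longrightarrow> enum a x \<Longrightarrow> P a x \<Longrightarrow> enum b y \<Longrightarrow> P b y \<Longrightarrow> P n (opair x y)"
  for P :: "'v::zfc \<Rightarrow> 'v \<Rightarrow> bool"
proof -
  have "\<exists>X. \<forall>p. p \<epsilon> X \<longleftrightarrow> p \<epsilon> cprod omega W \<and> (\<exists>n x. p = opair n x \<and> enum n x \<and> P n x)"
    by (rule comprehension[of _ "cprod omega W"], intro dfn_intros dfn_subst2[where P = enum, OF enum_True] dfn_subst2[where P = P, OF P])
      (erule conjunct1)
  then obtain X where X0: "\<forall>p. p \<epsilon> X \<longleftrightarrow> p \<epsilon> cprod omega W \<and> (\<exists>n x. p = opair n x \<and> enum n x \<and> P n x)" by (rule exE)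
  from pair_set[OF X0] have X: "opair n x \<epsilon> X \<longleftrightarrow> enum n x \<and> P n x" for n x
    using enum_hf[OF _ W, of n x] by auto
  have "enum_closed X" unfolding enum_closed_def X using P1 P2 enum_number enum_pair by blast
  moreover have "elts X \<subseteq> elts (cprod omega W)" using X0 by auto
  ultimately show ?thesis using X by blast
qed

lemma enum_dfn [dfn_intros]:
  assumes "dft b t" "dft b u" shows "dfn b (\<lambda>e. enum (t e) (u e))"
proof (rule dfn_subst2[where P = enum, OF _ assms])
  show "dfn b (\<lambda>e :: nat \<Rightarrow> 'a. enum (e 0) (e 1))" unfolding enum_def
  proof (rule dfn_all, goal_cases)
    case 1 show ?case by (intro dfn_intros dfn_subst1[where P = enum_closed, OF enum_closed_dfn])
  next
    case (2 U e)
    obtain W where W: "W \<in> U" "hf_closed W" using univ_hf_closed[OF 2(1)] by blast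
    obtain X :: 'a where X: "enum_closed X" "elts X \<subseteq> elts (cprod omega W)" "\<forall>n x. opair n x \<epsilon> X \<longleftrightarrow> enum n x \<and> True"
      using enum_set[OF W(2), of "\<lambda>_ _. True"] dfn_triv by blast
    have "cprod omega W \<in> U" using 2(1) W(1) by (intro univ_intros)
    then have "X \<in> U" by (rule univ_sub[OF 2(1)]) (use X(2) in auto)
    then show ?case using 2(3) X(1,3) unfolding enum_def by blast
  qed
qed

lemma enum_cases:
  assumes "enum n x"
  shows "(walk n empty x) \<or> (\<exists>a b y z. walk n (succ a) b \<and> enum a y \<and> enum b z \<and> x = opair y z)" (is "?P n x")
proof -
  obtain W :: 'a where W: "hf_closed W" using univ_hf_closed[of True UNIV] by auto
  have "\<exists>X. enum_closed X \<and> elts X \<subseteq> elts (cprod omega W) \<and> (\<forall>n x. opair n x \<epsilon> X \<longleftrightarrow> enum n x \<and> ?P n x)"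
    by (rule enum_set[OF W]) (intro dfn_intros, blast+)
  then show ?thesis using assms unfolding enum_def by blast
qed

lemma enum_unique: "enum n x \<Longrightarrow> enum n y \<Longrightarrow> x = y"
proof -
  assume x: "enum n x" and y: "enum n y"
  obtain W :: 'a where W: "hf_closed W" using univ_hf_closed[of True UNIV] by auto
  have "\<exists>X. enum_closed X \<and> elts X \<subseteq> elts (cprod omega W) \<and> (\<forall>n x. opair n x \<epsilon> X \<longleftrightarrow> enum n x \<and> (\<forall>y. enum n y \<longrightarrow> x = y))"
  proof (rule enum_set[OF W])
    fix n k y :: 'a assume w: "walk n empty k"
    show "\<forall>y. enum n y \<longrightarrow> k = y"
      using enum_cases walk_unique[OF w] by (metis succ_neq_empty(2))
  next
    fix n a b x y :: 'a assume w: "walk n (succ a) b" and IH: "\<forall>y. enum a y \<longrightarrow> x = y" "\<forall>z. enum b z \<longrightarrow> y = z"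
    show "\<forall>z. enum n z \<longrightarrow> opair x y = z"
    proof (intro allI impI)
      fix z assume "enum n z"
      then show "opair x y = z"
        using enum_cases[of n z] walk_unique[OF w] IH by (metis succ_neq_empty(1) succ_inject)
    qed
  qed (intro dfn_intros)
  then show ?thesis using x y unfolding enum_def by blast
qed

definition coded :: "'v::zfc \<Rightarrow> bool" where
  "coded x \<longleftrightarrow> (\<exists>n. n \<epsilon> omega \<and> enum n x)"

lemma coded_omega: "k \<epsilon> omega \<Longrightarrow> coded k"
  using walk_surjective[OF empty_omega] enum_number walk_omega unfolding coded_def by blast

lemma coded_opair: "coded x \<Longrightarrow> coded y \<Longrightarrow> coded (opair x y)"
  using walk_surjective[OF succ_omega] enum_pair walk_omega unfolding coded_def by blast

lemma coded_numeral: "coded (numeral_set n)"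
  by (rule coded_omega, rule numeral_set_omega)

text \<open>Allows a set of formulas to be stored as a set of numbers, that is, as a real;
  \<open>enum_unique\<close> allows it to be read back.\<close>

lemma coded_formula: "formula f \<Longrightarrow> coded f"
proof (rule formula_induct[where P = coded])
  show "dfn True (\<lambda>e :: nat \<Rightarrow> 'a. coded (e 0))" unfolding coded_def by (intro dfn_intros)
  show "coded (c_mem i j)" "coded (c_eq i j)" if "i \<epsilon> omega" "j \<epsilon> omega" for i j :: 'a
    unfolding c_defs by (intro coded_opair coded_numeral coded_omega that)+
  show "coded (c_neg g)" if "coded g" for g :: 'a
    unfolding c_defs by (intro coded_opair coded_numeral that)
  show "coded (c_and g h)" if "coded g" "coded h" for g h :: 'a
    unfolding c_defs by (intro coded_opair coded_numeral that)
  show "coded (c_ex i g)" "coded (c_ex2 i g)" if "i \<epsilon> omega" "coded g" for i g :: 'a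
    unfolding c_defs by (rule coded_opair[OF coded_numeral coded_opair[OF coded_omega[OF that(1)] that(2)]])+
qed

section \<open>Higher-order satisfaction\<close>

lemma objects_eq: "objects M = cprod (upair (numeral_set 0) (numeral_set 0)) M"
  unfolding objects_def by (rule set_of_eqI) (auto simp: mem_cprod set_eq_iff)

lemma objects_dft [dfn_intros]: "dft b t \<Longrightarrow> dft b (\<lambda>e. objects (t e))"
  unfolding objects_eq by (intro dfn_intros)

text \<open>One step of \<open>ho_level\<close>, written with \<open>VG\<close> to inherit its
  definability and monotonicity.\<close>

definition HG :: "'v::zfc \<Rightarrow> 'v \<Rightarrow> 'v" where
  "HG M X = un (objects M) (cprod (upair (numeral_set 1) (numeral_set 1)) (VG X))"

lemma HG_d0: "dft b (\<lambda>e. HG (e 0) (e 1))"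
  unfolding HG_def by (intro dfn_intros)

lemma HG_mono: "(\<And>z. z \<epsilon> X \<Longrightarrow> z \<epsilon> Y) \<Longrightarrow> elts (HG M X) \<subseteq> elts (HG M Y)"
  using VG_mono[of X Y] unfolding HG_def by (auto simp: mem_cprod subset_iff)

lemma ho_level_rec: "ho_level M = ord_rec (HG M)"
proof -
  have "set_of (elts (objects M) \<union> {opair (numeral_set 1) z | z. \<exists>x\<in>elts X. elts z \<subseteq> elts x}) = HG M X" for X
  proof (rule set_of_eqI, rule set_eqI)
    fix p
    show "p \<in> elts (HG M X) \<longleftrightarrow> p \<in> elts (objects M) \<union> {opair (numeral_set 1) z | z. \<exists>x\<in>elts X. elts z \<subseteq> elts x}"
      unfolding HG_def by (simp add: mem_cprod mem_VG Bex_def del: numeral_set.simps One_nat_def) blast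
  qed
  then show ?thesis unfolding ho_level_def by presburger
qed

lemma ho_level_d0: "dfn b (\<lambda>e. ordinal (e 1) \<and> e 2 = ho_level (e 0) (e 1))"
  unfolding ho_level_rec by (rule ord_rec_dfn[OF HG_d0 HG_mono])
lemmas ho_level_dfn [dfn_intros] = dfn_subst3[where P = "\<lambda>M \<alpha> L. ordinal \<alpha> \<and> L = ho_level M \<alpha>", OF ho_level_d0]

text \<open>\<open>ho_mem_rel\<close> with the level itself as argument: the level is described by a
  relation only, so it is passed around as a separate object.\<close>

definition HM :: "'v::zfc \<Rightarrow> 'v \<Rightarrow> 'v" where
  "HM R L = set_of {opair u v | u v. u \<epsilon> L \<and> v \<epsilon> L \<and>
    ((\<exists>m n. u = opair (numeral_set 0) m \<and> v = opair (numeral_set 0) n \<and> opair m n \<epsilon> R) \<or>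
     (\<exists>X. v = opair (numeral_set 1) X \<and> u \<epsilon> X))}"

text \<open>The second component of a pair lies in the union of the pair, which bounds the
  quantifiers over m, n and X.\<close>

lemma mem_HM: "z \<epsilon> HM R L \<longleftrightarrow> (\<exists>u. u \<epsilon> L \<and> (\<exists>v. v \<epsilon> L \<and> z = opair u v \<and>
    ((\<exists>m. m \<epsilon> sUn u \<and> (\<exists>n. n \<epsilon> sUn v \<and> u = opair (numeral_set 0) m \<and> v = opair (numeral_set 0) n \<and> opair m n \<epsilon> R)) \<or>
     (\<exists>X. X \<epsilon> sUn v \<and> v = opair (numeral_set 1) X \<and> u \<epsilon> X))))" (is "_ \<longleftrightarrow> ?P z")
proof -
  have sU: "y \<epsilon> sUn (opair x y)" for x y :: 'a
  proof -
    have "upair x y \<epsilon> opair x y" "y \<epsilon> upair x y" by (simp_all add: opair_upair)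
    then show ?thesis unfolding mem_sUn by blast
  qed
  have 1: "(\<exists>m n. u = opair (numeral_set 0) m \<and> v = opair (numeral_set 0) n \<and> opair m n \<epsilon> R) \<longleftrightarrow>
      (\<exists>m. m \<epsilon> sUn u \<and> (\<exists>n. n \<epsilon> sUn v \<and> u = opair (numeral_set 0) m \<and> v = opair (numeral_set 0) n \<and> opair m n \<epsilon> R))"
    for u v :: 'a by (auto simp: sU simp del: numeral_set.simps mem_sUn One_nat_def)
  have 2: "(\<exists>X. v = opair (numeral_set 1) X \<and> u \<epsilon> X) \<longleftrightarrow> (\<exists>X. X \<epsilon> sUn v \<and> v = opair (numeral_set 1) X \<and> u \<epsilon> X)"
    for u v :: 'a by (auto simp: sU simp del: numeral_set.simps mem_sUn One_nat_def)
  have "small {z. ?P z}"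
    by (rule small_Collect[of _ "cprod L L"], intro dfn_intros) (auto simp del: numeral_set.simps)
  moreover have "{opair u v | u v. u \<epsilon> L \<and> v \<epsilon> L \<and>
    ((\<exists>m n. u = opair (numeral_set 0) m \<and> v = opair (numeral_set 0) n \<and> opair m n \<epsilon> R) \<or>
     (\<exists>X. v = opair (numeral_set 1) X \<and> u \<epsilon> X))} = {z. ?P z}"
    by (rule Collect_cong) (simp only: 1 2, blast)
  ultimately show ?thesis unfolding HM_def by (simp only: in_set_of mem_Collect_eq)
qed

lemma HM_d0: "dft b (\<lambda>e. HM (e 0) (e 1))"
proof (rule dft_setI, rule mem_HM, intro dfn_intros)
  fix U and e :: "nat \<Rightarrow> 'a" assume U: "univ b U" "range e \<subseteq> U"
  have "cprod (e 1) (e 1) \<in> U" using U by (auto intro!: univ_intros)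
  then show "HM (e 0) (e 1) \<in> U" by (rule univ_sub[OF U(1)]) (auto simp: mem_HM simp del: numeral_set.simps)
qed
lemmas [dfn_intros] = dft_subst2[where f = HM, OF HM_d0]

definition mods :: "'v::zfc \<Rightarrow> 'v \<Rightarrow> 'v \<Rightarrow> 'v \<Rightarrow> bool" where
  "mods M R L \<sigma> \<longleftrightarrow> (\<exists>s. sat (objects M) (dif L (objects M)) (HM R L) \<sigma> s)"

lemma models_mods: "models \<alpha> M R \<sigma> \<longleftrightarrow> mods M R (ho_level M \<alpha>) \<sigma>"
  unfolding models_def mods_def ho_objects_def dif_def HM_def ho_mem_rel_def ..

lemma dfn_ex_sat:
  assumes "dft b d" "dft b h" "dft b r" "dft b t"
  shows "dfn b (\<lambda>e. \<exists>s. sat (d e) (h e) (r e) (t e) s)"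
proof (rule dfn_ex, goal_cases)
  case 1 show ?case by (intro sat_dfn dfn_intros dft_ren[OF assms(1)] dft_ren[OF assms(2)] dft_ren[OF assms(3)] dft_ren[OF assms(4)])
next
  case (2 U e)
  then obtain s where s: "sat (d e) (h e) (r e) (t e) s" by blast
  then have m: "maps s omega (un (d e) (h e))" unfolding sat_def assignment_iff by blast
  have "omega \<in> U" using 2(1) by (rule univ_omega)
  moreover have "un (d e) (h e) \<in> U"
    using 2(1) dft_closed[OF assms(1) 2(1,2)] dft_closed[OF assms(2) 2(1,2)] by (intro univ_intros)
  ultimately have "s \<in> U" using univ_maps[OF 2(1) m] by blast
  with s show ?case by blast
qed

lemma mods_dfn [dfn_intros]:
  assumes "dft b t" "dft b u" "dft b v" "dft b w" shows "dfn b (\<lambda>e. mods (t e) (u e) (v e) (w e))"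
  unfolding mods_def by (intro dfn_ex_sat dfn_intros assms)

lemma dfn_ex_sat_in [dfn_intros]:
  assumes "dft b t" "dft b u" shows "dfn b (\<lambda>e. \<exists>s. sat_in (t e) (u e) s)"
  unfolding sat_in_def by (intro dfn_ex_sat dfn_intros assms)

definition defines_in :: "'v::zfc \<Rightarrow> 'v \<Rightarrow> 'v \<Rightarrow> bool" where
  "defines_in v \<phi> a \<longleftrightarrow> (\<exists>s. ap s (numeral_set 0) = a \<and> sat_in v \<phi> s)"

lemma defines_in_d0: "dfn b (\<lambda>e. defines_in (e 0) (e 1) (e 2))"
  unfolding defines_in_def
proof (rule dfn_ex, goal_cases)
  case 1 show ?case by (intro dfn_intros)
next
  case (2 U e)
  then obtain s where s: "ap s (numeral_set 0) = e 2" "sat_in (e 0) (e 1) s" by blast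
  have "e 0 \<in> U" "omega \<in> U" using 2(1,2) univ_omega by auto
  then have "s \<in> U" using univ_maps[OF 2(1)] sat_inD[OF s(2)] by blast
  with s show ?case by blast
qed
lemmas [dfn_intros] = dfn_subst3[where P = defines_in, OF defines_in_d0]

lemma dfn_ex_enum:
  assumes "dfn b (\<lambda>e. Q (e 0) (\<lambda>k. e (Suc k)))" "dft b t" "dft b u"
  shows "dfn b (\<lambda>e. \<exists>x. enum (t e) (opair (u e) x) \<and> Q x e)"
proof (rule dfn_ex, goal_cases)
  case 1 show ?case by (intro dfn_intros assms dft_ren[OF assms(2)] dft_ren[OF assms(3)])
next
  case (2 U e)
  then obtain x where x: "enum (t e) (opair (u e) x)" "Q x e" by blast
  obtain W where W: "W \<in> U" "hf_closed W" using univ_hf_closed[OF 2(1)] by blast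
  then have "opair (u e) x \<in> U" using enum_hf[OF x(1) W(2)] univ_trans[OF 2(1)] by blast
  with x show ?case using univ_opairD[OF 2(1)] by blast
qed

lemma dfn_all_enum:
  assumes "dfn b (\<lambda>e. Q (e 0) (\<lambda>k. e (Suc k)))" "dft b t" "dft b u"
  shows "dfn b (\<lambda>e. \<forall>x. enum (t e) (opair (u e) x) \<longrightarrow> Q x e)"
  by (rule dfn_cong[OF dfn_neg[OF dfn_ex_enum[OF dfn_neg[OF assms(1)] assms(2,3)]]]) blast

section \<open>Categorical and fresh cardinals\<close>

lemmas [dfn_intros] = dfn_subst2[where P = zfc2_model, OF zfc2_model_d0]

lemma opair_transD: "transitive_set t \<Longrightarrow> opair x y \<epsilon> t \<Longrightarrow> x \<epsilon> t \<and> y \<epsilon> t"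
proof -
  assume t: "transitive_set t" "opair x y \<epsilon> t"
  have "upair x y \<epsilon> opair x y" "x \<epsilon> upair x y" "y \<epsilon> upair x y" by (simp_all add: opair_upair)
  then show ?thesis using t transitive_setD by blast
qed

lemma const_lam:
  fixes r x t :: "'v::zfc"
  shows "x \<epsilon> t \<Longrightarrow> maps (lam omega (\<lambda>_. x)) omega t" "k \<epsilon> omega \<Longrightarrow> ap (lam omega (\<lambda>_. r)) k = r"
proof -
  have c: "dft True (\<lambda>e :: nat \<Rightarrow> 'v. x)" "dft True (\<lambda>e :: nat \<Rightarrow> 'v. r)" by (intro dfn_intros)+
  show "x \<epsilon> t \<Longrightarrow> maps (lam omega (\<lambda>_. x)) omega t"
    unfolding maps_iff using fun_on_lam[OF c(1)] ap_lam[OF c(1)] by simp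
  show "k \<epsilon> omega \<Longrightarrow> ap (lam omega (\<lambda>_. r)) k = r" by (rule ap_lam[OF c(2)])
qed

text \<open>The common core of the cases of \<open>logic_order\<close>. The order itself may be no
  number; what a real can store is the formula that defines it in each inaccessible level.\<close>

definition pins :: "'v::zfc \<Rightarrow> 'v \<Rightarrow> bool" where
  "pins \<phi> \<alpha> \<longleftrightarrow> formula \<phi> \<and> ordinal \<alpha> \<and>
    (\<forall>\<kappa>. inaccessible \<kappa> \<longrightarrow> \<alpha> \<epsilon> V \<kappa> \<and> (\<forall>x. x \<epsilon> V \<kappa> \<longrightarrow> (defines_in (V \<kappa>) \<phi> x \<longleftrightarrow> x = \<alpha>)))"

lemma pins_numeral: "\<exists>\<phi>. pins \<phi> (numeral_set n :: 'v::zfc)"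
proof -
  have "dfn False (\<lambda>e :: nat \<Rightarrow> 'v. e 0 = numeral_set n)" by (intro dfn_intros)
  then obtain q where q: "\<forall>U e. nice U \<longrightarrow> range e \<subseteq> U \<longrightarrow> (e 0 = (numeral_set n :: 'v) \<longleftrightarrow> hold U q e)"
    unfolding dfn_def join_def by auto
  obtain q' where q': "\<forall>U (s :: nat \<Rightarrow> 'v). hold U q' s = hold U q (s \<circ> (\<lambda>_. 0))" using hold_rename by blast
  have "pins (cd q') (numeral_set n :: 'v)" unfolding pins_def
  proof (intro conjI allI impI)
    show "formula (cd q' :: 'v)" by (intro fo_formula_formula formula_cd)
    show "ordinal (numeral_set n :: 'v)" by (rule ordinal_nat) (rule numeral_set_omega)
    fix \<kappa> :: 'v assume k: "inaccessible \<kappa>"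
    have o: "ordinal \<kappa>" and om: "omega \<epsilon> \<kappa>" using k inaccessible_ordinal inaccessible_omega by blast+
    show "numeral_set n \<epsilon> V \<kappa>" by (rule ordinal_subset_V[OF o ordinal_trans[OF o om numeral_set_omega]])
    fix x assume x: "x \<epsilon> V \<kappa>"
    have *: "sat_in (V \<kappa>) (cd q') s \<longleftrightarrow> ap s (numeral_set 0) = numeral_set n" if s: "maps s omega (V \<kappa>)" for s
    proof -
      let ?e = "(\<lambda>k. ap s (numeral_set k)) \<circ> (\<lambda>_ :: nat. 0 :: nat)"
      have "range ?e \<subseteq> elts (V \<kappa>)" using ap_in[OF s numeral_set_omega[of 0]] by auto
      then have "?e 0 = numeral_set n \<longleftrightarrow> hold (elts (V \<kappa>)) q ?e"
        using spec[OF spec[OF q, of "elts (V \<kappa>)"], of ?e] nice_V_inaccessible[OF k] by argo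
      then show ?thesis unfolding sat_in_cd[OF s] using q' by (simp del: numeral_set.simps)
    qed
    show "defines_in (V \<kappa>) (cd q') x \<longleftrightarrow> x = numeral_set n"
    proof
      assume "defines_in (V \<kappa>) (cd q') x"
      then show "x = numeral_set n" unfolding defines_in_def using * sat_inD by metis
    next
      assume "x = numeral_set n"
      then show "defines_in (V \<kappa>) (cd q') x" unfolding defines_in_def
        using *[OF const_lam(1)[OF x]] const_lam(2)[OF numeral_set_omega, of x 0] by metis
    qed
  qed
  then show ?thesis by blast
qed

lemma logic_order_pins: "logic_order \<alpha> \<Longrightarrow> \<exists>\<phi>. pins \<phi> \<alpha>"
proof -
  have app: "(\<exists>s. app s (numeral_set 0) = x \<and> sat_in v \<phi> s) \<longleftrightarrow> defines_in v \<phi> x" for x v \<phi> :: 'a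
  proof -
    have "app s (numeral_set 0) = ap s (numeral_set 0)" if "sat_in v \<phi> s" for s
      using sat_inD[OF that] fun_on_app[OF _ numeral_set_omega] unfolding maps_iff by blast
    then show ?thesis unfolding defines_in_def by metis
  qed
  assume "logic_order \<alpha>"
  then show ?thesis unfolding logic_order_def
  proof (elim disjE)
    assume "absolutely_definable \<alpha>"
    then obtain \<phi> where "ordinal \<alpha>" "fo_formula \<phi>" "\<forall>\<kappa>. inaccessible \<kappa> \<longrightarrow> \<alpha> \<epsilon> V \<kappa> \<and>
        (\<forall>x\<in>elts (V \<kappa>). (\<exists>s. app s (numeral_set 0) = x \<and> sat_in (V \<kappa>) \<phi> s) \<longleftrightarrow> x = \<alpha>)"
      unfolding absolutely_definable_def by blast
    then have "pins \<phi> \<alpha>" unfolding pins_def app by (simp add: fo_formula_formula Ball_def)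
    then show ?thesis by blast
  qed (use pins_numeral in blast)+
qed

text \<open>
  The natural numbers in \<open>r\<close> code sentences to be satisfied (tag 0) or refuted (tag 1) in \<open>V \<kappa>\<close> and the
  formula defining the order of the logic (tag 2).
\<close>

definition theory_cardinal :: "bool \<Rightarrow> 'v::zfc \<Rightarrow> 'v \<Rightarrow> bool" where
  "theory_cardinal c z r \<longleftrightarrow> (\<exists>\<kappa> p. z = opair \<kappa> p \<and> (\<exists>v q. p = opair v q \<and> (\<exists>a L. q = opair a L \<and>
    inaccessible \<kappa> \<and> (ordinal \<kappa> \<and> v = V \<kappa>) \<and> (ordinal a \<and> L = ho_level v a) \<and>
    (c \<longrightarrow> zfc2_model v (mem_rel v)) \<and>
    (\<exists>n\<in>elts r. \<exists>\<phi>. enum n (opair (numeral_set 2) \<phi>) \<and> a \<epsilon> v \<and> defines_in v \<phi> a) \<and>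
    (\<forall>n\<in>elts r. \<forall>\<sigma>. enum n (opair (numeral_set 0) \<sigma>) \<longrightarrow> mods v (mem_rel v) L \<sigma>) \<and>
    (\<forall>n\<in>elts r. \<forall>\<sigma>. enum n (opair (numeral_set 1) \<sigma>) \<longrightarrow> \<not> mods v (mem_rel v) L \<sigma>))))"

lemma theory_cardinal_dfn: "dfn b (\<lambda>e. theory_cardinal c (e 0) (e 1))"
  unfolding theory_cardinal_def
  by (intro dfn_ex_opair dfn_all_enum dfn_ex_enum V_dfn ho_level_dfn dfn_intros)

lemma theory_cardinal_intro:
  assumes k: "inaccessible \<kappa>" and \<phi>: "pins \<phi> \<alpha>" and c: "c \<longrightarrow> zfc2_model (V \<kappa>) (mem_rel (V \<kappa>))"
    and 2: "m \<epsilon> r" "enum m (opair (numeral_set 2) \<phi>)"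
    and 0: "\<And>n \<sigma>. n \<epsilon> r \<Longrightarrow> enum n (opair (numeral_set 0) \<sigma>) \<Longrightarrow> models \<alpha> (V \<kappa>) (mem_rel (V \<kappa>)) \<sigma>"
    and 1: "\<And>n \<sigma>. n \<epsilon> r \<Longrightarrow> enum n (opair (numeral_set 1) \<sigma>) \<Longrightarrow> \<not> models \<alpha> (V \<kappa>) (mem_rel (V \<kappa>)) \<sigma>"
  shows "\<exists>z. theory_cardinal c z r"
proof -
  have a: "\<alpha> \<epsilon> V \<kappa>" "defines_in (V \<kappa>) \<phi> \<alpha>" "ordinal \<alpha>" using \<phi> k unfolding pins_def by blast+
  have "theory_cardinal c (opair \<kappa> (opair (V \<kappa>) (opair \<alpha> (ho_level (V \<kappa>) \<alpha>)))) r"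
    unfolding theory_cardinal_def Bex_def Ball_def in_elts
    using k c 2 a 0 1 inaccessible_ordinal[OF k] unfolding models_mods
    by (intro exI conjI allI impI refl) (assumption | blast)+
  then show ?thesis by blast
qed

text \<open>Transitivity of \<open>V \<delta>\<close> puts the first component of \<open>z\<close>
  below \<delta>. By \<open>uniq\<close> the formula found in \<open>r\<close> is \<phi>, which
  identifies the order used in \<open>V \<kappa>\<close> as \<alpha>.\<close>

lemma theory_cardinal_elim:
  assumes z: "theory_cardinal c z r" and o: "ordinal \<delta>" and zV: "z \<epsilon> V \<delta>" and \<phi>: "pins \<phi> \<alpha>"
    and uniq: "\<forall>n \<psi>. n \<epsilon> r \<longrightarrow> enum n (opair (numeral_set 2) \<psi>) \<longrightarrow> \<psi> = \<phi>"
  shows "\<exists>\<kappa>. \<kappa> \<epsilon> \<delta> \<and> inaccessible \<kappa> \<and> (c \<longrightarrow> zfc2_model (V \<kappa>) (mem_rel (V \<kappa>))) \<and>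
    (\<forall>n \<sigma>. n \<epsilon> r \<longrightarrow> enum n (opair (numeral_set 0) \<sigma>) \<longrightarrow> models \<alpha> (V \<kappa>) (mem_rel (V \<kappa>)) \<sigma>) \<and>
    (\<forall>n \<sigma>. n \<epsilon> r \<longrightarrow> enum n (opair (numeral_set 1) \<sigma>) \<longrightarrow> \<not> models \<alpha> (V \<kappa>) (mem_rel (V \<kappa>)) \<sigma>)"
proof -
  obtain \<kappa> p v q a L where 1: "z = opair \<kappa> p" and "p = opair v q" "q = opair a L" and k: "inaccessible \<kappa>"
    and "ordinal \<kappa>" and v: "v = V \<kappa>" and "ordinal a" and L: "L = ho_level v a"
    and c': "c \<longrightarrow> zfc2_model v (mem_rel v)"
    and d': "\<exists>n\<in>elts r. \<exists>\<phi>. enum n (opair (numeral_set 2) \<phi>) \<and> a \<epsilon> v \<and> defines_in v \<phi> a"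
    and m': "\<forall>n\<in>elts r. \<forall>\<sigma>. enum n (opair (numeral_set 0) \<sigma>) \<longrightarrow> mods v (mem_rel v) L \<sigma>"
      "\<forall>n\<in>elts r. \<forall>\<sigma>. enum n (opair (numeral_set 1) \<sigma>) \<longrightarrow> \<not> mods v (mem_rel v) L \<sigma>"
    using z unfolding theory_cardinal_def by (elim exE conjE) (rule that)
  note c = c'[unfolded v] and d = d'[unfolded v] and m = m'[unfolded L v]
  obtain n \<psi> where "n \<epsilon> r" "enum n (opair (numeral_set 2) \<psi>)" "a \<epsilon> V \<kappa>" "defines_in (V \<kappa>) \<psi> a"
    using d by auto
  then have "a = \<alpha>" using uniq \<phi> k unfolding pins_def by metis
  have "\<kappa> \<epsilon> V \<delta>" using opair_transD[OF V_transitive[OF o]] zV 1 by metis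
  then have "\<kappa> \<epsilon> \<delta>" using ordinal_in_V[OF o inaccessible_ordinal[OF k]] by blast
  then show ?thesis using k c m unfolding models_mods \<open>a = \<alpha>\<close> Ball_def in_elts by blast
qed

lemma sententially_categorical_below_lightface:
  assumes \<alpha>: "logic_order \<alpha>" and sc: "sententially_categorical \<alpha> \<kappa>" and \<delta>: "lightface_correct \<delta>"
  shows "\<kappa> \<epsilon> \<delta>"
proof -
  obtain \<phi> where \<phi>: "pins \<phi> \<alpha>" using logic_order_pins[OF \<alpha>] by blast
  obtain \<sigma> where card: "cardinal \<kappa>" and \<sigma>: "sentence \<alpha> \<sigma>" and tc: "theory_categorical_for \<alpha> (set_of {\<sigma>}) \<kappa>"
    using sc unfolding sententially_categorical_def by blast
  have "small {\<sigma>}" using small_pair[of \<sigma> \<sigma>] by simp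
  then have T: "elts (set_of {\<sigma>}) = {\<sigma>}" by (rule elts_set_of)
  have zm: "zfc2_model (V \<kappa>) (mem_rel (V \<kappa>))" and km: "models \<alpha> (V \<kappa>) (mem_rel (V \<kappa>)) \<sigma>"
    and cat: "\<And>M R. is_structure M R \<Longrightarrow> zfc2_model M R \<Longrightarrow> models \<alpha> M R \<sigma> \<Longrightarrow> isomorphic M R (V \<kappa>) (mem_rel (V \<kappa>))"
    using tc unfolding theory_categorical_for_def T by auto
  have k: "inaccessible \<kappa>" by (rule zfc2_model_inaccessible[OF card zm])
  have o: "ordinal \<delta>" using \<delta> unfolding lightface_correct_def by blast
  let ?N = "numeral_set :: nat \<Rightarrow> 'a"
  have "formula \<sigma>" using \<sigma> unfolding sentence_def by (auto intro: fo_formula_formula split: if_splits)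
  then obtain n1 where n1: "n1 \<epsilon> omega" "enum n1 (opair (?N 0) \<sigma>)"
    using coded_opair[OF coded_numeral coded_formula] unfolding coded_def by blast
  have "formula \<phi>" using \<phi> unfolding pins_def by blast
  then obtain n2 where n2: "n2 \<epsilon> omega" "enum n2 (opair (?N 2) \<phi>)"
    using coded_opair[OF coded_numeral coded_formula] unfolding coded_def by blast
  \<comment> \<open>\<open>transfer_number\<close> handles a single number, so the codes of the
    sentence and of the order are packed into an index on the walk.\<close>
  obtain i where i: "walk i n1 n2" using walk_surjective n1 n2 by blast
  have iom: "i \<epsilon> omega" using walk_omega[OF i] by blast
  let ?Q = "\<lambda>z i. \<exists>a. a \<epsilon> omega \<and> (\<exists>b. b \<epsilon> omega \<and> walk i a b \<and> theory_cardinal True z (upair a b))"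
  have Q: "dfn False (\<lambda>e. ?Q (e 0) (e 1))"
    by (intro dfn_intros dfn_subst2[where P = "theory_cardinal True", OF theory_cardinal_dfn])
  have Qi: "?Q z i \<longleftrightarrow> theory_cardinal True z (upair n1 n2)" for z
    using i n1 n2 walk_unique[OF i] by metis
  obtain f where f: "sigma2 f" "closed_formula f"
    and f1: "\<And>\<delta> s. ordinal \<delta> \<Longrightarrow> sat_in (V \<delta>) f s \<Longrightarrow> \<exists>z. z \<epsilon> V \<delta> \<and> theory_cardinal True z (upair n1 n2)"
    and f2: "\<And>s z. fun_on s omega \<Longrightarrow> theory_cardinal True z (upair n1 n2) \<Longrightarrow> sigma2_true f s"
    using transfer_number[OF Q iom] unfolding Qi by blast
  have ne: "?N 0 \<noteq> ?N 1" "?N 0 \<noteq> ?N 2" "?N 1 \<noteq> ?N 2" unfolding numeral_set_inject by simp_all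
  have mem0: "\<tau> = \<sigma>" if "n \<epsilon> upair n1 n2" "enum n (opair (?N 0) \<tau>)" for n \<tau>
    using that enum_unique[OF _ n1(2)] enum_unique[OF _ n2(2)] ne unfolding mem_upair by (metis opair_inject)
  have mem1: False if "n \<epsilon> upair n1 n2" "enum n (opair (?N 1) \<tau>)" for n \<tau>
    using that enum_unique[OF _ n1(2)] enum_unique[OF _ n2(2)] ne unfolding mem_upair by (metis opair_inject)
  have "\<tau> = \<phi>" if "n \<epsilon> upair n1 n2" "enum n (opair (?N 2) \<tau>)" for n \<tau>
    using that enum_unique[OF _ n1(2)] enum_unique[OF _ n2(2)] ne unfolding mem_upair by (metis opair_inject)
  then have mem2: "\<forall>n \<tau>. n \<epsilon> upair n1 n2 \<longrightarrow> enum n (opair (?N 2) \<tau>) \<longrightarrow> \<tau> = \<phi>" by blast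
  have "\<exists>z. theory_cardinal True z (upair n1 n2)"
  proof (rule theory_cardinal_intro[OF k \<phi>])
    show "n2 \<epsilon> upair n1 n2" "enum n2 (opair (?N 2) \<phi>)" using n2 by simp_all
    show "models \<alpha> (V \<kappa>) (mem_rel (V \<kappa>)) \<tau>" if "n \<epsilon> upair n1 n2" "enum n (opair (?N 0) \<tau>)" for n \<tau>
      using mem0[OF that] km by simp
    show "\<not> models \<alpha> (V \<kappa>) (mem_rel (V \<kappa>)) \<tau>" if "n \<epsilon> upair n1 n2" "enum n (opair (?N 1) \<tau>)" for n \<tau>
      using mem1[OF that] by simp
  qed (use zm in blast)
  \<comment> \<open>Lightface truth of a sentence still asks for some assignment; a constant one is
    at hand.\<close>
  moreover have "fun_on (lam omega (\<lambda>_. empty :: 'a)) omega"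
    using const_lam(1)[of "empty :: 'a" "succ empty"] unfolding maps_iff by simp
  ultimately have "\<exists>s. sigma2_true f s" using f2 by blast
  then have "\<exists>s. sat_in (V \<delta>) f s" using \<delta> f unfolding lightface_correct_def by blast
  then obtain z where z: "z \<epsilon> V \<delta>" "theory_cardinal True z (upair n1 n2)" using f1[OF o] by blast
  obtain \<kappa>' where k': "\<kappa>' \<epsilon> \<delta>" "inaccessible \<kappa>'" "zfc2_model (V \<kappa>') (mem_rel (V \<kappa>'))"
    and mo: "\<forall>n \<tau>. n \<epsilon> upair n1 n2 \<longrightarrow> enum n (opair (?N 0) \<tau>) \<longrightarrow> models \<alpha> (V \<kappa>') (mem_rel (V \<kappa>')) \<tau>"
    using theory_cardinal_elim[OF z(2) o z(1) \<phi> mem2] by blast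
  have "models \<alpha> (V \<kappa>') (mem_rel (V \<kappa>')) \<sigma>" using mo n1(2) by (metis mem_upair)
  moreover have "is_structure (V \<kappa>') (mem_rel (V \<kappa>'))"
  proof -
    have "omega \<epsilon> V \<kappa>'"
      by (rule ordinal_subset_V[OF inaccessible_ordinal[OF k'(2)] inaccessible_omega[OF k'(2)]])
    then have "V \<kappa>' \<noteq> empty" by auto
    then show ?thesis unfolding is_structure_def by (auto simp: mem_mem_rel)
  qed
  \<comment> \<open>Categoricity is applied to the model found below \<delta>. Isomorphic levels
    coincide, so \<kappa> itself is below \<delta>.\<close>
  ultimately have "isomorphic (V \<kappa>') (mem_rel (V \<kappa>')) (V \<kappa>) (mem_rel (V \<kappa>))" using cat k'(3) by blast
  then have "\<kappa>' = \<kappa>" using isomorphic_V inaccessible_ordinal k k'(2) by blast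
  then show ?thesis using k'(1) by simp
qed

section \<open>Theory categorical and fresh cardinals\<close>

lemma real_transfer:
  assumes \<delta>: "real_correct \<delta>" and Q: "dfn False (\<lambda>e. Q (e 0) (e 1))"
    and r: "elts r \<subseteq> elts omega" and z: "Q z r"
  shows "\<exists>z. z \<epsilon> V \<delta> \<and> Q z r"
proof -
  have o: "ordinal \<delta>" using \<delta> unfolding real_correct_def by blast
  obtain f where f: "sigma2 f" and f1: "\<And>\<delta> s. ordinal \<delta> \<Longrightarrow> sat_in (V \<delta>) f s \<Longrightarrow> \<exists>z. z \<epsilon> V \<delta> \<and> Q z (ap s (numeral_set 0))"
    and f2: "\<And>s z. fun_on s omega \<Longrightarrow> Q z (ap s (numeral_set 0)) \<Longrightarrow> sigma2_true f s"
    using transfer_parameter[OF Q] by blast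
  \<comment> \<open>\<open>real_correct\<close> requires every variable to carry a real, and a
    constant assignment achieves this.\<close>
  let ?s = "lam omega (\<lambda>_. r)"
  have s: "maps ?s omega (pow omega)" by (rule const_lam(1)) (simp add: r)
  have r0: "ap ?s (numeral_set 0) = r" by (rule const_lam(2)[OF numeral_set_omega])
  have "sigma2_true f ?s" using f2[of ?s z] s z r0 unfolding maps_iff by simp
  then have "sat_in (V \<delta>) f ?s" using \<delta> f s unfolding real_correct_def by blast
  from f1[OF o this] show ?thesis unfolding r0 .
qed

text \<open>One statement for two uses: a categorical theory is given by \<open>T\<close>, with
  \<open>c\<close> preserving the second-order axioms; for a fresh cardinal the refuted sentences in
  \<open>N\<close> make the two theories equal.\<close>

lemma theory_below_real:
  assumes \<alpha>: "logic_order \<alpha>" and k: "inaccessible \<kappa>" and \<delta>: "real_correct \<delta>"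
    and TN: "\<And>\<sigma>. \<sigma> \<epsilon> T \<Longrightarrow> sentence \<alpha> \<sigma> \<and> models \<alpha> (V \<kappa>) (mem_rel (V \<kappa>)) \<sigma>"
      "\<And>\<sigma>. \<sigma> \<epsilon> N \<Longrightarrow> sentence \<alpha> \<sigma> \<and> \<not> models \<alpha> (V \<kappa>) (mem_rel (V \<kappa>)) \<sigma>"
    and c: "c \<longrightarrow> zfc2_model (V \<kappa>) (mem_rel (V \<kappa>))"
  shows "\<exists>\<kappa>'. \<kappa>' \<epsilon> \<delta> \<and> inaccessible \<kappa>' \<and> (c \<longrightarrow> zfc2_model (V \<kappa>') (mem_rel (V \<kappa>'))) \<and>
    (\<forall>\<sigma>. \<sigma> \<epsilon> T \<longrightarrow> models \<alpha> (V \<kappa>') (mem_rel (V \<kappa>')) \<sigma>) \<and> (\<forall>\<sigma>. \<sigma> \<epsilon> N \<longrightarrow> \<not> models \<alpha> (V \<kappa>') (mem_rel (V \<kappa>')) \<sigma>)"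
proof -
  obtain \<phi> where \<phi>: "pins \<phi> \<alpha>" using logic_order_pins[OF \<alpha>] by blast
  have o: "ordinal \<delta>" using \<delta> unfolding real_correct_def by blast
  let ?N = "numeral_set :: nat \<Rightarrow> 'a"
  let ?P = "\<lambda>n. n \<epsilon> omega \<and> ((\<exists>\<sigma>. \<sigma> \<epsilon> T \<and> enum n (opair (?N 0) \<sigma>)) \<or>
    (\<exists>\<sigma>. \<sigma> \<epsilon> N \<and> enum n (opair (?N 1) \<sigma>)) \<or> enum n (opair (?N 2) \<phi>))"
  have "\<exists>r. \<forall>n. n \<epsilon> r \<longleftrightarrow> ?P n"
    by (rule comprehension[of _ omega], intro dfn_intros) (erule conjunct1)
  then obtain r where "\<forall>n. n \<epsilon> r \<longleftrightarrow> ?P n" by (rule exE)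
  then have r: "n \<epsilon> r \<longleftrightarrow> ?P n" for n by (rule spec)
  have sub: "elts r \<subseteq> elts omega" using r by auto
  have ne: "?N 0 \<noteq> ?N 1" "?N 0 \<noteq> ?N 2" "?N 1 \<noteq> ?N 2" unfolding numeral_set_inject by simp_all
  have mem0: "\<tau> \<epsilon> T" if "n \<epsilon> r" "enum n (opair (?N 0) \<tau>)" for n \<tau>
    using that(1) enum_unique[OF that(2)] ne unfolding r by (metis opair_inject)
  have mem1: "\<tau> \<epsilon> N" if "n \<epsilon> r" "enum n (opair (?N 1) \<tau>)" for n \<tau>
    using that(1) enum_unique[OF that(2)] ne unfolding r by (metis opair_inject)
  have "\<tau> = \<phi>" if "n \<epsilon> r" "enum n (opair (?N 2) \<tau>)" for n \<tau>
    using that(1) enum_unique[OF that(2)] ne unfolding r by (metis opair_inject)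
  then have mem2: "\<forall>n \<tau>. n \<epsilon> r \<longrightarrow> enum n (opair (?N 2) \<tau>) \<longrightarrow> \<tau> = \<phi>" by blast
  have code: "\<exists>n. n \<epsilon> omega \<and> enum n (opair (?N m) f)" if "formula f" for m f
    using coded_opair[OF coded_numeral coded_formula[OF that]] unfolding coded_def by blast
  have form: "formula \<sigma>" if "sentence \<alpha> \<sigma>" for \<sigma>
    using that unfolding sentence_def by (auto intro: fo_formula_formula split: if_splits)
  have "formula \<phi>" using \<phi> unfolding pins_def by blast
  then obtain m where m: "m \<epsilon> omega" "enum m (opair (?N 2) \<phi>)" using code by blast
  have "\<exists>z. theory_cardinal c z r"
  proof (rule theory_cardinal_intro[OF k \<phi> c])
    show "m \<epsilon> r" "enum m (opair (?N 2) \<phi>)" using m r by blast+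
    show "models \<alpha> (V \<kappa>) (mem_rel (V \<kappa>)) \<tau>" if "n \<epsilon> r" "enum n (opair (?N 0) \<tau>)" for n \<tau>
      using mem0[OF that] TN by blast
    show "\<not> models \<alpha> (V \<kappa>) (mem_rel (V \<kappa>)) \<tau>" if "n \<epsilon> r" "enum n (opair (?N 1) \<tau>)" for n \<tau>
      using mem1[OF that] TN by blast
  qed
  then obtain z where z: "z \<epsilon> V \<delta>" "theory_cardinal c z r"
    using real_transfer[OF \<delta> theory_cardinal_dfn sub] by blast
  obtain \<kappa>' where k': "\<kappa>' \<epsilon> \<delta>" "inaccessible \<kappa>'" "c \<longrightarrow> zfc2_model (V \<kappa>') (mem_rel (V \<kappa>'))"
    and m0: "\<forall>n \<tau>. n \<epsilon> r \<longrightarrow> enum n (opair (?N 0) \<tau>) \<longrightarrow> models \<alpha> (V \<kappa>') (mem_rel (V \<kappa>')) \<tau>"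
    and m1: "\<forall>n \<tau>. n \<epsilon> r \<longrightarrow> enum n (opair (?N 1) \<tau>) \<longrightarrow> \<not> models \<alpha> (V \<kappa>') (mem_rel (V \<kappa>')) \<tau>"
    using theory_cardinal_elim[OF z(2) o z(1) \<phi> mem2] by blast
  have "models \<alpha> (V \<kappa>') (mem_rel (V \<kappa>')) \<sigma>" if s: "\<sigma> \<epsilon> T" for \<sigma>
  proof -
    obtain n where n: "n \<epsilon> omega" "enum n (opair (?N 0) \<sigma>)" using code[OF form] TN(1)[OF s] by blast
    then have "n \<epsilon> r" unfolding r using s by blast
    then show ?thesis using m0 n by blast
  qed
  moreover have "\<not> models \<alpha> (V \<kappa>') (mem_rel (V \<kappa>')) \<sigma>" if s: "\<sigma> \<epsilon> N" for \<sigma>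
  proof -
    obtain n where n: "n \<epsilon> omega" "enum n (opair (?N 1) \<sigma>)" using code[OF form] TN(2)[OF s] by blast
    then have "n \<epsilon> r" unfolding r using s by blast
    then show ?thesis using m1 n by blast
  qed
  ultimately show ?thesis using k' by blast
qed

lemma theory_categorical_below_real:
  assumes \<alpha>: "logic_order \<alpha>" and tc: "theory_categorical \<alpha> \<kappa>" and \<delta>: "real_correct \<delta>"
  shows "\<kappa> \<epsilon> \<delta>"
proof -
  obtain T where card: "cardinal \<kappa>" and T: "\<forall>\<sigma>\<in>elts T. sentence \<alpha> \<sigma>" and tf: "theory_categorical_for \<alpha> T \<kappa>"
    using tc unfolding theory_categorical_def by blast
  have zm: "zfc2_model (V \<kappa>) (mem_rel (V \<kappa>))" and km: "\<forall>\<sigma>\<in>elts T. models \<alpha> (V \<kappa>) (mem_rel (V \<kappa>)) \<sigma>"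
    and cat: "\<And>M R. is_structure M R \<Longrightarrow> zfc2_model M R \<Longrightarrow> \<forall>\<sigma>\<in>elts T. models \<alpha> M R \<sigma> \<Longrightarrow> isomorphic M R (V \<kappa>) (mem_rel (V \<kappa>))"
    using tf unfolding theory_categorical_for_def by blast+
  have k: "inaccessible \<kappa>" by (rule zfc2_model_inaccessible[OF card zm])
  have "\<exists>\<kappa>'. \<kappa>' \<epsilon> \<delta> \<and> inaccessible \<kappa>' \<and> (True \<longrightarrow> zfc2_model (V \<kappa>') (mem_rel (V \<kappa>'))) \<and>
    (\<forall>\<sigma>. \<sigma> \<epsilon> T \<longrightarrow> models \<alpha> (V \<kappa>') (mem_rel (V \<kappa>')) \<sigma>) \<and> (\<forall>\<sigma>. \<sigma> \<epsilon> empty \<longrightarrow> \<not> models \<alpha> (V \<kappa>') (mem_rel (V \<kappa>')) \<sigma>)"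
    by (rule theory_below_real[OF \<alpha> k \<delta>]) (use T km zm in simp_all)
  then obtain \<kappa>' where k': "\<kappa>' \<epsilon> \<delta>" "inaccessible \<kappa>'" "zfc2_model (V \<kappa>') (mem_rel (V \<kappa>'))"
    and m: "\<forall>\<sigma>. \<sigma> \<epsilon> T \<longrightarrow> models \<alpha> (V \<kappa>') (mem_rel (V \<kappa>')) \<sigma>" by blast
  have "omega \<epsilon> V \<kappa>'"
    by (rule ordinal_subset_V[OF inaccessible_ordinal[OF k'(2)] inaccessible_omega[OF k'(2)]])
  then have "V \<kappa>' \<noteq> empty" by auto
  then have "is_structure (V \<kappa>') (mem_rel (V \<kappa>'))" unfolding is_structure_def by (auto simp: mem_mem_rel)
  then have "isomorphic (V \<kappa>') (mem_rel (V \<kappa>')) (V \<kappa>) (mem_rel (V \<kappa>))" using cat k'(3) m by simp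
  then have "\<kappa>' = \<kappa>" using isomorphic_V inaccessible_ordinal k k'(2) by blast
  then show ?thesis using k'(1) by simp
qed

lemma sentence_dfn: "dfn True (\<lambda>e. sentence \<alpha> (e 0))"
  unfolding sentence_def if_bool_eq_conj by (intro dfn_intros)

lemma fresh_below_real:
  assumes \<alpha>: "logic_order \<alpha>" and fr: "fresh \<alpha> \<kappa>" and \<delta>: "real_correct \<delta>"
  shows "\<kappa> \<epsilon> \<delta>"
proof -
  have o: "ordinal \<delta>" using \<delta> unfolding real_correct_def by blast
  have k: "inaccessible \<kappa>" and fresh: "\<And>\<gamma>. \<gamma> \<epsilon> \<kappa> \<Longrightarrow> inaccessible \<gamma> \<Longrightarrow> theory_of_V \<alpha> \<kappa> \<noteq> theory_of_V \<alpha> \<gamma>"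
    using fr unfolding fresh_def by auto
  let ?m = "models \<alpha> (V \<kappa>) (mem_rel (V \<kappa>))"
  have form: "formula \<sigma>" if "sentence \<alpha> \<sigma>" for \<sigma>
    using that unfolding sentence_def by (auto intro: fo_formula_formula split: if_splits)
  have "\<exists>T. \<forall>\<sigma>. \<sigma> \<epsilon> T \<longleftrightarrow> sentence \<alpha> \<sigma> \<and> ?m \<sigma>"
    by (rule comprehension[of _ Form], unfold models_mods, intro dfn_intros sentence_dfn) (use form mem_Form in blast)
  then obtain T where T: "\<forall>\<sigma>. \<sigma> \<epsilon> T \<longleftrightarrow> sentence \<alpha> \<sigma> \<and> ?m \<sigma>" by (rule exE)
  have "\<exists>N. \<forall>\<sigma>. \<sigma> \<epsilon> N \<longleftrightarrow> sentence \<alpha> \<sigma> \<and> \<not> ?m \<sigma>"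
    by (rule comprehension[of _ Form], unfold models_mods, intro dfn_intros sentence_dfn) (use form mem_Form in blast)
  then obtain N where N: "\<forall>\<sigma>. \<sigma> \<epsilon> N \<longleftrightarrow> sentence \<alpha> \<sigma> \<and> \<not> ?m \<sigma>" by (rule exE)
  have "\<exists>\<kappa>'. \<kappa>' \<epsilon> \<delta> \<and> inaccessible \<kappa>' \<and> (False \<longrightarrow> zfc2_model (V \<kappa>') (mem_rel (V \<kappa>'))) \<and>
    (\<forall>\<sigma>. \<sigma> \<epsilon> T \<longrightarrow> models \<alpha> (V \<kappa>') (mem_rel (V \<kappa>')) \<sigma>) \<and> (\<forall>\<sigma>. \<sigma> \<epsilon> N \<longrightarrow> \<not> models \<alpha> (V \<kappa>') (mem_rel (V \<kappa>')) \<sigma>)"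
    by (rule theory_below_real[OF \<alpha> k \<delta>]) (use T N in simp_all)
  then obtain \<kappa>' where k': "\<kappa>' \<epsilon> \<delta>" "inaccessible \<kappa>'"
    and m: "\<forall>\<sigma>. \<sigma> \<epsilon> T \<longrightarrow> models \<alpha> (V \<kappa>') (mem_rel (V \<kappa>')) \<sigma>" "\<forall>\<sigma>. \<sigma> \<epsilon> N \<longrightarrow> \<not> models \<alpha> (V \<kappa>') (mem_rel (V \<kappa>')) \<sigma>" by blast
  have "theory_of_V \<alpha> \<kappa> = theory_of_V \<alpha> \<kappa>'" unfolding theory_of_V_def
    using m T N by (intro arg_cong[where f = set_of] Collect_cong) blast
  then have "\<not> \<kappa>' \<epsilon> \<kappa>" using fresh k'(2) by blast
  \<comment> \<open>Freshness excludes that \<kappa>' is below \<kappa>; in the remaining cases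
    \<kappa> is at most \<kappa>', hence below \<delta>.\<close>
  then have "\<kappa> = \<kappa>' \<or> \<kappa> \<epsilon> \<kappa>'" using ordinal_linear inaccessible_ordinal k k'(2) by blast
  then show ?thesis using k'(1) ordinal_trans[OF o] by blast
qed

section \<open>Correct cardinals\<close>

lemma lightface_correct_iff: "lightface_correct \<delta> \<longleftrightarrow> ordinal \<delta> \<and>
    (\<forall>\<phi>. sigma2 \<phi> \<and> closed_formula \<phi> \<longrightarrow> ((\<exists>s. sat_in (VV \<delta>) \<phi> s) \<longleftrightarrow> (\<exists>s. sigma2_true \<phi> s)))"
  unfolding lightface_correct_def by (cases "ordinal \<delta>") simp_all

lemma real_correct_iff: "real_correct \<delta> \<longleftrightarrow> ordinal \<delta> \<and>
    (\<forall>\<phi> s. sigma2 \<phi> \<and> maps s omega (pow omega) \<longrightarrow> (sat_in (VV \<delta>) \<phi> s \<longleftrightarrow> sigma2_true \<phi> s))"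
  unfolding real_correct_def by (cases "ordinal \<delta>") simp_all

lemma fully_correct_iff: "fully_correct \<delta> \<longleftrightarrow> ordinal \<delta> \<and> VV \<delta> \<noteq> empty \<and>
    (\<forall>\<phi> s. sigma2 \<phi> \<and> maps s omega (VV \<delta>) \<longrightarrow> (sat_in (VV \<delta>) \<phi> s \<longleftrightarrow> sigma2_true \<phi> s))"
  unfolding fully_correct_def by (cases "ordinal \<delta>") simp_all

lemma correct_dfn:
  "dfn True (\<lambda>e. cardinal (e 0) \<and> lightface_correct (e 0))"
  "dfn True (\<lambda>e. cardinal (e 0) \<and> real_correct (e 0))"
  "dfn True (\<lambda>e. cardinal (e 0) \<and> fully_correct (e 0))"
  unfolding lightface_correct_iff real_correct_iff fully_correct_iff by (intro dfn_intros)+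

lemma ex_least_cardinal:
  assumes "dfn True (\<lambda>e. cardinal (e 0) \<and> P (e 0))" "cardinal \<delta>" "P \<delta>"
  shows "\<exists>\<gamma>. least_cardinal P \<gamma> \<and> (\<gamma> = \<delta> \<or> \<gamma> \<epsilon> \<delta>)"
proof -
  have o: "ordinal \<delta>" using assms(2) by (simp add: cardinal_def)
  obtain \<gamma> where g: "ordinal \<gamma>" "cardinal \<gamma> \<and> P \<gamma>" "\<And>\<beta>. \<beta> \<epsilon> \<gamma> \<Longrightarrow> \<not> (cardinal \<beta> \<and> P \<beta>)"
    using ordinal_least[of "\<lambda>x. cardinal x \<and> P x" \<delta>] assms o by blast
  then have "least_cardinal P \<gamma>" unfolding least_cardinal_def by auto
  moreover have "\<gamma> = \<delta> \<or> \<gamma> \<epsilon> \<delta>" using ordinal_linear[OF g(1) o] g(3)[of \<delta>] assms(2,3) by blast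
  ultimately show ?thesis by blast
qed

section \<open>Existence of a fully correct cardinal\<close>

lemma V_mono_sub: "ordinal \<alpha> \<Longrightarrow> ordinal \<beta> \<Longrightarrow> (\<And>z. z \<epsilon> \<alpha> \<Longrightarrow> z \<epsilon> \<beta>) \<Longrightarrow> x \<epsilon> V \<alpha> \<Longrightarrow> x \<epsilon> V \<beta>"
  using mem_V by blast

lemma delta0_true_support:
  assumes g: "delta0 g" and N: "supported N g" and s: "fun_on s omega" "fun_on s' omega"
    and eq: "\<And>k. k \<epsilon> N \<Longrightarrow> ap s k = ap s' k"
  shows "delta0_true g s \<longleftrightarrow> delta0_true g s'"
proof -
  obtain t where t: "transitive_set t" "\<forall>y. y \<epsilon> un (imgf s omega) (imgf s' omega) \<longrightarrow> y \<epsilon> t"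
    using transitive_closure by blast
  then have "maps s omega t" "maps s' omega t" using s unfolding maps_iff by auto
  then show ?thesis using delta0_true_iff[OF g t(1)] supportedD[OF N t(1) _ _ eq] by blast
qed

definition cut :: "'v::zfc \<Rightarrow> 'v \<Rightarrow> 'v \<Rightarrow> 'v" where
  "cut N f k = (if k \<epsilon> N then ap f k else empty)"

lemma cut_dft: "dft True (\<lambda>e. cut N f (e 0))"
proof (rule dft_setI)
  show "z \<epsilon> cut N f (e 0) \<longleftrightarrow> (\<lambda>z e. e 0 \<epsilon> N \<and> z \<epsilon> ap f (e 0)) z e" for z and e :: "nat \<Rightarrow> 'a"
    by (simp add: cut_def)
qed (intro dfn_intros, simp)

text \<open>
  Only finitely many values of an assignment matter, so every assignment in \<open>V \<lambda>\<close> may be replaced by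
  one in some \<open>V \<beta>\<close> with \<open>\<beta> < \<lambda>\<close>, although \<open>\<lambda>\<close> may have cofinality \<open>\<omega>\<close>.
\<close>

lemma bounded_assignment:
  assumes o: "ordinal l" and lim: "\<And>\<beta>. \<beta> \<epsilon> l \<Longrightarrow> succ \<beta> \<epsilon> l" and ne: "\<alpha> \<epsilon> l"
    and s: "maps s omega (V l)" and N: "N \<epsilon> omega"
  shows "\<exists>\<beta> s'. \<beta> \<epsilon> l \<and> maps s' omega (V \<beta>) \<and> (\<forall>k. k \<epsilon> N \<longrightarrow> ap s' k = ap s k)"
proof -
  have ordl: "ordinal \<gamma>" if "\<gamma> \<epsilon> l" for \<gamma> using that o ordinal_elt by blast
  \<comment> \<open>\<open>empty\<close> has to be available as the default value of
    \<open>cut\<close> off \<open>N\<close>. The induction on \<open>N\<close> takes one maximum at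
    a time.\<close>
  have "\<exists>\<beta>. \<beta> \<epsilon> l \<and> empty \<epsilon> VV \<beta> \<and> (\<forall>k. k \<epsilon> N \<longrightarrow> ap s k \<epsilon> VV \<beta>)"
  proof (rule omega_induct[where P = "\<lambda>N. \<exists>\<beta>. \<beta> \<epsilon> l \<and> empty \<epsilon> VV \<beta> \<and> (\<forall>k. k \<epsilon> N \<longrightarrow> ap s k \<epsilon> VV \<beta>)", OF _ N])
    show "dfn True (\<lambda>e. \<exists>\<beta>. \<beta> \<epsilon> l \<and> empty \<epsilon> VV \<beta> \<and> (\<forall>k. k \<epsilon> e 0 \<longrightarrow> ap s k \<epsilon> VV \<beta>))" by (intro dfn_intros)
    have "empty \<epsilon> V (succ \<alpha>)"
      unfolding mem_V[OF ordinal_succ[OF ordl[OF ne]]] by (rule exI[of _ \<alpha>]) auto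
    then show "\<exists>\<beta>. \<beta> \<epsilon> l \<and> empty \<epsilon> VV \<beta> \<and> (\<forall>k. k \<epsilon> empty \<longrightarrow> ap s k \<epsilon> VV \<beta>)"
      using lim[OF ne] ordl[OF lim[OF ne]] by (intro exI[of _ "succ \<alpha>"]) simp
  next
    fix n assume n: "n \<epsilon> omega" and "\<exists>\<beta>. \<beta> \<epsilon> l \<and> empty \<epsilon> VV \<beta> \<and> (\<forall>k. k \<epsilon> n \<longrightarrow> ap s k \<epsilon> VV \<beta>)"
    then obtain \<beta> where b: "\<beta> \<epsilon> l" "empty \<epsilon> V \<beta>" "\<forall>k. k \<epsilon> n \<longrightarrow> ap s k \<epsilon> V \<beta>" using ordl by auto
    obtain \<gamma> where c: "\<gamma> \<epsilon> l" "elts (ap s n) \<subseteq> elts (V \<gamma>)" using ap_in[OF s n] mem_V[OF o] by blast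
    let ?u = "un \<beta> (succ \<gamma>)"
    have oc: "ordinal (succ \<gamma>)" using ordinal_succ[OF ordl[OF c(1)]] .
    have u: "?u \<epsilon> l"
    proof -
      have "?u = \<beta> \<or> ?u = succ \<gamma>" using ordinal_linear[OF ordl[OF b(1)] oc]
      proof (elim disjE)
        assume m: "succ \<gamma> \<epsilon> \<beta>"
        have "?u = \<beta>" by (rule set_ext) (use ordinal_trans[OF ordl[OF b(1)] m] in \<open>simp only: mem_un, blast\<close>)
        then show ?thesis by (rule disjI1)
      next
        assume m: "\<beta> \<epsilon> succ \<gamma>"
        have "?u = succ \<gamma>" by (rule set_ext) (use ordinal_trans[OF oc m] in \<open>simp only: mem_un, blast\<close>)
        then show ?thesis by (rule disjI2)
      next
        assume "\<beta> = succ \<gamma>"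
        then have "?u = succ \<gamma>" by (intro set_ext) simp
        then show ?thesis by (rule disjI2)
      qed
      then show ?thesis using b(1) lim[OF c(1)] by (elim disjE) (simp_all only:)
    qed
    have "ap s n \<epsilon> V (succ \<gamma>)" unfolding mem_V[OF oc] using c(2) by (intro exI[of _ \<gamma>]) simp
    then have "ap s n \<epsilon> V ?u" by (rule V_mono_sub[OF oc ordl[OF u], rotated]) simp
    moreover have "x \<epsilon> V ?u" if "x \<epsilon> V \<beta>" for x using that by (rule V_mono_sub[OF ordl[OF b(1)] ordl[OF u], rotated]) simp
    ultimately have "empty \<epsilon> V ?u" "\<forall>k. k \<epsilon> succ n \<longrightarrow> ap s k \<epsilon> V ?u" using b by auto
    then show "\<exists>\<beta>. \<beta> \<epsilon> l \<and> empty \<epsilon> VV \<beta> \<and> (\<forall>k. k \<epsilon> succ n \<longrightarrow> ap s k \<epsilon> VV \<beta>)"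
      using u ordl[OF u] by (intro exI[of _ ?u]) simp
  qed
  then obtain \<beta> where b: "\<beta> \<epsilon> l" "empty \<epsilon> V \<beta>" "\<forall>k. k \<epsilon> N \<longrightarrow> ap s k \<epsilon> V \<beta>" using ordl by auto
  let ?s = "lam omega (cut N s)"
  have "maps ?s omega (V \<beta>)" unfolding maps_iff
  proof (intro conjI allI impI)
    show "fun_on ?s omega" by (rule fun_on_lam[OF cut_dft])
    show "ap ?s k \<epsilon> V \<beta>" if "k \<epsilon> omega" for k unfolding ap_lam[OF cut_dft that] using b by (simp add: cut_def)
  qed
  moreover have "\<forall>k. k \<epsilon> N \<longrightarrow> ap ?s k = ap s k"
  proof (intro allI impI)
    fix k assume k: "k \<epsilon> N"
    show "ap ?s k = ap s k" unfolding ap_lam[OF cut_dft omega_subset[OF N k]] using k by (simp add: cut_def)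
  qed
  ultimately show ?thesis using b(1) by blast
qed

text \<open>One part for each quantifier of a Sigma2 formula: values for the outer one and
  counterexamples to the inner one.\<close>

definition witnesses :: "'v::zfc \<Rightarrow> 'v \<Rightarrow> bool" where
  "witnesses a c \<longleftrightarrow> (\<forall>g i j s. delta0 g \<and> i \<epsilon> omega \<and> j \<epsilon> omega \<and> maps s omega a \<longrightarrow>
    ((\<exists>x. \<forall>y. delta0_true g (upd (upd s i x) j y)) \<longrightarrow> (\<exists>x. x \<epsilon> c \<and> (\<forall>y. delta0_true g (upd (upd s i x) j y)))) \<and>
    ((\<exists>y. \<not> delta0_true g (upd s j y)) \<longrightarrow> (\<exists>y. y \<epsilon> c \<and> \<not> delta0_true g (upd s j y))))"

lemma ex_witnesses: "\<exists>\<gamma>. ordinal \<gamma> \<and> witnesses a (V \<gamma>)"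
proof -
  let ?B = "cprod Form (cprod omega (cprod omega (pow (cprod omega a))))"
  \<comment> \<open>The requests are tuples of formula, variables and assignment. They form a set,
    so collection bounds the ranks of the answers.\<close>
  let ?R1 = "\<lambda>p x. \<exists>g i j s. p = opair g (opair i (opair j s)) \<and> (\<forall>y. delta0_true g (upd (upd s i x) j y))"
  let ?R2 = "\<lambda>p x. \<exists>g i j s. p = opair g (opair i (opair j s)) \<and> \<not> delta0_true g (upd s j x)"
  have "\<exists>\<gamma>. ordinal \<gamma> \<and> (\<forall>p. p \<epsilon> ?B \<longrightarrow> (\<exists>x. ?R1 p x) \<longrightarrow> (\<exists>x. x \<epsilon> V \<gamma> \<and> ?R1 p x))"
    by (rule collection, intro dfn_intros)
  then obtain \<gamma> where c: "ordinal \<gamma>" "\<And>p. p \<epsilon> ?B \<Longrightarrow> \<exists>x. ?R1 p x \<Longrightarrow> \<exists>x. x \<epsilon> V \<gamma> \<and> ?R1 p x" by blast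
  have "\<exists>\<gamma>. ordinal \<gamma> \<and> (\<forall>p. p \<epsilon> ?B \<longrightarrow> (\<exists>x. ?R2 p x) \<longrightarrow> (\<exists>x. x \<epsilon> V \<gamma> \<and> ?R2 p x))"
    by (rule collection, intro dfn_intros)
  then obtain \<delta> where d: "ordinal \<delta>" "\<And>p. p \<epsilon> ?B \<Longrightarrow> \<exists>x. ?R2 p x \<Longrightarrow> \<exists>x. x \<epsilon> V \<delta> \<and> ?R2 p x" by blast
  have o: "ordinal (un \<gamma> \<delta>)" by (rule ordinal_un[OF c(1) d(1)])
  have mono: "x \<epsilon> V \<gamma> \<Longrightarrow> x \<epsilon> V (un \<gamma> \<delta>)" "x \<epsilon> V \<delta> \<Longrightarrow> x \<epsilon> V (un \<gamma> \<delta>)" for x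
    using V_mono_sub[OF c(1) o] V_mono_sub[OF d(1) o] by auto
  have "witnesses a (V (un \<gamma> \<delta>))" unfolding witnesses_def
  proof (intro allI impI conjI)
    fix g i j s :: 'a assume *: "delta0 g \<and> i \<epsilon> omega \<and> j \<epsilon> omega \<and> maps s omega a"
    have p: "opair g (opair i (opair j s)) \<epsilon> ?B"
      using * delta0_formula mem_Form maps_sub by (auto simp: subset_iff)
    show "\<exists>x. x \<epsilon> V (un \<gamma> \<delta>) \<and> (\<forall>y. delta0_true g (upd (upd s i x) j y))"
      if "\<exists>x. \<forall>y. delta0_true g (upd (upd s i x) j y)"
      using c(2)[OF p] that mono(1) unfolding opair_inject by blast
    show "\<exists>y. y \<epsilon> V (un \<gamma> \<delta>) \<and> \<not> delta0_true g (upd s j y)" if "\<exists>y. \<not> delta0_true g (upd s j y)"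
      using d(2)[OF p] that mono(2) unfolding opair_inject by blast
  qed
  with o show ?thesis by blast
qed

text \<open>A Tarski-Vaught argument. The values of an assignment in \<open>V l\<close> may have
  ranks unbounded in \<open>l\<close>, so the assignment is replaced by a bounded one with the same
  values on the support of the formula.\<close>

lemma fully_correct_closed:
  assumes o: "ordinal l" and ne: "\<alpha> \<epsilon> l" and lim: "\<And>\<beta>. \<beta> \<epsilon> l \<Longrightarrow> succ \<beta> \<epsilon> l"
    and W: "\<And>\<beta>. \<beta> \<epsilon> l \<Longrightarrow> \<exists>\<gamma>. \<gamma> \<epsilon> l \<and> witnesses (V \<beta>) (V \<gamma>)"
  shows "fully_correct l"
proof -
  have ordl: "ordinal \<gamma>" if "\<gamma> \<epsilon> l" for \<gamma> using that o ordinal_elt by blast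
  have t: "transitive_set (V l)" by (rule V_transitive[OF o])
  have wit: "((\<exists>x. \<forall>y. delta0_true g (upd (upd s i x) j y)) \<longrightarrow> (\<exists>x. x \<epsilon> V l \<and> (\<forall>y. delta0_true g (upd (upd s i x) j y)))) \<and>
    ((\<exists>y. \<not> delta0_true g (upd s j y)) \<longrightarrow> (\<exists>y. y \<epsilon> V l \<and> \<not> delta0_true g (upd s j y)))"
    if g: "delta0 g" and ij: "i \<epsilon> omega" "j \<epsilon> omega" and s: "maps s omega (V l)" for g i j s
  proof -
    obtain N where N: "N \<epsilon> omega" "supported N g" using delta0_support[OF g] by blast
    obtain \<beta> s' where b: "\<beta> \<epsilon> l" "maps s' omega (V \<beta>)" "\<forall>k. k \<epsilon> N \<longrightarrow> ap s' k = ap s k"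
      using bounded_assignment[OF o lim ne s N(1)] by blast
    obtain \<gamma> where c: "\<gamma> \<epsilon> l" "witnesses (V \<beta>) (V \<gamma>)" using W[OF b(1)] by blast
    have f: "fun_on s omega" "fun_on s' omega" using s b(2) unfolding maps_iff by blast+
    have e1: "delta0_true g (upd s j y) \<longleftrightarrow> delta0_true g (upd s' j y)" for y
      by (rule delta0_true_support[OF g N(2)])
        (use f ij b(3) omega_subset[OF N(1)] in \<open>simp_all add: fun_on_upd ap_upd[where d = omega]\<close>)
    have e2: "delta0_true g (upd (upd s i x) j y) \<longleftrightarrow> delta0_true g (upd (upd s' i x) j y)" for x y
      by (rule delta0_true_support[OF g N(2)])
        (use f ij b(3) omega_subset[OF N(1)] in \<open>simp_all add: fun_on_upd ap_upd[where d = omega]\<close>)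
    have "x \<epsilon> V l" if "x \<epsilon> V \<gamma>" for x using V_mono[OF o c(1) that] .
    then show ?thesis using c(2) g ij b(2) unfolding witnesses_def e1 e2 by blast
  qed
  have "sat_in (V l) \<phi> s \<longleftrightarrow> sigma2_true \<phi> s" if \<phi>: "sigma2 \<phi>" and s: "maps s omega (V l)" for \<phi> s
  proof -
    obtain i j g where f: "sigma2_form i j g \<phi>" using \<phi> unfolding sigma2_def by blast
    have ij: "i \<epsilon> omega" "j \<epsilon> omega" and g: "delta0 g" using f unfolding sigma2_form_def by blast+
    have fs: "fun_on s omega" using s unfolding maps_iff by blast
    have eq: "sat_in (V l) g (upd (upd s i x) j y) \<longleftrightarrow> delta0_true g (upd (upd s i x) j y)" if "x \<epsilon> V l" "y \<epsilon> V l" for x y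
      using delta0_true_iff[OF g t maps_upd[OF maps_upd[OF s ij(1) that(1)] ij(2) that(2)]] by blast
    have all: "(\<forall>y. y \<epsilon> V l \<longrightarrow> delta0_true g (upd (upd s i x) j y)) \<longleftrightarrow> (\<forall>y. delta0_true g (upd (upd s i x) j y))"
      if "x \<epsilon> V l" for x
      using wit[OF g ij maps_upd[OF s ij(1) that]] by blast
    have "sat_in (V l) \<phi> s \<longleftrightarrow> (\<exists>x. x \<epsilon> V l \<and> (\<forall>y. delta0_true g (upd (upd s i x) j y)))"
      unfolding sigma2_sat_iff[OF f s] using eq all by blast
    also have "\<dots> \<longleftrightarrow> (\<exists>x. \<forall>y. delta0_true g (upd (upd s i x) j y))" using wit[OF g ij s] by blast
    finally show ?thesis unfolding sigma2_true_iff[OF f fs] .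
  qed
  moreover have "V l \<noteq> empty" using V_mem[OF o ne] by auto
  ultimately show ?thesis unfolding fully_correct_def using o by blast
qed

lemma ex_fully_and_lightface_correct: "\<exists>\<delta> :: 'v::zfc. cardinal \<delta> \<and> fully_correct \<delta> \<and> lightface_correct \<delta>"
proof -
  \<comment> \<open>Lightface truth speaks of assignments anywhere in the universe, full correctness
    only of those in \<open>V l\<close>. Hence a satisfying assignment for each true formula is
    placed below \<open>l\<close>.\<close>
  have "\<exists>\<gamma>. ordinal \<gamma> \<and> (\<forall>\<phi>. \<phi> \<epsilon> Form \<longrightarrow> (\<exists>s :: 'v. sigma2_true \<phi> s) \<longrightarrow> (\<exists>s. s \<epsilon> V \<gamma> \<and> sigma2_true \<phi> s))"
    by (rule collection, intro dfn_intros)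
  then obtain \<gamma>0 :: 'v where c: "ordinal \<gamma>0" "\<And>\<phi>. \<phi> \<epsilon> Form \<Longrightarrow> \<exists>s. sigma2_true \<phi> s \<Longrightarrow> \<exists>s. s \<epsilon> V \<gamma>0 \<and> sigma2_true \<phi> s"
    by blast
  \<comment> \<open>The second conjunct demands passing an ordinal that does not inject into
    \<beta>, which makes the closure point a cardinal.\<close>
  let ?C = "\<lambda>\<beta> \<gamma> :: 'v. witnesses (VV \<beta>) (VV \<gamma>) \<and> (\<exists>\<zeta>. \<zeta> \<epsilon> \<gamma> \<and> ordinal \<zeta> \<and> \<not> (\<exists>f. injects f \<zeta> \<beta>))"
  have tot: "\<exists>\<gamma>. ordinal \<gamma> \<and> ?C \<beta> \<gamma>" if b: "ordinal \<beta>" for \<beta>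
  proof -
    obtain \<gamma> where g: "ordinal \<gamma>" "witnesses (V \<beta>) (V \<gamma>)" using ex_witnesses by blast
    obtain \<zeta> where z: "ordinal \<zeta>" "\<not> (\<exists>f. injects f \<zeta> \<beta>)" using hartogs by blast
    have o: "ordinal (un \<gamma> (succ \<zeta>))" by (rule ordinal_un[OF g(1) ordinal_succ[OF z(1)]])
    have "x \<epsilon> V (un \<gamma> (succ \<zeta>))" if "x \<epsilon> V \<gamma>" for x using V_mono_sub[OF g(1) o _ that] by simp
    then have "witnesses (V \<beta>) (V (un \<gamma> (succ \<zeta>)))" using g(2) unfolding witnesses_def by blast
    then have "?C \<beta> (un \<gamma> (succ \<zeta>))" using b o z by (intro conjI exI[of _ \<zeta>]) simp_all
    with o show ?thesis by blast
  qed
  have "\<exists>l. ordinal l \<and> \<gamma>0 \<epsilon> l \<and> (\<forall>\<beta>. \<beta> \<epsilon> l \<longrightarrow> succ \<beta> \<epsilon> l \<and> (\<exists>\<gamma>. \<gamma> \<epsilon> l \<and> ?C \<beta> \<gamma>))"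
    by (rule ord_closing[OF _ tot c(1)]) (unfold witnesses_def, intro dfn_intros)
  then obtain l where l: "ordinal l" "\<gamma>0 \<epsilon> l" "\<And>\<beta>. \<beta> \<epsilon> l \<Longrightarrow> succ \<beta> \<epsilon> l \<and> (\<exists>\<gamma>. \<gamma> \<epsilon> l \<and> ?C \<beta> \<gamma>)" by blast
  have ordl: "ordinal \<gamma>" if "\<gamma> \<epsilon> l" for \<gamma> using that l(1) ordinal_elt by blast
  have fc: "fully_correct l"
  proof (rule fully_correct_closed[OF l(1,2)])
    show "\<exists>\<gamma>. \<gamma> \<epsilon> l \<and> witnesses (V \<beta>) (V \<gamma>)" if "\<beta> \<epsilon> l" for \<beta>
      using l(3)[OF that] ordl[OF that] ordl by (metis VV_V)
  qed (use l(3) in blast)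
  have card: "cardinal l" unfolding cardinal_def
  proof (intro conjI notI)
    assume "\<exists>\<alpha>\<in>elts l. \<exists>f. bijects f \<alpha> l"
    then obtain \<alpha> f where a: "\<alpha> \<epsilon> l" "bijects f \<alpha> l" by auto
    obtain g where g: "injects g l \<alpha>" using bijects_inverse[OF a(2)] by blast
    obtain \<gamma> \<zeta> where z: "\<gamma> \<epsilon> l" "\<zeta> \<epsilon> \<gamma>" "\<not> (\<exists>f. injects f \<zeta> \<alpha>)" using l(3)[OF a(1)] by blast
    have sub: "x \<epsilon> l" if "x \<epsilon> \<zeta>" for x using that z ordinal_trans[OF l(1)] by blast
    have d: "dft True (\<lambda>e. ap g (e 0))" by (intro dfn_intros)
    have "injects (lam \<zeta> (ap g)) \<zeta> \<alpha>" unfolding injects_iff maps_iff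
      using fun_on_lam[OF d, of \<zeta>] ap_lam[OF d, of _ \<zeta>] g sub unfolding injects_iff maps_iff by simp
    then show False using z(3) by blast
  qed (rule l(1))
  have "(\<exists>s. sat_in (V l) \<phi> s) \<longleftrightarrow> (\<exists>s. sigma2_true \<phi> s)" if \<phi>: "sigma2 \<phi>" for \<phi>
  proof
    assume "\<exists>s. sat_in (V l) \<phi> s"
    then obtain s where s: "sat_in (V l) \<phi> s" by blast
    then have "sigma2_true \<phi> s" using fc \<phi> sat_inD[OF s] unfolding fully_correct_def by blast
    then show "\<exists>s. sigma2_true \<phi> s" by blast
  next
    assume "\<exists>s. sigma2_true \<phi> s"
    moreover have "\<phi> \<epsilon> Form" using \<phi> sigma2_formula unfolding sigma2_def mem_Form by blast
    ultimately obtain s where s: "s \<epsilon> V \<gamma>0" "sigma2_true \<phi> s" using c(2) by blast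
    have f: "fun_on s omega" using s(2) unfolding sigma2_true_def by blast
    have "ap s k \<epsilon> V l" if "k \<epsilon> omega" for k
    proof -
      have "opair k (ap s k) \<epsilon> s" using fun_on_ap[OF f that] by blast
      then have "opair k (ap s k) \<epsilon> V \<gamma>0" using V_trans[OF c(1) s(1)] by blast
      then have "ap s k \<epsilon> V \<gamma>0" using opair_transD[OF V_transitive[OF c(1)]] by blast
      then show ?thesis by (rule V_mono[OF l(1,2)])
    qed
    then have "maps s omega (V l)" unfolding maps_iff using f by blast
    then have "sat_in (V l) \<phi> s" using fc \<phi> s(2) unfolding fully_correct_def by blast
    then show "\<exists>s. sat_in (V l) \<phi> s" by blast
  qed
  then have "lightface_correct l" unfolding lightface_correct_def using l(1) by blast
  with card fc show ?thesis by blast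
qed

section \<open>Comparison of the least correct cardinals\<close>

definition lightface_witness :: "'v::zfc \<Rightarrow> 'v \<Rightarrow> bool" where
  "lightface_witness z r \<longleftrightarrow> (\<exists>\<gamma> v. z = opair \<gamma> v \<and> cardinal \<gamma> \<and> (ordinal \<gamma> \<and> v = V \<gamma>) \<and>
    (\<forall>n\<in>elts r. \<forall>\<phi>. enum n (opair (numeral_set 0) \<phi>) \<longrightarrow> (\<exists>s. sat_in v \<phi> s)) \<and>
    (\<forall>n\<in>elts r. \<forall>\<phi>. enum n (opair (numeral_set 1) \<phi>) \<longrightarrow> \<not> (\<exists>s. sat_in v \<phi> s)))"

text \<open>Sigma2 truth in the universe is not absolute, but here it enters only through the
  parameter \<open>r\<close>, which will list true formulas under tag 0 and false ones under tag
  1.\<close>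

lemma lightface_witness_dfn: "dfn b (\<lambda>e. lightface_witness (e 0) (e 1))"
  unfolding lightface_witness_def by (intro dfn_ex_opair dfn_all_enum V_dfn dfn_intros)

lemma lightface_below_real:
  assumes \<delta>: "real_correct \<delta>"
  shows "\<exists>\<gamma>. \<gamma> \<epsilon> \<delta> \<and> cardinal \<gamma> \<and> lightface_correct \<gamma>"
proof -
  have o: "ordinal \<delta>" using \<delta> unfolding real_correct_def by blast
  let ?N = "numeral_set :: nat \<Rightarrow> 'a"
  let ?S = "\<lambda>\<phi> :: 'a. sigma2 \<phi> \<and> closed_formula \<phi>"
  let ?t = "\<lambda>\<phi> :: 'a. \<exists>s. sigma2_true \<phi> s"
  let ?P = "\<lambda>n. n \<epsilon> omega \<and> ((\<exists>\<phi>. ?S \<phi> \<and> ?t \<phi> \<and> enum n (opair (?N 0) \<phi>)) \<or> (\<exists>\<phi>. ?S \<phi> \<and> \<not> ?t \<phi> \<and> enum n (opair (?N 1) \<phi>)))"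
  have "\<exists>r. \<forall>n. n \<epsilon> r \<longleftrightarrow> ?P n"
    by (rule comprehension[of _ omega], intro dfn_intros) (erule conjunct1)
  then obtain r where "\<forall>n. n \<epsilon> r \<longleftrightarrow> ?P n" by (rule exE)
  then have r: "n \<epsilon> r \<longleftrightarrow> ?P n" for n by (rule spec)
  have sub: "elts r \<subseteq> elts omega" using r by auto
  have ne: "?N 0 \<noteq> ?N 1" unfolding numeral_set_inject by simp
  have mem0: "?S \<phi> \<and> ?t \<phi>" if "n \<epsilon> r" "enum n (opair (?N 0) \<phi>)" for n \<phi>
    using that(1) enum_unique[OF that(2)] ne unfolding r by (metis opair_inject)
  have mem1: "?S \<phi> \<and> \<not> ?t \<phi>" if "n \<epsilon> r" "enum n (opair (?N 1) \<phi>)" for n \<phi>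
    using that(1) enum_unique[OF that(2)] ne unfolding r by (metis opair_inject)
  obtain d :: 'a where d: "cardinal d" "lightface_correct d" using ex_fully_and_lightface_correct by blast
  have od: "ordinal d" using d(1) by (simp add: cardinal_def)
  \<comment> \<open>Any lightface correct cardinal serves as a witness, however large;
    \<open>real_transfer\<close> then provides one below \<delta>.\<close>
  have "lightface_witness (opair d (V d)) r" unfolding lightface_witness_def
  proof (rule exI[of _ d], rule exI[of _ "V d"], intro conjI refl d(1) od ballI allI impI)
    show "\<exists>s. sat_in (V d) \<phi> s" if n: "n \<in> elts r" "enum n (opair (?N 0) \<phi>)" for n \<phi>
      using mem0[of n \<phi>] n d(2) unfolding lightface_correct_def by simp
    show "\<not> (\<exists>s. sat_in (V d) \<phi> s)" if n: "n \<in> elts r" "enum n (opair (?N 1) \<phi>)" for n \<phi>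
      using mem1[of n \<phi>] n d(2) unfolding lightface_correct_def by simp
  qed
  then obtain z where z: "z \<epsilon> V \<delta>" "lightface_witness z r"
    using real_transfer[OF \<delta> lightface_witness_dfn sub] by blast
  obtain \<gamma> v where g: "z = opair \<gamma> v" "cardinal \<gamma>" "ordinal \<gamma>" "v = V \<gamma>"
    and m0: "\<forall>n\<in>elts r. \<forall>\<phi>. enum n (opair (?N 0) \<phi>) \<longrightarrow> (\<exists>s. sat_in v \<phi> s)"
    and m1: "\<forall>n\<in>elts r. \<forall>\<phi>. enum n (opair (?N 1) \<phi>) \<longrightarrow> \<not> (\<exists>s. sat_in v \<phi> s)"
    using z(2) unfolding lightface_witness_def by (elim exE conjE) (rule that)
  have "\<gamma> \<epsilon> V \<delta>" using opair_transD[OF V_transitive[OF o]] z(1) g(1) by metis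
  then have gd: "\<gamma> \<epsilon> \<delta>" using ordinal_in_V[OF o g(3)] by blast
  have code: "\<exists>n. n \<epsilon> omega \<and> enum n (opair (?N m) \<phi>)" if "?S \<phi>" for m \<phi>
    using that sigma2_formula coded_opair[OF coded_numeral coded_formula] unfolding sigma2_def coded_def by blast
  have "(\<exists>s. sat_in (V \<gamma>) \<phi> s) \<longleftrightarrow> ?t \<phi>" if S: "?S \<phi>" for \<phi>
  proof (cases "?t \<phi>")
    case True
    obtain n where n: "n \<epsilon> omega" "enum n (opair (?N 0) \<phi>)" using code[OF S] by blast
    then have "n \<in> elts r" unfolding in_elts r using S True by blast
    then show ?thesis using m0 n True g(4) by blast
  next
    case False
    obtain n where n: "n \<epsilon> omega" "enum n (opair (?N 1) \<phi>)" using code[OF S] by blast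
    then have "n \<in> elts r" unfolding in_elts r using S False by blast
    then show ?thesis using m1 n False g(4) by blast
  qed
  then have "lightface_correct \<gamma>" unfolding lightface_correct_def using g(3) by blast
  with gd g(2) show ?thesis by blast
qed

lemma full_transfer:
  assumes \<delta>: "fully_correct \<delta>" and Q: "dfn False (\<lambda>e. Q (e 0) (e 1))" and r: "r \<epsilon> V \<delta>" and z: "Q z r"
  shows "\<exists>z. z \<epsilon> V \<delta> \<and> Q z r"
proof -
  have o: "ordinal \<delta>" using \<delta> unfolding fully_correct_def by blast
  obtain f where f: "sigma2 f" and f1: "\<And>\<delta> s. ordinal \<delta> \<Longrightarrow> sat_in (V \<delta>) f s \<Longrightarrow> \<exists>z. z \<epsilon> V \<delta> \<and> Q z (ap s (numeral_set 0))"
    and f2: "\<And>s z. fun_on s omega \<Longrightarrow> Q z (ap s (numeral_set 0)) \<Longrightarrow> sigma2_true f s"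
    using transfer_parameter[OF Q] by blast
  let ?s = "lam omega (\<lambda>_. r)"
  have s: "maps ?s omega (V \<delta>)" by (rule const_lam(1)[OF r])
  have r0: "ap ?s (numeral_set 0) = r" by (rule const_lam(2)[OF numeral_set_omega])
  have "sigma2_true f ?s" using f2[of ?s z] s z r0 unfolding maps_iff by simp
  then have "sat_in (V \<delta>) f ?s" using \<delta> f s unfolding fully_correct_def by blast
  from f1[OF o this] show ?thesis unfolding r0 .
qed

lemma dfn_all_opair_eq:
  assumes "dfn b (\<lambda>e. Q (e 1) (e 0) (\<lambda>k. e (Suc (Suc k))))" "dft b t"
  shows "dfn b (\<lambda>e. \<forall>x y. t e = opair x y \<longrightarrow> Q x y e)"
  by (rule dfn_cong[OF dfn_neg[OF dfn_ex_opair[OF dfn_neg[OF assms(1)] assms(2)]]]) blast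

definition real_witness :: "'v::zfc \<Rightarrow> 'v \<Rightarrow> bool" where
  "real_witness z r \<longleftrightarrow> (\<exists>\<gamma> v. z = opair \<gamma> v \<and> cardinal \<gamma> \<and> (ordinal \<gamma> \<and> v = V \<gamma>) \<and>
    (\<forall>p\<in>elts r. \<forall>c q. p = opair c q \<longrightarrow> (\<forall>\<phi> s. q = opair \<phi> s \<longrightarrow>
      (c = numeral_set 0 \<longrightarrow> sat_in v \<phi> s) \<and> (c = numeral_set 1 \<longrightarrow> \<not> sat_in v \<phi> s))))"

text \<open>As for \<open>lightface_witness\<close>, truth is moved into the parameter. It now
  consists of triples of tag, formula and assignment of reals, so it is no set of numbers but still
  an element of \<open>V \<delta>\<close>.\<close>

lemma real_witness_dfn: "dfn b (\<lambda>e. real_witness (e 0) (e 1))"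
  unfolding real_witness_def by (intro dfn_ex_opair dfn_all_opair_eq V_dfn dfn_intros)

lemma real_below_full:
  assumes \<delta>: "cardinal \<delta>" "fully_correct \<delta>"
  shows "\<exists>\<gamma>. \<gamma> \<epsilon> \<delta> \<and> cardinal \<gamma> \<and> real_correct \<gamma>"
proof -
  have o: "ordinal \<delta>" and ne: "V \<delta> \<noteq> empty" using \<delta>(2) unfolding fully_correct_def by blast+
  let ?N = "numeral_set :: nat \<Rightarrow> 'a"
  have emp: "empty \<epsilon> V \<delta>"
  proof -
    obtain x where "x \<epsilon> V \<delta>" using ne unfolding empty_iff by blast
    then obtain \<gamma> where "\<gamma> \<epsilon> \<delta>" using mem_V[OF o] by blast
    then show ?thesis unfolding mem_V[OF o] by (intro exI[of _ \<gamma>]) auto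
  qed
  let ?B = "cprod (upair (?N 0) (?N 1)) (cprod Form (pow (cprod omega (pow omega))))"
  have "dfn False (\<lambda>e. e 0 = ?B)" "dfn False (\<lambda>e :: nat \<Rightarrow> 'a. e 0 = pow omega)" by (intro dfn_intros)+
  \<comment> \<open>Both sets are definable without parameters, so their existence transfers to
    \<open>V \<delta>\<close>; \<open>empty\<close> fills the place of the parameter.\<close>
  then have B: "?B \<epsilon> V \<delta>" and P: "pow omega \<epsilon> V \<delta>"
    using full_transfer[OF \<delta>(2), of "\<lambda>z _. z = ?B" empty] full_transfer[OF \<delta>(2), of "\<lambda>z _. z = pow omega" empty] emp by blast+
  let ?R = "\<lambda>p. p \<epsilon> ?B \<and> (\<exists>c q. p = opair c q \<and> (\<exists>\<phi> s. q = opair \<phi> s \<and> sigma2 \<phi> \<and> maps s omega (pow omega) \<and>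
    (c = ?N 0 \<and> sigma2_true \<phi> s \<or> c = ?N 1 \<and> \<not> sigma2_true \<phi> s)))"
  have "\<exists>r. \<forall>p. p \<epsilon> r \<longleftrightarrow> ?R p"
    by (rule comprehension[of _ ?B], intro dfn_intros) (erule conjunct1)
  then obtain r where "\<forall>p. p \<epsilon> r \<longleftrightarrow> ?R p" by (rule exE)
  then have r: "p \<epsilon> r \<longleftrightarrow> ?R p" for p by (rule spec)
  have rV: "r \<epsilon> V \<delta>" by (rule V_subset[OF o B]) (use r in auto)
  have ne01: "?N 0 \<noteq> ?N 1" unfolding numeral_set_inject by simp
  have mem: "sigma2 \<phi> \<and> maps s omega (pow omega) \<and> (c = ?N 0 \<longrightarrow> sigma2_true \<phi> s) \<and> (c = ?N 1 \<longrightarrow> \<not> sigma2_true \<phi> s)"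
    if "opair c (opair \<phi> s) \<epsilon> r" for c \<phi> s
  proof -
    have "sigma2 \<phi> \<and> maps s omega (pow omega) \<and> (c = ?N 0 \<and> sigma2_true \<phi> s \<or> c = ?N 1 \<and> \<not> sigma2_true \<phi> s)"
      using that unfolding r by (elim conjE exE) (simp only: opair_inject simp_thms)
    then show ?thesis using ne01 by metis
  qed
  have sub: "maps s omega (V \<delta>)" if "maps s omega (pow omega)" for s
    using that V_trans[OF o P] unfolding maps_iff by blast
  \<comment> \<open>In the universe \<delta> itself is the witness; the transferred one lies in
    \<open>V \<delta>\<close> and so strictly below \<delta>.\<close>
  have "real_witness (opair \<delta> (V \<delta>)) r" unfolding real_witness_def
  proof (rule exI[of _ \<delta>], rule exI[of _ "V \<delta>"], intro conjI refl \<delta>(1) o ballI allI impI)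
    fix p c q \<phi> s assume p: "p \<in> elts r" "p = opair c q" "q = opair \<phi> s"
    then have m: "opair c (opair \<phi> s) \<epsilon> r" by simp
    have iff: "sat_in (V \<delta>) \<phi> s \<longleftrightarrow> sigma2_true \<phi> s"
      using mem[OF m] sub \<delta>(2) unfolding fully_correct_def by blast
    show "sat_in (V \<delta>) \<phi> s" if "c = ?N 0" using iff mem[OF m] that by blast
    show "\<not> sat_in (V \<delta>) \<phi> s" if "c = ?N 1" using iff mem[OF m] that by blast
  qed
  then obtain z where z: "z \<epsilon> V \<delta>" "real_witness z r"
    using full_transfer[OF \<delta>(2) real_witness_dfn rV] by blast
  obtain \<gamma> v where g: "z = opair \<gamma> v" "cardinal \<gamma>" "ordinal \<gamma>" "v = V \<gamma>"
    and m: "\<forall>p\<in>elts r. \<forall>c q. p = opair c q \<longrightarrow> (\<forall>\<phi> s. q = opair \<phi> s \<longrightarrow>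
      (c = numeral_set 0 \<longrightarrow> sat_in v \<phi> s) \<and> (c = numeral_set 1 \<longrightarrow> \<not> sat_in v \<phi> s))"
    using z(2) unfolding real_witness_def by (elim exE conjE) (rule that)
  have "\<gamma> \<epsilon> V \<delta>" using opair_transD[OF V_transitive[OF o]] z(1) g(1) by metis
  then have gd: "\<gamma> \<epsilon> \<delta>" using ordinal_in_V[OF o g(3)] by blast
  have "sat_in (V \<gamma>) \<phi> s \<longleftrightarrow> sigma2_true \<phi> s" if \<phi>: "sigma2 \<phi>" and s: "maps s omega (pow omega)" for \<phi> s
  proof -
    have "\<phi> \<epsilon> Form" using \<phi> sigma2_formula unfolding sigma2_def mem_Form by blast
    then have in_B: "opair c (opair \<phi> s) \<epsilon> ?B" if "c = ?N 0 \<or> c = ?N 1" for c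
      using that maps_sub[OF s] unfolding opair_in_cprod mem_pow mem_upair by auto
    show ?thesis
    proof (cases "sigma2_true \<phi> s")
      case True
      then have "opair (?N 0) (opair \<phi> s) \<in> elts r" unfolding in_elts r using in_B[of "?N 0"] \<phi> s by blast
      then show ?thesis using m True g(4) by blast
    next
      case False
      then have "opair (?N 1) (opair \<phi> s) \<in> elts r" unfolding in_elts r using in_B[of "?N 1"] \<phi> s by blast
      then show ?thesis using m False g(4) by blast
    qed
  qed
  then have "real_correct \<gamma>" unfolding real_correct_def using g(3) by blast
  with gd g(2) show ?thesis by blast
qed

theorem theorem13:
  shows "(\<forall>\<alpha> \<kappa> \<delta> :: 'v::zfc.
      logic_order \<alpha> \<and> sententially_categorical \<alpha> \<kappa> \<and> cardinal \<delta> \<and> lightface_correct \<delta>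
      \<longrightarrow> \<kappa> \<epsilon> \<delta>) \<and>
    (\<forall>\<alpha> \<kappa> \<delta> :: 'v.
      logic_order \<alpha> \<and> (theory_categorical \<alpha> \<kappa> \<or> fresh \<alpha> \<kappa>) \<and> cardinal \<delta> \<and> real_correct \<delta>
      \<longrightarrow> \<kappa> \<epsilon> \<delta>) \<and>
    (\<exists>\<delta>\<^sub>0 \<delta>\<^sub>1 \<delta>\<^sub>2 :: 'v.
      least_cardinal lightface_correct \<delta>\<^sub>0 \<and>
      least_cardinal real_correct \<delta>\<^sub>1 \<and>
      least_cardinal fully_correct \<delta>\<^sub>2 \<and>
      \<delta>\<^sub>0 \<epsilon> \<delta>\<^sub>1 \<and> \<delta>\<^sub>1 \<epsilon> \<delta>\<^sub>2)"
proof (intro conjI allI impI)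
  fix \<alpha> \<kappa> \<delta> :: 'v
  show "\<kappa> \<epsilon> \<delta>" if "logic_order \<alpha> \<and> sententially_categorical \<alpha> \<kappa> \<and> cardinal \<delta> \<and> lightface_correct \<delta>"
    using that sententially_categorical_below_lightface by blast
  show "\<kappa> \<epsilon> \<delta>" if "logic_order \<alpha> \<and> (theory_categorical \<alpha> \<kappa> \<or> fresh \<alpha> \<kappa>) \<and> cardinal \<delta> \<and> real_correct \<delta>"
    using that theory_categorical_below_real fresh_below_real by blast
next
  obtain d :: 'v where "cardinal d" "fully_correct d" using ex_fully_and_lightface_correct by blast
  then obtain \<delta>2 :: 'v where 2: "least_cardinal fully_correct \<delta>2"
    using ex_least_cardinal[OF correct_dfn(3)] by blast
  then have "cardinal \<delta>2" "fully_correct \<delta>2" and o2: "ordinal \<delta>2"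
    unfolding least_cardinal_def cardinal_def by blast+
  then obtain \<gamma> where c: "\<gamma> \<epsilon> \<delta>2" "cardinal \<gamma>" "real_correct \<gamma>" using real_below_full by blast
  obtain \<delta>1 where 1: "least_cardinal real_correct \<delta>1" "\<delta>1 = \<gamma> \<or> \<delta>1 \<epsilon> \<gamma>"
    using ex_least_cardinal[OF correct_dfn(2) c(2,3)] by blast
  then have 12: "\<delta>1 \<epsilon> \<delta>2" using c(1) ordinal_trans[OF o2] by blast
  have "real_correct \<delta>1" and o1: "ordinal \<delta>1" using 1(1) unfolding least_cardinal_def cardinal_def by blast+
  then obtain \<beta> where b: "\<beta> \<epsilon> \<delta>1" "cardinal \<beta>" "lightface_correct \<beta>" using lightface_below_real by blast
  obtain \<delta>0 where 0: "least_cardinal lightface_correct \<delta>0" "\<delta>0 = \<beta> \<or> \<delta>0 \<epsilon> \<beta>"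
    using ex_least_cardinal[OF correct_dfn(1) b(2,3)] by blast
  then have "\<delta>0 \<epsilon> \<delta>1" using b(1) ordinal_trans[OF o1] by blast
  then show "\<exists>\<delta>\<^sub>0 \<delta>\<^sub>1 \<delta>\<^sub>2 :: 'v. least_cardinal lightface_correct \<delta>\<^sub>0 \<and> least_cardinal real_correct \<delta>\<^sub>1 \<and>
      least_cardinal fully_correct \<delta>\<^sub>2 \<and> \<delta>\<^sub>0 \<epsilon> \<delta>\<^sub>1 \<and> \<delta>\<^sub>1 \<epsilon> \<delta>\<^sub>2"
    using 0(1) 1(1) 2 12 by blast
qed

end
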